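(* Let $A$ be a $2\times 2$ real symmetric positive-semidefinite matrix and let $f:\mathbb{H}\times\mathbb{R}^2\to\mathbb{R}$ satisfy: (A1) there exists $L_1>0$ such that $|f(p,w_1)-f(p,w_2)|\le L_1|w_1-w_2|$ for all $p\in\mathbb{H}$, $w_1,w_2\in\mathbb{R}^2$; (A2') there exists $L_0>0$ such that $|f(p,\xi)-f(q,\xi)|\le L_0|p\cdot q^{-1}|_G$ for all $p,q\in\mathbb{H}$ and $\xi\in\mathbb{R}^2$; (A3) there exists $C_f>0$ such that $|f(p,\xi)|\le C_f(1+|\xi|)$ for all $p\in\mathbb{H}$, $\xi\in\mathbb{R}^2$. Let $u\in C(\mathbb{H}\times[0,\infty))$ be the unique viscosity solution of $$u_t-\operatorname{tr}\left(A(\nabla_H^2u)^\ast\right)+f(p,\nabla_Hu)=0\ \text{ in }\mathbb{H}\times(0,\infty),\qquad u(\cdot,0)=u_0\ \text{ in }\mathbb{H},$$ satisfying the growth condition (G) for any $T>0$ there exist $k>0$ and $C_T>0$ such that $|u(p,t)|\le C_Te^{k\langle p\rangle}$ for all $(p,t)\in\mathbb{H}\times[0,T]$. Assume also that $u(\cdot,t)$ is an even or vertically even function for each $t\ge 0$. If there exists $L>0$ such that $|u_0(p)-u_0(q)|\le L\,d_L(p,q)$ for all $p,q\in\mathbb{H}$, then $$|u(p,t)-u(q,t)|\le(L+L_0t)\,d_L(p,q)\qquad(\ast)$$ for all $p,q\in\mathbb{H}$ and $t\ge0$. In particular, when $f$ does not depend on the space variable $p$, $(\ast)$ holds with $L_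0=0$.
   Context: The Heisenberg group $\mathbb{H}$ is $\mathbb{R}^3$ with the group law $(x_p,y_p,z_p)\cdot(x_q,y_q,z_q)=\left(x_p+x_q,\,y_p+y_q,\,z_p+z_q+\tfrac12(x_py_q-x_qy_p)\right)$; the inverse of $p=(x,y,z)$ is $p^{-1}=(-x,-y,-z)$. The Korányi gauge is $|p|_G=\left((x^2+y^2)^2+16z^2\right)^{1/4}$; $d_L(p,q)=|p^{-1}\cdot q|_G$; $\langle p\rangle=(1+x^4+y^4+16z^2)^{1/4}$ for $p=(x,y,z)$. A function $w:\mathbb{H}\to\mathbb{R}$ is even if $w(p)=w(p^{-1})$ for all $p\in\mathbb{H}$, and vertically even if $w(x,y,z)=w(x,y,-z)$ for all $(x,y,z)\in\mathbb{H}$. Left-invariant vector fields: $X_1=\partial_x-\tfrac y2\partial_z$, $X_2=\partial_y+\tfrac x2\partial_z$. The horizontal gradient is $\nabla_Hu=(X_1u,X_2u)$, and the symmetrized horizontal Hessian $(\nabla_H^2u)^\ast$ is the symmetric $2\times2$ matrix with diagonal entries $X_1^2u$, $X_2^2u$ and off-diagonal entries $\tfrac12(X_1X_2u+X_2X_1u)$ (derivatives in the space variable only). Viscosity notions: an upper semicontinuous (resp. lower semicontinuous) function $u$ is a viscosity subsolution (resp. supersolution) of the equation in $\mathbb{H}\times(0,\infty)$ if, whenever $\phi$ is $C^2$ near $(p_0,t_0)\in\mathbb{H}\times(0,\infty)$ and $u-\phi$ has a local maximum (resp. minimum) at $(p_0,t_0)$, one has $\phi_t-\operatorname{tr}(A(\nabla_H^2\phi)^\ast)+f(p_0,\nabla_H\phi)\le0$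 (resp. $\ge0$) at $(p_0,t_0)$. A continuous function is a viscosity solution if it is both. *)

theory Defs
  imports "HOL-Analysis.Analysis"
begin

text \<open>Points are \<open>(x, y, z)\<close>; the product topology on this type is the Euclidean one, which is
  the topology of the Heisenberg group.\<close>

type_synonym heis = "real \<times> real \<times> real"

fun heis_mult :: "heis \<Rightarrow> heis \<Rightarrow> heis" (infixl "\<odot>" 70) where
  "(xp, yp, zp) \<odot> (xq, yq, zq) =
     (xp + xq, yp + yq, zp + zq + (1/2) * (xp * yq - xq * yp))"

fun heis_inv :: "heis \<Rightarrow> heis" where
  "heis_inv (x, y, z) = (-x, -y, -z)"

fun koranyi_gauge :: "heis \<Rightarrow> real" where
  "koranyi_gauge (x, y, z) = root 4 ((x\<^sup>2 + y\<^sup>2)\<^sup>2 + 16 * z\<^sup>2)"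

definition d_L :: "heis \<Rightarrow> heis \<Rightarrow> real" where
  "d_L p q = koranyi_gauge (heis_inv p \<odot> q)"

fun heis_bracket :: "heis \<Rightarrow> real" where
  "heis_bracket (x, y, z) = root 4 (1 + x ^ 4 + y ^ 4 + 16 * z\<^sup>2)"

definition heis_even :: "(heis \<Rightarrow> real) \<Rightarrow> bool" where
  "heis_even w \<longleftrightarrow> (\<forall>p. w p = w (heis_inv p))"

definition vertically_even :: "(heis \<Rightarrow> real) \<Rightarrow> bool" where
  "vertically_even w \<longleftrightarrow> (\<forall>x y z. w (x, y, z) = w (x, y, -z))"

fun X1 :: "(heis \<Rightarrow> real) \<Rightarrow> heis \<Rightarrow> real" where
  "X1 g (x, y, z) = deriv (\<lambda>s. g (s, y, z)) x - y / 2 * deriv (\<lambda>s. g (x, y, s)) z"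

fun X2 :: "(heis \<Rightarrow> real) \<Rightarrow> heis \<Rightarrow> real" where
  "X2 g (x, y, z) = deriv (\<lambda>s. g (x, s, z)) y + x / 2 * deriv (\<lambda>s. g (x, y, s)) z"

definition hor_grad :: "(heis \<Rightarrow> real) \<Rightarrow> heis \<Rightarrow> real^2" where
  "hor_grad g p = vector [X1 g p, X2 g p]"

definition sym_hor_hessian :: "(heis \<Rightarrow> real) \<Rightarrow> heis \<Rightarrow> real^2^2" where
  "sym_hor_hessian g p =
     vector [vector [X1 (X1 g) p, (X1 (X2 g) p + X2 (X1 g) p) / 2],
             vector [(X1 (X2 g) p + X2 (X1 g) p) / 2, X2 (X2 g) p]]"

text \<open>Twice continuously (Frechet) differentiable; meant for open \<open>S\<close>.\<close>

definition C2_on :: "'a::real_normed_vector set \<Rightarrow> ('a \<Rightarrow> real) \<Rightarrow> bool" where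
  "C2_on S \<phi> \<longleftrightarrow>
     (\<exists>(D1 :: 'a \<Rightarrow> 'a \<Rightarrow>\<^sub>L real) (D2 :: 'a \<Rightarrow> 'a \<Rightarrow>\<^sub>L ('a \<Rightarrow>\<^sub>L real)).
        (\<forall>a\<in>S. (\<phi> has_derivative blinfun_apply (D1 a)) (at a)) \<and>
        (\<forall>a\<in>S. (D1 has_derivative blinfun_apply (D2 a)) (at a)) \<and>
        continuous_on S D2)"

definition C2_near :: "'a::real_normed_vector \<Rightarrow> ('a \<Rightarrow> real) \<Rightarrow> bool" where
  "C2_near a \<phi> \<longleftrightarrow> (\<exists>S. open S \<and> a \<in> S \<and> C2_on S \<phi>)"

definition usc_on :: "'a::topological_space set \<Rightarrow> ('a \<Rightarrow> real) \<Rightarrow> bool" where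
  "usc_on S u \<longleftrightarrow> (\<forall>a\<in>S. \<forall>c > u a. \<forall>\<^sub>F b in at a within S. u b < c)"

definition lsc_on :: "'a::topological_space set \<Rightarrow> ('a \<Rightarrow> real) \<Rightarrow> bool" where
  "lsc_on S u \<longleftrightarrow> (\<forall>a\<in>S. \<forall>c < u a. \<forall>\<^sub>F b in at a within S. c < u b)"

definition local_max_at :: "('a::topological_space \<Rightarrow> real) \<Rightarrow> 'a \<Rightarrow> bool" where
  "local_max_at g a \<longleftrightarrow> (\<forall>\<^sub>F b in nhds a. g b \<le> g a)"

definition local_min_at :: "('a::topological_space \<Rightarrow> real) \<Rightarrow> 'a \<Rightarrow> bool" where
  "local_min_at g a \<longleftrightarrow> (\<forall>\<^sub>F b in nhds a. g a \<le> g b)"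

definition psd_matrix :: "real^'n^'n \<Rightarrow> bool" where
  "psd_matrix A \<longleftrightarrow> transpose A = A \<and> (\<forall>v. 0 \<le> v \<bullet> (A *v v))"

text \<open>The second component of a pair in \<open>heis \<times> real\<close> is time.  The derivatives are taken
  with the total operator \<open>deriv\<close>, which is meaningful here because \<open>\<phi>\<close> is a \<open>C\<^sup>2\<close>
  test function.\<close>

definition parabolic_op ::
  "real^2^2 \<Rightarrow> (heis \<Rightarrow> real^2 \<Rightarrow> real) \<Rightarrow> (heis \<times> real \<Rightarrow> real) \<Rightarrow> heis \<Rightarrow> real \<Rightarrow> real" where
  "parabolic_op A f \<phi> p t =
     deriv (\<lambda>s. \<phi> (p, s)) t
     - trace (A ** sym_hor_hessian (\<lambda>q. \<phi> (q, t)) p)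
     + f p (hor_grad (\<lambda>q. \<phi> (q, t)) p)"

text \<open>Below, \<open>u\<close> is a total function on \<open>heis \<times> real\<close>, but only its values at positive times
  matter: at \<open>t\<^sub>0 > 0\<close> a local extremum depends only on times near \<open>t\<^sub>0\<close>.\<close>

definition viscosity_subsolution ::
  "real^2^2 \<Rightarrow> (heis \<Rightarrow> real^2 \<Rightarrow> real) \<Rightarrow> (heis \<times> real \<Rightarrow> real) \<Rightarrow> bool" where
  "viscosity_subsolution A f u \<longleftrightarrow>
     usc_on (UNIV \<times> {0<..}) u \<and>
     (\<forall>p0 t0 \<phi>. t0 > 0 \<longrightarrow> C2_near (p0, t0) \<phi> \<longrightarrow>
        local_max_at (\<lambda>a. u a - \<phi> a) (p0, t0) \<longrightarrow> parabolic_op A f \<phi> p0 t0 \<le> 0)"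

definition viscosity_supersolution ::
  "real^2^2 \<Rightarrow> (heis \<Rightarrow> real^2 \<Rightarrow> real) \<Rightarrow> (heis \<times> real \<Rightarrow> real) \<Rightarrow> bool" where
  "viscosity_supersolution A f u \<longleftrightarrow>
     lsc_on (UNIV \<times> {0<..}) u \<and>
     (\<forall>p0 t0 \<phi>. t0 > 0 \<longrightarrow> C2_near (p0, t0) \<phi> \<longrightarrow>
        local_min_at (\<lambda>a. u a - \<phi> a) (p0, t0) \<longrightarrow> parabolic_op A f \<phi> p0 t0 \<ge> 0)"

definition viscosity_solution ::
  "real^2^2 \<Rightarrow> (heis \<Rightarrow> real^2 \<Rightarrow> real) \<Rightarrow> (heis \<times> real \<Rightarrow> real) \<Rightarrow> bool" where
  "viscosity_solution A f u \<longleftrightarrow>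
     continuous_on (UNIV \<times> {0<..}) u \<and>
     viscosity_subsolution A f u \<and> viscosity_supersolution A f u"

definition exp_growth :: "(heis \<times> real \<Rightarrow> real) \<Rightarrow> bool" where
  "exp_growth u \<longleftrightarrow>
     (\<forall>T>0. \<exists>k>0. \<exists>C>0. \<forall>p. \<forall>t\<in>{0..T}. \<bar>u (p, t)\<bar> \<le> C * exp (k * heis_bracket p))"

end

theory Submission
  imports Defs
begin

text \<open>Left translations preserve the horizontal vector fields, so \<open>u (h \<odot> p, t)\<close> solves the same
  equation with \<open>f\<close> frozen at \<open>h \<odot> p\<close>, which by (A2') costs at most \<open>L0\<close> times the gauge of \<open>h\<close>.
  Comparing it with \<open>u (p, t)\<close> gives \<open>u (h \<odot> p, t) - u (p, t) \<le> (L + L0 * t) * koranyi_gauge h\<close>, a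
  Lipschitz bound for the right-invariant distance; evenness, applied at time zero and at time \<open>t\<close>,
  exchanges the right-invariant distance with \<open>d_L\<close>.

  The comparison needs that the sum of the subsolution \<open>u (h \<odot> p, t)\<close> and of the subsolution
  \<open>- u (p, t)\<close> is a subsolution. Without the gradient term this is because a subsolution of the
  linear equation lies below the averages of its past along a random walk with horizontal steps, and
  averages are additive, so neither Aleksandrov's theorem nor doubling of variables is needed.
  Sup-convolution along left translates makes both functions semiconvex, so that their gradients are almost
  constant near a touching point and the gradient term reduces to a constant. Exponential growth is handled
  by a barrier built from \<open>exp (k * heis_bracket p)\<close>.\<close>

section \<open>Group structure and jets\<close>

text \<open>Additivity of averages has its price. The walk steps multiply on the right, so the
  smooth data need Taylor bounds along left increments: these commute with the steps and keep the
  same constant however often one averages. A right step read as a left increment, however, grows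
  with the base point, so the estimate has to be localized to a cylinder. One step of length r lasts
  the time r^2/4 and is accurate up to O(r^3); the steps filling a time \<tau> together cost
  O(\<tau> r), which vanishes as they are refined. What remains is of order \<tau>^2, from the
  localization and from the superjet, together with terms that are a small fraction of \<tau>. An
  assumed violation of the inequality for the sum gains a full multiple of \<tau>, which is a
  contradiction for small \<tau>. The nonlinear term sees only the space gradient, so regularity in
  space is enough to freeze it and time is never convolved.\<close>

definition om :: "heis \<Rightarrow> heis \<Rightarrow> real" where
  "om p q = (fst p * fst (snd q) - fst q * fst (snd p)) / 2"

text \<open>This is \<open>p \<odot> q \<odot> - p\<close>. As \<open>om\<close> is half the
  symplectic form of the horizontal parts, conjugation shears \<open>q\<close> vertically by twice
  \<open>om p q\<close>. It rewrites a right increment at \<open>p\<close> as a left increment and,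
  being linear in \<open>q\<close>, carries linear and bilinear data to data of the same
  kind.\<close>

definition heis_conj :: "heis \<Rightarrow> heis \<Rightarrow> heis" where
  "heis_conj p q = q + (0, 0, 2 * om p q)"

lemma heis_mult_eq: "p \<odot> q = p + q + (0, 0, om p q)"
  by (cases p; cases q) (simp add: om_def)

lemma heis_inv_eq: "heis_inv p = - p"
  by (cases p) simp

lemma heis_zero [simp]: "0 \<odot> p = p" "p \<odot> 0 = p"
  by (auto simp: heis_mult_eq om_def prod_eq_iff)

lemma heis_assoc: "p \<odot> q \<odot> r = p \<odot> (q \<odot> r)"
  by (simp add: heis_mult_eq om_def prod_eq_iff) (simp add: algebra_simps add_divide_distrib diff_divide_distrib)

lemma heis_cancel [simp]:
  "- p \<odot> p = 0" "p \<odot> - p = 0" "- p \<odot> (p \<odot> q) = q" "p \<odot> (- p \<odot> q) = q"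
proof -
  show a: "- p \<odot> p = 0" and b: "p \<odot> - p = 0"
    by (auto simp: heis_mult_eq om_def prod_eq_iff)
  show "- p \<odot> (p \<odot> q) = q" "p \<odot> (- p \<odot> q) = q"
    by (simp_all add: heis_assoc[symmetric] a b)
qed

lemma heis_conj_mult: "heis_conj p q \<odot> p = p \<odot> q"
  by (simp add: heis_conj_def heis_mult_eq om_def prod_eq_iff) (simp add: algebra_simps add_divide_distrib diff_divide_distrib)

lemma linear_om: "linear (om p)"
  by (rule linearI) (auto simp: om_def algebra_simps add_divide_distrib diff_divide_distrib)

lemma linear_heis_conj: "linear (heis_conj p)"
  by (rule linearI) (simp_all add: heis_conj_def om_def prod_eq_iff algebra_simps add_divide_distrib diff_divide_distrib)

lemma om_self [simp]: "om p p = 0" "om p 0 = 0" "om 0 p = 0"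
  by (auto simp: om_def)

lemma norm_heis_sq: "(norm (p::heis))\<^sup>2 = (fst p)\<^sup>2 + (fst (snd p))\<^sup>2 + (snd (snd p))\<^sup>2"
  by (cases p) (simp add: norm_Pair)

lemma abs_coord_le_norm:
  fixes p :: heis
  shows "\<bar>fst p\<bar> \<le> norm p" "\<bar>fst (snd p)\<bar> \<le> norm p" "\<bar>snd (snd p)\<bar> \<le> norm p"
proof -
  have "\<bar>c\<bar> \<le> norm p" if "c\<^sup>2 \<le> (norm p)\<^sup>2" for c
    using power2_le_imp_le[of "\<bar>c\<bar>" "norm p"] that by simp
  then show "\<bar>fst p\<bar> \<le> norm p" "\<bar>fst (snd p)\<bar> \<le> norm p" "\<bar>snd (snd p)\<bar> \<le> norm p"
    unfolding norm_heis_sq by simp_all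
qed

lemma abs_om_le: "\<bar>om p q\<bar> \<le> norm p * norm q"
proof -
  have "\<bar>fst p\<bar> * \<bar>fst (snd q)\<bar> \<le> norm p * norm q" "\<bar>fst (snd p)\<bar> * \<bar>fst q\<bar> \<le> norm p * norm q"
    using abs_coord_le_norm[of p] abs_coord_le_norm[of q] by (auto intro: mult_mono)
  moreover have "\<bar>om p q\<bar> \<le> (\<bar>fst p\<bar> * \<bar>fst (snd q)\<bar> + \<bar>fst (snd p)\<bar> * \<bar>fst q\<bar>) / 2"
    unfolding om_def by (simp add: abs_mult[symmetric]) (simp add: mult.commute)
  ultimately show ?thesis by argo
qed

lemma norm_vert [simp]: "norm ((0, 0, c)::heis) = \<bar>c\<bar>"
  by (simp add: norm_Pair)

text \<open>The factor grows with the base point: a bounded right step is a bounded left increment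
  only over bounded sets, which is what forces localization.\<close>

lemma norm_heis_conj_le: "norm (heis_conj p q) \<le> (1 + 2 * norm p) * norm q"
proof -
  have "norm (heis_conj p q) \<le> norm q + norm ((0,0,2 * om p q)::heis)"
    unfolding heis_conj_def by (rule norm_triangle_ineq)
  also have "\<dots> \<le> norm q + 2 * (norm p * norm q)"
    using abs_om_le[of p q] by (simp add: abs_mult)
  finally show ?thesis by (simp add: algebra_simps)
qed

lemma norm_heis_mult_le: "norm (p \<odot> q) \<le> norm p + norm q + norm p * norm q"
proof -
  have "norm (p \<odot> q) \<le> norm (p + q) + norm ((0,0,om p q)::heis)"
    unfolding heis_mult_eq by (rule norm_triangle_ineq)
  then show ?thesis using abs_om_le[of p q] norm_triangle_ineq[of p q] by simp
qed

lemma continuous_on_om [continuous_intros]: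
  "continuous_on S f \<Longrightarrow> continuous_on S g \<Longrightarrow> continuous_on S (\<lambda>x. om (f x) (g x))"
  unfolding om_def by (intro continuous_intros) auto

lemma continuous_on_heis_mult [continuous_intros]:
  "continuous_on S f \<Longrightarrow> continuous_on S g \<Longrightarrow> continuous_on S (\<lambda>x. f x \<odot> g x)"
  unfolding heis_mult_eq by (intro continuous_intros)

lemma heis_expand: "(q::heis) = fst q *\<^sub>R (1,0,0) + fst (snd q) *\<^sub>R (0,1,0) + snd (snd q) *\<^sub>R (0,0,1)"
  by (auto simp: prod_eq_iff)

lemma linear_heis_expand:
  fixes \<xi> :: "heis \<Rightarrow> real"
  assumes "linear \<xi>"
  shows "\<xi> q = fst q * \<xi> (1,0,0) + fst (snd q) * \<xi> (0,1,0) + snd (snd q) * \<xi> (0,0,1)"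
proof -
  have "\<xi> q = \<xi> (fst q *\<^sub>R (1,0,0) + fst (snd q) *\<^sub>R (0,1,0) + snd (snd q) *\<^sub>R (0,0,1))"
    by (rule arg_cong[OF heis_expand])
  then show ?thesis
    by (simp only: linear_add[OF assms] linear_scale[OF assms] real_scaleR_def)
qed

lemma bilinear_heis_expand:
  fixes B :: "heis \<Rightarrow> heis \<Rightarrow> real"
  assumes "bilinear B"
  shows "B q q = (fst q)\<^sup>2 * B (1,0,0) (1,0,0) + (fst (snd q))\<^sup>2 * B (0,1,0) (0,1,0)
     + (snd (snd q))\<^sup>2 * B (0,0,1) (0,0,1)
     + fst q * fst (snd q) * (B (1,0,0) (0,1,0) + B (0,1,0) (1,0,0))
     + fst q * snd (snd q) * (B (1,0,0) (0,0,1) + B (0,0,1) (1,0,0))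
     + fst (snd q) * snd (snd q) * (B (0,1,0) (0,0,1) + B (0,0,1) (0,1,0))"
proof -
  have l: "linear (B x)" "linear (\<lambda>x. B x y)" for x y
    using assms unfolding bilinear_def by blast+
  have "B x q = fst q * B x (1,0,0) + fst (snd q) * B x (0,1,0) + snd (snd q) * B x (0,0,1)" for x
    by (rule linear_heis_expand[OF l(1)])
  moreover have "B q y = fst q * B (1,0,0) y + fst (snd q) * B (0,1,0) y + snd (snd q) * B (0,0,1) y" for y
    by (rule linear_heis_expand[OF l(2)])
  ultimately show ?thesis
    by (simp only:) (simp only: algebra_simps power2_eq_square)
qed

lemma bilinearI':
  assumes "\<And>x. linear (B x)" "\<And>y. linear (\<lambda>x. B x y)"
  shows "bilinear B"
  using assms by (auto simp: bilinear_def)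

lemma linear_bound:
  fixes \<xi> :: "heis \<Rightarrow> real"
  assumes "linear \<xi>"
  obtains C where "C > 0" "\<And>q. \<bar>\<xi> q\<bar> \<le> C * norm q"
  using linear_bounded_pos[OF assms] by auto

lemma bilinear_bound:
  fixes B :: "heis \<Rightarrow> heis \<Rightarrow> real"
  assumes "bilinear B"
  obtains C where "C > 0" "\<And>q r. \<bar>B q r\<bar> \<le> C * norm q * norm r"
  using bilinear_bounded_pos[OF assms] by auto

text \<open>In the coordinates \<open>q \<mapsto> p \<odot> q\<close> the first two axes are the
  flow lines of \<open>X1\<close> and \<open>X2\<close> through \<open>p\<close>, so these two
  values of the differential form the horizontal gradient at \<open>p\<close>.\<close>

definition grad2 :: "(heis \<Rightarrow> real) \<Rightarrow> real^2" where
  "grad2 \<xi> = vector [\<xi> (1,0,0), \<xi> (0,1,0)]"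

text \<open>A two-sided Peano expansion along right increments. \<open>B\<close> is read on the
  diagonal and is not asked to be symmetric, so that the product rule can record a cross term
  \<open>\<xi> q * \<eta> r\<close> as it comes.\<close>

definition space_jet :: "(heis \<Rightarrow> real) \<Rightarrow> heis \<Rightarrow> (heis \<Rightarrow> real) \<Rightarrow> (heis \<Rightarrow> heis \<Rightarrow> real) \<Rightarrow> bool" where
  "space_jet d p \<xi> B \<longleftrightarrow> linear \<xi> \<and> bilinear B \<and>
     (\<forall>e>0. \<exists>\<delta>>0. \<forall>q. norm q < \<delta> \<longrightarrow> \<bar>d (p \<odot> q) - d p - \<xi> q - B q q\<bar> \<le> e * (norm q)\<^sup>2)"

text \<open>Second-order data along \<open>q \<mapsto> p \<odot> q\<close>. The form \<open>B\<close> is half the Hessian, so for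
  \<open>A = form_matrix s1 s2\<close> the second-order term of the equation is \<open>2 * (B s1 s1 + B s2 s2)\<close>.\<close>

definition superjet ::
  "(heis \<times> real \<Rightarrow> real) \<Rightarrow> heis \<Rightarrow> real \<Rightarrow> real \<Rightarrow> (heis \<Rightarrow> real) \<Rightarrow> (heis \<Rightarrow> heis \<Rightarrow> real) \<Rightarrow> bool" where
  "superjet v p t b \<xi> B \<longleftrightarrow> linear \<xi> \<and> bilinear B \<and>
     (\<forall>e>0. \<exists>C. \<exists>\<delta>>0. \<forall>q s. norm q < \<delta> \<longrightarrow> \<bar>s - t\<bar> < \<delta> \<longrightarrow>
        v (p \<odot> q, s) \<le> v (p, t) + b * (s - t) + \<xi> q + B q q + e * (norm q)\<^sup>2 + C * (s - t)\<^sup>2)"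

section \<open>Quadratic test functions: from superjets to the viscosity inequalities\<close>

lemma C2_on_add:
  assumes "C2_on S f" "C2_on S g"
  shows "C2_on S (\<lambda>x. f x + g x)"
proof -
  obtain D1 D2 E1 E2 where
    "\<forall>a\<in>S. (f has_derivative blinfun_apply (D1 a)) (at a)"
    "\<forall>a\<in>S. (D1 has_derivative blinfun_apply (D2 a)) (at a)" "continuous_on S D2"
    "\<forall>a\<in>S. (g has_derivative blinfun_apply (E1 a)) (at a)"
    "\<forall>a\<in>S. (E1 has_derivative blinfun_apply (E2 a)) (at a)" "continuous_on S E2"
    using assms unfolding C2_on_def by metis
  then show ?thesis unfolding C2_on_def
    by (intro exI[of _ "\<lambda>a. D1 a + E1 a"] exI[of _ "\<lambda>a. D2 a + E2 a"])
       (auto simp: plus_blinfun.rep_eq intro!: continuous_intros derivative_eq_intros)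
qed

lemma C2_on_affine_mult:
  fixes m1 m2 :: "'a::real_normed_vector \<Rightarrow> real"
  assumes "bounded_linear m1" "bounded_linear m2"
  shows "C2_on S (\<lambda>a. (c1 + m1 a) * (c2 + m2 a))"
proof -
  define M1 M2 where "M1 = Blinfun m1" and "M2 = Blinfun m2"
  have M: "m1 = blinfun_apply M1" "m2 = blinfun_apply M2"
    using assms by (auto simp: M1_def M2_def bounded_linear_Blinfun_apply)
  define D2 where "D2 = Blinfun (\<lambda>w. M1 w *\<^sub>R M2 + M2 w *\<^sub>R M1)"
  have D2: "blinfun_apply D2 = (\<lambda>w. M1 w *\<^sub>R M2 + M2 w *\<^sub>R M1)"
    unfolding D2_def
    by (rule bounded_linear_Blinfun_apply)
       (intro bounded_linear_add bounded_linear_scaleR_left[THEN bounded_linear_compose]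
          blinfun.bounded_linear_right)
  show ?thesis unfolding C2_on_def M
    by (intro exI[of _ "\<lambda>a. (c1 + M1 a) *\<^sub>R M2 + (c2 + M2 a) *\<^sub>R M1"] exI[of _ "\<lambda>_. D2"])
       (auto simp: D2 plus_blinfun.rep_eq scaleR_blinfun.rep_eq blinfun.bilinear_simps fun_eq_iff
          intro!: derivative_eq_intros)
qed

lemma C2_on_affine_mult':
  assumes "\<exists>c m. bounded_linear m \<and> f = (\<lambda>a. c + m a)" "\<exists>c m. bounded_linear m \<and> g = (\<lambda>a. c + m a)"
  shows "C2_on S (\<lambda>a. f a * g a)"
  using assms C2_on_affine_mult by blast

lemma gauge_nonneg: "koranyi_gauge p \<ge> 0"
  by (cases p) (simp)

lemma koranyi_gauge_eq:
  "koranyi_gauge p = root 4 (((fst p)\<^sup>2 + (fst (snd p))\<^sup>2)\<^sup>2 + 16 * (snd (snd p))\<^sup>2)"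
  by (cases p) simp

lemma continuous_on_gauge: "continuous_on S koranyi_gauge"
  unfolding koranyi_gauge_eq[abs_def] by (intro continuous_intros)

text \<open>The polynomial is written in the coordinates of the increment from the base point, whose
  third entry is \<open>z - z0 - (x0 * y - y0 * x) / 2\<close>. Its horizontal derivatives at the
  base point are then read off from the coefficients. The vertical slope \<open>g3\<close> enters
  \<open>X1 X2\<close> and \<open>X2 X1\<close> with opposite signs, because the commutator of the
  two fields is the vertical derivative, and it cancels in the symmetrized Hessian.\<close>

lemma quadratic_test:
  fixes x0 y0 z0 t b C g1 g2 g3 c11 c22 c33 c12 c13 c23 :: real
  defines "\<phi> \<equiv> (\<lambda>((x,y,z),s). b * (s - t) + C * (s - t)\<^sup>2
      + g1 * (x - x0) + g2 * (y - y0) + g3 * (z - z0 - (x0 * y - y0 * x) / 2)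
      + c11 * (x - x0)\<^sup>2 + c22 * (y - y0)\<^sup>2 + c33 * (z - z0 - (x0 * y - y0 * x) / 2)\<^sup>2
      + c12 * (x - x0) * (y - y0) + c13 * (x - x0) * (z - z0 - (x0 * y - y0 * x) / 2)
      + c23 * (y - y0) * (z - z0 - (x0 * y - y0 * x) / 2))"
  shows "C2_near a \<phi>"
    and "parabolic_op A f \<phi> (x0,y0,z0) t =
      b - (2 * c11 * A$1$1 + c12 * A$1$2 + c12 * A$2$1 + 2 * c22 * A$2$2)
        + f (x0,y0,z0) (vector [g1, g2])"
proof -
  define x where "x = (\<lambda>a::heis \<times> real. fst (fst a))"
  define y where "y = (\<lambda>a::heis \<times> real. fst (snd (fst a)))"
  define z where "z = (\<lambda>a::heis \<times> real. snd (snd (fst a)))"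
  define k where "k = (\<lambda>a::heis \<times> real. snd a)"
  have bl: "bounded_linear x" "bounded_linear y" "bounded_linear z" "bounded_linear k"
    unfolding x_def y_def z_def k_def
    by (intro bounded_linear_fst bounded_linear_snd bounded_linear_fst_comp bounded_linear_snd_comp)+
  note bli = bl bounded_linear_add bounded_linear_sub bounded_linear_const_mult
  define w where "w = (\<lambda>a. z a - (x0 * y a - y0 * x a) / 2)"
  have w: "bounded_linear w"
    unfolding w_def divide_inverse
    by (intro bli bounded_linear_mult_const)
  have q: "\<exists>c m. bounded_linear m \<and> (\<lambda>a. x a - x0) = (\<lambda>a. c + m a)"
      "\<exists>c m. bounded_linear m \<and> (\<lambda>a. y a - y0) = (\<lambda>a. c + m a)"
      "\<exists>c m. bounded_linear m \<and> (\<lambda>a. w a - z0) = (\<lambda>a. c + m a)"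
      "\<exists>c m. bounded_linear m \<and> (\<lambda>a. k a - t) = (\<lambda>a. c + m a)"
    by (rule exI[of _ "-x0"], rule exI[of _ x], use bl in simp)
       (rule exI[of _ "-y0"], rule exI[of _ y], use bl in simp,
        rule exI[of _ "-z0"], rule exI[of _ w], use w in simp,
        rule exI[of _ "-t"], rule exI[of _ k], use bl in simp)
  have cc: "\<exists>c' m. bounded_linear m \<and> (\<lambda>a. c) = (\<lambda>a::heis \<times> real. c' + m a)" for c :: real
    by (rule exI[of _ c], rule exI[of _ "\<lambda>_. 0"]) simp
  have cm: "\<exists>c' m. bounded_linear m \<and> (\<lambda>a. c * f a) = (\<lambda>a::heis \<times> real. c' + m a)"
    if f: "\<exists>c' m. bounded_linear m \<and> f = (\<lambda>a::heis \<times> real. c' + m a)" for c :: real and f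
  proof -
    obtain c' m where "bounded_linear m" "f = (\<lambda>a. c' + m a)" using f by blast
    then show ?thesis
      by (intro exI[of _ "c * c'"] exI[of _ "\<lambda>a. c * m a"])
         (auto simp: algebra_simps intro: bounded_linear_const_mult)
  qed
  have "\<phi> = (\<lambda>a. b * (k a - t) + C * (k a - t) * (k a - t)
      + g1 * (x a - x0) + g2 * (y a - y0) + g3 * (w a - z0)
      + c11 * (x a - x0) * (x a - x0) + c22 * (y a - y0) * (y a - y0) + c33 * (w a - z0) * (w a - z0)
      + c12 * (x a - x0) * (y a - y0) + c13 * (x a - x0) * (w a - z0)
      + c23 * (y a - y0) * (w a - z0))"
    unfolding \<phi>_def x_def y_def z_def w_def k_def
    by (rule ext) (clarsimp simp: power2_eq_square, simp add: field_simps)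
  moreover have "C2_on UNIV \<dots>"
    by (intro C2_on_add C2_on_affine_mult' cm q cc)
  ultimately show "C2_near a \<phi>" unfolding C2_near_def by (metis UNIV_I open_UNIV)

  have t: "deriv (\<lambda>s. \<phi> ((x0,y0,z0), s)) t = b"
    by (rule DERIV_imp_deriv) (auto simp: \<phi>_def intro!: derivative_eq_intros)
  have X1: "X1 (\<lambda>q. \<phi> (q, t)) = (\<lambda>(x,y,z). g1 - (y - y0) * g3 / 2 + 2 * c11 * (x - x0) + c12 * (y - y0)
     + c13 * (z - z0 - (x0 * y - y0 * x) / 2 - (x - x0) * (y - y0) / 2)
     - c33 * (y - y0) * (z - z0 - (x0 * y - y0 * x) / 2) - c23 * (y - y0)\<^sup>2 / 2)"
  proof (rule ext, clarify)
    fix x y z :: real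
    have "deriv (\<lambda>s. \<phi> ((s,y,z), t)) x = g1 + g3 * y0 / 2 + 2 * c11 * (x - x0)
        + c33 * y0 * (z - z0 - (x0 * y - y0 * x) / 2) + c12 * (y - y0)
        + c13 * (z - z0 - (x0 * y - y0 * x) / 2) + c13 * (x - x0) * y0 / 2 + c23 * (y - y0) * y0 / 2"
      by (rule DERIV_imp_deriv) (auto simp: \<phi>_def field_simps intro!: derivative_eq_intros)
    moreover have "deriv (\<lambda>s. \<phi> ((x,y,s), t)) z = g3 + 2 * c33 * (z - z0 - (x0 * y - y0 * x) / 2)
        + c13 * (x - x0) + c23 * (y - y0)"
      by (rule DERIV_imp_deriv) (auto simp: \<phi>_def intro!: derivative_eq_intros)
    ultimately show "X1 (\<lambda>q. \<phi> (q, t)) (x,y,z) = g1 - (y - y0) * g3 / 2 + 2 * c11 * (x - x0) + c12 * (y - y0)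
     + c13 * (z - z0 - (x0 * y - y0 * x) / 2 - (x - x0) * (y - y0) / 2)
     - c33 * (y - y0) * (z - z0 - (x0 * y - y0 * x) / 2) - c23 * (y - y0)\<^sup>2 / 2"
      by (simp add: power2_eq_square) (simp add: field_simps)
  qed
  have X2: "X2 (\<lambda>q. \<phi> (q, t)) = (\<lambda>(x,y,z). g2 + (x - x0) * g3 / 2 + 2 * c22 * (y - y0) + c12 * (x - x0)
     + c23 * (z - z0 - (x0 * y - y0 * x) / 2 + (x - x0) * (y - y0) / 2)
     + c33 * (x - x0) * (z - z0 - (x0 * y - y0 * x) / 2) + c13 * (x - x0)\<^sup>2 / 2)"
  proof (rule ext, clarify)
    fix x y z :: real
    have "deriv (\<lambda>s. \<phi> ((x,s,z), t)) y = g2 - g3 * x0 / 2 + 2 * c22 * (y - y0)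
        - c33 * x0 * (z - z0 - (x0 * y - y0 * x) / 2) + c12 * (x - x0)
        + c23 * (z - z0 - (x0 * y - y0 * x) / 2) - c13 * (x - x0) * x0 / 2 - c23 * (y - y0) * x0 / 2"
      by (rule DERIV_imp_deriv) (auto simp: \<phi>_def field_simps intro!: derivative_eq_intros)
    moreover have "deriv (\<lambda>s. \<phi> ((x,y,s), t)) z = g3 + 2 * c33 * (z - z0 - (x0 * y - y0 * x) / 2)
        + c13 * (x - x0) + c23 * (y - y0)"
      by (rule DERIV_imp_deriv) (auto simp: \<phi>_def intro!: derivative_eq_intros)
    ultimately show "X2 (\<lambda>q. \<phi> (q, t)) (x,y,z) = g2 + (x - x0) * g3 / 2 + 2 * c22 * (y - y0) + c12 * (x - x0)
     + c23 * (z - z0 - (x0 * y - y0 * x) / 2 + (x - x0) * (y - y0) / 2)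
     + c33 * (x - x0) * (z - z0 - (x0 * y - y0 * x) / 2) + c13 * (x - x0)\<^sup>2 / 2"
      by (simp add: power2_eq_square) (simp add: field_simps)
  qed
  have 11: "X1 (X1 (\<lambda>q. \<phi> (q, t))) (x0,y0,z0) = 2 * c11"
  proof -
    have "deriv (\<lambda>s. X1 (\<lambda>q. \<phi> (q, t)) (s,y0,z0)) x0 = 2 * c11 + c13 * y0 / 2"
      unfolding X1 by (rule DERIV_imp_deriv) (auto intro!: derivative_eq_intros)
    moreover have "deriv (\<lambda>s. X1 (\<lambda>q. \<phi> (q, t)) (x0,y0,s)) z0 = c13"
      unfolding X1 by (rule DERIV_imp_deriv) (auto intro!: derivative_eq_intros)
    ultimately show ?thesis by simp
  qed
  have 22: "X2 (X2 (\<lambda>q. \<phi> (q, t))) (x0,y0,z0) = 2 * c22"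
  proof -
    have "deriv (\<lambda>s. X2 (\<lambda>q. \<phi> (q, t)) (x0,s,z0)) y0 = 2 * c22 - c23 * x0 / 2"
      unfolding X2 by (rule DERIV_imp_deriv) (auto intro!: derivative_eq_intros)
    moreover have "deriv (\<lambda>s. X2 (\<lambda>q. \<phi> (q, t)) (x0,y0,s)) z0 = c23"
      unfolding X2 by (rule DERIV_imp_deriv) (auto intro!: derivative_eq_intros)
    ultimately show ?thesis by simp
  qed
  have 12: "X1 (X2 (\<lambda>q. \<phi> (q, t))) (x0,y0,z0) = g3 / 2 + c12"
  proof -
    have "deriv (\<lambda>s. X2 (\<lambda>q. \<phi> (q, t)) (s,y0,z0)) x0 = g3 / 2 + c12 + c23 * y0 / 2"
      unfolding X2 by (rule DERIV_imp_deriv) (auto intro!: derivative_eq_intros)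
    moreover have "deriv (\<lambda>s. X2 (\<lambda>q. \<phi> (q, t)) (x0,y0,s)) z0 = c23"
      unfolding X2 by (rule DERIV_imp_deriv) (auto intro!: derivative_eq_intros)
    ultimately show ?thesis by simp
  qed
  have 21: "X2 (X1 (\<lambda>q. \<phi> (q, t))) (x0,y0,z0) = - g3 / 2 + c12"
  proof -
    have "deriv (\<lambda>s. X1 (\<lambda>q. \<phi> (q, t)) (x0,s,z0)) y0 = - g3 / 2 + c12 - c13 * x0 / 2"
      unfolding X1 by (rule DERIV_imp_deriv) (auto intro!: derivative_eq_intros)
    moreover have "deriv (\<lambda>s. X1 (\<lambda>q. \<phi> (q, t)) (x0,y0,s)) z0 = c13"
      unfolding X1 by (rule DERIV_imp_deriv) (auto intro!: derivative_eq_intros)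
    ultimately show ?thesis by simp
  qed
  have g: "hor_grad (\<lambda>q. \<phi> (q, t)) (x0,y0,z0) = vector [g1, g2]"
    unfolding hor_grad_def X1 X2 by simp
  show "parabolic_op A f \<phi> (x0,y0,z0) t =
      b - (2 * c11 * A$1$1 + c12 * A$1$2 + c12 * A$2$1 + 2 * c22 * A$2$2)
        + f (x0,y0,z0) (vector [g1, g2])"
    unfolding parabolic_op_def t g sym_hor_hessian_def 11 22 12 21
    by (simp add: trace_def matrix_matrix_mult_def sum_2)
qed

text \<open>The sum of the two rank-one matrices formed from the horizontal parts of
  \<open>s1\<close> and \<open>s2\<close>. It turns the trace against the Hessian into a sum of
  second derivatives along two directions, which become the directions of the random walk.\<close>

definition form_matrix :: "heis \<Rightarrow> heis \<Rightarrow> real^2^2" where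
  "form_matrix s1 s2 = vector
     [vector [(fst s1)\<^sup>2 + (fst s2)\<^sup>2, fst s1 * fst (snd s1) + fst s2 * fst (snd s2)],
      vector [fst s1 * fst (snd s1) + fst s2 * fst (snd s2), (fst (snd s1))\<^sup>2 + (fst (snd s2))\<^sup>2]]"

text \<open>A Cholesky factorization. If the pivot \<open>a\<close> vanishes, positivity of the form
  forces \<open>b = 0\<close> and one direction suffices.\<close>

lemma psd_matrix_form:
  assumes "psd_matrix A"
  obtains s1 s2 where "snd (snd s1) = 0" "snd (snd s2) = 0" "A = form_matrix s1 s2"
proof -
  define a b c where "a = A$1$1" "b = A$1$2" "c = A$2$2"
  have s: "A$2$1 = b"
  proof -
    have "transpose A $ 1 $ 2 = A$2$1" by (simp add: transpose_def)
    then show ?thesis using assms unfolding psd_matrix_def a_b_c_def by simp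
  qed
  have q: "0 \<le> a * x\<^sup>2 + 2 * b * x * y + c * y\<^sup>2" for x y
  proof -
    have "0 \<le> (vector [x,y] :: real^2) \<bullet> (A *v vector [x,y])"
      using assms unfolding psd_matrix_def by blast
    then show ?thesis
      by (simp add: inner_vec_def matrix_vector_mult_def sum_2 s a_b_c_def[symmetric]
          algebra_simps power2_eq_square)
  qed
  have a0: "a \<ge> 0" and c0: "c \<ge> 0" using q[of 1 0] q[of 0 1] by auto
  have M: "A = vector [vector [a, b], vector [b, c]]"
    by (simp add: vec_eq_iff forall_2 s a_b_c_def)
  show thesis
  proof (cases "a = 0")
    case True
    have "b = 0"
    proof (rule ccontr)
      assume "b \<noteq> 0"
      \<comment> \<open>With \<open>a = 0\<close> the form takes the value \<open>-1\<close> at this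
        point.\<close>
      then show False using q[of "- (c + 1) / (2 * b)" 1] True by (simp add: field_simps)
    qed
    then show thesis
      using that[of "(0, sqrt c, 0)" "(0,0,0)"] c0 True M by (simp add: form_matrix_def)
  next
    case False
    have d: "c - b\<^sup>2 / a \<ge> 0"
      using q[of "- b / a" 1] False by (simp add: field_simps power2_eq_square)
    have "(sqrt a)\<^sup>2 = a" "sqrt a * (b / sqrt a) = b" "(b / sqrt a)\<^sup>2 + (sqrt (c - b\<^sup>2 / a))\<^sup>2 = c"
      using a0 False d by (simp_all add: power_divide)
    then have "A = form_matrix (sqrt a, b / sqrt a, 0) (0, sqrt (c - b\<^sup>2 / a), 0)"
      unfolding M form_matrix_def by simp
    then show thesis using that[of "(sqrt a, b / sqrt a, 0)" "(0, sqrt (c - b\<^sup>2 / a), 0)"] by simp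
  qed
qed

text \<open>The error \<open>e * (norm q)\<^sup>2\<close> of the superjet is moved into the
  polynomial by adding \<open>e\<close> to its diagonal coefficients. The polynomial then really
  touches \<open>w\<close> from above, at the price of the last term of \<open>N\<close>. Its
  negative is provided as well, as the test function for a supersolution.\<close>

lemma superjet_test:
  fixes w :: "heis \<times> real \<Rightarrow> real" and B :: "heis \<Rightarrow> heis \<Rightarrow> real" and s1 s2 :: heis
  assumes w: "superjet w p t b \<xi> B" and "e > 0" and s: "snd (snd s1) = 0" "snd (snd s2) = 0"
  defines "N \<equiv> b - 2 * (B s1 s1 + B s2 s2) - 2 * e * ((norm s1)\<^sup>2 + (norm s2)\<^sup>2)"
  obtains \<phi> where "C2_near (p,t) \<phi>" "C2_near (p,t) (\<lambda>a. - \<phi> a)"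
    "local_max_at (\<lambda>a. w a - \<phi> a) (p,t)"
    "\<forall>f. parabolic_op (form_matrix s1 s2) f \<phi> p t = N + f p (grad2 \<xi>)"
    "\<forall>f. parabolic_op (form_matrix s1 s2) f (\<lambda>a. - \<phi> a) p t = - N + f p (- grad2 \<xi>)"
proof -
  have lin: "linear \<xi>" and bil: "bilinear B" using w by (auto simp: superjet_def)
  obtain C \<delta> where \<delta>: "\<delta> > 0" and le: "\<And>q s. norm q < \<delta> \<Longrightarrow> \<bar>s - t\<bar> < \<delta> \<Longrightarrow>
        w (p \<odot> q, s) \<le> w (p, t) + b * (s - t) + \<xi> q + B q q + e * (norm q)\<^sup>2 + C * (s - t)\<^sup>2"
    using w \<open>e > 0\<close> unfolding superjet_def by meson
  obtain x0 y0 z0 where p: "p = (x0,y0,z0)" by (cases p)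
  define g1 g2 g3 where "g1 = \<xi> (1,0,0)" "g2 = \<xi> (0,1,0)" "g3 = \<xi> (0,0,1)"
  define c11 c22 c33 where "c11 = B (1,0,0) (1,0,0) + e" "c22 = B (0,1,0) (0,1,0) + e" "c33 = B (0,0,1) (0,0,1) + e"
  define c12 c13 c23 where "c12 = B (1,0,0) (0,1,0) + B (0,1,0) (1,0,0)"
    "c13 = B (1,0,0) (0,0,1) + B (0,0,1) (1,0,0)" "c23 = B (0,1,0) (0,0,1) + B (0,0,1) (0,1,0)"
  define \<phi> :: "heis \<times> real \<Rightarrow> real" where
    "\<phi> = (\<lambda>((x,y,z),s). b * (s - t) + C * (s - t)\<^sup>2
      + g1 * (x - x0) + g2 * (y - y0) + g3 * (z - z0 - (x0 * y - y0 * x) / 2)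
      + c11 * (x - x0)\<^sup>2 + c22 * (y - y0)\<^sup>2 + c33 * (z - z0 - (x0 * y - y0 * x) / 2)\<^sup>2
      + c12 * (x - x0) * (y - y0) + c13 * (x - x0) * (z - z0 - (x0 * y - y0 * x) / 2)
      + c23 * (y - y0) * (z - z0 - (x0 * y - y0 * x) / 2))"
  have neg: "(\<lambda>a. - \<phi> a) = (\<lambda>((x,y,z),s). (-b) * (s - t) + (-C) * (s - t)\<^sup>2
      + (-g1) * (x - x0) + (-g2) * (y - y0) + (-g3) * (z - z0 - (x0 * y - y0 * x) / 2)
      + (-c11) * (x - x0)\<^sup>2 + (-c22) * (y - y0)\<^sup>2 + (-c33) * (z - z0 - (x0 * y - y0 * x) / 2)\<^sup>2
      + (-c12) * (x - x0) * (y - y0) + (-c13) * (x - x0) * (z - z0 - (x0 * y - y0 * x) / 2)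
      + (-c23) * (y - y0) * (z - z0 - (x0 * y - y0 * x) / 2))"
    unfolding \<phi>_def by (rule ext) (simp split: prod.split)
  \<comment> \<open>As a function of the increment \<open>- p \<odot> P\<close> the test polynomial
    is the right-hand side of the superjet inequality without the constant
    \<open>w (p, t)\<close>.\<close>
  have val: "\<phi> (P, s) = b * (s - t) + \<xi> (- p \<odot> P) + B (- p \<odot> P) (- p \<odot> P)
      + e * (norm (- p \<odot> P))\<^sup>2 + C * (s - t)\<^sup>2" for P s
  proof -
    obtain x y z where P: "P = (x,y,z)" by (cases P)
    have q: "- p \<odot> P = (x - x0, y - y0, z - z0 - (x0 * y - y0 * x) / 2)"
      unfolding p P by (simp add: field_simps)
    show ?thesis
      unfolding q linear_heis_expand[OF lin, of "(x - x0, y - y0, z - z0 - (x0 * y - y0 * x) / 2)"]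
        bilinear_heis_expand[OF bil, of "(x - x0, y - y0, z - z0 - (x0 * y - y0 * x) / 2)"] norm_heis_sq
      unfolding P \<phi>_def g1_g2_g3_def c11_c22_c33_def c12_c13_c23_def
      by (simp only: prod.case fst_conv snd_conv) (simp only: algebra_simps)
  qed
  have "open {a::heis \<times> real. norm (- p \<odot> fst a) < \<delta>}" "open {a::heis \<times> real. \<bar>snd a - t\<bar> < \<delta>}"
    by (intro open_Collect_less continuous_intros)+
  then have "\<forall>\<^sub>F a in nhds (p,t). norm (- p \<odot> fst a) < \<delta>" "\<forall>\<^sub>F a in nhds (p,t). \<bar>snd a - t\<bar> < \<delta>"
    using \<delta> by (auto dest!: eventually_nhds_in_open[of _ "(p,t)"])
  then have lm: "local_max_at (\<lambda>a. w a - \<phi> a) (p,t)"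
    unfolding local_max_at_def
  proof eventually_elim
    case (elim a)
    note el = elim
    have "\<phi> (p,t) = 0" unfolding val using lin bil by (simp add: linear_0 bilinear_lzero)
    then show ?case using le[OF el] val[of "fst a" "snd a"] by simp
  qed
  have gr: "grad2 \<xi> = vector [g1, g2]" "- grad2 \<xi> = vector [- g1, - g2]"
    by (auto simp: grad2_def g1_g2_g3_def vec_eq_iff forall_2)
  have "B s1 s1 = (fst s1)\<^sup>2 * (c11 - e) + (fst (snd s1))\<^sup>2 * (c22 - e) + fst s1 * fst (snd s1) * c12"
    "B s2 s2 = (fst s2)\<^sup>2 * (c11 - e) + (fst (snd s2))\<^sup>2 * (c22 - e) + fst s2 * fst (snd s2) * c12"
    using bilinear_heis_expand[OF bil, of s1] bilinear_heis_expand[OF bil, of s2]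
    by (simp_all add: s c11_c22_c33_def c12_c13_c23_def)
  then have N: "N = b - (2 * c11 * (form_matrix s1 s2)$1$1 + c12 * (form_matrix s1 s2)$1$2
      + c12 * (form_matrix s1 s2)$2$1 + 2 * c22 * (form_matrix s1 s2)$2$2)"
    unfolding N_def norm_heis_sq
    by (simp add: s form_matrix_def algebra_simps)
  show thesis
  proof (rule that[OF _ _ lm])
    show "C2_near (p,t) \<phi>" unfolding \<phi>_def by (rule quadratic_test)
    show "C2_near (p,t) (\<lambda>a. - \<phi> a)" unfolding neg by (rule quadratic_test)
    show "\<forall>f. parabolic_op (form_matrix s1 s2) f \<phi> p t = N + f p (grad2 \<xi>)"
      unfolding \<phi>_def p gr N by (intro allI quadratic_test)
    show "\<forall>f. parabolic_op (form_matrix s1 s2) f (\<lambda>a. - \<phi> a) p t = - N + f p (- grad2 \<xi>)"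
      unfolding neg p gr(2) N by (rule allI, subst quadratic_test) simp
  qed
qed

lemma le_of_all_eps:
  fixes x D :: real
  assumes "\<And>e. e > 0 \<Longrightarrow> x \<le> e * D"
  shows "x \<le> 0"
proof (rule field_le_epsilon)
  fix e :: real assume "e > 0"
  have "x \<le> e / (\<bar>D\<bar> + 1) * D" using assms[of "e / (\<bar>D\<bar> + 1)"] \<open>e > 0\<close> by simp
  also have "\<dots> \<le> e / (\<bar>D\<bar> + 1) * (\<bar>D\<bar> + 1)" using \<open>e > 0\<close> by (intro mult_left_mono) auto
  finally show "x \<le> 0 + e" by simp
qed

lemma subsolution_superjet:
  assumes sub: "viscosity_subsolution (form_matrix s1 s2) f u" and "t > 0"
    and j: "superjet u p t b \<xi> B" and s: "snd (snd s1) = 0" "snd (snd s2) = 0"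
  shows "b - 2 * (B s1 s1 + B s2 s2) + f p (grad2 \<xi>) \<le> 0"
proof (rule le_of_all_eps)
  fix e :: real assume "e > 0"
  let ?N = "b - 2 * (B s1 s1 + B s2 s2) - 2 * e * ((norm s1)\<^sup>2 + (norm s2)\<^sup>2)"
  obtain \<phi> where \<phi>: "C2_near (p,t) \<phi>" "C2_near (p,t) (\<lambda>a. - \<phi> a)"
    "local_max_at (\<lambda>a. u a - \<phi> a) (p,t)"
    "\<forall>f. parabolic_op (form_matrix s1 s2) f \<phi> p t = ?N + f p (grad2 \<xi>)"
    "\<forall>f. parabolic_op (form_matrix s1 s2) f (\<lambda>a. - \<phi> a) p t = - ?N + f p (- grad2 \<xi>)"
    by (rule superjet_test[OF j \<open>e > 0\<close> s]) (rule that)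
  have "parabolic_op (form_matrix s1 s2) f \<phi> p t \<le> 0"
    using sub \<open>t > 0\<close> \<phi>(1,3) unfolding viscosity_subsolution_def by blast
  then show "b - 2 * (B s1 s1 + B s2 s2) + f p (grad2 \<xi>) \<le> e * (2 * ((norm s1)\<^sup>2 + (norm s2)\<^sup>2))"
    unfolding \<phi>(4)[rule_format] by (simp add: algebra_simps)
qed

text \<open>A superjet of \<open>- u\<close> is a subjet of \<open>u\<close> with all signs
  reversed, whence the argument \<open>- grad2 \<xi>\<close> and the minus sign in front of
  \<open>f\<close>. In this form a supersolution is treated as a second subsolution.\<close>

lemma supersolution_superjet:
  assumes sup: "viscosity_supersolution (form_matrix s1 s2) f u" and "t > 0"
    and j: "superjet (\<lambda>a. - u a) p t b \<xi> B" and s: "snd (snd s1) = 0" "snd (snd s2) = 0"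
  shows "b - 2 * (B s1 s1 + B s2 s2) - f p (- grad2 \<xi>) \<le> 0"
proof (rule le_of_all_eps)
  fix e :: real assume "e > 0"
  let ?N = "b - 2 * (B s1 s1 + B s2 s2) - 2 * e * ((norm s1)\<^sup>2 + (norm s2)\<^sup>2)"
  obtain \<phi> where \<phi>: "C2_near (p,t) \<phi>" "C2_near (p,t) (\<lambda>a. - \<phi> a)"
    "local_max_at (\<lambda>a. - u a - \<phi> a) (p,t)"
    "\<forall>f. parabolic_op (form_matrix s1 s2) f \<phi> p t = ?N + f p (grad2 \<xi>)"
    "\<forall>f. parabolic_op (form_matrix s1 s2) f (\<lambda>a. - \<phi> a) p t = - ?N + f p (- grad2 \<xi>)"
    by (rule superjet_test[OF j \<open>e > 0\<close> s]) (rule that)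
  have "local_min_at (\<lambda>a. u a - - \<phi> a) (p,t)"
    using \<phi>(3) unfolding local_max_at_def local_min_at_def by (rule eventually_mono) simp
  then have "0 \<le> parabolic_op (form_matrix s1 s2) f (\<lambda>a. - \<phi> a) p t"
    using sup \<open>t > 0\<close> \<phi>(2) unfolding viscosity_supersolution_def by blast
  then show "b - 2 * (B s1 s1 + B s2 s2) - f p (- grad2 \<xi>) \<le> e * (2 * ((norm s1)\<^sup>2 + (norm s2)\<^sup>2))"
    unfolding \<phi>(5)[rule_format] by (simp add: algebra_simps)
qed

section \<open>Calculus of jets\<close>

lemma jet_mult_real:
  fixes a b x y X Y r s n C e :: real
  assumes C: "1 \<le> C" and n: "0 \<le> n" "n \<le> 1" and e: "0 \<le> e" "e \<le> 1"
    and a: "\<bar>a\<bar> \<le> C" and b: "\<bar>b\<bar> \<le> C" and x: "\<bar>x\<bar> \<le> C * n" and y: "\<bar>y\<bar> \<le> C * n"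
    and X: "\<bar>X\<bar> \<le> C * n\<^sup>2" and Y: "\<bar>Y\<bar> \<le> C * n\<^sup>2"
    and r: "\<bar>r\<bar> \<le> e * n\<^sup>2" and s: "\<bar>s\<bar> \<le> e * n\<^sup>2"
  shows "\<bar>(a + x + X + r) * (b + y + Y + s) - a * b - (a * y + b * x) - (a * Y + b * X + x * y)\<bar>
    \<le> n\<^sup>2 * (2 * C * e + 8 * C\<^sup>2 * n)"
proof -
  have en: "e * n\<^sup>2 \<le> n\<^sup>2" using e n by (simp add: mult_left_le_one_le)
  have Xr: "\<bar>X + r\<bar> \<le> 2 * C * n\<^sup>2" and Ys: "\<bar>Y + s\<bar> \<le> 2 * C * n\<^sup>2"
  proof -
    have "n\<^sup>2 \<le> C * n\<^sup>2" using mult_right_mono[OF C, of "n\<^sup>2"] by simp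
    then have "\<bar>r\<bar> \<le> C * n\<^sup>2" "\<bar>s\<bar> \<le> C * n\<^sup>2" using r s en by linarith+
    then show "\<bar>X + r\<bar> \<le> 2 * C * n\<^sup>2" "\<bar>Y + s\<bar> \<le> 2 * C * n\<^sup>2"
      using X Y by (simp_all add: abs_le_iff)
  qed
  have nn: "n\<^sup>2 \<le> n" using n by (simp add: power2_eq_square mult_left_le)
  have yY: "\<bar>y + (Y + s)\<bar> \<le> 3 * C * n"
    using y Ys mult_left_mono[OF nn, of "2 * C"] C abs_triangle_ineq[of y "Y + s"] by linarith
  have t1: "\<bar>a * s\<bar> \<le> C * (e * n\<^sup>2)"
    unfolding abs_mult by (rule mult_mono) (use a s C in simp_all)
  have t2: "\<bar>r * b\<bar> \<le> e * n\<^sup>2 * C"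
    unfolding abs_mult by (rule mult_mono) (use b r C e in simp_all)
  have t3: "\<bar>x * (Y + s)\<bar> \<le> C * n * (2 * C * n\<^sup>2)"
    unfolding abs_mult by (rule mult_mono) (use x Ys C n in simp_all)
  have t4: "\<bar>(X + r) * (y + (Y + s))\<bar> \<le> 2 * C * n\<^sup>2 * (3 * C * n)"
    unfolding abs_mult[of "X + r"] using C n Xr yY by (intro mult_mono) auto
  \<comment> \<open>Apart from the first- and second-order terms there remain \<open>a * s\<close>
    and \<open>r * b\<close>, each worth \<open>C * e\<close> times \<open>n\<^sup>2\<close>, and
    two products of order three, worth \<open>2 * C\<^sup>2 * n\<close> and
    \<open>6 * C\<^sup>2 * n\<close> times \<open>n\<^sup>2\<close>.\<close>
  have "(a + x + X + r) * (b + y + Y + s) - a * b - (a * y + b * x) - (a * Y + b * X + x * y)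
      = a * s + r * b + x * (Y + s) + (X + r) * (y + (Y + s))"
    by (simp add: algebra_simps)
  also have "\<bar>\<dots>\<bar> \<le> C * (e * n\<^sup>2) + e * n\<^sup>2 * C + C * n * (2 * C * n\<^sup>2) + 2 * C * n\<^sup>2 * (3 * C * n)"
    using t1 t2 t3 t4 by linarith
  also have "\<dots> = n\<^sup>2 * (2 * C * e + 8 * C\<^sup>2 * n)"
    by (simp add: algebra_simps power2_eq_square)
  finally show ?thesis .
qed

lemma space_jet_linear: "space_jet d p \<xi> B \<Longrightarrow> linear \<xi>"
  and space_jet_bilinear: "space_jet d p \<xi> B \<Longrightarrow> bilinear B"
  by (simp_all add: space_jet_def)

lemma space_jetD:
  assumes "space_jet d p \<xi> B" "e > 0"
  obtains \<delta> where "\<delta> > 0"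
    "\<And>q. norm q < \<delta> \<Longrightarrow> \<bar>d (p \<odot> q) - d p - \<xi> q - B q q\<bar> \<le> e * (norm q)\<^sup>2"
  using assms unfolding space_jet_def by blast

lemma jet_forms_bound:
  fixes \<xi> :: "heis \<Rightarrow> real" and B :: "heis \<Rightarrow> heis \<Rightarrow> real"
  assumes "linear \<xi>" "bilinear B"
  obtains C where "C \<ge> 1" "\<bar>c\<bar> \<le> C" "\<And>q. \<bar>\<xi> q\<bar> \<le> C * norm q" "\<And>q. \<bar>B q q\<bar> \<le> C * (norm q)\<^sup>2"
proof -
  obtain C1 where C1: "C1 > 0" "\<And>q. \<bar>\<xi> q\<bar> \<le> C1 * norm q" using linear_bound[OF assms(1)] by blast
  obtain C2 where C2: "C2 > 0" "\<And>q r. \<bar>B q r\<bar> \<le> C2 * norm q * norm r" using bilinear_bound[OF assms(2)] by blast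
  define C where "C = 1 + \<bar>c\<bar> + C1 + C2"
  have 1: "\<bar>\<xi> q\<bar> \<le> C * norm q" for q
  proof -
    have "C1 * norm q \<le> C * norm q" using C2 by (intro mult_right_mono) (auto simp: C_def)
    then show ?thesis using C1(2)[of q] by linarith
  qed
  have 2: "\<bar>B q q\<bar> \<le> C * (norm q)\<^sup>2" for q
  proof -
    have "C2 * (norm q)\<^sup>2 \<le> C * (norm q)\<^sup>2" using C1 by (intro mult_right_mono) (auto simp: C_def)
    then show ?thesis using C2(2)[of q q] by (simp add: power2_eq_square mult.assoc)
  qed
  have "C \<ge> 1" "\<bar>c\<bar> \<le> C" using C1(1) C2(1) by (simp_all add: C_def)
  from that[OF this 1 2] show thesis .
qed

lemma linear_mult_const: "linear \<xi> \<Longrightarrow> linear (\<lambda>q. (c::real) * \<xi> q)"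
  by (rule linearI) (simp_all add: linear_add linear_scale algebra_simps)

lemma bilinear_linear:
  assumes "bilinear B"
  shows "linear (B x)" "linear (\<lambda>x. B x y)"
  using assms unfolding bilinear_def by blast+

lemma bilinear_cmult:
  assumes "bilinear B"
  shows "bilinear (\<lambda>q r. (c::real) * B q r)"
  by (intro bilinearI' linear_mult_const bilinear_linear[OF assms])

lemma bilinear_add:
  assumes "bilinear A" "bilinear B"
  shows "bilinear (\<lambda>q r. A q r + B q r :: real)"
  by (intro bilinearI' linear_compose_add bilinear_linear[OF assms(1)] bilinear_linear[OF assms(2)])

lemma bilinear_tensor:
  assumes "linear \<xi>" "linear \<eta>"
  shows "bilinear (\<lambda>q r. \<xi> q * \<eta> r :: real)"
proof (rule bilinearI')
  show "linear (\<lambda>r. \<xi> x * \<eta> r)" for x by (rule linear_mult_const[OF assms(2)])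
  show "linear (\<lambda>q. \<xi> q * \<eta> y)" for y
    using linear_mult_const[OF assms(1), of "\<eta> y"] by (simp only: mult.commute)
qed

lemma bilinear_compose_linear:
  assumes "bilinear B" "linear h"
  shows "bilinear (\<lambda>q r. B (h q) (h r) :: real)"
proof (rule bilinearI')
  show "linear (\<lambda>r. B (h x) (h r))" for x
    by (rule linear_compose[OF assms(2) bilinear_linear(1)[OF assms(1)], unfolded o_def])
  show "linear (\<lambda>q. B (h q) (h y))" for y
    by (rule linear_compose[OF assms(2) bilinear_linear(2)[OF assms(1)], unfolded o_def])
qed

lemma space_jet_mult:
  assumes d: "space_jet d p \<xi> A" and f: "space_jet f p \<eta> B"
  shows "space_jet (\<lambda>q. d q * f q) p (\<lambda>q. d p * \<eta> q + f p * \<xi> q)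
    (\<lambda>q r. d p * B q r + f p * A q r + \<xi> q * \<eta> r)"
proof -
  note lin = space_jet_linear[OF d] space_jet_linear[OF f] space_jet_bilinear[OF d] space_jet_bilinear[OF f]
  obtain C1 where C1: "C1 \<ge> 1" "\<bar>d p\<bar> \<le> C1" "\<And>q. \<bar>\<xi> q\<bar> \<le> C1 * norm q" "\<And>q. \<bar>A q q\<bar> \<le> C1 * (norm q)\<^sup>2"
    using jet_forms_bound[OF lin(1,3), of "d p"] by blast
  obtain C2 where C2: "C2 \<ge> 1" "\<bar>f p\<bar> \<le> C2" "\<And>q. \<bar>\<eta> q\<bar> \<le> C2 * norm q" "\<And>q. \<bar>B q q\<bar> \<le> C2 * (norm q)\<^sup>2"
    using jet_forms_bound[OF lin(2,4), of "f p"] by blast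
  define C where "C = C1 + C2"
  have C: "1 \<le> C" "\<bar>d p\<bar> \<le> C" "\<bar>f p\<bar> \<le> C" using C1 C2 by (auto simp: C_def)
  have b: "\<bar>\<xi> q\<bar> \<le> C * norm q" "\<bar>A q q\<bar> \<le> C * (norm q)\<^sup>2" "\<bar>\<eta> q\<bar> \<le> C * norm q" "\<bar>B q q\<bar> \<le> C * (norm q)\<^sup>2" for q
  proof -
    have "C1 * norm q \<le> C * norm q" "C1 * (norm q)\<^sup>2 \<le> C * (norm q)\<^sup>2"
      "C2 * norm q \<le> C * norm q" "C2 * (norm q)\<^sup>2 \<le> C * (norm q)\<^sup>2"
      using C1(1) C2(1) by (auto simp: C_def intro!: mult_right_mono)
    then show "\<bar>\<xi> q\<bar> \<le> C * norm q" "\<bar>A q q\<bar> \<le> C * (norm q)\<^sup>2" "\<bar>\<eta> q\<bar> \<le> C * norm q" "\<bar>B q q\<bar> \<le> C * (norm q)\<^sup>2"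
      using C1(3,4)[of q] C2(3,4)[of q] by linarith+
  qed
  show ?thesis unfolding space_jet_def
  proof (intro conjI allI impI)
    show "linear (\<lambda>q. d p * \<eta> q + f p * \<xi> q)"
      by (intro linear_compose_add linear_mult_const lin)
    show "bilinear (\<lambda>q r. d p * B q r + f p * A q r + \<xi> q * \<eta> r)"
      by (intro bilinear_add bilinear_cmult bilinear_tensor lin)
    fix e :: real assume "e > 0"
    \<comment> \<open>The product error, relative to \<open>(norm q)\<^sup>2\<close>, is
      \<open>2 * C * e' + 8 * C\<^sup>2 * norm q\<close>. Half of \<open>e\<close> goes to each
      summand: the first is controlled by \<open>e'\<close>, the second by
      \<open>\<delta>\<close>.\<close>
    define e' where "e' = min 1 (e / (4 * C))"
    have e': "0 < e'" "e' \<le> 1" "2 * C * e' \<le> e / 2"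
    proof -
      show "0 < e'" "e' \<le> 1" using \<open>e > 0\<close> C by (auto simp: e'_def)
      have "2 * C * e' \<le> 2 * C * (e / (4 * C))" using C by (intro mult_left_mono) (auto simp: e'_def)
      then show "2 * C * e' \<le> e / 2" using C by simp
    qed
    obtain \<delta>1 where \<delta>1: "\<delta>1 > 0" "\<And>q. norm q < \<delta>1 \<Longrightarrow> \<bar>d (p \<odot> q) - d p - \<xi> q - A q q\<bar> \<le> e' * (norm q)\<^sup>2"
      using space_jetD[OF d e'(1)] by blast
    obtain \<delta>2 where \<delta>2: "\<delta>2 > 0" "\<And>q. norm q < \<delta>2 \<Longrightarrow> \<bar>f (p \<odot> q) - f p - \<eta> q - B q q\<bar> \<le> e' * (norm q)\<^sup>2"
      using space_jetD[OF f e'(1)] by blast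
    define \<delta> where "\<delta> = min (min \<delta>1 \<delta>2) (min 1 (e / (16 * C\<^sup>2)))"
    have "\<delta> > 0" using \<delta>1 \<delta>2 \<open>e > 0\<close> C by (auto simp: \<delta>_def)
    moreover have "\<bar>d (p \<odot> q) * f (p \<odot> q) - d p * f p - (d p * \<eta> q + f p * \<xi> q)
        - (d p * B q q + f p * A q q + \<xi> q * \<eta> q)\<bar> \<le> e * (norm q)\<^sup>2" if q: "norm q < \<delta>" for q
    proof -
      define r s where "r = d (p \<odot> q) - d p - \<xi> q - A q q" and "s = f (p \<odot> q) - f p - \<eta> q - B q q"
      have eq: "d (p \<odot> q) = d p + \<xi> q + A q q + r" "f (p \<odot> q) = f p + \<eta> q + B q q + s"
        by (simp_all add: r_def s_def)
      have n: "0 \<le> norm q" "norm q \<le> 1" using q by (auto simp: \<delta>_def)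
      have rs: "\<bar>r\<bar> \<le> e' * (norm q)\<^sup>2" "\<bar>s\<bar> \<le> e' * (norm q)\<^sup>2"
        unfolding r_def s_def using q by (auto simp: \<delta>_def intro!: \<delta>1 \<delta>2)
      have "8 * C\<^sup>2 * norm q \<le> 8 * C\<^sup>2 * (e / (16 * C\<^sup>2))"
        using q C by (intro mult_left_mono) (auto simp: \<delta>_def)
      also have "\<dots> = e / 2" using C by simp
      finally have *: "2 * C * e' + 8 * C\<^sup>2 * norm q \<le> e" using e'(3) by linarith
      have "\<bar>d (p \<odot> q) * f (p \<odot> q) - d p * f p - (d p * \<eta> q + f p * \<xi> q)
        - (d p * B q q + f p * A q q + \<xi> q * \<eta> q)\<bar> \<le> (norm q)\<^sup>2 * (2 * C * e' + 8 * C\<^sup>2 * norm q)"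
        unfolding eq
        by (rule jet_mult_real[OF C(1) n less_imp_le[OF e'(1)] e'(2) C(2,3) b(1,3,2,4) rs])
      also have "\<dots> \<le> (norm q)\<^sup>2 * e" by (rule mult_left_mono[OF *]) simp
      finally show ?thesis by (simp add: mult.commute)
    qed
    ultimately show "\<exists>\<delta>>0. \<forall>q. norm q < \<delta> \<longrightarrow> \<bar>d (p \<odot> q) * f (p \<odot> q) - d p * f p - (d p * \<eta> q + f p * \<xi> q)
        - (d p * B q q + f p * A q q + \<xi> q * \<eta> q)\<bar> \<le> e * (norm q)\<^sup>2" by blast
  qed
qed

lemma space_jet_add:
  assumes d: "space_jet d p \<xi> A" and f: "space_jet f p \<eta> B"
  shows "space_jet (\<lambda>q. d q + f q) p (\<lambda>q. \<xi> q + \<eta> q) (\<lambda>q r. A q r + B q r)"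
  unfolding space_jet_def
proof (intro conjI allI impI)
  note lin = space_jet_linear[OF d] space_jet_linear[OF f] space_jet_bilinear[OF d] space_jet_bilinear[OF f]
  show "linear (\<lambda>q. \<xi> q + \<eta> q)" "bilinear (\<lambda>q r. A q r + B q r)"
    by (intro linear_compose_add bilinear_add lin)+
  fix e :: real assume "e > 0"
  then have e: "e / 2 > 0" by simp
  obtain \<delta>1 where \<delta>1: "\<delta>1 > 0" "\<And>q. norm q < \<delta>1 \<Longrightarrow> \<bar>d (p \<odot> q) - d p - \<xi> q - A q q\<bar> \<le> e / 2 * (norm q)\<^sup>2"
    using space_jetD[OF d e] by blast
  obtain \<delta>2 where \<delta>2: "\<delta>2 > 0" "\<And>q. norm q < \<delta>2 \<Longrightarrow> \<bar>f (p \<odot> q) - f p - \<eta> q - B q q\<bar> \<le> e / 2 * (norm q)\<^sup>2"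
    using space_jetD[OF f e] by blast
  show "\<exists>\<delta>>0. \<forall>q. norm q < \<delta> \<longrightarrow> \<bar>d (p \<odot> q) + f (p \<odot> q) - (d p + f p) - (\<xi> q + \<eta> q)
     - (A q q + B q q)\<bar> \<le> e * (norm q)\<^sup>2"
    using \<delta>1(1) \<delta>2(1)
  proof (intro exI[of _ "min \<delta>1 \<delta>2"] conjI allI impI)
    fix q :: heis assume "norm q < min \<delta>1 \<delta>2"
    then have q: "norm q < \<delta>1" "norm q < \<delta>2" by simp_all
    have "e / 2 * (norm q)\<^sup>2 + e / 2 * (norm q)\<^sup>2 = e * (norm q)\<^sup>2" by simp
    then show "\<bar>d (p \<odot> q) + f (p \<odot> q) - (d p + f p) - (\<xi> q + \<eta> q) - (A q q + B q q)\<bar> \<le> e * (norm q)\<^sup>2"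
      using \<delta>1(2)[OF q(1)] \<delta>2(2)[OF q(2)] by linarith
  qed simp
qed

lemma space_jet_of_eq:
  assumes "linear \<xi>" "bilinear B" "\<And>q. d (p \<odot> q) = d p + \<xi> q + B q q"
  shows "space_jet d p \<xi> B"
  unfolding space_jet_def
proof (intro conjI allI impI)
  show "\<exists>\<delta>>0. \<forall>q. norm q < \<delta> \<longrightarrow> \<bar>d (p \<odot> q) - d p - \<xi> q - B q q\<bar> \<le> e * (norm q)\<^sup>2" if "e > 0" for e
    by (rule exI[of _ 1]) (use that in \<open>simp add: assms(3)\<close>)
qed (rule assms)+

lemma linear_const_zero: "linear (\<lambda>_. 0 :: real)"
  by (rule linearI) simp_all

lemma space_jet_const: "space_jet (\<lambda>_. c) p (\<lambda>_. 0) (\<lambda>_ _. 0)"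
  by (rule space_jet_of_eq) (simp_all add: linear_const_zero bilinearI')

lemma space_jet_cmult:
  assumes "space_jet d p \<xi> A"
  shows "space_jet (\<lambda>q. c * d q) p (\<lambda>q. c * \<xi> q) (\<lambda>q r. c * A q r)"
  using space_jet_mult[OF space_jet_const[of c p] assms] by simp

text \<open>The assumption on \<open>\<Phi>\<close> is a Peano expansion at \<open>d p\<close> with
  \<open>k2\<close> half the second derivative, so the inner gradient reappears as a rank-one
  second-order form.\<close>

lemma space_jet_compose:
  assumes d: "space_jet d p \<xi> A"
    and \<Phi>: "\<And>e. e > 0 \<Longrightarrow> \<exists>\<delta>>0. \<forall>a. \<bar>a\<bar> < \<delta> \<longrightarrow> \<bar>\<Phi> (d p + a) - \<Phi> (d p) - k1 * a - k2 * a\<^sup>2\<bar> \<le> e * a\<^sup>2"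
  shows "space_jet (\<lambda>q. \<Phi> (d q)) p (\<lambda>q. k1 * \<xi> q) (\<lambda>q r. k1 * A q r + k2 * (\<xi> q * \<xi> r))"
proof -
  note lin = space_jet_linear[OF d] space_jet_bilinear[OF d]
  obtain C where C: "C \<ge> 1" "\<bar>\<bar>k1\<bar> + \<bar>k2\<bar>\<bar> \<le> C" "\<And>q. \<bar>\<xi> q\<bar> \<le> C * norm q" "\<And>q. \<bar>A q q\<bar> \<le> C * (norm q)\<^sup>2"
    using jet_forms_bound[OF lin, of "\<bar>k1\<bar> + \<bar>k2\<bar>"] by blast
  show ?thesis unfolding space_jet_def
  proof (intro conjI allI impI)
    show "linear (\<lambda>q. k1 * \<xi> q)" by (intro linear_mult_const lin)
    show "bilinear (\<lambda>q r. k1 * A q r + k2 * (\<xi> q * \<xi> r))"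
      by (intro bilinear_add bilinear_cmult bilinear_tensor lin)
    fix e :: real assume "e > 0"
    \<comment> \<open>A third of \<open>e\<close> each goes to the remainder of
      \<open>\<Phi>\<close>, whose argument satisfies \<open>\<bar>a\<bar> \<le> 3 * C * n\<close>;
      to the remainder of \<open>d\<close>, multiplied by \<open>k1\<close>; and to the replacement
      of \<open>a\<^sup>2\<close> by the square of the linear part.\<close>
    define e1 where "e1 = e / (3 * (9 * C\<^sup>2))"
    define e2 where "e2 = min 1 (e / (3 * C))"
    have e12: "e1 > 0" "e2 > 0" using \<open>e > 0\<close> C(1) by (auto simp: e1_def e2_def)
    obtain \<delta>1 where \<delta>1: "\<delta>1 > 0" "\<And>a. \<bar>a\<bar> < \<delta>1 \<Longrightarrow> \<bar>\<Phi> (d p + a) - \<Phi> (d p) - k1 * a - k2 * a\<^sup>2\<bar> \<le> e1 * a\<^sup>2"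
      using \<Phi>[OF e12(1)] by blast
    obtain \<delta>2 where \<delta>2: "\<delta>2 > 0" "\<And>q. norm q < \<delta>2 \<Longrightarrow> \<bar>d (p \<odot> q) - d p - \<xi> q - A q q\<bar> \<le> e2 * (norm q)\<^sup>2"
      using space_jetD[OF d e12(2)] by blast
    define \<delta> where "\<delta> = min (min \<delta>2 1) (min (\<delta>1 / (3 * C)) (e / (3 * (8 * C^3))))"
    have "\<delta> > 0" using \<delta>1 \<delta>2 \<open>e > 0\<close> C(1) by (auto simp: \<delta>_def)
    moreover have "\<bar>\<Phi> (d (p \<odot> q)) - \<Phi> (d p) - k1 * \<xi> q - (k1 * A q q + k2 * (\<xi> q * \<xi> q))\<bar> \<le> e * (norm q)\<^sup>2"
      if q: "norm q < \<delta>" for q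
    proof -
      define n where "n = norm q"
      have n: "0 \<le> n" "n \<le> 1" "n < \<delta>" using q by (auto simp: \<delta>_def n_def)
      define r where "r = d (p \<odot> q) - d p - \<xi> q - A q q"
      define a where "a = \<xi> q + (A q q + r)"
      have da: "d (p \<odot> q) = d p + a" by (simp add: a_def r_def)
      have r: "\<bar>r\<bar> \<le> e2 * n\<^sup>2" unfolding r_def n_def using q by (intro \<delta>2) (auto simp: \<delta>_def)
      have "e2 * n\<^sup>2 \<le> 1 * n\<^sup>2" by (intro mult_right_mono) (auto simp: e2_def)
      moreover have "1 * n\<^sup>2 \<le> C * n\<^sup>2" by (rule mult_right_mono[OF C(1)]) simp
      ultimately have Ar: "\<bar>A q q + r\<bar> \<le> 2 * C * n\<^sup>2"
        using r C(4)[of q] unfolding n_def[symmetric] by linarith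
      have nn: "n\<^sup>2 \<le> n" using n by (simp add: power2_eq_square mult_left_le)
      have x: "\<bar>\<xi> q\<bar> \<le> C * n" using C(3) by (simp add: n_def)
      have Ar': "2 * C * n\<^sup>2 \<le> 2 * C * n" using C(1) nn by (intro mult_left_mono) auto
      have a: "\<bar>a\<bar> \<le> 3 * C * n" unfolding a_def using x Ar Ar' by linarith
      have "3 * C * n < \<delta>1"
      proof -
        have "n < \<delta>1 / (3 * C)" using n by (auto simp: \<delta>_def)
        then show ?thesis using C(1) by (simp add: field_simps)
      qed
      then have 1: "\<bar>\<Phi> (d p + a) - \<Phi> (d p) - k1 * a - k2 * a\<^sup>2\<bar> \<le> e1 * a\<^sup>2"
        using a by (intro \<delta>1) linarith
      have "a\<^sup>2 \<le> (3 * C * n)\<^sup>2" using a by (intro abs_le_square_iff[THEN iffD1]) auto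
      then have "e1 * a\<^sup>2 \<le> e1 * (3 * C * n)\<^sup>2" using e12 by (intro mult_left_mono) auto
      also have "\<dots> = e / 3 * n\<^sup>2" using C(1) by (simp add: e1_def power_mult_distrib)
      finally have 2: "e1 * a\<^sup>2 \<le> e / 3 * n\<^sup>2" .
      have "\<bar>k1 * r\<bar> \<le> C * (e2 * n\<^sup>2)" unfolding abs_mult using r C(1,2) by (intro mult_mono) auto
      also have "\<dots> \<le> C * (e / (3 * C) * n\<^sup>2)" using C(1) by (intro mult_left_mono mult_right_mono) (auto simp: e2_def)
      also have "\<dots> = e / 3 * n\<^sup>2" using C(1) by simp
      finally have 3: "\<bar>k1 * r\<bar> \<le> e / 3 * n\<^sup>2" .
      have "a\<^sup>2 - \<xi> q * \<xi> q = (A q q + r) * (a + \<xi> q)" by (simp add: a_def algebra_simps power2_eq_square)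
      then have "\<bar>k2 * (a\<^sup>2 - \<xi> q * \<xi> q)\<bar> = \<bar>k2\<bar> * (\<bar>A q q + r\<bar> * \<bar>a + \<xi> q\<bar>)" by (simp add: abs_mult)
      also have "\<dots> \<le> C * (2 * C * n\<^sup>2 * (4 * C * n))"
        using C(1,2) Ar a x n(1) by (intro mult_mono) auto
      also have "\<dots> = n\<^sup>2 * (8 * C^3 * n)" by (simp add: power2_eq_square power3_eq_cube)
      also have "\<dots> \<le> n\<^sup>2 * (8 * C^3 * (e / (3 * (8 * C^3))))"
        using n C(1) by (intro mult_left_mono) (auto simp: \<delta>_def)
      also have "\<dots> = e / 3 * n\<^sup>2" using C(1) by simp
      finally have 4: "\<bar>k2 * (a\<^sup>2 - \<xi> q * \<xi> q)\<bar> \<le> e / 3 * n\<^sup>2" .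
      have "\<Phi> (d p + a) - \<Phi> (d p) - k1 * \<xi> q - (k1 * A q q + k2 * (\<xi> q * \<xi> q))
          = (\<Phi> (d p + a) - \<Phi> (d p) - k1 * a - k2 * a\<^sup>2) + k1 * r + k2 * (a\<^sup>2 - \<xi> q * \<xi> q)"
        by (simp add: a_def algebra_simps)
      then show ?thesis unfolding da n_def[symmetric] using 1 2 3 4 by linarith
    qed
    ultimately show "\<exists>\<delta>>0. \<forall>q. norm q < \<delta> \<longrightarrow> \<bar>\<Phi> (d (p \<odot> q)) - \<Phi> (d p) - k1 * \<xi> q
       - (k1 * A q q + k2 * (\<xi> q * \<xi> q))\<bar> \<le> e * (norm q)\<^sup>2" by blast
  qed
qed

lemma superjet_linear: "superjet v p t b \<xi> B \<Longrightarrow> linear \<xi>"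
  and superjet_bilinear: "superjet v p t b \<xi> B \<Longrightarrow> bilinear B"
  by (simp_all add: superjet_def)

lemma superjetD:
  assumes "superjet v p t b \<xi> B" "e > 0"
  obtains C \<delta> where "C \<ge> 0" "\<delta> > 0" "\<forall>q s. norm q < \<delta> \<longrightarrow> \<bar>s - t\<bar> < \<delta> \<longrightarrow>
    v (p \<odot> q, s) \<le> v (p, t) + b * (s - t) + \<xi> q + B q q + e * (norm q)\<^sup>2 + C * (s - t)\<^sup>2"
proof -
  obtain C \<delta> where C: "\<delta> > 0" "\<And>q s. norm q < \<delta> \<Longrightarrow> \<bar>s - t\<bar> < \<delta> \<Longrightarrow>
    v (p \<odot> q, s) \<le> v (p, t) + b * (s - t) + \<xi> q + B q q + e * (norm q)\<^sup>2 + C * (s - t)\<^sup>2"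
    using assms unfolding superjet_def by meson
  have CC: "C * (s - t)\<^sup>2 \<le> max 0 C * (s - t)\<^sup>2" for s by (intro mult_right_mono) auto
  show thesis
  proof (rule that[of "max 0 C" \<delta>], goal_cases)
    case 3
    show ?case
    proof (intro allI impI)
    fix q :: heis and s assume "norm q < \<delta>" "\<bar>s - t\<bar> < \<delta>"
    then show "v (p \<odot> q, s) \<le> v (p, t) + b * (s - t) + \<xi> q + B q q + e * (norm q)\<^sup>2 + max 0 C * (s - t)\<^sup>2"
      using C(2)[of q s] CC[of s] by linarith
    qed
  qed (use C in simp_all)
qed

lemma superjetI:
  assumes "linear \<xi>" "bilinear B"
    and "\<And>e. e > 0 \<Longrightarrow> \<exists>C. \<exists>\<delta>>0. \<forall>q s. norm q < \<delta> \<longrightarrow> \<bar>s - t\<bar> < \<delta> \<longrightarrow>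
        v (p \<odot> q, s) \<le> v (p, t) + b * (s - t) + \<xi> q + B q q + e * (norm q)\<^sup>2 + C * (s - t)\<^sup>2"
  shows "superjet v p t b \<xi> B"
  unfolding superjet_def by (intro conjI allI impI assms)

text \<open>The slack \<open>d * (s - t) + \<Lambda> * (s - t)\<^sup>2\<close> is what a penalty in
  time leaves behind at a maximum. Its slope is added to the time derivative, and its quadratic part
  disappears into the time constant of the superjet.\<close>

lemma superjet_touch:
  assumes \<Phi>: "superjet \<Phi> p t b \<xi> B" and "\<delta>0 > 0"
    and touch: "\<And>q s. norm q < \<delta>0 \<Longrightarrow> \<bar>s - t\<bar> < \<delta>0 \<Longrightarrow>
      v (p \<odot> q, s) - \<Phi> (p \<odot> q, s) \<le> v (p, t) - \<Phi> (p, t) + d * (s - t) + \<Lambda> * (s - t)\<^sup>2"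
  shows "superjet v p t (b + d) \<xi> B"
proof (rule superjetI[OF superjet_linear[OF \<Phi>] superjet_bilinear[OF \<Phi>]])
  fix e :: real assume "e > 0"
  obtain C \<delta> where C: "\<delta> > 0" "\<forall>q s. norm q < \<delta> \<longrightarrow> \<bar>s - t\<bar> < \<delta> \<longrightarrow>
    \<Phi> (p \<odot> q, s) \<le> \<Phi> (p, t) + b * (s - t) + \<xi> q + B q q + e * (norm q)\<^sup>2 + C * (s - t)\<^sup>2"
    by (rule superjetD[OF \<Phi> \<open>e > 0\<close>]) (rule that)
  show "\<exists>C. \<exists>\<delta>>0. \<forall>q s. norm q < \<delta> \<longrightarrow> \<bar>s - t\<bar> < \<delta> \<longrightarrow>
        v (p \<odot> q, s) \<le> v (p, t) + (b + d) * (s - t) + \<xi> q + B q q + e * (norm q)\<^sup>2 + C * (s - t)\<^sup>2"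
  proof (rule exI[of _ "C + \<Lambda>"], rule exI[of _ "min \<delta> \<delta>0"], intro conjI allI impI)
    fix q :: heis and s assume "norm q < min \<delta> \<delta>0" "\<bar>s - t\<bar> < min \<delta> \<delta>0"
    then show "v (p \<odot> q, s) \<le> v (p, t) + (b + d) * (s - t) + \<xi> q + B q q + e * (norm q)\<^sup>2 + (C + \<Lambda>) * (s - t)\<^sup>2"
      using C(2)[rule_format, of q s] touch[of q s] by (simp add: algebra_simps)
  qed (use C \<open>\<delta>0 > 0\<close> in auto)
qed

lemma superjet_add:
  assumes v: "superjet v p t b \<xi> A" and w: "superjet w p t c \<eta> B"
  shows "superjet (\<lambda>x. v x + w x) p t (b + c) (\<lambda>q. \<xi> q + \<eta> q) (\<lambda>q r. A q r + B q r)"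
proof (rule superjetI)
  show "linear (\<lambda>q. \<xi> q + \<eta> q)" "bilinear (\<lambda>q r. A q r + B q r)"
    by (intro linear_compose_add bilinear_add superjet_linear[OF v] superjet_linear[OF w]
       superjet_bilinear[OF v] superjet_bilinear[OF w])+
  fix e :: real assume "e > 0"
  then have e: "e / 2 > 0" by simp
  obtain C \<delta> where C: "\<delta> > 0" "\<forall>q s. norm q < \<delta> \<longrightarrow> \<bar>s - t\<bar> < \<delta> \<longrightarrow>
    v (p \<odot> q, s) \<le> v (p, t) + b * (s - t) + \<xi> q + A q q + e / 2 * (norm q)\<^sup>2 + C * (s - t)\<^sup>2"
    by (rule superjetD[OF v e]) (rule that)
  obtain D \<epsilon> where D: "\<epsilon> > 0" "\<forall>q s. norm q < \<epsilon> \<longrightarrow> \<bar>s - t\<bar> < \<epsilon> \<longrightarrow>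
    w (p \<odot> q, s) \<le> w (p, t) + c * (s - t) + \<eta> q + B q q + e / 2 * (norm q)\<^sup>2 + D * (s - t)\<^sup>2"
    by (rule superjetD[OF w e]) (rule that)
  show "\<exists>C. \<exists>\<delta>>0. \<forall>q s. norm q < \<delta> \<longrightarrow> \<bar>s - t\<bar> < \<delta> \<longrightarrow>
        v (p \<odot> q, s) + w (p \<odot> q, s) \<le> v (p, t) + w (p, t) + (b + c) * (s - t) + (\<xi> q + \<eta> q)
          + (A q q + B q q) + e * (norm q)\<^sup>2 + C * (s - t)\<^sup>2"
  proof (rule exI[of _ "C + D"], rule exI[of _ "min \<delta> \<epsilon>"], intro conjI allI impI)
    fix q :: heis and s assume "norm q < min \<delta> \<epsilon>" "\<bar>s - t\<bar> < min \<delta> \<epsilon>"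
    moreover have "e / 2 * (norm q)\<^sup>2 + e / 2 * (norm q)\<^sup>2 = e * (norm q)\<^sup>2" by simp
    moreover have "(b + c) * (s - t) = b * (s - t) + c * (s - t)" "(C + D) * (s - t)\<^sup>2 = C * (s - t)\<^sup>2 + D * (s - t)\<^sup>2"
      by (simp_all add: distrib_right)
    ultimately show "v (p \<odot> q, s) + w (p \<odot> q, s) \<le> v (p, t) + w (p, t) + (b + c) * (s - t) + (\<xi> q + \<eta> q)
          + (A q q + B q q) + e * (norm q)\<^sup>2 + (C + D) * (s - t)\<^sup>2"
      using C(2)[rule_format, of q s] D(2)[rule_format, of q s] by linarith
  qed (use C D in auto)
qed

text \<open>Since \<open>h \<odot> (p \<odot> q) = h \<odot> p \<odot> q\<close>, data taken along
  right increments survive a left translation unchanged. This is the left-invariance of the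
  horizontal fields in the language of jets.\<close>

lemma superjet_left_translate:
  assumes "superjet (\<lambda>x. v (h \<odot> fst x, c + snd x)) p t b \<xi> B"
  shows "superjet v (h \<odot> p) (c + t) b \<xi> B"
proof (rule superjetI[OF superjet_linear[OF assms] superjet_bilinear[OF assms]])
  fix e :: real assume "e > 0"
  obtain C \<delta> where C: "\<delta> > 0" "\<forall>q s. norm q < \<delta> \<longrightarrow> \<bar>s - t\<bar> < \<delta> \<longrightarrow>
    v (h \<odot> fst (p \<odot> q, s), c + snd (p \<odot> q, s)) \<le> v (h \<odot> fst (p, t), c + snd (p, t)) + b * (s - t) + \<xi> q + B q q + e * (norm q)\<^sup>2 + C * (s - t)\<^sup>2"
    by (rule superjetD[OF assms \<open>e > 0\<close>]) (rule that)
  show "\<exists>C. \<exists>\<delta>>0. \<forall>q s. norm q < \<delta> \<longrightarrow> \<bar>s - (c + t)\<bar> < \<delta> \<longrightarrow>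
        v (h \<odot> p \<odot> q, s) \<le> v (h \<odot> p, c + t) + b * (s - (c + t)) + \<xi> q + B q q + e * (norm q)\<^sup>2 + C * (s - (c + t))\<^sup>2"
  proof (rule exI[of _ C], rule exI[of _ \<delta>], intro conjI allI impI)
    fix q :: heis and s assume "norm q < \<delta>" "\<bar>s - (c + t)\<bar> < \<delta>"
    then show "v (h \<odot> p \<odot> q, s) \<le> v (h \<odot> p, c + t) + b * (s - (c + t)) + \<xi> q + B q q + e * (norm q)\<^sup>2 + C * (s - (c + t))\<^sup>2"
      using C(2)[rule_format, of q "s - c"] by (simp add: heis_assoc algebra_simps)
  qed (use C in auto)
qed

text \<open>The product contains a mixed term in \<open>s - t\<close> and \<open>q\<close>. Young's
  inequality splits it into \<open>e / 2\<close> times \<open>(norm q)\<^sup>2\<close> and a large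
  multiple of \<open>(s - t)\<^sup>2\<close>; this is why the time constant of a superjet may depend
  on \<open>e\<close>.\<close>

lemma superjet_time_mult:
  fixes a :: "real \<Rightarrow> real"
  assumes d: "space_jet d p \<xi> B" and "\<delta>0 > 0"
    and a: "\<And>s. \<bar>s - t\<bar> < \<delta>0 \<Longrightarrow> \<bar>a s - a t - a1 * (s - t)\<bar> \<le> Ca * (s - t)\<^sup>2"
  shows "superjet (\<lambda>x. a (snd x) * d (fst x)) p t (a1 * d p) (\<lambda>q. a t * \<xi> q) (\<lambda>q r. a t * B q r)"
proof (rule superjetI)
  note lin = space_jet_linear[OF d] space_jet_bilinear[OF d]
  show "linear (\<lambda>q. a t * \<xi> q)" "bilinear (\<lambda>q r. a t * B q r)"
    by (intro linear_mult_const bilinear_cmult lin)+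
  obtain C where C: "C \<ge> 1" "\<bar>d p\<bar> \<le> C" "\<And>q. \<bar>\<xi> q\<bar> \<le> C * norm q" "\<And>q. \<bar>B q q\<bar> \<le> C * (norm q)\<^sup>2"
    using jet_forms_bound[OF lin, of "d p"] by blast
  fix e :: real assume "e > 0"
  define e1 where "e1 = min 1 (e / (2 * (\<bar>a t\<bar> + 1)))"
  have e1: "0 < e1" "e1 \<le> 1" "\<bar>a t\<bar> * e1 \<le> e / 2"
  proof -
    show "0 < e1" "e1 \<le> 1" using \<open>e > 0\<close> by (auto simp: e1_def)
    have "\<bar>a t\<bar> * e1 \<le> (\<bar>a t\<bar> + 1) * (e / (2 * (\<bar>a t\<bar> + 1)))" using \<open>0 < e1\<close> by (intro mult_mono) (auto simp: e1_def)
    also have "\<dots> = e / 2" by (simp add: field_simps add_nonneg_eq_0_iff)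
    finally show "\<bar>a t\<bar> * e1 \<le> e / 2" .
  qed
  obtain \<delta>1 where \<delta>1: "\<delta>1 > 0" "\<And>q. norm q < \<delta>1 \<Longrightarrow> \<bar>d (p \<odot> q) - d p - \<xi> q - B q q\<bar> \<le> e1 * (norm q)\<^sup>2"
    using space_jetD[OF d e1(1)] by blast
  define D where "D = 3 * C * \<bar>a1\<bar>"
  have D: "D \<ge> 0" using C by (simp add: D_def)
  show "\<exists>C. \<exists>\<delta>>0. \<forall>q s. norm q < \<delta> \<longrightarrow> \<bar>s - t\<bar> < \<delta> \<longrightarrow>
        a (snd (p \<odot> q, s)) * d (fst (p \<odot> q, s)) \<le> a (snd (p, t)) * d (fst (p, t)) + a1 * d p * (s - t)
         + a t * \<xi> q + a t * B q q + e * (norm q)\<^sup>2 + C * (s - t)\<^sup>2"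
  proof (rule exI[of _ "D\<^sup>2 / (2 * e) + \<bar>Ca\<bar> * (4 * C)"], rule exI[of _ "min \<delta>0 (min \<delta>1 1)"], intro conjI allI impI)
    fix q :: heis and s assume q: "norm q < min \<delta>0 (min \<delta>1 1)" and s: "\<bar>s - t\<bar> < min \<delta>0 (min \<delta>1 1)"
    define n where "n = norm q"
    have n: "0 \<le> n" "n \<le> 1" "n < \<delta>1" using q by (auto simp: n_def)
    define r where "r = d (p \<odot> q) - d p - \<xi> q - B q q"
    have r: "\<bar>r\<bar> \<le> e1 * n\<^sup>2" unfolding r_def n_def using q by (intro \<delta>1) auto
    have nn: "n\<^sup>2 \<le> n" using n by (simp add: power2_eq_square mult_left_le)
    have "e1 * n\<^sup>2 \<le> 1 * n" using e1 nn n by (intro mult_mono) auto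
    also have "1 * n \<le> C * n" using C n by (intro mult_right_mono) auto
    finally have "\<bar>r\<bar> \<le> C * n" using r by linarith
    moreover have "\<bar>\<xi> q\<bar> \<le> C * n" using C by (simp add: n_def)
    moreover have "\<bar>B q q\<bar> \<le> C * n" 
    proof -
      have "C * n\<^sup>2 \<le> C * n" using nn C(1) by (intro mult_left_mono) auto
      then show ?thesis using C(4)[of q] by (simp add: n_def)
    qed
    ultimately have dd: "\<bar>\<xi> q + B q q + r\<bar> \<le> 3 * C * n" by linarith
    have dpq: "d (p \<odot> q) = d p + (\<xi> q + B q q + r)" by (simp add: r_def)
    have "C * n \<le> C" using C n by (simp add: mult_left_le)
    then have d4: "\<bar>d (p \<odot> q)\<bar> \<le> 4 * C" unfolding dpq using dd C(2) by linarith
    define R where "R = a s - a t - a1 * (s - t)"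
    have "\<bar>R\<bar> \<le> Ca * (s - t)\<^sup>2" unfolding R_def using s by (intro a) auto
    then have "\<bar>R\<bar> \<le> \<bar>Ca\<bar> * (s - t)\<^sup>2" by (rule order_trans[OF _ mult_right_mono]) auto
    then have "\<bar>R * d (p \<odot> q)\<bar> \<le> \<bar>Ca\<bar> * (s - t)\<^sup>2 * (4 * C)"
      unfolding abs_mult using d4 by (intro mult_mono) auto
    then have t1: "R * d (p \<odot> q) \<le> \<bar>Ca\<bar> * (4 * C) * (s - t)\<^sup>2" by (simp add: abs_le_iff algebra_simps)
    have "\<bar>a1 * (s - t) * (\<xi> q + B q q + r)\<bar> \<le> \<bar>a1\<bar> * \<bar>s - t\<bar> * (3 * C * n)"
      unfolding abs_mult using dd by (intro mult_mono) auto
    also have "\<dots> = D * \<bar>s - t\<bar> * n" by (simp add: D_def)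
    also have "\<dots> \<le> D\<^sup>2 / (2 * e) * (s - t)\<^sup>2 + e / 2 * n\<^sup>2"
    proof -
      have "0 \<le> (D * \<bar>s - t\<bar> - e * n)\<^sup>2 / (2 * e)" using \<open>e > 0\<close> by simp
      also have "\<dots> = D\<^sup>2 / (2 * e) * (s - t)\<^sup>2 + e / 2 * n\<^sup>2 - D * \<bar>s - t\<bar> * n"
        using \<open>e > 0\<close> by (simp add: power2_diff power_mult_distrib field_simps power2_eq_square)
      finally show ?thesis by simp
    qed
    finally have t2: "a1 * (s - t) * (\<xi> q + B q q + r) \<le> D\<^sup>2 / (2 * e) * (s - t)\<^sup>2 + e / 2 * n\<^sup>2" by linarith
    have "\<bar>a t * r\<bar> \<le> \<bar>a t\<bar> * (e1 * n\<^sup>2)" unfolding abs_mult using r by (intro mult_left_mono) auto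
    also have "\<dots> \<le> e / 2 * n\<^sup>2" using mult_right_mono[OF e1(3), of "n\<^sup>2"] by (simp add: mult.assoc)
    finally have t3: "a t * r \<le> e / 2 * n\<^sup>2" by linarith
    have "a s * d (p \<odot> q) = R * d (p \<odot> q) + a1 * (s - t) * (\<xi> q + B q q + r) + a t * r
      + a t * d p + a1 * d p * (s - t) + a t * \<xi> q + a t * B q q"
    proof -
      have "a s = a t + a1 * (s - t) + R" by (simp add: R_def)
      then show ?thesis unfolding dpq by (simp only:) (simp add: algebra_simps)
    qed
    moreover have "e / 2 * n\<^sup>2 + e / 2 * n\<^sup>2 = e * n\<^sup>2" by simp
    moreover have "(D\<^sup>2 / (2 * e) + \<bar>Ca\<bar> * (4 * C)) * (s - t)\<^sup>2 = D\<^sup>2 / (2 * e) * (s - t)\<^sup>2 + \<bar>Ca\<bar> * (4 * C) * (s - t)\<^sup>2"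
      by (simp only: distrib_right)
    ultimately show "a (snd (p \<odot> q, s)) * d (fst (p \<odot> q, s)) \<le> a (snd (p, t)) * d (fst (p, t)) + a1 * d p * (s - t)
         + a t * \<xi> q + a t * B q q + e * (norm q)\<^sup>2 + (D\<^sup>2 / (2 * e) + \<bar>Ca\<bar> * (4 * C)) * (s - t)\<^sup>2"
      using t1 t2 t3 unfolding n_def[symmetric] fst_conv snd_conv by linarith
  qed (use \<open>\<delta>0 > 0\<close> \<delta>1 in auto)
qed

text \<open>The viscosity inequality cannot be tested at a maximum on the final slice. A penalty
  switched on after a time \<open>t2 < b\<close> at which the excess is still positive moves the
  maximum into the open time interval. As the penalty is nondecreasing in time, it contributes only
  a slope \<open>d \<ge> 0\<close>, which works for the contradiction.\<close>

lemma cylinder_comparison: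
  fixes v \<Psi> :: "heis \<times> real \<Rightarrow> real"
  assumes K: "compact K" and "a < b"
    and cv: "continuous_on (K \<times> {a..b}) v" and c\<Psi>: "continuous_on (K \<times> {a..b}) \<Psi>"
    and init: "\<And>p. p \<in> K \<Longrightarrow> v (p, a) \<le> \<Psi> (p, a)"
    and lat: "\<And>p t. p \<in> K \<Longrightarrow> p \<notin> K0 \<Longrightarrow> a \<le> t \<Longrightarrow> t \<le> b \<Longrightarrow> v (p, t) \<le> \<Psi> (p, t)"
    and nomax: "\<And>p t d \<Lambda>. p \<in> K \<Longrightarrow> p \<in> K0 \<Longrightarrow> a < t \<Longrightarrow> t < b \<Longrightarrow> d \<ge> 0 \<Longrightarrow>
      v (p, t) - \<Psi> (p, t) > 0 \<Longrightarrow>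
      (\<And>q s. q \<in> K \<Longrightarrow> a \<le> s \<Longrightarrow> s \<le> b \<Longrightarrow>
         v (q, s) - \<Psi> (q, s) \<le> v (p, t) - \<Psi> (p, t) + d * (s - t) + \<Lambda> * (s - t)\<^sup>2) \<Longrightarrow> False"
    and "p \<in> K" "a \<le> t" "t \<le> b"
  shows "v (p, t) \<le> \<Psi> (p, t)"
proof (rule ccontr)
  define g where "g = (\<lambda>x. v x - \<Psi> x)"
  have cg: "continuous_on (K \<times> {a..b}) g" unfolding g_def by (intro continuous_intros cv c\<Psi>)
  have comp: "compact (K \<times> {a..b})" by (intro compact_Times K compact_Icc)
  assume "\<not> v (p, t) \<le> \<Psi> (p, t)"
  then have gt: "g (p, t) > 0" by (simp add: g_def)
  obtain t2 where t2: "a \<le> t2" "t2 < b" "g (p, t2) > 0"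
  proof (cases "t < b")
    case True then show thesis using that gt \<open>a \<le> t\<close> by blast
  next
    case False
    then have "t = b" using \<open>t \<le> b\<close> by simp
    have "continuous_on {a..b} (\<lambda>s. g (p, s))"
      by (rule continuous_on_compose2[OF cg]) (use \<open>p \<in> K\<close> in \<open>auto intro!: continuous_intros\<close>)
    then have "\<forall>e>0. \<exists>d>0. \<forall>s\<in>{a..b}. dist s b < d \<longrightarrow> dist (g (p, s)) (g (p, b)) < e"
      using \<open>a < b\<close> unfolding continuous_on_iff by auto
    then obtain d where d: "d > 0" "\<And>s. s \<in> {a..b} \<Longrightarrow> dist s b < d \<Longrightarrow> dist (g (p, s)) (g (p, b)) < g (p, b)"
      using gt \<open>t = b\<close> by blast
    define s where "s = max a (b - d / 2)"
    have "s \<in> {a..b}" "dist s b < d" "s < b" using d \<open>a < b\<close> by (auto simp: s_def dist_real_def)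
    moreover from this have "g (p, s) > 0" using d(2)[of s] by (auto simp: dist_real_def)
    ultimately show thesis using that by auto
  qed
  have ne: "K \<times> {a..b} \<noteq> {}" using \<open>p \<in> K\<close> \<open>a < b\<close> by auto
  obtain xm where xm: "xm \<in> K \<times> {a..b}" "\<And>x. x \<in> K \<times> {a..b} \<Longrightarrow> g x \<le> g xm"
    using continuous_attains_sup[OF comp ne cg] by blast
  have gm: "g xm > 0" using xm(2)[of "(p,t2)"] t2 \<open>p \<in> K\<close> by force
  \<comment> \<open>With this factor the penalty at \<open>b\<close> is the maximal excess plus
    \<open>1\<close>, so no maximum of the penalized excess with positive value sits at
    \<open>b\<close>.\<close>
  define \<Lambda> where "\<Lambda> = (g xm + 1) / (b - t2)\<^sup>2"
  have \<Lambda>: "\<Lambda> \<ge> 0" using gm by (simp add: \<Lambda>_def)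
  define pen where "pen = (\<lambda>s. \<Lambda> * (max 0 (s - t2))\<^sup>2)"
  have "continuous_on (K \<times> {a..b}) (\<lambda>x. g x - pen (snd x))"
    unfolding pen_def by (intro continuous_intros cg)
  from continuous_attains_sup[OF comp ne this] obtain x0 where x0: "x0 \<in> K \<times> {a..b}"
    "\<And>x. x \<in> K \<times> {a..b} \<Longrightarrow> g x - pen (snd x) \<le> g x0 - pen (snd x0)" by blast
  obtain p0 t0 where pt: "x0 = (p0, t0)" by (cases x0)
  have pen0: "pen s \<ge> 0" for s using \<Lambda> by (simp add: pen_def)
  have "g (p, t2) - pen t2 \<le> g (p0, t0) - pen t0" using x0(2)[of "(p,t2)"] t2 \<open>p \<in> K\<close> pt by force
  moreover have "pen t2 = 0" by (simp add: pen_def)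
  ultimately have pos: "g (p0, t0) > 0" "g (p0, t0) > pen t0" using t2 pen0[of t0] by auto
  have p0: "p0 \<in> K" "a \<le> t0" "t0 \<le> b" using x0 pt by auto
  have "p0 \<in> K0" using lat[OF p0(1) _ p0(2,3)] pos by (force simp: g_def)
  moreover have "t0 \<noteq> a" using init[OF p0(1)] pos by (auto simp: g_def)
  moreover have "t0 \<noteq> b"
  proof
    assume "t0 = b"
    then have "pen t0 = g xm + 1" using t2 by (simp add: pen_def \<Lambda>_def)
    then show False using xm(2)[of x0] x0(1) pos pt by auto
  qed
  moreover have "v (q, s) - \<Psi> (q, s) \<le> v (p0, t0) - \<Psi> (p0, t0) + (2 * \<Lambda> * max 0 (t0 - t2)) * (s - t0) + \<Lambda> * (s - t0)\<^sup>2"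
    if "q \<in> K" "a \<le> s" "s \<le> b" for q s
  proof -
    \<comment> \<open>The truncated square has no second derivative at \<open>t2\<close>, but it
      stays below its tangent line plus \<open>(s - t0)\<^sup>2\<close> everywhere.\<close>
    have "(max 0 (s - t2))\<^sup>2 \<le> (max 0 (t0 - t2))\<^sup>2 + 2 * max 0 (t0 - t2) * (s - t0) + (s - t0)\<^sup>2"
    proof (cases "t0 \<ge> t2")
      case True
      then have "(max 0 (t0 - t2))\<^sup>2 + 2 * max 0 (t0 - t2) * (s - t0) + (s - t0)\<^sup>2 = (s - t2)\<^sup>2"
        by (simp add: power2_eq_square algebra_simps)
      then show ?thesis by (simp add: max_def)
    next
      case False
      then have "\<bar>max 0 (s - t2)\<bar> \<le> \<bar>s - t0\<bar>" by auto
      then have "(max 0 (s - t2))\<^sup>2 \<le> (s - t0)\<^sup>2" by (rule abs_le_square_iff[THEN iffD1])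
      then show ?thesis using False by simp
    qed
    then have "pen s \<le> \<Lambda> * ((max 0 (t0 - t2))\<^sup>2 + 2 * max 0 (t0 - t2) * (s - t0) + (s - t0)\<^sup>2)"
      unfolding pen_def using \<Lambda> by (intro mult_left_mono)
    moreover have "g (q, s) - pen s \<le> g (p0, t0) - pen t0" using x0(2)[of "(q,s)"] that pt by auto
    ultimately show ?thesis unfolding g_def pen_def by (simp add: algebra_simps)
  qed
  ultimately show False
    using nomax[of p0 t0 "2 * \<Lambda> * max 0 (t0 - t2)" \<Lambda>] p0 pos \<Lambda> by (force simp: g_def)
qed

section \<open>Smooth approximation with uniform Taylor estimates\<close>

text \<open>The increment multiplies on the left, so these are derivatives along the right-invariant
  fields, with all directions \<open>k\<close> required at once. They commute with right
  translations and therefore with the steps of the walk.\<close>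

definition has_right_derivs :: "(heis \<Rightarrow> real) \<Rightarrow> (heis \<Rightarrow> real) \<Rightarrow> (heis \<Rightarrow> real) \<Rightarrow> (heis \<Rightarrow> real) \<Rightarrow> bool" where
  "has_right_derivs g g1 g2 g3 \<longleftrightarrow> (\<forall>q k. ((\<lambda>s. g ((s *\<^sub>R k) \<odot> q)) has_real_derivative
     fst k * g1 q + fst (snd k) * g2 q + snd (snd k) * g3 q) (at 0))"

text \<open>Boundedness of all right-invariant derivatives up to order \<open>m\<close>. Asking for
  witnesses at each level, instead of naming iterated derivatives, makes closure under the ring
  operations a plain induction on \<open>m\<close>.\<close>

primrec right_regular :: "nat \<Rightarrow> (heis \<Rightarrow> real) \<Rightarrow> bool" where
  "right_regular 0 g \<longleftrightarrow> (\<exists>C. \<forall>q. \<bar>g q\<bar> \<le> C)"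
| "right_regular (Suc m) g \<longleftrightarrow> (\<exists>C. \<forall>q. \<bar>g q\<bar> \<le> C) \<and>
     (\<exists>g1 g2 g3. right_regular m g1 \<and> right_regular m g2 \<and> right_regular m g3 \<and> has_right_derivs g g1 g2 g3)"

lemma right_regular_bounded: "right_regular m g \<Longrightarrow> \<exists>C. \<forall>q. \<bar>g q\<bar> \<le> C"
  by (cases m) auto

lemma right_regular_SucI:
  assumes "\<exists>C. \<forall>q. \<bar>g q\<bar> \<le> C" "right_regular m g1" "right_regular m g2" "right_regular m g3"
    "has_right_derivs g g1 g2 g3"
  shows "right_regular (Suc m) g"
  unfolding right_regular.simps(2)
  by (intro conjI assms(1), rule exI[of _ g1], rule exI[of _ g2], rule exI[of _ g3]) (intro conjI assms)

lemma right_regular_SucE: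
  assumes "right_regular (Suc m) g"
  obtains g1 g2 g3 where "right_regular m g1" "right_regular m g2" "right_regular m g3"
    "has_right_derivs g g1 g2 g3"
  using assms unfolding right_regular.simps(2) by blast

lemma right_regular_mono: "right_regular (Suc m) g \<Longrightarrow> right_regular m g"
proof (induction m arbitrary: g)
  case 0 then show ?case by simp
next
  case (Suc m)
  obtain g1 g2 g3 where g: "right_regular (Suc m) g1" "right_regular (Suc m) g2" "right_regular (Suc m) g3"
    "has_right_derivs g g1 g2 g3"
    by (rule right_regular_SucE[OF Suc.prems])
  show ?case
    by (rule right_regular_SucI[OF right_regular_bounded[OF Suc.prems]
        Suc.IH[OF g(1)] Suc.IH[OF g(2)] Suc.IH[OF g(3)] g(4)])
qed

lemma right_regular_const: "right_regular m (\<lambda>_. c)"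
proof (induction m arbitrary: c)
  case 0 then show ?case by auto
next
  case (Suc m)
  show ?case
    by (rule right_regular_SucI[OF _ Suc.IH[of 0] Suc.IH[of 0] Suc.IH[of 0]])
       (auto simp: has_right_derivs_def)
qed

lemma right_regular_add:
  "right_regular m f \<Longrightarrow> right_regular m g \<Longrightarrow> right_regular m (\<lambda>q. f q + g q)"
proof (induction m arbitrary: f g)
  case 0
  then obtain C D where "\<forall>q. \<bar>f q\<bar> \<le> C" "\<forall>q. \<bar>g q\<bar> \<le> D" by auto
  then have "\<bar>f q + g q\<bar> \<le> C + D" for q by (meson abs_triangle_ineq add_mono order_trans)
  then show ?case by auto
next
  case (Suc m)
  obtain f1 f2 f3 where f: "right_regular m f1" "right_regular m f2" "right_regular m f3" "has_right_derivs f f1 f2 f3"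
    by (rule right_regular_SucE[OF Suc.prems(1)])
  obtain g1 g2 g3 where g: "right_regular m g1" "right_regular m g2" "right_regular m g3" "has_right_derivs g g1 g2 g3"
    by (rule right_regular_SucE[OF Suc.prems(2)])
  obtain C D where "\<forall>q. \<bar>f q\<bar> \<le> C" "\<forall>q. \<bar>g q\<bar> \<le> D"
    using right_regular_bounded[OF Suc.prems(1)] right_regular_bounded[OF Suc.prems(2)] by auto
  then have "\<bar>f q + g q\<bar> \<le> C + D" for q by (meson abs_triangle_ineq add_mono order_trans)
  then have b: "\<exists>C. \<forall>q. \<bar>f q + g q\<bar> \<le> C" by blast
  have "has_right_derivs (\<lambda>q. f q + g q) (\<lambda>q. f1 q + g1 q) (\<lambda>q. f2 q + g2 q) (\<lambda>q. f3 q + g3 q)"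
    unfolding has_right_derivs_def
  proof (intro allI)
    fix q k :: heis
    show "((\<lambda>s. f ((s *\<^sub>R k) \<odot> q) + g ((s *\<^sub>R k) \<odot> q)) has_real_derivative
       fst k * (f1 q + g1 q) + fst (snd k) * (f2 q + g2 q) + snd (snd k) * (f3 q + g3 q)) (at 0)"
      by (rule DERIV_cong[OF DERIV_add[OF f(4)[unfolded has_right_derivs_def, rule_format]
            g(4)[unfolded has_right_derivs_def, rule_format]]])
         (simp only: algebra_simps)
  qed
  then show ?case
    by (rule right_regular_SucI[OF b Suc.IH[OF f(1) g(1)] Suc.IH[OF f(2) g(2)] Suc.IH[OF f(3) g(3)]])
qed

lemma right_regular_mult:
  "right_regular m f \<Longrightarrow> right_regular m g \<Longrightarrow> right_regular m (\<lambda>q. f q * g q)"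
proof (induction m arbitrary: f g)
  case 0
  then obtain C D where "\<forall>q. \<bar>f q\<bar> \<le> C" "\<forall>q. \<bar>g q\<bar> \<le> D" by auto
  then have "\<bar>f q * g q\<bar> \<le> C * D" for q unfolding abs_mult by (meson abs_ge_zero mult_mono order_trans)
  then show ?case by auto
next
  case (Suc m)
  obtain f1 f2 f3 where f: "right_regular m f1" "right_regular m f2" "right_regular m f3" "has_right_derivs f f1 f2 f3"
    by (rule right_regular_SucE[OF Suc.prems(1)])
  obtain g1 g2 g3 where g: "right_regular m g1" "right_regular m g2" "right_regular m g3" "has_right_derivs g g1 g2 g3"
    by (rule right_regular_SucE[OF Suc.prems(2)])
  obtain C D where "\<forall>q. \<bar>f q\<bar> \<le> C" "\<forall>q. \<bar>g q\<bar> \<le> D"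
    using right_regular_bounded[OF Suc.prems(1)] right_regular_bounded[OF Suc.prems(2)] by auto
  then have "\<bar>f q * g q\<bar> \<le> C * D" for q unfolding abs_mult by (meson abs_ge_zero mult_mono order_trans)
  then have b: "\<exists>C. \<forall>q. \<bar>f q * g q\<bar> \<le> C" by blast
  note fg = right_regular_mono[OF Suc.prems(1)] right_regular_mono[OF Suc.prems(2)]
  have "has_right_derivs (\<lambda>q. f q * g q) (\<lambda>q. f1 q * g q + f q * g1 q) (\<lambda>q. f2 q * g q + f q * g2 q) (\<lambda>q. f3 q * g q + f q * g3 q)"
    unfolding has_right_derivs_def
  proof (intro allI)
    fix q k :: heis
    show "((\<lambda>s. f ((s *\<^sub>R k) \<odot> q) * g ((s *\<^sub>R k) \<odot> q)) has_real_derivative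
       fst k * (f1 q * g q + f q * g1 q) + fst (snd k) * (f2 q * g q + f q * g2 q) + snd (snd k) * (f3 q * g q + f q * g3 q)) (at 0)"
      by (rule DERIV_cong[OF DERIV_mult[OF f(4)[unfolded has_right_derivs_def, rule_format]
            g(4)[unfolded has_right_derivs_def, rule_format]]])
         (simp add: algebra_simps)
  qed
  from this show ?case
    by (rule right_regular_SucI[OF b, rotated 3]) (intro right_regular_add Suc.IH f g fg)+
qed

text \<open>Proved for both functions together, as each derivative calls for the other function. The
  sine later turns approximants into functions bounded on the whole group.\<close>

lemma right_regular_sin_cos:
  "right_regular m g \<Longrightarrow> right_regular m (\<lambda>q. sin (g q)) \<and> right_regular m (\<lambda>q. cos (g q))"
proof (induction m arbitrary: g)
  case 0
  show ?case by (auto intro!: exI[of _ 1])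
next
  case (Suc m)
  obtain g1 g2 g3 where g: "right_regular m g1" "right_regular m g2" "right_regular m g3" "has_right_derivs g g1 g2 g3"
    by (rule right_regular_SucE[OF Suc.prems])
  have D: "((\<lambda>s. g ((s *\<^sub>R k) \<odot> q)) has_real_derivative
     fst k * g1 q + fst (snd k) * g2 q + snd (snd k) * g3 q) (at 0)" for q k
    using g(4) unfolding has_right_derivs_def by blast
  have IH: "right_regular m (\<lambda>q. sin (g q))" "right_regular m (\<lambda>q. cos (g q))"
    "right_regular m (\<lambda>q. - 1 * sin (g q))"
    using Suc.IH[OF right_regular_mono[OF Suc.prems]] right_regular_mult[OF right_regular_const[of m "-1"]]
    by blast+
  have 1: "has_right_derivs (\<lambda>q. sin (g q)) (\<lambda>q. cos (g q) * g1 q) (\<lambda>q. cos (g q) * g2 q) (\<lambda>q. cos (g q) * g3 q)"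
    unfolding has_right_derivs_def
  proof (intro allI)
    fix q k
    show "((\<lambda>s. sin (g ((s *\<^sub>R k) \<odot> q))) has_real_derivative
       fst k * (cos (g q) * g1 q) + fst (snd k) * (cos (g q) * g2 q) + snd (snd k) * (cos (g q) * g3 q)) (at 0)"
      by (rule DERIV_cong[OF DERIV_chain2[OF DERIV_sin D]]) (simp add: algebra_simps)
  qed
  have 2: "has_right_derivs (\<lambda>q. cos (g q)) (\<lambda>q. - 1 * sin (g q) * g1 q) (\<lambda>q. - 1 * sin (g q) * g2 q) (\<lambda>q. - 1 * sin (g q) * g3 q)"
    unfolding has_right_derivs_def
  proof (intro allI)
    fix q k
    show "((\<lambda>s. cos (g ((s *\<^sub>R k) \<odot> q))) has_real_derivative
       fst k * (- 1 * sin (g q) * g1 q) + fst (snd k) * (- 1 * sin (g q) * g2 q) + snd (snd k) * (- 1 * sin (g q) * g3 q)) (at 0)"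
      by (rule DERIV_cong[OF DERIV_chain2[OF DERIV_cos D]]) (simp add: algebra_simps)
  qed
  have b: "\<exists>C. \<forall>q. \<bar>sin (g q)\<bar> \<le> C" "\<exists>C. \<forall>q. \<bar>cos (g q)\<bar> \<le> C"
    by (rule exI[of _ 1], simp)+
  show ?case
    using right_regular_SucI[OF b(1) _ _ _ 1] right_regular_SucI[OF b(2) _ _ _ 2]
      right_regular_mult[OF IH(2) g(1)] right_regular_mult[OF IH(2) g(2)] right_regular_mult[OF IH(2) g(3)]
      right_regular_mult[OF IH(3) g(1)] right_regular_mult[OF IH(3) g(2)] right_regular_mult[OF IH(3) g(3)]
    by blast
qed

lemma right_regular_right_translate:
  "right_regular m g \<Longrightarrow> right_regular m (\<lambda>q. g (q \<odot> w))"
proof (induction m arbitrary: g)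
  case 0 then show ?case unfolding right_regular.simps by blast
next
  case (Suc m)
  obtain g1 g2 g3 where g: "right_regular m g1" "right_regular m g2" "right_regular m g3" "has_right_derivs g g1 g2 g3"
    by (rule right_regular_SucE[OF Suc.prems])
  have "has_right_derivs (\<lambda>q. g (q \<odot> w)) (\<lambda>q. g1 (q \<odot> w)) (\<lambda>q. g2 (q \<odot> w)) (\<lambda>q. g3 (q \<odot> w))"
    using g(4) unfolding has_right_derivs_def heis_assoc by blast
  moreover have "\<exists>C. \<forall>q. \<bar>g (q \<odot> w)\<bar> \<le> C" using right_regular_bounded[OF Suc.prems] by blast
  ultimately show ?case by (intro right_regular_SucI[OF _ Suc.IH[OF g(1)] Suc.IH[OF g(2)] Suc.IH[OF g(3)]])
qed

text \<open>Quotients of quadratic polynomials by \<open>heis_den\<close> have bounded right-invariant derivatives of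
  every order and separate points, which is all that Stone-Weierstrass asks for.\<close>

definition quad_poly :: "(heis \<Rightarrow> real) \<Rightarrow> bool" where
  "quad_poly f \<longleftrightarrow> (\<exists>c0 c1 c2 c3 c11 c22 c33 c12 c13 c23. f = (\<lambda>(x,y,z). c0 + c1 * x + c2 * y + c3 * z
     + c11 * x\<^sup>2 + c22 * y\<^sup>2 + c33 * z\<^sup>2 + c12 * (x * y) + c13 * (x * z) + c23 * (y * z)))"

lemma quad_polyI:
  "quad_poly (\<lambda>(x,y,z). c0 + c1 * x + c2 * y + c3 * z
     + c11 * x\<^sup>2 + c22 * y\<^sup>2 + c33 * z\<^sup>2 + c12 * (x * y) + c13 * (x * z) + c23 * (y * z))"
  unfolding quad_poly_def by (intro exI) (rule refl)

text \<open>The right-invariant fields are d/dx + (y/2) d/dz, d/dy - (x/2) d/dz and d/dz. Their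
  coefficients have degree at most one, and each differentiation lowers the degree by one, so
  quadratic polynomials are mapped to quadratic polynomials.\<close>

lemma quad_poly_right_derivs:
  assumes "quad_poly f"
  obtains f1 f2 f3 where "quad_poly f1" "quad_poly f2" "quad_poly f3" "has_right_derivs f f1 f2 f3"
proof -
  obtain c0 c1 c2 c3 c11 c22 c33 c12 c13 c23 where f: "f = (\<lambda>(x,y,z). c0 + c1 * x + c2 * y + c3 * z
     + c11 * x\<^sup>2 + c22 * y\<^sup>2 + c33 * z\<^sup>2 + c12 * (x * y) + c13 * (x * z) + c23 * (y * z))"
    using assms unfolding quad_poly_def by (elim exE) (rule that)
  define f1 where "f1 = (\<lambda>(x,y,z). c1 + (2 * c11) * x + (c12 + c3 / 2) * y + c13 * z
     + 0 * x\<^sup>2 + (c23 / 2) * y\<^sup>2 + 0 * z\<^sup>2 + (c13 / 2) * (x * y) + 0 * (x * z) + c33 * (y * z))"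
  define f2 where "f2 = (\<lambda>(x,y,z). c2 + (c12 - c3 / 2) * x + (2 * c22) * y + c23 * z
     + (- c13 / 2) * x\<^sup>2 + 0 * y\<^sup>2 + 0 * z\<^sup>2 + (- c23 / 2) * (x * y) + (- c33) * (x * z) + 0 * (y * z))"
  define f3 where "f3 = (\<lambda>(x,y,z). c3 + c13 * x + c23 * y + (2 * c33) * z
     + 0 * x\<^sup>2 + 0 * y\<^sup>2 + 0 * z\<^sup>2 + 0 * (x * y) + 0 * (x * z) + 0 * (y * z))"
  have q: "quad_poly f1" "quad_poly f2" "quad_poly f3"
    unfolding f1_def f2_def f3_def by (rule quad_polyI)+
  have "has_right_derivs f f1 f2 f3" unfolding has_right_derivs_def
  proof (intro allI)
    fix q k :: heis
    obtain x y z where qq: "q = (x,y,z)" by (cases q)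
    obtain k1 k2 k3 where kk: "k = (k1,k2,k3)" by (cases k)
    have "((\<lambda>s. c0 + c1 * (s * k1 + x) + c2 * (s * k2 + y) + c3 * (s * k3 + z + (s * k1 * y - x * (s * k2)) / 2)
       + c11 * (s * k1 + x)\<^sup>2 + c22 * (s * k2 + y)\<^sup>2 + c33 * (s * k3 + z + (s * k1 * y - x * (s * k2)) / 2)\<^sup>2
       + c12 * ((s * k1 + x) * (s * k2 + y)) + c13 * ((s * k1 + x) * (s * k3 + z + (s * k1 * y - x * (s * k2)) / 2))
       + c23 * ((s * k2 + y) * (s * k3 + z + (s * k1 * y - x * (s * k2)) / 2)))
      has_real_derivative k1 * f1 q + k2 * f2 q + k3 * f3 q) (at 0)"
      unfolding qq f1_def f2_def f3_def
      by (auto intro!: derivative_eq_intros) (simp add: power2_eq_square algebra_simps add_divide_distrib diff_divide_distrib)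
    then show "((\<lambda>s. f ((s *\<^sub>R k) \<odot> q)) has_real_derivative
       fst k * f1 q + fst (snd k) * f2 q + snd (snd k) * f3 q) (at 0)"
      unfolding f kk qq by simp
  qed
  with q show thesis by (rule that)
qed

definition heis_den :: "heis \<Rightarrow> real" where
  "heis_den p = 1 + (norm p)\<^sup>2"

lemma heis_den_ge: "heis_den p \<ge> 1"
  by (simp add: heis_den_def)

lemma quad_poly_heis_den: "quad_poly heis_den"
proof -
  have "heis_den = (\<lambda>(x,y,z). 1 + 0 * x + 0 * y + 0 * z
     + 1 * x\<^sup>2 + 1 * y\<^sup>2 + 1 * z\<^sup>2 + 0 * (x * y) + 0 * (x * z) + 0 * (y * z))"
    unfolding heis_den_def norm_heis_sq by (rule ext) (simp split: prod.split)
  then show ?thesis by (rule ssubst) (rule quad_polyI)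
qed

lemma quad_poly_bound:
  assumes "quad_poly f"
  shows "\<exists>C. \<forall>q. \<bar>f q / heis_den q\<bar> \<le> C"
proof -
  obtain c0 c1 c2 c3 c11 c22 c33 c12 c13 c23 where f: "f = (\<lambda>(x,y,z). c0 + c1 * x + c2 * y + c3 * z
     + c11 * x\<^sup>2 + c22 * y\<^sup>2 + c33 * z\<^sup>2 + c12 * (x * y) + c13 * (x * z) + c23 * (y * z))"
    using assms unfolding quad_poly_def by (elim exE) (rule that)
  define C where "C = \<bar>c0\<bar> + \<bar>c1\<bar> + \<bar>c2\<bar> + \<bar>c3\<bar> + \<bar>c11\<bar> + \<bar>c22\<bar> + \<bar>c33\<bar> + \<bar>c12\<bar> + \<bar>c13\<bar> + \<bar>c23\<bar>"
  have "\<bar>f q\<bar> \<le> C * heis_den q" for q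
  proof -
    obtain x y z where qq: "q = (x,y,z)" by (cases q)
    define F where "F = heis_den q"
    have F: "F = 1 + x\<^sup>2 + y\<^sup>2 + z\<^sup>2" by (simp add: F_def heis_den_def norm_heis_sq qq)
    have one: "\<bar>a\<bar> \<le> F" if "a\<^sup>2 \<le> F" for a
    proof -
      have "F \<ge> 1" unfolding F_def by (rule heis_den_ge)
      then have "a\<^sup>2 \<le> F\<^sup>2" using that self_le_power[of F 2] by simp
      then show ?thesis using \<open>F \<ge> 1\<close> by (intro power2_le_imp_le[of "\<bar>a\<bar>" F]) simp_all
    qed
    have two: "\<bar>a * b\<bar> \<le> F" if "a\<^sup>2 + b\<^sup>2 \<le> F" for a b
    proof -
      have "2 * \<bar>a * b\<bar> \<le> a\<^sup>2 + b\<^sup>2" using sum_squares_bound[of "\<bar>a\<bar>" "\<bar>b\<bar>"] by (simp add: abs_mult)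
      then show ?thesis using that abs_ge_zero[of "a * b"] by simp
    qed
    have m: "\<bar>c * a\<bar> \<le> \<bar>c\<bar> * F" if "\<bar>a\<bar> \<le> F" for c a
      unfolding abs_mult by (rule mult_left_mono[OF that]) simp
    have bd: "\<bar>a0 + a1 + a2 + a3 + a4 + a5 + a6 + a7 + a8 + a9\<bar> \<le> b0 + b1 + b2 + b3 + b4 + b5 + b6 + b7 + b8 + b9"
      if "\<bar>a0\<bar> \<le> b0" "\<bar>a1\<bar> \<le> b1" "\<bar>a2\<bar> \<le> b2" "\<bar>a3\<bar> \<le> b3" "\<bar>a4\<bar> \<le> b4" "\<bar>a5\<bar> \<le> b5" "\<bar>a6\<bar> \<le> b6"
        "\<bar>a7\<bar> \<le> b7" "\<bar>a8\<bar> \<le> b8" "\<bar>a9\<bar> \<le> b9" for a0 a1 a2 a3 a4 a5 a6 a7 a8 a9 b0 b1 b2 b3 b4 b5 b6 b7 b8 b9 :: real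
    proof -
      have 1: "a0 + a1 + a2 + a3 + a4 + a5 + a6 + a7 + a8 + a9 \<le> b0 + b1 + b2 + b3 + b4 + b5 + b6 + b7 + b8 + b9"
        by (intro add_mono) (use that in \<open>simp_all only: abs_le_iff\<close>)
      have 2: "- a0 + - a1 + - a2 + - a3 + - a4 + - a5 + - a6 + - a7 + - a8 + - a9 \<le> b0 + b1 + b2 + b3 + b4 + b5 + b6 + b7 + b8 + b9"
        by (intro add_mono) (use that in \<open>simp_all only: abs_le_iff\<close>)
      show ?thesis unfolding abs_le_iff using 1 2 by simp
    qed
    have b0: "\<bar>c0\<bar> \<le> \<bar>c0\<bar> * F" using m[of 1 c0] F by simp
    have b1: "\<bar>c1 * x\<bar> \<le> \<bar>c1\<bar> * F" "\<bar>c2 * y\<bar> \<le> \<bar>c2\<bar> * F" "\<bar>c3 * z\<bar> \<le> \<bar>c3\<bar> * F"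
      by (rule m, rule one, simp add: F)+
    have b2: "\<bar>c11 * x\<^sup>2\<bar> \<le> \<bar>c11\<bar> * F" "\<bar>c22 * y\<^sup>2\<bar> \<le> \<bar>c22\<bar> * F" "\<bar>c33 * z\<^sup>2\<bar> \<le> \<bar>c33\<bar> * F"
      by (rule m, simp add: F)+
    have b3: "\<bar>c12 * (x * y)\<bar> \<le> \<bar>c12\<bar> * F" "\<bar>c13 * (x * z)\<bar> \<le> \<bar>c13\<bar> * F" "\<bar>c23 * (y * z)\<bar> \<le> \<bar>c23\<bar> * F"
      by (rule m, rule two, simp add: F)+
    have "\<bar>f q\<bar> \<le> \<bar>c0\<bar> * F + \<bar>c1\<bar> * F + \<bar>c2\<bar> * F + \<bar>c3\<bar> * F + \<bar>c11\<bar> * F + \<bar>c22\<bar> * F + \<bar>c33\<bar> * F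
       + \<bar>c12\<bar> * F + \<bar>c13\<bar> * F + \<bar>c23\<bar> * F"
      unfolding f qq prod.case by (rule bd[OF b0 b1 b2 b3])
    then show ?thesis unfolding C_def F_def[symmetric] by (simp only: distrib_right)
  qed
  then have "\<bar>f q / heis_den q\<bar> \<le> C" for q
    using heis_den_ge[of q] by (simp add: abs_divide divide_le_eq)
  then show ?thesis by blast
qed

text \<open>The derivative of \<open>f / heis_den\<close> is
  \<open>f1 / heis_den - (f / heis_den) * (d1 / heis_den)\<close>. These are again products of
  quotients of the same shape, so the induction closes with the ring operations.\<close>

lemma right_regular_quad_poly: "quad_poly f \<Longrightarrow> right_regular m (\<lambda>q. f q / heis_den q)"
proof (induction m arbitrary: f)
  case 0
  then show ?case using quad_poly_bound by simp
next
  case (Suc m)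
  obtain f1 f2 f3 where f: "quad_poly f1" "quad_poly f2" "quad_poly f3" "has_right_derivs f f1 f2 f3"
    by (rule quad_poly_right_derivs[OF Suc.prems])
  obtain d1 d2 d3 where d: "quad_poly d1" "quad_poly d2" "quad_poly d3" "has_right_derivs heis_den d1 d2 d3"
    by (rule quad_poly_right_derivs[OF quad_poly_heis_den])
  have nz: "heis_den q \<noteq> 0" for q using heis_den_ge[of q] by linarith
  have "has_right_derivs (\<lambda>q. f q / heis_den q)
     (\<lambda>q. f1 q / heis_den q + (- 1 * (f q / heis_den q)) * (d1 q / heis_den q))
     (\<lambda>q. f2 q / heis_den q + (- 1 * (f q / heis_den q)) * (d2 q / heis_den q))
     (\<lambda>q. f3 q / heis_den q + (- 1 * (f q / heis_den q)) * (d3 q / heis_den q))"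
    unfolding has_right_derivs_def
  proof (intro allI)
    fix q k :: heis
    have z: "(0 *\<^sub>R k) \<odot> q = q" by simp
    have "((\<lambda>s. f ((s *\<^sub>R k) \<odot> q) / heis_den ((s *\<^sub>R k) \<odot> q)) has_real_derivative
       ((fst k * f1 q + fst (snd k) * f2 q + snd (snd k) * f3 q) * heis_den ((0 *\<^sub>R k) \<odot> q)
         - f ((0 *\<^sub>R k) \<odot> q) * (fst k * d1 q + fst (snd k) * d2 q + snd (snd k) * d3 q))
         / (heis_den ((0 *\<^sub>R k) \<odot> q) * heis_den ((0 *\<^sub>R k) \<odot> q))) (at 0)"
      by (rule DERIV_divide[OF f(4)[unfolded has_right_derivs_def, rule_format]
          d(4)[unfolded has_right_derivs_def, rule_format] nz])
    then show "((\<lambda>s. f ((s *\<^sub>R k) \<odot> q) / heis_den ((s *\<^sub>R k) \<odot> q)) has_real_derivative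
       fst k * (f1 q / heis_den q + (- 1 * (f q / heis_den q)) * (d1 q / heis_den q)) +
       fst (snd k) * (f2 q / heis_den q + (- 1 * (f q / heis_den q)) * (d2 q / heis_den q)) +
       snd (snd k) * (f3 q / heis_den q + (- 1 * (f q / heis_den q)) * (d3 q / heis_den q))) (at 0)"
      unfolding z by (rule DERIV_cong) (use nz[of q] in \<open>simp add: field_simps\<close>)
  qed
  from this show ?case
    by (rule right_regular_SucI[OF quad_poly_bound[OF Suc.prems], rotated 3])
       (intro right_regular_add right_regular_mult right_regular_const Suc.IH f d Suc.prems)+
qed

text \<open>Third-order Taylor data along left translations, uniform over the whole group. Uniformity is
  what survives averaging over right translations.\<close>

definition uniform_jets ::
  "real \<Rightarrow> (heis \<Rightarrow> real) \<Rightarrow> (heis \<Rightarrow> heis \<Rightarrow> real) \<Rightarrow> (heis \<Rightarrow> heis \<Rightarrow> heis \<Rightarrow> real) \<Rightarrow> bool" where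
  "uniform_jets C g l B \<longleftrightarrow> (\<forall>q. linear (l q)) \<and> (\<forall>q. bilinear (B q)) \<and>
     (\<forall>q k. \<bar>g (k \<odot> q) - g q - l q k - B q k k\<bar> \<le> C * norm k ^ 3) \<and>
     (\<forall>q k r. \<bar>B (k \<odot> q) r r - B q r r\<bar> \<le> C * norm k * (norm r)\<^sup>2)"

text \<open>The multiples of one \<open>k\<close> form a one-parameter subgroup, so a derivative
  known at parameter \<open>0\<close> can be transported to any \<open>t\<close>.\<close>

lemma has_right_derivs_line:
  assumes "has_right_derivs g g1 g2 g3"
  shows "((\<lambda>s. g ((s *\<^sub>R k) \<odot> q)) has_real_derivative
     fst k * g1 ((t *\<^sub>R k) \<odot> q) + fst (snd k) * g2 ((t *\<^sub>R k) \<odot> q) + snd (snd k) * g3 ((t *\<^sub>R k) \<odot> q)) (at t)"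
proof -
  have om: "om (a *\<^sub>R k) (b *\<^sub>R k) = 0" for a b
    by (simp add: om_def algebra_simps)
  have "((s *\<^sub>R k) \<odot> (t *\<^sub>R k)) = (s + t) *\<^sub>R k" for s
    unfolding heis_mult_eq om by (simp add: algebra_simps zero_prod_def[symmetric])
  then have eq: "(s *\<^sub>R k) \<odot> ((t *\<^sub>R k) \<odot> q) = ((s + t) *\<^sub>R k) \<odot> q" for s
    by (simp add: heis_assoc[symmetric])
  have "((\<lambda>s. g ((s *\<^sub>R k) \<odot> ((t *\<^sub>R k) \<odot> q))) has_real_derivative
     fst k * g1 ((t *\<^sub>R k) \<odot> q) + fst (snd k) * g2 ((t *\<^sub>R k) \<odot> q) + snd (snd k) * g3 ((t *\<^sub>R k) \<odot> q)) (at 0)"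
    using assms unfolding has_right_derivs_def by blast
  then show ?thesis unfolding eq using DERIV_shift[of "\<lambda>s. g ((s *\<^sub>R k) \<odot> q)" _ 0 t] by (simp add: add.commute)
qed

lemma right_deriv_bound:
  fixes k :: heis
  assumes "\<And>q. \<bar>g1 q\<bar> \<le> C" "\<And>q. \<bar>g2 q\<bar> \<le> C" "\<And>q. \<bar>g3 q\<bar> \<le> C"
  shows "\<bar>fst k * g1 q + fst (snd k) * g2 q + snd (snd k) * g3 q\<bar> \<le> 3 * C * norm k"
proof -
  have "\<bar>a * g\<bar> \<le> norm k * C" if "\<bar>a\<bar> \<le> norm k" "\<bar>g\<bar> \<le> C" for a g
    unfolding abs_mult using that by (intro mult_mono) auto
  from this[OF abs_coord_le_norm(1) assms(1), of q] this[OF abs_coord_le_norm(2) assms(2), of q]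
    this[OF abs_coord_le_norm(3) assms(3), of q]
  have "\<bar>fst k * g1 q\<bar> \<le> norm k * C" "\<bar>fst (snd k) * g2 q\<bar> \<le> norm k * C" "\<bar>snd (snd k) * g3 q\<bar> \<le> norm k * C"
    by auto
  moreover have "3 * C * norm k = norm k * C + norm k * C + norm k * C" by simp
  ultimately show ?thesis by linarith
qed

lemma right_mvt:
  assumes "has_right_derivs g g1 g2 g3"
  obtains t where "0 < t" "t < 1" "g (k \<odot> q) - g q =
    fst k * g1 ((t *\<^sub>R k) \<odot> q) + fst (snd k) * g2 ((t *\<^sub>R k) \<odot> q) + snd (snd k) * g3 ((t *\<^sub>R k) \<odot> q)"
proof -
  have "\<exists>t. t > 0 \<and> t < 1 \<and> g ((1 *\<^sub>R k) \<odot> q) - g ((0 *\<^sub>R k) \<odot> q) = (1 - 0) *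
    (fst k * g1 ((t *\<^sub>R k) \<odot> q) + fst (snd k) * g2 ((t *\<^sub>R k) \<odot> q) + snd (snd k) * g3 ((t *\<^sub>R k) \<odot> q))"
    by (rule MVT2) (use has_right_derivs_line[OF assms] in simp_all)
  then show thesis using that by auto
qed

lemma right_regular_lipschitz:
  assumes "has_right_derivs g g1 g2 g3" "\<And>q. \<bar>g1 q\<bar> \<le> C" "\<And>q. \<bar>g2 q\<bar> \<le> C" "\<And>q. \<bar>g3 q\<bar> \<le> C"
  shows "\<bar>g (k \<odot> q) - g q\<bar> \<le> 3 * C * norm k"
proof -
  obtain t where "g (k \<odot> q) - g q =
    fst k * g1 ((t *\<^sub>R k) \<odot> q) + fst (snd k) * g2 ((t *\<^sub>R k) \<odot> q) + snd (snd k) * g3 ((t *\<^sub>R k) \<odot> q)"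
    by (rule right_mvt[OF assms(1)])
  then show ?thesis using right_deriv_bound[of g1 C g2 g3 k, OF assms(2,3,4)] by simp
qed

lemma right_regular_1_lipschitz:
  assumes "right_regular (Suc 0) g"
  obtains C where "C \<ge> 0" "\<forall>k q. \<bar>g (k \<odot> q) - g q\<bar> \<le> C * norm k"
proof -
  obtain g1 g2 g3 where g: "right_regular 0 g1" "right_regular 0 g2" "right_regular 0 g3" "has_right_derivs g g1 g2 g3"
    by (rule right_regular_SucE[OF assms])
  obtain C1 C2 C3 where C: "\<And>q. \<bar>g1 q\<bar> \<le> C1" "\<And>q. \<bar>g2 q\<bar> \<le> C2" "\<And>q. \<bar>g3 q\<bar> \<le> C3"
    using g(1-3) unfolding right_regular.simps by blast
  define C where "C = max 0 (max C1 (max C2 C3))"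
  have "\<bar>g1 q\<bar> \<le> C" "\<bar>g2 q\<bar> \<le> C" "\<bar>g3 q\<bar> \<le> C" for q
    using C[of q] by (simp_all add: C_def)
  note right_regular_lipschitz[OF g(4) this]
  moreover have "3 * C \<ge> 0" by (simp add: C_def)
  ultimately show thesis using that[of "3 * C"] by blast
qed

lemma right_regular_2_expansion:
  assumes "right_regular (Suc (Suc 0)) g"
  obtains g1 g2 g3 C where "has_right_derivs g g1 g2 g3" "C \<ge> 0"
    "\<forall>k q. \<bar>g1 (k \<odot> q) - g1 q\<bar> \<le> C * norm k" "\<forall>k q. \<bar>g2 (k \<odot> q) - g2 q\<bar> \<le> C * norm k"
    "\<forall>k q. \<bar>g3 (k \<odot> q) - g3 q\<bar> \<le> C * norm k"
    "\<forall>k q. \<bar>g (k \<odot> q) - g q - (fst k * g1 q + fst (snd k) * g2 q + snd (snd k) * g3 q)\<bar> \<le> 3 * C * (norm k)\<^sup>2"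
proof -
  obtain g1 g2 g3 where g: "right_regular (Suc 0) g1" "right_regular (Suc 0) g2" "right_regular (Suc 0) g3" "has_right_derivs g g1 g2 g3"
    by (rule right_regular_SucE[OF assms])
  obtain C1 where C1: "C1 \<ge> 0" "\<forall>k q. \<bar>g1 (k \<odot> q) - g1 q\<bar> \<le> C1 * norm k"
    by (rule right_regular_1_lipschitz[OF g(1)])
  obtain C2 where C2: "C2 \<ge> 0" "\<forall>k q. \<bar>g2 (k \<odot> q) - g2 q\<bar> \<le> C2 * norm k"
    by (rule right_regular_1_lipschitz[OF g(2)])
  obtain C3 where C3: "C3 \<ge> 0" "\<forall>k q. \<bar>g3 (k \<odot> q) - g3 q\<bar> \<le> C3 * norm k"
    by (rule right_regular_1_lipschitz[OF g(3)])
  define C where "C = C1 + C2 + C3"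
  have le: "C1 * norm k \<le> C * norm k" "C2 * norm k \<le> C * norm k" "C3 * norm k \<le> C * norm k" for k :: heis
    using C1(1) C2(1) C3(1) by (auto simp: C_def intro!: mult_right_mono)
  have L: "\<bar>g1 (k \<odot> q) - g1 q\<bar> \<le> C * norm k" "\<bar>g2 (k \<odot> q) - g2 q\<bar> \<le> C * norm k" "\<bar>g3 (k \<odot> q) - g3 q\<bar> \<le> C * norm k" for k q
    using C1(2) C2(2) C3(2) le[of k] order_trans by blast+
  have C0: "C \<ge> 0" using C1 C2 C3 by (simp add: C_def)
  have "\<bar>g (k \<odot> q) - g q - (fst k * g1 q + fst (snd k) * g2 q + snd (snd k) * g3 q)\<bar> \<le> 3 * C * (norm k)\<^sup>2" for k q
  proof -
    obtain t where t: "0 < t" "t < 1" and eq: "g (k \<odot> q) - g q =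
      fst k * g1 ((t *\<^sub>R k) \<odot> q) + fst (snd k) * g2 ((t *\<^sub>R k) \<odot> q) + snd (snd k) * g3 ((t *\<^sub>R k) \<odot> q)"
      by (rule right_mvt[OF g(4)])
    have small: "C * norm (t *\<^sub>R k) \<le> C * norm k"
      using t C0 by (intro mult_left_mono) (simp_all add: mult_left_le_one_le)
    have b: "\<bar>g1 ((t *\<^sub>R k) \<odot> q) - g1 q\<bar> \<le> C * norm k" "\<bar>g2 ((t *\<^sub>R k) \<odot> q) - g2 q\<bar> \<le> C * norm k"
      "\<bar>g3 ((t *\<^sub>R k) \<odot> q) - g3 q\<bar> \<le> C * norm k"
      using L[of "t *\<^sub>R k" q] small by linarith+
    have "g (k \<odot> q) - g q - (fst k * g1 q + fst (snd k) * g2 q + snd (snd k) * g3 q)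
      = fst k * (g1 ((t *\<^sub>R k) \<odot> q) - g1 q) + fst (snd k) * (g2 ((t *\<^sub>R k) \<odot> q) - g2 q) + snd (snd k) * (g3 ((t *\<^sub>R k) \<odot> q) - g3 q)"
      using eq by (simp add: algebra_simps)
    also have "\<bar>\<dots>\<bar> \<le> 3 * (C * norm k) * norm k"
      by (rule right_deriv_bound[of "\<lambda>_. g1 ((t *\<^sub>R k) \<odot> q) - g1 q" _ "\<lambda>_. g2 ((t *\<^sub>R k) \<odot> q) - g2 q"
           "\<lambda>_. g3 ((t *\<^sub>R k) \<odot> q) - g3 q", OF b])
    finally show ?thesis by (simp add: power2_eq_square)
  qed
  with g(4) C0 L show thesis by (intro that[of g1 g2 g3 C]) blast+
qed

text \<open>\<open>B\<close> is half the matrix of second right-invariant derivatives, left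
  unsymmetrized. Boundedness of the third derivatives serves twice: for the cubic remainder and for
  the Lipschitz bound on \<open>B\<close>.\<close>

lemma right_regular_uniform_jets:
  assumes "right_regular (Suc (Suc (Suc 0))) g"
  obtains C l B where "uniform_jets C g l B"
proof -
  obtain g1 g2 g3 where g: "right_regular (Suc (Suc 0)) g1" "right_regular (Suc (Suc 0)) g2"
      "right_regular (Suc (Suc 0)) g3" "has_right_derivs g g1 g2 g3"
    by (rule right_regular_SucE[OF assms])
  obtain g11 g12 g13 C1 where 1: "has_right_derivs g1 g11 g12 g13" "C1 \<ge> 0"
    "\<forall>k q. \<bar>g11 (k \<odot> q) - g11 q\<bar> \<le> C1 * norm k" "\<forall>k q. \<bar>g12 (k \<odot> q) - g12 q\<bar> \<le> C1 * norm k"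
    "\<forall>k q. \<bar>g13 (k \<odot> q) - g13 q\<bar> \<le> C1 * norm k"
    "\<forall>k q. \<bar>g1 (k \<odot> q) - g1 q - (fst k * g11 q + fst (snd k) * g12 q + snd (snd k) * g13 q)\<bar> \<le> 3 * C1 * (norm k)\<^sup>2"
    by (rule right_regular_2_expansion[OF g(1)])
  obtain g21 g22 g23 C2 where 2: "has_right_derivs g2 g21 g22 g23" "C2 \<ge> 0"
    "\<forall>k q. \<bar>g21 (k \<odot> q) - g21 q\<bar> \<le> C2 * norm k" "\<forall>k q. \<bar>g22 (k \<odot> q) - g22 q\<bar> \<le> C2 * norm k"
    "\<forall>k q. \<bar>g23 (k \<odot> q) - g23 q\<bar> \<le> C2 * norm k"
    "\<forall>k q. \<bar>g2 (k \<odot> q) - g2 q - (fst k * g21 q + fst (snd k) * g22 q + snd (snd k) * g23 q)\<bar> \<le> 3 * C2 * (norm k)\<^sup>2"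
    by (rule right_regular_2_expansion[OF g(2)])
  obtain g31 g32 g33 C3 where 3: "has_right_derivs g3 g31 g32 g33" "C3 \<ge> 0"
    "\<forall>k q. \<bar>g31 (k \<odot> q) - g31 q\<bar> \<le> C3 * norm k" "\<forall>k q. \<bar>g32 (k \<odot> q) - g32 q\<bar> \<le> C3 * norm k"
    "\<forall>k q. \<bar>g33 (k \<odot> q) - g33 q\<bar> \<le> C3 * norm k"
    "\<forall>k q. \<bar>g3 (k \<odot> q) - g3 q - (fst k * g31 q + fst (snd k) * g32 q + snd (snd k) * g33 q)\<bar> \<le> 3 * C3 * (norm k)\<^sup>2"
    by (rule right_regular_2_expansion[OF g(3)])
  define C where "C = 3 * (C1 + C2 + C3)"
  have C0: "C \<ge> 0" using 1 2 3 by (simp add: C_def)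
  have le: "3 * C1 * x \<le> C * x" "3 * C2 * x \<le> C * x" "3 * C3 * x \<le> C * x" if "x \<ge> 0" for x
    using that 1(2) 2(2) 3(2) by (auto simp: C_def intro!: mult_right_mono)
  define G where "G = (\<lambda>a b c q k. fst k * a q + fst (snd k) * b q + snd (snd k) * c (q::heis) :: real)"
  have linG: "linear (G a b c q)" for a b c q
    unfolding G_def by (rule linearI) (simp_all add: algebra_simps)
  have Ge: "G g1 g2 g3 p k = fst k * g1 p + fst (snd k) * g2 p + snd (snd k) * g3 p" for p k
    by (simp add: G_def)
  define l where "l = G g1 g2 g3"
  define B where "B = (\<lambda>q k r. 1/2 * (fst k * G g11 g12 g13 q r + fst (snd k) * G g21 g22 g23 q r + snd (snd k) * G g31 g32 g33 q r))"
  have bilB: "bilinear (B q)" for q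
  proof -
    have c: "linear (\<lambda>k::heis. fst k)" "linear (\<lambda>k::heis. fst (snd k))" "linear (\<lambda>k::heis. snd (snd k))"
      by (rule linearI; simp)+
    show ?thesis unfolding B_def
      by (intro bilinear_cmult bilinear_add bilinear_tensor linG c)
  qed
  have rem: "\<bar>g (k \<odot> q) - g q - l q k - B q k k\<bar> \<le> 3 * C * norm k ^ 3" for q k
  proof -
    \<comment> \<open>The mean value theorem is applied once, to \<open>g\<close> minus its
      second-order part along the line. The derivative consists of first-order remainders of
      \<open>g1\<close>, \<open>g2\<close>, \<open>g3\<close>, which are quadratic in
      \<open>norm k\<close>; the factor \<open>k\<close> in front supplies the third power.\<close>
    define \<phi> where "\<phi> = (\<lambda>s. g ((s *\<^sub>R k) \<odot> q) - s * l q k - s\<^sup>2 * B q k k)"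
    have D: "(\<phi> has_real_derivative G g1 g2 g3 ((t *\<^sub>R k) \<odot> q) k - l q k - 2 * t * B q k k) (at t)" for t
      unfolding \<phi>_def
      by (rule derivative_eq_intros has_right_derivs_line[OF g(4)] refl)+ (simp add: G_def)
    have "\<exists>t. t > 0 \<and> t < 1 \<and> \<phi> 1 - \<phi> 0 = (1 - 0) * (G g1 g2 g3 ((t *\<^sub>R k) \<odot> q) k - l q k - 2 * t * B q k k)"
      by (rule MVT2) (simp_all add: D)
    then obtain t where t: "0 < t" "t < 1" and eq: "\<phi> 1 - \<phi> 0 = G g1 g2 g3 ((t *\<^sub>R k) \<odot> q) k - l q k - 2 * t * B q k k"
      by auto
    have tk: "(norm (t *\<^sub>R k))\<^sup>2 \<le> (norm k)\<^sup>2"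
      using t by (intro power_mono) (simp_all add: mult_left_le_one_le)
    have b: "\<bar>g1 ((t *\<^sub>R k) \<odot> q) - g1 q - t * G g11 g12 g13 q k\<bar> \<le> C * (norm k)\<^sup>2"
      "\<bar>g2 ((t *\<^sub>R k) \<odot> q) - g2 q - t * G g21 g22 g23 q k\<bar> \<le> C * (norm k)\<^sup>2"
      "\<bar>g3 ((t *\<^sub>R k) \<odot> q) - g3 q - t * G g31 g32 g33 q k\<bar> \<le> C * (norm k)\<^sup>2"
    proof -
      have sc: "t * G a b c q k = fst (t *\<^sub>R k) * a q + fst (snd (t *\<^sub>R k)) * b q + snd (snd (t *\<^sub>R k)) * c q" for a b c
        by (simp add: G_def algebra_simps)
      have up: "3 * C' * (norm (t *\<^sub>R k))\<^sup>2 \<le> 3 * C' * (norm k)\<^sup>2" if "C' \<ge> 0" for C'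
        using tk that by (intro mult_left_mono) auto
      show "\<bar>g1 ((t *\<^sub>R k) \<odot> q) - g1 q - t * G g11 g12 g13 q k\<bar> \<le> C * (norm k)\<^sup>2"
        unfolding sc using 1(6)[rule_format, of "t *\<^sub>R k" q] up[OF 1(2)] le(1)[of "(norm k)\<^sup>2"] by (meson order_trans zero_le_power2)
      show "\<bar>g2 ((t *\<^sub>R k) \<odot> q) - g2 q - t * G g21 g22 g23 q k\<bar> \<le> C * (norm k)\<^sup>2"
        unfolding sc using 2(6)[rule_format, of "t *\<^sub>R k" q] up[OF 2(2)] le(2)[of "(norm k)\<^sup>2"] by (meson order_trans zero_le_power2)
      show "\<bar>g3 ((t *\<^sub>R k) \<odot> q) - g3 q - t * G g31 g32 g33 q k\<bar> \<le> C * (norm k)\<^sup>2"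
        unfolding sc using 3(6)[rule_format, of "t *\<^sub>R k" q] up[OF 3(2)] le(3)[of "(norm k)\<^sup>2"] by (meson order_trans zero_le_power2)
    qed
    have "g (k \<odot> q) - g q - l q k - B q k k = \<phi> 1 - \<phi> 0" by (simp add: \<phi>_def)
    also have "\<dots> = fst k * (g1 ((t *\<^sub>R k) \<odot> q) - g1 q - t * G g11 g12 g13 q k)
      + fst (snd k) * (g2 ((t *\<^sub>R k) \<odot> q) - g2 q - t * G g21 g22 g23 q k)
      + snd (snd k) * (g3 ((t *\<^sub>R k) \<odot> q) - g3 q - t * G g31 g32 g33 q k)"
      unfolding eq l_def B_def by (simp add: Ge algebra_simps)
    also have "\<bar>\<dots>\<bar> \<le> 3 * (C * (norm k)\<^sup>2) * norm k"
      by (rule right_deriv_bound[of "\<lambda>_. g1 ((t *\<^sub>R k) \<odot> q) - g1 q - t * G g11 g12 g13 q k" _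
           "\<lambda>_. g2 ((t *\<^sub>R k) \<odot> q) - g2 q - t * G g21 g22 g23 q k"
           "\<lambda>_. g3 ((t *\<^sub>R k) \<odot> q) - g3 q - t * G g31 g32 g33 q k", OF b])
    finally show ?thesis by (simp add: power2_eq_square power3_eq_cube mult.assoc)
  qed
  have lipB: "\<bar>B (k \<odot> q) r r - B q r r\<bar> \<le> 3 * C * norm k * (norm r)\<^sup>2" for q k r
  proof -
    have G: "\<bar>G a b c (k \<odot> q) r - G a b c q r\<bar> \<le> 3 * (C' * norm k) * norm r"
      if "\<forall>k q. \<bar>a (k \<odot> q) - a q\<bar> \<le> C' * norm k" "\<forall>k q. \<bar>b (k \<odot> q) - b q\<bar> \<le> C' * norm k" "\<forall>k q. \<bar>c (k \<odot> q) - c q\<bar> \<le> C' * norm k"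
      for a b c C'
      using right_deriv_bound[of "\<lambda>_. a (k \<odot> q) - a q" "C' * norm k" "\<lambda>_. b (k \<odot> q) - b q" "\<lambda>_. c (k \<odot> q) - c q" r]
        that by (simp add: G_def algebra_simps)
    have nn: "norm k * norm r \<ge> 0" by simp
    have b: "\<bar>G g11 g12 g13 (k \<odot> q) r - G g11 g12 g13 q r\<bar> \<le> C * (norm k * norm r)"
      "\<bar>G g21 g22 g23 (k \<odot> q) r - G g21 g22 g23 q r\<bar> \<le> C * (norm k * norm r)"
      "\<bar>G g31 g32 g33 (k \<odot> q) r - G g31 g32 g33 q r\<bar> \<le> C * (norm k * norm r)"
      using G[OF 1(3-5)] G[OF 2(3-5)] G[OF 3(3-5)] le[OF nn] by (simp_all add: mult.assoc)
    have "B (k \<odot> q) r r - B q r r = 1/2 * (fst r * (G g11 g12 g13 (k \<odot> q) r - G g11 g12 g13 q r)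
       + fst (snd r) * (G g21 g22 g23 (k \<odot> q) r - G g21 g22 g23 q r)
       + snd (snd r) * (G g31 g32 g33 (k \<odot> q) r - G g31 g32 g33 q r))"
      unfolding B_def by (simp add: algebra_simps)
    also have "\<bar>\<dots>\<bar> \<le> 1/2 * (3 * (C * (norm k * norm r)) * norm r)"
      unfolding abs_mult[of "1/2"] using right_deriv_bound[of "\<lambda>_. G g11 g12 g13 (k \<odot> q) r - G g11 g12 g13 q r" _
         "\<lambda>_. G g21 g22 g23 (k \<odot> q) r - G g21 g22 g23 q r"
         "\<lambda>_. G g31 g32 g33 (k \<odot> q) r - G g31 g32 g33 q r", OF b, of r] by simp
    also have "\<dots> \<le> 3 * C * norm k * (norm r)\<^sup>2"
      using C0 by (simp add: power2_eq_square mult.assoc)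
    finally show ?thesis .
  qed
  have "uniform_jets (3 * C) g l B"
    unfolding uniform_jets_def
    by (intro conjI allI bilB rem lipB) (simp add: l_def linG)
  then show thesis by (rule that)
qed

lemma right_regular_continuous:
  assumes "right_regular (Suc 0) g"
  shows "continuous_on S g"
proof -
  obtain C where C: "C \<ge> 0" "\<forall>k q. \<bar>g (k \<odot> q) - g q\<bar> \<le> C * norm k"
    by (rule right_regular_1_lipschitz[OF assms])
  have "isCont g p" for p
  proof -
    have "isCont (\<lambda>q. q \<odot> - p) p"
      using continuous_on_heis_mult[OF continuous_on_id continuous_on_const, of UNIV "- p"]
      unfolding continuous_on_eq_continuous_at[OF open_UNIV] by (rule bspec) (rule UNIV_I)
    then have "((\<lambda>q. C * norm (q \<odot> - p)) \<longlongrightarrow> C * norm (p \<odot> - p)) (at p)"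
      unfolding isCont_def by (intro tendsto_intros)
    then have lim: "((\<lambda>q. C * norm (q \<odot> - p)) \<longlongrightarrow> 0) (at p)" by simp
    have "\<bar>g q - g p\<bar> \<le> C * norm (q \<odot> - p)" for q
      using C(2)[rule_format, of "q \<odot> - p" p] by (simp add: heis_assoc)
    then have "\<forall>\<^sub>F q in at p. norm (g q - g p) \<le> C * norm (q \<odot> - p)"
      by (intro always_eventually allI) (simp only: real_norm_def)
    from Lim_null_comparison[OF this lim] show ?thesis
      unfolding isCont_def by (rule LIM_zero_cancel)
  qed
  then show ?thesis by (intro continuous_at_imp_continuous_on ballI)
qed

text \<open>The walk may leave \<open>K\<close>, so closeness on \<open>K\<close> has to be
  accompanied by a bound on the whole group. Instead of a cut-off,
  \<open>arcsin (w p / (2 * M))\<close> is approximated and the sine of the approximant is taken: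
  the sine is bounded and 1-Lipschitz. The upward shift by \<open>e / 2\<close> makes the
  approximation one-sided.\<close>

lemma uniform_jets_approximation:
  fixes w :: "heis \<Rightarrow> real"
  assumes K: "compact K" and w: "continuous_on K w" and M: "M > 0" "\<And>p. p \<in> K \<Longrightarrow> \<bar>w p\<bar> \<le> M" and "e > 0"
  obtains g C l B where "uniform_jets C g l B" "\<forall>p\<in>K. w p \<le> g p" "\<forall>p\<in>K. g p \<le> w p + e"
    "\<forall>p. \<bar>g p\<bar> \<le> 2 * M + e"
proof -
  let ?R = "{g. right_regular (Suc (Suc (Suc 0))) g}"
  interpret function_ring_on ?R K
  proof
    show "compact K" by (rule K)
    show "continuous_on K f" if "f \<in> ?R" for f
      using that right_regular_continuous right_regular_mono by blast
    show "(\<lambda>x. f x + g x) \<in> ?R" if "f \<in> ?R" "g \<in> ?R" for f g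
      using that right_regular_add by blast
    show "(\<lambda>x. f x * g x) \<in> ?R" if "f \<in> ?R" "g \<in> ?R" for f g
      using that right_regular_mult by blast
    show "(\<lambda>_. c) \<in> ?R" for c using right_regular_const by blast
    show "\<exists>f\<in>?R. f x \<noteq> f y" if "x \<noteq> y" for x y
    proof
      have "quad_poly (\<lambda>(x,y,z). 1 + 0 * x + 0 * y + 0 * z
         + 0 * x\<^sup>2 + 0 * y\<^sup>2 + 0 * z\<^sup>2 + 0 * (x * y) + 0 * (x * z) + 0 * (y * z))"
        by (rule quad_polyI)
      then have one: "quad_poly (\<lambda>_. 1)" by (simp add: case_prod_unfold)
      \<comment> \<open>This function equals \<open>1\<close> at \<open>x\<close> and is smaller
        elsewhere, because \<open>heis_den\<close> takes the value \<open>1\<close> only at the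
        identity.\<close>
      show "(\<lambda>q. 1 / heis_den (q \<odot> - x)) \<in> ?R"
        using right_regular_right_translate[OF right_regular_quad_poly[OF one]] by blast
      have "y \<odot> - x \<noteq> 0"
      proof
        assume "y \<odot> - x = 0"
        then have "y \<odot> - x \<odot> x = x" by simp
        then have "y = x" unfolding heis_assoc by simp
        with that show False by simp
      qed
      then show "1 / heis_den (x \<odot> - x) \<noteq> 1 / heis_den (y \<odot> - x)"
        by (simp add: heis_den_def)
    qed
  qed
  have in1: "w p / (2 * M) \<in> {-1..1}" if "p \<in> K" for p
    using M(2)[OF that] M(1) by (auto simp: abs_le_iff field_simps)
  have "continuous_on K (\<lambda>p. arcsin (w p / (2 * M)))"
    by (rule continuous_on_compose2[OF continuous_on_arcsin'])
       (use in1 M(1) in \<open>auto intro!: continuous_intros w\<close>)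
  moreover have "e / (4 * M) > 0" using M(1) \<open>e > 0\<close> by simp
  ultimately have "\<exists>g\<in>?R. \<forall>p\<in>K. \<bar>arcsin (w p / (2 * M)) - g p\<bar> < e / (4 * M)"
    by (rule Stone_Weierstrass_basic)
  then obtain P where P: "right_regular (Suc (Suc (Suc 0))) P"
    "\<And>p. p \<in> K \<Longrightarrow> \<bar>arcsin (w p / (2 * M)) - P p\<bar> < e / (4 * M)"
    unfolding mem_Collect_eq by (elim bexE) (unfold mem_Collect_eq, blast)
  define g where "g = (\<lambda>p. 2 * M * sin (P p) + e / 2)"
  have "right_regular (Suc (Suc (Suc 0))) g"
    unfolding g_def by (intro right_regular_add right_regular_mult right_regular_const)
      (use right_regular_sin_cos[OF P(1)] in blast)
  then obtain C l B where j: "uniform_jets C g l B" by (rule right_regular_uniform_jets)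
  have cl: "\<bar>2 * M * sin (P p) - w p\<bar> \<le> e / 2" if "p \<in> K" for p
  proof -
    have "\<bar>sin a - sin b\<bar> \<le> \<bar>a - b\<bar>" for a b :: real
    proof -
      have "sin a - sin b = 2 * sin ((a - b) / 2) * cos ((a + b) / 2)" by (rule sin_diff_sin)
      then have "\<bar>sin a - sin b\<bar> = 2 * (\<bar>sin ((a - b) / 2)\<bar> * \<bar>cos ((a + b) / 2)\<bar>)" by (simp add: abs_mult)
      also have "\<dots> \<le> 2 * (\<bar>(a - b) / 2\<bar> * 1)" by (intro mult_left_mono mult_mono abs_sin_x_le_abs_x) auto
      finally show ?thesis by simp
    qed
    from this[of "P p" "arcsin (w p / (2 * M))"] have "\<bar>sin (P p) - w p / (2 * M)\<bar> \<le> e / (4 * M)"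
      using in1[OF that] P(2)[OF that] by auto
    then have "2 * M * \<bar>sin (P p) - w p / (2 * M)\<bar> \<le> 2 * M * (e / (4 * M))"
      using M(1) by (intro mult_left_mono) auto
    moreover have "2 * M * \<bar>sin (P p) - w p / (2 * M)\<bar> = \<bar>2 * M * (sin (P p) - w p / (2 * M))\<bar>"
      using M(1) by (simp add: abs_mult)
    moreover have "2 * M * (sin (P p) - w p / (2 * M)) = 2 * M * sin (P p) - w p"
      using M(1) by (simp add: field_simps)
    ultimately show ?thesis using M(1) by simp
  qed
  show thesis
  proof (rule that[OF j])
    have "w p \<le> g p \<and> g p \<le> w p + e" if "p \<in> K" for p
      using cl[OF that] unfolding g_def by linarith
    then show "\<forall>p\<in>K. w p \<le> g p" "\<forall>p\<in>K. g p \<le> w p + e" by blast+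
    show "\<forall>p. \<bar>g p\<bar> \<le> 2 * M + e"
    proof
      fix p
      have "\<bar>2 * M * sin (P p)\<bar> \<le> 2 * M" using M(1) by (simp add: abs_mult mult_left_le)
      then show "\<bar>g p\<bar> \<le> 2 * M + e" unfolding g_def using \<open>e > 0\<close> by linarith
    qed
  qed
qed

section \<open>Random walks and linear subsolutions\<close>

text \<open>One step stands for the time \<open>r\<^sup>2 / 4\<close>.\<close>

definition walk_avg :: "heis \<Rightarrow> heis \<Rightarrow> real \<Rightarrow> (heis \<Rightarrow> real) \<Rightarrow> heis \<Rightarrow> real" where
  "walk_avg s1 s2 r g p = (g (p \<odot> (r *\<^sub>R s1)) + g (p \<odot> ((-r) *\<^sub>R s1)) + g (p \<odot> (r *\<^sub>R s2)) + g (p \<odot> ((-r) *\<^sub>R s2))) / 4"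

lemma walk_avg_mono: "(\<And>q. f q \<le> g q) \<Longrightarrow> walk_avg s1 s2 r f p \<le> walk_avg s1 s2 r g p"
  unfolding walk_avg_def by (intro divide_right_mono add_mono) simp_all

lemma walk_avg_iter_mono:
  assumes "\<And>q. f q \<le> g q"
  shows "(walk_avg s1 s2 r ^^ n) f p \<le> (walk_avg s1 s2 r ^^ n) g p"
  by (induction n arbitrary: p) (simp_all add: assms walk_avg_mono)

lemma walk_avg_iter_add:
  "(walk_avg s1 s2 r ^^ n) (\<lambda>q. f q + g q) p = (walk_avg s1 s2 r ^^ n) f p + (walk_avg s1 s2 r ^^ n) g p"
proof (induction n arbitrary: p)
  case (Suc n)
  show ?case unfolding funpow.simps o_def walk_avg_def
    unfolding Suc.IH[unfolded walk_avg_def[abs_def]] by (simp add: add_divide_distrib)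
qed simp

lemma walk_avg_iter_cmult:
  "(walk_avg s1 s2 r ^^ n) (\<lambda>q. c * f q) p = c * (walk_avg s1 s2 r ^^ n) f p"
proof (induction n arbitrary: p)
  case (Suc n)
  show ?case unfolding funpow.simps o_def walk_avg_def
    unfolding Suc.IH[unfolded walk_avg_def[abs_def]] by (simp add: algebra_simps)
qed simp

lemma walk_avg_iter_const: "(walk_avg s1 s2 r ^^ n) (\<lambda>q. c) p = c"
  by (induction n arbitrary: p) (simp_all add: walk_avg_def)

lemma walk_avg_iter_bound:
  assumes "\<And>q. \<bar>f q\<bar> \<le> M"
  shows "\<bar>(walk_avg s1 s2 r ^^ n) f p\<bar> \<le> M"
proof -
  have "(walk_avg s1 s2 r ^^ n) f p \<le> (walk_avg s1 s2 r ^^ n) (\<lambda>_. M) p"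
    by (rule walk_avg_iter_mono) (use assms in \<open>simp add: abs_le_iff\<close>)
  moreover have "(walk_avg s1 s2 r ^^ n) (\<lambda>_. - M) p \<le> (walk_avg s1 s2 r ^^ n) f p"
  proof (rule walk_avg_iter_mono)
    show "- M \<le> f q" for q using assms[of q] by linarith
  qed
  ultimately show ?thesis unfolding walk_avg_iter_const by linarith
qed

lemma avg4_le:
  fixes a b c d x :: real
  assumes "\<bar>a\<bar> \<le> x" "\<bar>b\<bar> \<le> x" "\<bar>c\<bar> \<le> x" "\<bar>d\<bar> \<le> x"
  shows "\<bar>(a + b + c + d) / 4\<bar> \<le> x"
proof -
  note h = assms[unfolded abs_le_iff]
  have "a + b + c + d \<le> 4 * x" "- (a + b + c + d) \<le> 4 * x"
    using h[THEN conjunct1] h[THEN conjunct2] by linarith+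
  then have "\<bar>a + b + c + d\<bar> \<le> 4 * x" by (rule abs_leI)
  then show ?thesis by simp
qed

lemma uniform_jets_linear: "uniform_jets C g l B \<Longrightarrow> linear (l q)"
  and uniform_jets_bilinear: "uniform_jets C g l B \<Longrightarrow> bilinear (B q)"
  and uniform_jets_remainder: "uniform_jets C g l B \<Longrightarrow> \<bar>g (k \<odot> q) - g q - l q k - B q k k\<bar> \<le> C * norm k ^ 3"
  and uniform_jets_lipschitz: "uniform_jets C g l B \<Longrightarrow> \<bar>B (k \<odot> q) r r - B q r r\<bar> \<le> C * norm k * (norm r)\<^sup>2"
  unfolding uniform_jets_def by blast+

text \<open>By associativity a left increment passes through a right step:
  \<open>k \<odot> q \<odot> w = k \<odot> (q \<odot> w)\<close>. The expansions are therefore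
  averaged as they stand, and the constant \<open>C\<close> does not deteriorate with the number of
  steps.\<close>

lemma uniform_jets_avg:
  assumes j: "uniform_jets C g l B"
  shows "uniform_jets C (walk_avg s1 s2 r g) (\<lambda>p k. walk_avg s1 s2 r (\<lambda>q. l q k) p)
    (\<lambda>p k m. walk_avg s1 s2 r (\<lambda>q. B q k m) p)"
  unfolding uniform_jets_def
proof (intro conjI allI)
  note lin = uniform_jets_linear[OF j] uniform_jets_bilinear[OF j]
  fix q k m :: heis
  show "linear (\<lambda>k. walk_avg s1 s2 r (\<lambda>q. l q k) q)"
    unfolding walk_avg_def divide_inverse mult.commute[of _ "inverse 4"]
    by (intro linear_mult_const linear_compose_add lin)
  show "bilinear (\<lambda>k m. walk_avg s1 s2 r (\<lambda>q. B q k m) q)"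
    unfolding walk_avg_def divide_inverse mult.commute[of _ "inverse 4"]
    by (intro bilinear_cmult bilinear_add lin)
  show "\<bar>walk_avg s1 s2 r g (k \<odot> q) - walk_avg s1 s2 r g q - walk_avg s1 s2 r (\<lambda>q. l q k) q
      - walk_avg s1 s2 r (\<lambda>q. B q k k) q\<bar> \<le> C * norm k ^ 3"
  proof -
    define D where "D = (\<lambda>w. g (k \<odot> (q \<odot> w)) - g (q \<odot> w) - l (q \<odot> w) k - B (q \<odot> w) k k)"
    have "\<bar>(D (r *\<^sub>R s1) + D ((-r) *\<^sub>R s1) + D (r *\<^sub>R s2) + D ((-r) *\<^sub>R s2)) / 4\<bar> \<le> C * norm k ^ 3"
      unfolding D_def by (intro avg4_le uniform_jets_remainder[OF j])
    moreover have "walk_avg s1 s2 r g (k \<odot> q) - walk_avg s1 s2 r g q - walk_avg s1 s2 r (\<lambda>q. l q k) q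
      - walk_avg s1 s2 r (\<lambda>q. B q k k) q = (D (r *\<^sub>R s1) + D ((-r) *\<^sub>R s1) + D (r *\<^sub>R s2) + D ((-r) *\<^sub>R s2)) / 4"
      unfolding walk_avg_def D_def heis_assoc by (simp add: field_simps)
    ultimately show ?thesis by simp
  qed
  show "\<bar>walk_avg s1 s2 r (\<lambda>q. B q m m) (k \<odot> q) - walk_avg s1 s2 r (\<lambda>q. B q m m) q\<bar> \<le> C * norm k * (norm m)\<^sup>2"
  proof -
    define D where "D = (\<lambda>w. B (k \<odot> (q \<odot> w)) m m - B (q \<odot> w) m m)"
    have "\<bar>(D (r *\<^sub>R s1) + D ((-r) *\<^sub>R s1) + D (r *\<^sub>R s2) + D ((-r) *\<^sub>R s2)) / 4\<bar> \<le> C * norm k * (norm m)\<^sup>2"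
      unfolding D_def by (intro avg4_le uniform_jets_lipschitz[OF j])
    moreover have "walk_avg s1 s2 r (\<lambda>q. B q m m) (k \<odot> q) - walk_avg s1 s2 r (\<lambda>q. B q m m) q
       = (D (r *\<^sub>R s1) + D ((-r) *\<^sub>R s1) + D (r *\<^sub>R s2) + D ((-r) *\<^sub>R s2)) / 4"
      unfolding walk_avg_def D_def heis_assoc by (simp add: field_simps)
    ultimately show ?thesis by simp
  qed
qed

lemma uniform_jets_iter:
  assumes "uniform_jets C g l B"
  shows "\<exists>l B. uniform_jets C ((walk_avg s1 s2 r ^^ n) g) l B"
proof (induction n)
  case 0 show ?case using assms by auto
next
  case (Suc n)
  then obtain l B where "uniform_jets C ((walk_avg s1 s2 r ^^ n) g) l B" by blast
  from uniform_jets_avg[OF this] show ?case unfolding funpow.simps o_def by blast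
qed

lemma heis_mult_scale_conj: "p \<odot> (r *\<^sub>R s) = (r *\<^sub>R heis_conj p s) \<odot> p"
  using heis_conj_mult[of p "r *\<^sub>R s"] linear_scale[OF linear_heis_conj] by simp

lemma bilinear_scale_both:
  fixes B :: "heis \<Rightarrow> heis \<Rightarrow> real"
  assumes "bilinear B"
  shows "B (c *\<^sub>R x) (c *\<^sub>R x) = c\<^sup>2 * B x x"
  by (simp add: bilinear_lmul[OF assms] bilinear_rmul[OF assms] power2_eq_square)

text \<open>Read as left increments, the steps are plus and minus \<open>r\<close> times
  \<open>heis_conj p s1\<close> and \<open>heis_conj p s2\<close>. Linear terms cancel in pairs, and
  the squares leave \<open>r\<^sup>2 / 2\<close> times the two diagonal values. Per elapsed time
  \<open>r\<^sup>2 / 4\<close> this is twice their sum, exactly the second-order term of the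
  equation.\<close>

lemma walk_avg_consistency:
  assumes j: "uniform_jets C g l B" and "r \<ge> 0"
    and S: "norm (heis_conj p s1) \<le> S" "norm (heis_conj p s2) \<le> S" and "C \<ge> 0"
  shows "\<bar>walk_avg s1 s2 r g p - g p - r\<^sup>2 / 2 * (B p (heis_conj p s1) (heis_conj p s1) + B p (heis_conj p s2) (heis_conj p s2))\<bar>
    \<le> C * (r * S) ^ 3"
proof -
  define D where "D = (\<lambda>k. g (k \<odot> p) - g p - l p k - B p k k)"
  have b: "\<bar>D (c *\<^sub>R k)\<bar> \<le> C * (r * S) ^ 3" if "\<bar>c\<bar> = r" "norm k \<le> S" for c k
  proof -
    have "norm (c *\<^sub>R k) ^ 3 \<le> (r * S) ^ 3"
      using that \<open>r \<ge> 0\<close> by (intro power_mono) (auto intro: mult_left_mono)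
    then have "C * norm (c *\<^sub>R k) ^ 3 \<le> C * (r * S) ^ 3" using \<open>C \<ge> 0\<close> by (rule mult_left_mono)
    then show ?thesis unfolding D_def using uniform_jets_remainder[OF j, of "c *\<^sub>R k" p] by linarith
  qed
  have g: "g ((c *\<^sub>R k) \<odot> p) = g p + c * l p k + c\<^sup>2 * B p k k + D (c *\<^sub>R k)" for c k
    unfolding D_def by (simp add: linear_scale[OF uniform_jets_linear[OF j]] bilinear_scale_both[OF uniform_jets_bilinear[OF j]])
  have "walk_avg s1 s2 r g p - g p - r\<^sup>2 / 2 * (B p (heis_conj p s1) (heis_conj p s1) + B p (heis_conj p s2) (heis_conj p s2))
     = (D (r *\<^sub>R heis_conj p s1) + D ((-r) *\<^sub>R heis_conj p s1) + D (r *\<^sub>R heis_conj p s2) + D ((-r) *\<^sub>R heis_conj p s2)) / 4"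
    unfolding walk_avg_def heis_mult_scale_conj g by (simp add: field_simps)
  also have "\<bar>\<dots>\<bar> \<le> C * (r * S) ^ 3"
    using \<open>r \<ge> 0\<close> S by (intro avg4_le b) simp_all
  finally show ?thesis .
qed

text \<open>Controls the change of the second-order form over one step. It is needed because the
  comparison function blends \<open>g\<close> with its average while time runs through the
  step.\<close>

lemma walk_avg_form_lipschitz:
  assumes j: "uniform_jets C g l B" and "r \<ge> 0"
    and S: "norm (heis_conj p s1) \<le> S" "norm (heis_conj p s2) \<le> S" and "C \<ge> 0"
  shows "\<bar>walk_avg s1 s2 r (\<lambda>q. B q m m) p - B p m m\<bar> \<le> C * (r * S) * (norm m)\<^sup>2"
proof -
  define D where "D = (\<lambda>k. B (k \<odot> p) m m - B p m m)"
  have b: "\<bar>D (c *\<^sub>R k)\<bar> \<le> C * (r * S) * (norm m)\<^sup>2" if "\<bar>c\<bar> = r" "norm k \<le> S" for c k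
  proof -
    have "norm (c *\<^sub>R k) \<le> r * S" using that \<open>r \<ge> 0\<close> by (auto intro: mult_left_mono)
    then have "C * norm (c *\<^sub>R k) * (norm m)\<^sup>2 \<le> C * (r * S) * (norm m)\<^sup>2"
      using \<open>C \<ge> 0\<close> by (intro mult_right_mono mult_left_mono) auto
    then show ?thesis unfolding D_def using uniform_jets_lipschitz[OF j, of "c *\<^sub>R k" p m] by linarith
  qed
  have "walk_avg s1 s2 r (\<lambda>q. B q m m) p - B p m m
     = (D (r *\<^sub>R heis_conj p s1) + D ((-r) *\<^sub>R heis_conj p s1) + D (r *\<^sub>R heis_conj p s2) + D ((-r) *\<^sub>R heis_conj p s2)) / 4"
    unfolding walk_avg_def heis_mult_scale_conj D_def by (simp add: field_simps)
  also have "\<bar>\<dots>\<bar> \<le> C * (r * S) * (norm m)\<^sup>2"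
    using \<open>r \<ge> 0\<close> S by (intro avg4_le b) simp_all
  finally show ?thesis .
qed

text \<open>Expansions along left increments become jets along right increments through
  \<open>heis_conj_mult\<close>. The remainder now depends on the base point, which is harmless for
  a jet at a fixed \<open>p\<close>.\<close>

lemma uniform_jets_space_jet:
  assumes j: "uniform_jets C g l B" and C: "C \<ge> 0"
  shows "space_jet g p (\<lambda>q. l p (heis_conj p q)) (\<lambda>q r. B p (heis_conj p q) (heis_conj p r))"
  unfolding space_jet_def
proof (intro conjI allI impI)
  show "linear (\<lambda>q. l p (heis_conj p q))"
    using linear_compose[OF linear_heis_conj uniform_jets_linear[OF j]] by (simp only: o_def)
  show "bilinear (\<lambda>q r. B p (heis_conj p q) (heis_conj p r))"
    by (rule bilinear_compose_linear[OF uniform_jets_bilinear[OF j] linear_heis_conj])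
  fix e :: real assume "e > 0"
  define A where "A = C * (1 + 2 * norm p) ^ 3 + 1"
  have A: "A > 0" using C by (simp add: A_def add_nonneg_pos)
  show "\<exists>\<delta>>0. \<forall>q. norm q < \<delta> \<longrightarrow> \<bar>g (p \<odot> q) - g p - l p (heis_conj p q) - B p (heis_conj p q) (heis_conj p q)\<bar> \<le> e * (norm q)\<^sup>2"
  proof (rule exI[of _ "e / A"], intro conjI allI impI)
    fix q :: heis assume q: "norm q < e / A"
    have "\<bar>g (p \<odot> q) - g p - l p (heis_conj p q) - B p (heis_conj p q) (heis_conj p q)\<bar> \<le> C * norm (heis_conj p q) ^ 3"
      using uniform_jets_remainder[OF j, of "heis_conj p q" p] by (simp add: heis_conj_mult)
    also have "\<dots> \<le> C * ((1 + 2 * norm p) * norm q) ^ 3"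
      using C norm_heis_conj_le by (intro mult_left_mono power_mono) auto
    also have "\<dots> = (A - 1) * norm q * (norm q)\<^sup>2" by (simp add: A_def power_mult_distrib power3_eq_cube power2_eq_square)
    also have "\<dots> \<le> (A * norm q) * (norm q)\<^sup>2" by (intro mult_right_mono) auto
    also have "\<dots> \<le> e * (norm q)\<^sup>2" using q A by (intro mult_right_mono) (auto simp: field_simps)
    finally show "\<bar>g (p \<odot> q) - g p - l p (heis_conj p q) - B p (heis_conj p q) (heis_conj p q)\<bar> \<le> e * (norm q)\<^sup>2" .
  qed (use A \<open>e > 0\<close> in simp)
qed

lemma uniform_jets_continuous:
  assumes j: "uniform_jets C g l B" and C: "C \<ge> 0"
  shows "continuous_on S g"
proof -
  have "isCont g p" for p
  proof -
    have jet: "space_jet g p (\<lambda>q. l p (heis_conj p q)) (\<lambda>q r. B p (heis_conj p q) (heis_conj p r))"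
      by (rule uniform_jets_space_jet[OF j C])
    obtain K where K: "K \<ge> 1" "\<bar>0\<bar> \<le> K" "\<And>q. \<bar>l p (heis_conj p q)\<bar> \<le> K * norm q"
      "\<And>q. \<bar>B p (heis_conj p q) (heis_conj p q)\<bar> \<le> K * (norm q)\<^sup>2"
      using jet_forms_bound[OF space_jet_linear[OF jet] space_jet_bilinear[OF jet], of 0] by blast
    obtain \<delta> where \<delta>: "\<delta> > 0" "\<And>q. norm q < \<delta> \<Longrightarrow>
        \<bar>g (p \<odot> q) - g p - l p (heis_conj p q) - B p (heis_conj p q) (heis_conj p q)\<bar> \<le> 1 * (norm q)\<^sup>2"
      using space_jetD[OF jet zero_less_one] by blast
    have c: "isCont (\<lambda>x. norm (- p \<odot> x)) p"
      using continuous_on_norm[OF continuous_on_heis_mult[OF continuous_on_const continuous_on_id, of UNIV "- p"]]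
      unfolding continuous_on_eq_continuous_at[OF open_UNIV] by (rule bspec) (rule UNIV_I)
    then have lim0: "((\<lambda>x. norm (- p \<odot> x)) \<longlongrightarrow> 0) (at p)" unfolding isCont_def by simp
    then have lim: "((\<lambda>x. K * norm (- p \<odot> x) + (K + 1) * (norm (- p \<odot> x))\<^sup>2) \<longlongrightarrow> K * 0 + (K + 1) * 0\<^sup>2) (at p)"
      by (intro tendsto_intros)
    have "\<forall>\<^sub>F x in at p. norm (- p \<odot> x) < \<delta>" using lim0 \<delta>(1) by (rule order_tendstoD)
    then have "\<forall>\<^sub>F x in at p. norm (g x - g p) \<le> K * norm (- p \<odot> x) + (K + 1) * (norm (- p \<odot> x))\<^sup>2"
    proof eventually_elim
      fix x assume x: "norm (- p \<odot> x) < \<delta>"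
      have "p \<odot> (- p \<odot> x) = x" by simp
      then have "\<bar>g x - g p - l p (heis_conj p (- p \<odot> x)) - B p (heis_conj p (- p \<odot> x)) (heis_conj p (- p \<odot> x))\<bar> \<le> 1 * (norm (- p \<odot> x))\<^sup>2"
        using \<delta>(2)[OF x] by simp
      then show "norm (g x - g p) \<le> K * norm (- p \<odot> x) + (K + 1) * (norm (- p \<odot> x))\<^sup>2"
        using K(3)[of "- p \<odot> x"] K(4)[of "- p \<odot> x"] unfolding real_norm_def distrib_right by linarith
    qed
    from Lim_null_comparison[OF this] lim show ?thesis
      unfolding isCont_def using LIM_zero_cancel by simp
  qed
  then show ?thesis by (intro continuous_at_imp_continuous_on ballI)
qed

section \<open>The quartic barrier\<close>

lemma space_jet_square:
  assumes "space_jet d p \<xi> B"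
  shows "space_jet (\<lambda>q. (d q)\<^sup>2) p (\<lambda>q. 2 * d p * \<xi> q) (\<lambda>q r. 2 * d p * B q r + \<xi> q * \<xi> r)"
  using space_jet_mult[OF assms assms] by (simp add: power2_eq_square algebra_simps)

lemma linear_coordinates: "linear (\<lambda>q::heis. fst q)" "linear (\<lambda>q::heis. fst (snd q))" "linear (\<lambda>q::heis. snd (snd q))"
  by (rule linearI; simp)+

lemma space_jet_coordinates:
  "space_jet (\<lambda>q. fst q) p (\<lambda>q. fst q) (\<lambda>_ _. 0)"
  "space_jet (\<lambda>q. fst (snd q)) p (\<lambda>q. fst (snd q)) (\<lambda>_ _. 0)"
  "space_jet (\<lambda>q. snd (snd q)) p (\<lambda>q. snd (snd q) + om p q) (\<lambda>_ _. 0)"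
  by (rule space_jet_of_eq; (intro linear_compose_add linear_coordinates linear_om bilinearI' linear_const_zero)?;
      simp add: heis_mult_eq)+

definition xy_sq :: "heis \<Rightarrow> real" where
  "xy_sq q = (fst q)\<^sup>2 + (fst (snd q))\<^sup>2"

text \<open>Homogeneous of degree four under the group dilations, with compact sublevel sets. The
  second-order operator takes it to at most a multiple of \<open>xy_sq\<close>, and
  \<open>xy_sq\<close> to a constant, so a polynomial of degree two in time closes the
  chain.\<close>

definition quartic :: "heis \<Rightarrow> real" where
  "quartic q = ((fst q)\<^sup>2)\<^sup>2 + ((fst (snd q))\<^sup>2)\<^sup>2 + (snd (snd q))\<^sup>2"

lemma xy_sq_nonneg: "xy_sq q \<ge> 0" and quartic_nonneg: "quartic q \<ge> 0"
  by (simp_all add: xy_sq_def quartic_def)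

lemma space_jet_xy_sq:
  "space_jet xy_sq p (\<lambda>q. 2 * fst p * fst q + 2 * fst (snd p) * fst (snd q))
     (\<lambda>q r. fst q * fst r + fst (snd q) * fst (snd r))"
  using space_jet_add[OF space_jet_square[OF space_jet_coordinates(1)[of p]] space_jet_square[OF space_jet_coordinates(2)[of p]]]
  unfolding xy_sq_def[abs_def] by simp

lemma space_jet_quartic:
  obtains \<xi> where "space_jet quartic p \<xi> (\<lambda>q r. 6 * (fst p)\<^sup>2 * (fst q * fst r)
    + 6 * (fst (snd p))\<^sup>2 * (fst (snd q) * fst (snd r)) + (snd (snd q) + om p q) * (snd (snd r) + om p r))"
proof -
  note x2 = space_jet_square[OF space_jet_coordinates(1)[of p]]
  note y2 = space_jet_square[OF space_jet_coordinates(2)[of p]]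
  note z2 = space_jet_square[OF space_jet_coordinates(3)[of p]]
  note j = space_jet_add[OF space_jet_add[OF space_jet_square[OF x2] space_jet_square[OF y2]] z2]
  show thesis
    by (rule that) (use j in \<open>unfold quartic_def[abs_def], simp add: algebra_simps power2_eq_square\<close>)
qed

text \<open>A supersolution for the walk and for the flow: on the lateral boundary it stays above the quartic,
  while at the origin it is only quadratic in the elapsed time. Localizing to a cylinder is therefore free
  to first order in time.\<close>

definition barrier :: "real \<Rightarrow> heis \<Rightarrow> real \<Rightarrow> real" where
  "barrier D q s = quartic q + 14 * D * s * xy_sq q + 14 * D\<^sup>2 * s\<^sup>2"

lemma barrier_ge: "D \<ge> 0 \<Longrightarrow> s \<ge> 0 \<Longrightarrow> barrier D q s \<ge> quartic q"
  unfolding barrier_def using xy_sq_nonneg[of q] by simp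

lemma barrier_zero: "barrier D 0 s = 14 * D\<^sup>2 * s\<^sup>2" "barrier D q 0 = quartic q"
  by (simp_all add: barrier_def quartic_def xy_sq_def)

lemma norm_horizontal_sq: "snd (snd s) = 0 \<Longrightarrow> (norm (s::heis))\<^sup>2 = (fst s)\<^sup>2 + (fst (snd s))\<^sup>2"
  by (simp add: norm_heis_sq)

lemma walk_avg_xy_sq:
  assumes "snd (snd s1) = 0" "snd (snd s2) = 0"
  shows "walk_avg s1 s2 r xy_sq p = xy_sq p + r\<^sup>2 / 2 * ((norm s1)\<^sup>2 + (norm s2)\<^sup>2)"
  unfolding walk_avg_def xy_sq_def norm_horizontal_sq[OF assms(1)] norm_horizontal_sq[OF assms(2)]
  by (simp add: heis_mult_eq power2_eq_square algebra_simps)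

text \<open>Odd powers of \<open>r\<close> cancel between the two opposite steps. The fourth powers
  give the factor \<open>12\<close>; the vertical square gives half of
  \<open>(x * b - a * y)\<^sup>2\<close>, rounded up to one whole and estimated by Lagrange's
  identity. Together this is \<open>13\<close>.\<close>

lemma quartic_pair:
  assumes "snd (snd s) = 0"
  shows "quartic (p \<odot> (r *\<^sub>R s)) + quartic (p \<odot> ((-r) *\<^sub>R s)) \<le> 2 * quartic p + 13 * r\<^sup>2 * xy_sq p * (norm s)\<^sup>2 + 2 * r^4 * ((norm s)\<^sup>2)\<^sup>2"
proof -
  obtain x y z where p: "p = (x,y,z)" by (cases p)
  obtain a b where s: "s = (a,b,0)" using assms by (cases s) simp
  have n: "(norm s)\<^sup>2 = a\<^sup>2 + b\<^sup>2" using norm_horizontal_sq[OF assms] s by simp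
  define D where "D = a\<^sup>2 + b\<^sup>2"
  have xx: "x\<^sup>2 * a\<^sup>2 + y\<^sup>2 * b\<^sup>2 \<le> (x\<^sup>2 + y\<^sup>2) * D"
  proof -
    have "(x\<^sup>2 + y\<^sup>2) * D = x\<^sup>2 * a\<^sup>2 + y\<^sup>2 * b\<^sup>2 + (x\<^sup>2 * b\<^sup>2 + y\<^sup>2 * a\<^sup>2)" by (simp add: D_def algebra_simps)
    moreover have "0 \<le> x\<^sup>2 * b\<^sup>2 + y\<^sup>2 * a\<^sup>2" by simp
    ultimately show ?thesis by linarith
  qed
  have cr: "(x * b - a * y)\<^sup>2 \<le> (x\<^sup>2 + y\<^sup>2) * D"
  proof -
    have "(x\<^sup>2 + y\<^sup>2) * D = (x * b - a * y)\<^sup>2 + (x * a + y * b)\<^sup>2" by (simp add: D_def power2_eq_square algebra_simps)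
    then show ?thesis by simp
  qed
  have d4: "(a\<^sup>2)\<^sup>2 + (b\<^sup>2)\<^sup>2 \<le> D\<^sup>2"
  proof -
    have "D\<^sup>2 = (a\<^sup>2)\<^sup>2 + (b\<^sup>2)\<^sup>2 + 2 * (a\<^sup>2 * b\<^sup>2)" by (simp add: D_def power2_eq_square algebra_simps)
    then show ?thesis by simp
  qed
  have eq: "quartic (p \<odot> (r *\<^sub>R s)) + quartic (p \<odot> ((-r) *\<^sub>R s)) = 2 * quartic p + 12 * r\<^sup>2 * (x\<^sup>2 * a\<^sup>2 + y\<^sup>2 * b\<^sup>2)
     + 2 * r^4 * ((a\<^sup>2)\<^sup>2 + (b\<^sup>2)\<^sup>2) + r\<^sup>2 / 2 * (x * b - a * y)\<^sup>2"
    unfolding quartic_def p s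
    by (simp add: power2_eq_square power4_eq_xxxx field_simps)
  have "12 * r\<^sup>2 * (x\<^sup>2 * a\<^sup>2 + y\<^sup>2 * b\<^sup>2) \<le> 12 * r\<^sup>2 * ((x\<^sup>2 + y\<^sup>2) * D)" using xx by (intro mult_left_mono) simp_all
  moreover have "2 * r^4 * ((a\<^sup>2)\<^sup>2 + (b\<^sup>2)\<^sup>2) \<le> 2 * r^4 * D\<^sup>2" using d4 by (intro mult_left_mono) simp_all
  moreover have "r\<^sup>2 / 2 * (x * b - a * y)\<^sup>2 \<le> r\<^sup>2 * ((x\<^sup>2 + y\<^sup>2) * D)"
    using cr by (intro mult_mono) simp_all
  ultimately show ?thesis unfolding eq n D_def[symmetric] by (simp add: xy_sq_def p)
qed

text \<open>In front of \<open>r\<^sup>2 * D * xy_sq p\<close> the walk produces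
  \<open>13 / 4\<close>, whereas the time shift in the barrier offers \<open>14 / 4\<close>. The
  last term of the barrier pays exactly for the drift of \<open>xy_sq\<close>, and its
  \<open>7 / 8\<close> in front of \<open>r^4 * D\<^sup>2\<close> covers the \<open>1 / 2\<close>
  coming from the fourth powers.\<close>

lemma walk_avg_barrier:
  assumes s: "snd (snd s1) = 0" "snd (snd s2) = 0" and "t \<ge> 0"
  defines "D \<equiv> (norm s1)\<^sup>2 + (norm s2)\<^sup>2"
  shows "walk_avg s1 s2 r (\<lambda>q. barrier D q t) p \<le> barrier D p (t + r\<^sup>2 / 4)"
proof -
  have D: "D \<ge> 0" by (simp add: D_def)
  have wq: "walk_avg s1 s2 r quartic p \<le> quartic p + 13 / 4 * r\<^sup>2 * xy_sq p * D + r^4 / 2 * D\<^sup>2"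
  proof -
    have "((norm s1)\<^sup>2)\<^sup>2 + ((norm s2)\<^sup>2)\<^sup>2 \<le> D\<^sup>2" by (simp add: D_def power2_sum)
    then have "2 * r^4 * (((norm s1)\<^sup>2)\<^sup>2 + ((norm s2)\<^sup>2)\<^sup>2) \<le> 2 * r^4 * D\<^sup>2" by (intro mult_left_mono) simp_all
    then have "2 * r^4 * ((norm s1)\<^sup>2)\<^sup>2 + 2 * r^4 * ((norm s2)\<^sup>2)\<^sup>2 \<le> 2 * r^4 * D\<^sup>2" by (simp only: distrib_left)
    moreover have "13 * r\<^sup>2 * xy_sq p * (norm s1)\<^sup>2 + 13 * r\<^sup>2 * xy_sq p * (norm s2)\<^sup>2 = 13 * r\<^sup>2 * xy_sq p * D"
      by (simp add: D_def distrib_left)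
    ultimately have "4 * walk_avg s1 s2 r quartic p \<le> 4 * quartic p + 13 * r\<^sup>2 * xy_sq p * D + 2 * r^4 * D\<^sup>2"
      using quartic_pair[OF s(1), of p r] quartic_pair[OF s(2), of p r] unfolding walk_avg_def by simp
    then show ?thesis by simp
  qed
  have lin: "walk_avg s1 s2 r (\<lambda>q. barrier D q t) p = walk_avg s1 s2 r quartic p + 14 * D * t * walk_avg s1 s2 r xy_sq p + 14 * D\<^sup>2 * t\<^sup>2"
    unfolding walk_avg_def barrier_def by (simp add: field_simps)
  have "barrier D p (t + r\<^sup>2 / 4) - (quartic p + 13 / 4 * r\<^sup>2 * xy_sq p * D + r^4 / 2 * D\<^sup>2
     + 14 * D * t * (xy_sq p + r\<^sup>2 / 2 * D) + 14 * D\<^sup>2 * t\<^sup>2) = r\<^sup>2 / 4 * D * xy_sq p + 3 / 8 * r^4 * D\<^sup>2"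
    unfolding barrier_def by (simp add: power2_eq_square power4_eq_xxxx field_simps)
  moreover have "0 \<le> r\<^sup>2 / 4 * D * xy_sq p + 3 / 8 * r^4 * D\<^sup>2" using D xy_sq_nonneg by simp
  ultimately show ?thesis using wq unfolding lin walk_avg_xy_sq[OF s] D_def[symmetric] by linarith
qed

lemma walk_avg_iter_barrier:
  assumes s: "snd (snd s1) = 0" "snd (snd s2) = 0"
  defines "D \<equiv> (norm s1)\<^sup>2 + (norm s2)\<^sup>2"
  shows "(walk_avg s1 s2 r ^^ n) quartic p \<le> barrier D p (real n * (r\<^sup>2 / 4))"
proof (induction n arbitrary: p)
  case 0 show ?case by (simp add: barrier_zero)
next
  case (Suc n)
  have "(walk_avg s1 s2 r ^^ Suc n) quartic p = walk_avg s1 s2 r ((walk_avg s1 s2 r ^^ n) quartic) p" by simp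
  also have "\<dots> \<le> walk_avg s1 s2 r (\<lambda>q. barrier D q (real n * (r\<^sup>2 / 4))) p" by (rule walk_avg_mono) (rule Suc.IH)
  also have "\<dots> \<le> barrier D p (real n * (r\<^sup>2 / 4) + r\<^sup>2 / 4)"
    unfolding D_def by (rule walk_avg_barrier[OF s]) simp
  also have "real n * (r\<^sup>2 / 4) + r\<^sup>2 / 4 = real (Suc n) * (r\<^sup>2 / 4)" by (simp add: field_simps)
  finally show ?case .
qed

lemma walk_avg_iter_xy_sq:
  assumes s: "snd (snd s1) = 0" "snd (snd s2) = 0"
  shows "(walk_avg s1 s2 r ^^ n) xy_sq p = xy_sq p + real n * (r\<^sup>2 / 2 * ((norm s1)\<^sup>2 + (norm s2)\<^sup>2))"
proof (induction n arbitrary: p)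
  case (Suc n)
  let ?c = "r\<^sup>2 / 2 * ((norm s1)\<^sup>2 + (norm s2)\<^sup>2)"
  have "(walk_avg s1 s2 r ^^ n) xy_sq = (\<lambda>p. xy_sq p + real n * ?c)" by (rule ext) (rule Suc.IH)
  then have "(walk_avg s1 s2 r ^^ Suc n) xy_sq p = walk_avg s1 s2 r (\<lambda>p. xy_sq p + real n * ?c) p" by simp
  also have "\<dots> = walk_avg s1 s2 r xy_sq p + real n * ?c" unfolding walk_avg_def by (simp add: field_simps)
  finally show ?case unfolding walk_avg_xy_sq[OF s] by (simp add: distrib_right)
qed simp

text \<open>The counterpart for the flow. At elapsed time \<open>t + c\<close> the time derivative
  is \<open>14 * D * xy_sq p + 28 * D\<^sup>2 * (t + c)\<close>; the second-order term takes at most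
  \<open>13 * D * xy_sq p\<close> from the quartic and \<open>28 * D\<^sup>2 * (t + c)\<close> from
  \<open>xy_sq\<close>.\<close>

lemma barrier_superjet:
  assumes s: "snd (snd s1) = 0" "snd (snd s2) = 0" and "t + c \<ge> 0"
  defines "D \<equiv> (norm s1)\<^sup>2 + (norm s2)\<^sup>2"
  obtains b \<xi> B where "superjet (\<lambda>x. barrier D (fst x) (snd x + c)) p t b \<xi> B" "b - 2 * (B s1 s1 + B s2 s2) \<ge> 0"
proof -
  obtain \<xi> where q: "space_jet quartic p \<xi> (\<lambda>q r. 6 * (fst p)\<^sup>2 * (fst q * fst r)
    + 6 * (fst (snd p))\<^sup>2 * (fst (snd q) * fst (snd r)) + (snd (snd q) + om p q) * (snd (snd r) + om p r))" (is "space_jet quartic p \<xi> ?Q")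
    by (rule space_jet_quartic)
  let ?X = "\<lambda>q r::heis. fst q * fst r + fst (snd q) * fst (snd r)"
  let ?x = "\<lambda>q. 2 * fst p * fst q + 2 * fst (snd p) * fst (snd q)"
  have 1: "superjet (\<lambda>x. (\<lambda>_. 1) (snd x) * quartic (fst x)) p t (0 * quartic p) (\<lambda>q. (\<lambda>_. 1) t * \<xi> q) (\<lambda>q r. (\<lambda>_. 1) t * ?Q q r)"
    by (rule superjet_time_mult[OF q zero_less_one, of _ _ _ 0]) simp
  have 2: "superjet (\<lambda>x. (\<lambda>s. 14 * D * (s + c)) (snd x) * xy_sq (fst x)) p t ((14 * D) * xy_sq p) (\<lambda>q. (\<lambda>s. 14 * D * (s + c)) t * ?x q)
     (\<lambda>q r. (\<lambda>s. 14 * D * (s + c)) t * ?X q r)"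
    by (rule superjet_time_mult[OF space_jet_xy_sq zero_less_one, of _ _ _ 0]) (simp add: algebra_simps)
  have 3: "superjet (\<lambda>x. (\<lambda>s. 14 * D\<^sup>2 * (s + c)\<^sup>2) (snd x) * (\<lambda>_. 1) (fst x)) p t ((28 * D\<^sup>2 * (t + c)) * (\<lambda>_. 1) p)
     (\<lambda>q. (\<lambda>s. 14 * D\<^sup>2 * (s + c)\<^sup>2) t * (\<lambda>_. 0) q) (\<lambda>q r. (\<lambda>s. 14 * D\<^sup>2 * (s + c)\<^sup>2) t * (\<lambda>_ _. 0) q r)"
  proof (rule superjet_time_mult[OF space_jet_const zero_less_one, of _ _ _ "14 * D\<^sup>2"])
    fix s :: real
    have "14 * D\<^sup>2 * (s + c)\<^sup>2 - 14 * D\<^sup>2 * (t + c)\<^sup>2 - 28 * D\<^sup>2 * (t + c) * (s - t) = 14 * D\<^sup>2 * (s - t)\<^sup>2"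
      by (simp add: power2_eq_square algebra_simps)
    then show "\<bar>14 * D\<^sup>2 * (s + c)\<^sup>2 - 14 * D\<^sup>2 * (t + c)\<^sup>2 - 28 * D\<^sup>2 * (t + c) * (s - t)\<bar> \<le> 14 * D\<^sup>2 * (s - t)\<^sup>2" by simp
  qed
  define b where "b = 14 * D * xy_sq p + 28 * D\<^sup>2 * (t + c)"
  define B where "B = (\<lambda>q r. ?Q q r + 14 * D * (t + c) * ?X q r)"
  have jet: "superjet (\<lambda>x. barrier D (fst x) (snd x + c)) p t b (\<lambda>q. \<xi> q + 14 * D * (t + c) * ?x q) B"
    using superjet_add[OF superjet_add[OF 1 2] 3] by (simp add: barrier_def b_def B_def)
  have Bs: "2 * B s s \<le> 13 * xy_sq p * (norm s)\<^sup>2 + 28 * D * (t + c) * (norm s)\<^sup>2" if s0: "snd (snd s) = 0" for s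
  proof -
    obtain x y z where p: "p = (x,y,z)" by (cases p)
    obtain a b where s: "s = (a,b,0)" using s0 by (cases s) simp
    have n: "(norm s)\<^sup>2 = a\<^sup>2 + b\<^sup>2" using norm_horizontal_sq[OF s0] s by simp
    have "13 * (x\<^sup>2 + y\<^sup>2) * (a\<^sup>2 + b\<^sup>2) - (12 * (x\<^sup>2 * a\<^sup>2 + y\<^sup>2 * b\<^sup>2) + (x * b - a * y)\<^sup>2 / 2)
       = 12 * (x\<^sup>2 * b\<^sup>2 + y\<^sup>2 * a\<^sup>2) + (x * b - a * y)\<^sup>2 / 2 + (x * a + y * b)\<^sup>2"
      by (simp add: power2_eq_square field_simps)
    moreover have "0 \<le> 12 * (x\<^sup>2 * b\<^sup>2 + y\<^sup>2 * a\<^sup>2) + (x * b - a * y)\<^sup>2 / 2 + (x * a + y * b)\<^sup>2"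
      by simp
    ultimately have "12 * (x\<^sup>2 * a\<^sup>2 + y\<^sup>2 * b\<^sup>2) + (x * b - a * y)\<^sup>2 / 2 \<le> 13 * (x\<^sup>2 + y\<^sup>2) * (a\<^sup>2 + b\<^sup>2)"
      by linarith
    moreover have "2 * B s s = 12 * (x\<^sup>2 * a\<^sup>2 + y\<^sup>2 * b\<^sup>2) + (x * b - a * y)\<^sup>2 / 2 + 28 * D * (t + c) * (a\<^sup>2 + b\<^sup>2)"
      unfolding B_def om_def p s by (simp add: power2_eq_square field_simps)
    ultimately show ?thesis unfolding n by (simp add: xy_sq_def p)
  qed
  have "2 * (B s1 s1 + B s2 s2) \<le> 13 * xy_sq p * D + 28 * D * (t + c) * D"
    using Bs[OF s(1)] Bs[OF s(2)] by (simp add: D_def algebra_simps)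
  moreover have "13 * xy_sq p * D + 28 * D * (t + c) * D \<le> b"
  proof -
    have "0 \<le> xy_sq p * D" using xy_sq_nonneg[of p] by (simp add: D_def)
    then show ?thesis unfolding b_def by (simp add: power2_eq_square algebra_simps)
  qed
  ultimately show thesis by (intro that[OF jet]) linarith
qed

declare split_paired_All [simp del] split_paired_Ex [simp del]

lemma superjet_cmult:
  assumes v: "superjet v p t b \<xi> B" and m: "m \<ge> 0"
  shows "superjet (\<lambda>x. m * v x) p t (m * b) (\<lambda>q. m * \<xi> q) (\<lambda>q r. m * B q r)"
proof (rule superjetI)
  show "linear (\<lambda>q. m * \<xi> q)" "bilinear (\<lambda>q r. m * B q r)"
    by (intro linear_mult_const bilinear_cmult superjet_linear[OF v] superjet_bilinear[OF v])+
  fix e :: real assume "e > 0"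
  then have e: "e / (m + 1) > 0" using m by simp
  obtain C \<delta> where C: "\<delta> > 0" "\<forall>q s. norm q < \<delta> \<longrightarrow> \<bar>s - t\<bar> < \<delta> \<longrightarrow>
    v (p \<odot> q, s) \<le> v (p, t) + b * (s - t) + \<xi> q + B q q + e / (m + 1) * (norm q)\<^sup>2 + C * (s - t)\<^sup>2"
    by (rule superjetD[OF v e]) (rule that)
  have em: "m * (e / (m + 1)) \<le> e" using \<open>e > 0\<close> m by (simp add: field_simps)
  show "\<exists>C. \<exists>\<delta>>0. \<forall>q s. norm q < \<delta> \<longrightarrow> \<bar>s - t\<bar> < \<delta> \<longrightarrow>
        m * v (p \<odot> q, s) \<le> m * v (p, t) + m * b * (s - t) + m * \<xi> q + m * B q q + e * (norm q)\<^sup>2 + C * (s - t)\<^sup>2"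
  proof (rule exI[of _ "m * C"], rule exI[of _ \<delta>], intro conjI allI impI)
    fix q :: heis and s assume "norm q < \<delta>" "\<bar>s - t\<bar> < \<delta>"
    then have "m * v (p \<odot> q, s) \<le> m * (v (p, t) + b * (s - t) + \<xi> q + B q q + e / (m + 1) * (norm q)\<^sup>2 + C * (s - t)\<^sup>2)"
      using C(2) m by (intro mult_left_mono) auto
    also have "\<dots> = m * v (p, t) + m * b * (s - t) + m * \<xi> q + m * B q q + m * (e / (m + 1)) * (norm q)\<^sup>2 + m * C * (s - t)\<^sup>2"
      by (simp add: distrib_left mult.assoc)
    finally show "m * v (p \<odot> q, s) \<le> m * v (p, t) + m * b * (s - t) + m * \<xi> q + m * B q q + e * (norm q)\<^sup>2 + m * C * (s - t)\<^sup>2"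
      using mult_right_mono[OF em, of "(norm q)\<^sup>2"] by simp
  qed (rule C)
qed

lemma compact_quartic: "compact {q. quartic q \<le> r}"
proof -
  have "{q. quartic q \<le> r} \<subseteq> cball 0 (2 + \<bar>r\<bar>)"
  proof
    fix q :: heis assume "q \<in> {q. quartic q \<le> r}"
    then have q: "quartic q \<le> r" by simp
    have sq: "a \<le> 1 + a\<^sup>2" for a :: real
      using zero_le_power2[of "a - 1/2"] by (simp add: power2_eq_square algebra_simps)
    have "(norm q)\<^sup>2 \<le> 2 + r"
      unfolding norm_heis_sq using q sq[of "(fst q)\<^sup>2"] sq[of "(fst (snd q))\<^sup>2"] unfolding quartic_def by linarith
    also have "\<dots> \<le> (2 + \<bar>r\<bar>)\<^sup>2" by (simp add: power2_eq_square algebra_simps) (smt (verit) zero_le_square)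
    finally have "norm q \<le> 2 + \<bar>r\<bar>" by (rule power2_le_imp_le) simp
    then show "q \<in> cball 0 (2 + \<bar>r\<bar>)" by simp
  qed
  moreover have "closed {q. quartic q \<le> r}"
    unfolding quartic_def by (intro closed_Collect_le continuous_intros)
  ultimately show ?thesis using bounded_subset[OF bounded_cball] by (simp add: compact_eq_bounded_closed)
qed

lemma quartic_open_nhd:
  assumes "quartic p < r"
  obtains \<delta> where "\<delta> > 0" "\<forall>q. norm q < \<delta> \<longrightarrow> quartic (p \<odot> q) < r"
proof -
  have "open {q. quartic (p \<odot> q) < r}"
    unfolding quartic_def by (intro open_Collect_less continuous_intros)
  moreover have "0 \<in> {q. quartic (p \<odot> q) < r}" using assms by simp
  ultimately obtain \<delta> where "\<delta> > 0" "ball 0 \<delta> \<subseteq> {q. quartic (p \<odot> q) < r}"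
    unfolding open_contains_ball by blast
  then show thesis by (intro that[of \<delta>]) auto
qed

text \<open>During one step the comparison function interpolates linearly in time between
  \<open>g\<close> and its average. Its time derivative is a difference quotient, which by
  consistency is the second-order term of \<open>g\<close> up to an error; its own second-order form
  is a blend of the forms of \<open>g\<close> and of the average. On the lateral boundary the
  barrier is at least \<open>r\<close>, and \<open>m * r \<ge> M + M'\<close> makes it large enough
  there.\<close>

lemma walk_step_comparison:
  fixes v :: "heis \<times> real \<Rightarrow> real" and s1 s2 :: heis
  assumes s: "snd (snd s1) = 0" "snd (snd s2) = 0"
    and j: "uniform_jets C g l B" and C: "C \<ge> 0" and \<rho>: "\<rho> > 0"
    and g: "\<And>q. \<bar>g q\<bar> \<le> M'"
    and c: "a + c \<ge> 0" and r: "r > 0" and m: "m \<ge> 0" "m * r \<ge> M + M'" and \<kappa>: "\<kappa> \<ge> 0"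
    and S: "\<And>p. quartic p \<le> r \<Longrightarrow> norm (heis_conj p s1) \<le> S" "\<And>p. quartic p \<le> r \<Longrightarrow> norm (heis_conj p s2) \<le> S"
    and cv: "continuous_on ({q. quartic q \<le> r} \<times> {a..a + \<rho>\<^sup>2 / 4}) v"
    and vM: "\<And>p t. quartic p \<le> r \<Longrightarrow> a \<le> t \<Longrightarrow> t \<le> a + \<rho>\<^sup>2 / 4 \<Longrightarrow> v (p, t) \<le> M"
    and sub: "\<And>p t b \<xi> B. quartic p < r \<Longrightarrow> a < t \<Longrightarrow> t < a + \<rho>\<^sup>2 / 4 \<Longrightarrow> superjet v p t b \<xi> B
       \<Longrightarrow> b - 2 * (B s1 s1 + B s2 s2) \<le> 0"
  defines "D \<equiv> (norm s1)\<^sup>2 + (norm s2)\<^sup>2"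
  assumes init: "\<And>p. quartic p \<le> r \<Longrightarrow> v (p, a) \<le> g p + m * barrier D p (a + c) + \<kappa>"
    and p: "quartic p \<le> r"
  shows "v (p, a + \<rho>\<^sup>2 / 4) \<le> walk_avg s1 s2 \<rho> g p + m * barrier D p (a + \<rho>\<^sup>2 / 4 + c)
     + (\<kappa> + \<rho>\<^sup>2 / 4 * ((8 * C * S^3 + 1) * \<rho>))"
proof -
  define h where "h = \<rho>\<^sup>2 / 4"
  have h: "h > 0" using \<rho> by (simp add: h_def)
  \<comment> \<open>With \<open>e = C * \<rho> * S^3\<close> this is \<open>8 * e + \<rho>\<close>:
    \<open>4 * e\<close> for consistency, \<open>4 * e\<close> for the change of the two diagonal
    values over the step, and \<open>\<rho>\<close> to make the inequality strict.\<close>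
  define E where "E = (8 * C * S^3 + 1) * \<rho>"
  define T where "T = walk_avg s1 s2 \<rho> g"
  define BT where "BT = (\<lambda>p k m. walk_avg s1 s2 \<rho> (\<lambda>q. B q k m) p)"
  obtain lT where jT: "uniform_jets C T lT BT"
    using uniform_jets_avg[OF j] unfolding T_def BT_def by blast
  have S0: "S \<ge> 0" using S(1)[of 0] r norm_ge_zero[of "heis_conj 0 s1"] by (simp add: quartic_def del: norm_ge_zero)
  have E: "E \<ge> 0" using C S0 \<rho> by (simp add: E_def)
  have D0: "D \<ge> 0" by (simp add: D_def)
  have Tb: "\<bar>T q\<bar> \<le> M'" for q using walk_avg_iter_bound[where f = g and M = M' and n = 1 and ?s1.0 = s1 and ?s2.0 = s2 and r = \<rho> and p = q] g
    by (simp add: T_def)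
  define \<Psi> where "\<Psi> = (\<lambda>x::heis \<times> real. (1 - (snd x - a) / h) * g (fst x) + ((snd x - a) / h) * T (fst x)
     + m * barrier D (fst x) (snd x + c) + (\<kappa> + (snd x - a) * E))"
  let ?K = "{q. quartic q \<le> r}"
  have "v (p, a + h) \<le> \<Psi> (p, a + h)"
  proof (rule cylinder_comparison[of ?K a "a + h" v \<Psi> "{q. quartic q < r}"])
    show "compact ?K" by (rule compact_quartic)
    show "a < a + h" using h by simp
    show "continuous_on (?K \<times> {a..a + h}) v" using cv by (simp add: h_def)
    have cg: "continuous_on UNIV g" "continuous_on UNIV T"
      by (rule uniform_jets_continuous[OF j C] uniform_jets_continuous[OF jT C])+
    have "continuous_on X (\<lambda>x. g (fst x))" "continuous_on X (\<lambda>x. T (fst x))" for X :: "(heis \<times> real) set"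
      by (rule continuous_on_compose2[OF cg(1)] continuous_on_compose2[OF cg(2)]; auto intro!: continuous_intros)+
    then show "continuous_on (?K \<times> {a..a + h}) \<Psi>"
      unfolding \<Psi>_def barrier_def quartic_def xy_sq_def using h
      by (intro continuous_intros) auto
    show "v (p, a) \<le> \<Psi> (p, a)" if "p \<in> ?K" for p
      using init[of p] that by (simp add: \<Psi>_def)
    show "v (p, t) \<le> \<Psi> (p, t)" if "p \<in> ?K" "p \<notin> {q. quartic q < r}" "a \<le> t" "t \<le> a + h" for p t
    proof -
      define \<theta> where "\<theta> = (t - a) / h"
      have \<theta>: "0 \<le> \<theta>" "\<theta> \<le> 1" using that h by (simp_all add: \<theta>_def field_simps)
      have "(1 - \<theta>) * (- M') \<le> (1 - \<theta>) * g p" "\<theta> * (- M') \<le> \<theta> * T p"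
        using \<theta> g[of p] Tb[of p] by (intro mult_left_mono; simp add: abs_le_iff)+
      then have "- M' \<le> (1 - \<theta>) * g p + \<theta> * T p" by (simp add: algebra_simps)
      moreover have "m * r \<le> m * barrier D p (t + c)"
        using barrier_ge[OF D0, of "t + c" p] that c m by (intro mult_left_mono) auto
      moreover have "0 \<le> \<kappa> + (t - a) * E" using \<kappa> E that by simp
      moreover have "v (p, t) \<le> M" using that by (intro vM) (auto simp: h_def)
      ultimately show ?thesis using m(2) unfolding \<Psi>_def \<theta>_def fst_conv snd_conv by linarith
    qed
    show "p \<in> ?K" "a \<le> a + h" "a + h \<le> a + h" using p h by simp_all
    fix p t d \<Lambda> assume pK: "p \<in> ?K" "p \<in> {q. quartic q < r}" and t: "a < t" "t < a + h" and d: "(0::real) \<le> d"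
      and max: "\<And>q s. q \<in> ?K \<Longrightarrow> a \<le> s \<Longrightarrow> s \<le> a + h \<Longrightarrow>
         v (q, s) - \<Psi> (q, s) \<le> v (p, t) - \<Psi> (p, t) + d * (s - t) + \<Lambda> * (s - t)\<^sup>2"
    define \<theta> where "\<theta> = (t - a) / h"
    have \<theta>: "0 \<le> \<theta>" "\<theta> \<le> 1" using t h by (simp_all add: \<theta>_def field_simps)
    have tc: "t + c \<ge> 0" using t c by simp
    obtain bb \<xi>b Bb where bar: "superjet (\<lambda>x. barrier D (fst x) (snd x + c)) p t bb \<xi>b Bb"
      "bb - 2 * (Bb s1 s1 + Bb s2 s2) \<ge> 0"
      by (rule barrier_superjet[OF s tc, folded D_def]) (rule that)
    let ?k1 = "heis_conj p s1" and ?k2 = "heis_conj p s2"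
    have 1: "superjet (\<lambda>x. (\<lambda>s. 1 - (s - a) / h) (snd x) * g (fst x)) p t ((- 1 / h) * g p)
       (\<lambda>q. (\<lambda>s. 1 - (s - a) / h) t * l p (heis_conj p q)) (\<lambda>q r. (\<lambda>s. 1 - (s - a) / h) t * B p (heis_conj p q) (heis_conj p r))"
      by (rule superjet_time_mult[OF uniform_jets_space_jet[OF j C] zero_less_one, of _ _ _ 0]) (use h in \<open>simp add: field_simps\<close>)
    have 2: "superjet (\<lambda>x. (\<lambda>s. (s - a) / h) (snd x) * T (fst x)) p t ((1 / h) * T p)
       (\<lambda>q. (\<lambda>s. (s - a) / h) t * lT p (heis_conj p q)) (\<lambda>q r. (\<lambda>s. (s - a) / h) t * BT p (heis_conj p q) (heis_conj p r))"
      by (rule superjet_time_mult[OF uniform_jets_space_jet[OF jT C] zero_less_one, of _ _ _ 0]) (use h in \<open>simp add: field_simps\<close>)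
    have 3: "superjet (\<lambda>x. (\<lambda>s. \<kappa> + (s - a) * E) (snd x) * (\<lambda>_. 1) (fst x)) p t (E * (\<lambda>_. 1) p)
       (\<lambda>q. (\<lambda>s. \<kappa> + (s - a) * E) t * (\<lambda>_. 0) q) (\<lambda>q r. (\<lambda>s. \<kappa> + (s - a) * E) t * (\<lambda>_ _. 0) q r)"
      by (rule superjet_time_mult[OF space_jet_const zero_less_one, of _ _ _ 0]) (simp add: algebra_simps)
    have 4: "superjet (\<lambda>x. m * barrier D (fst x) (snd x + c)) p t (m * bb) (\<lambda>q. m * \<xi>b q) (\<lambda>q r. m * Bb q r)"
      by (rule superjet_cmult[OF bar(1) m(1)])
    note J = superjet_add[OF superjet_add[OF superjet_add[OF 1 2] 4] 3]
    have P: "superjet \<Psi> p t (- 1 / h * g p + 1 / h * T p + m * bb + E)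
      (\<lambda>q. (1 - \<theta>) * l p (heis_conj p q) + \<theta> * lT p (heis_conj p q) + m * \<xi>b q)
      (\<lambda>q r. (1 - \<theta>) * B p (heis_conj p q) (heis_conj p r) + \<theta> * BT p (heis_conj p q) (heis_conj p r) + m * Bb q r)"
      using J unfolding \<Psi>_def \<theta>_def by simp
    obtain \<delta> where \<delta>: "\<delta> > 0" "\<forall>q. norm q < \<delta> \<longrightarrow> quartic (p \<odot> q) < r"
      by (rule quartic_open_nhd[of p r]) (use pK in simp, rule that)
    have vj: "superjet v p t ((- 1 / h * g p + 1 / h * T p + m * bb + E) + d)
      (\<lambda>q. (1 - \<theta>) * l p (heis_conj p q) + \<theta> * lT p (heis_conj p q) + m * \<xi>b q)
      (\<lambda>q r. (1 - \<theta>) * B p (heis_conj p q) (heis_conj p r) + \<theta> * BT p (heis_conj p q) (heis_conj p r) + m * Bb q r)"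
    proof (rule superjet_touch[OF P, of "min \<delta> (min (t - a) (a + h - t))"])
      show "0 < min \<delta> (min (t - a) (a + h - t))" using \<delta> t by simp
      fix q :: heis and s assume q: "norm q < min \<delta> (min (t - a) (a + h - t))" and s: "\<bar>s - t\<bar> < min \<delta> (min (t - a) (a + h - t))"
      have "quartic (p \<odot> q) < r" using \<delta>(2) q by simp
      then show "v (p \<odot> q, s) - \<Psi> (p \<odot> q, s) \<le> v (p, t) - \<Psi> (p, t) + d * (s - t) + \<Lambda> * (s - t)\<^sup>2"
        using s by (intro max) (simp, linarith, linarith)
    qed
    have pr: "quartic p \<le> r" using pK by simp
    have neg: "((- 1 / h * g p + 1 / h * T p + m * bb + E) + d) - 2 * (((1 - \<theta>) * B p ?k1 ?k1 + \<theta> * BT p ?k1 ?k1 + m * Bb s1 s1)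
       + ((1 - \<theta>) * B p ?k2 ?k2 + \<theta> * BT p ?k2 ?k2 + m * Bb s2 s2)) \<le> 0"
      using sub[OF _ t(1) _ vj] pK t by (simp add: h_def)
    have cons: "\<bar>T p - g p - \<rho>\<^sup>2 / 2 * (B p ?k1 ?k1 + B p ?k2 ?k2)\<bar> \<le> C * (\<rho> * S) ^ 3"
      unfolding T_def by (rule walk_avg_consistency[OF j _ S(1)[OF pr] S(2)[OF pr] C]) (use \<rho> in simp)
    have lip: "\<bar>BT p k k - B p k k\<bar> \<le> C * \<rho> * S^3" if "norm k \<le> S" for k
    proof -
      have "\<bar>BT p k k - B p k k\<bar> \<le> C * (\<rho> * S) * (norm k)\<^sup>2"
        unfolding BT_def by (rule walk_avg_form_lipschitz[OF j _ S(1)[OF pr] S(2)[OF pr] C]) (use \<rho> in simp)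
      also have "\<dots> \<le> C * (\<rho> * S) * S\<^sup>2" using that C \<rho> S0 by (intro mult_left_mono power_mono) auto
      finally show ?thesis by (simp add: power2_eq_square power3_eq_cube mult.assoc)
    qed
    define e where "e = C * \<rho> * S^3"
    have e0: "e \<ge> 0" using C \<rho> S0 by (simp add: e_def)
    have "1 / h * (T p - g p) \<ge> 1 / h * (\<rho>\<^sup>2 / 2 * (B p ?k1 ?k1 + B p ?k2 ?k2) - C * (\<rho> * S) ^ 3)"
      using cons h by (intro mult_left_mono) (auto simp: abs_le_iff)
    moreover have "1 / h * (\<rho>\<^sup>2 / 2 * (B p ?k1 ?k1 + B p ?k2 ?k2) - C * (\<rho> * S) ^ 3) = 2 * (B p ?k1 ?k1 + B p ?k2 ?k2) - 4 * e"
      using \<rho> by (simp add: h_def e_def power_mult_distrib field_simps power2_eq_square power3_eq_cube)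
    ultimately have t1: "- 1 / h * g p + 1 / h * T p \<ge> 2 * (B p ?k1 ?k1 + B p ?k2 ?k2) - 4 * e"
      by (simp add: algebra_simps)
    have t2: "(1 - \<theta>) * B p k k + \<theta> * BT p k k \<le> B p k k + e" if "norm k \<le> S" for k
    proof -
      have "\<theta> * (BT p k k - B p k k) \<le> \<theta> * e"
        using lip[OF that] \<theta> by (intro mult_left_mono) (auto simp: e_def abs_le_iff)
      also have "\<dots> \<le> e" using \<theta> e0 by (simp add: mult_left_le_one_le)
      finally show ?thesis by (simp add: algebra_simps)
    qed
    have "0 \<le> m * (bb - 2 * (Bb s1 s1 + Bb s2 s2))" using bar(2) m by simp
    then have t3: "0 \<le> m * bb - 2 * (m * Bb s1 s1 + m * Bb s2 s2)" by (simp add: algebra_simps)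
    have "E = 8 * e + \<rho>" by (simp add: E_def e_def algebra_simps)
    then show False using neg t1 t2[OF S(1)[OF pr]] t2[OF S(2)[OF pr]] t3 d \<rho> by (simp add: algebra_simps)
  qed
  moreover have "\<Psi> (p, a + h) = T p + m * barrier D p (a + h + c) + (\<kappa> + h * E)"
    using h by (simp add: \<Psi>_def)
  ultimately show ?thesis by (simp add: h_def T_def E_def)
qed

text \<open>One-step comparisons are chained: the average reached after one step is the initial
  function of the next, and \<open>uniform_jets_iter\<close> provides the same \<open>C\<close> for
  all of them. The errors add up to \<open>\<tau> * (A * \<rho>)\<close>, which tends to zero as the
  number of steps grows. At the origin the barrier leaves only a term in
  \<open>\<tau>\<^sup>2\<close>.\<close>

lemma walk_mean_value:
  fixes v :: "heis \<times> real \<Rightarrow> real" and s1 s2 :: heis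
  assumes s: "snd (snd s1) = 0" "snd (snd s2) = 0"
    and j: "uniform_jets C g l B" and C: "C \<ge> 0" and \<tau>: "\<tau> > 0"
    and g: "\<And>q. \<bar>g q\<bar> \<le> M'" and r: "r > 0" and m: "m \<ge> 0" "m * r \<ge> M + M'"
    and cv: "continuous_on ({q. quartic q \<le> r} \<times> {-\<tau>..0}) v"
    and vM: "\<And>p t. quartic p \<le> r \<Longrightarrow> - \<tau> \<le> t \<Longrightarrow> t \<le> 0 \<Longrightarrow> v (p, t) \<le> M"
    and sub: "\<And>p t b \<xi> B. quartic p < r \<Longrightarrow> - \<tau> < t \<Longrightarrow> t < 0 \<Longrightarrow> superjet v p t b \<xi> B
       \<Longrightarrow> b - 2 * (B s1 s1 + B s2 s2) \<le> 0"
    and init: "\<And>p. quartic p \<le> r \<Longrightarrow> v (p, - \<tau>) \<le> g p"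
    and e: "e > 0"
  defines "D \<equiv> (norm s1)\<^sup>2 + (norm s2)\<^sup>2"
  obtains N where "\<forall>n\<ge>N. v (0, 0) \<le> (walk_avg s1 s2 (2 * sqrt (\<tau> / real n)) ^^ n) g 0 + m * (14 * D\<^sup>2 * \<tau>\<^sup>2) + e"
proof -
  let ?K = "{q. quartic q \<le> r}"
  obtain R where R: "\<And>p. p \<in> ?K \<Longrightarrow> norm p \<le> R"
    using compact_imp_bounded[OF compact_quartic] unfolding bounded_iff by blast
  define S where "S = (1 + 2 * R) * (norm s1 + norm s2)"
  have R0: "R \<ge> 0" using R[of 0] r by (simp add: quartic_def)
  have S: "norm (heis_conj p s1) \<le> S" "norm (heis_conj p s2) \<le> S" if "quartic p \<le> r" for p
  proof -
    have "(1 + 2 * norm p) * norm s1 \<le> S" "(1 + 2 * norm p) * norm s2 \<le> S"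
      unfolding S_def using R[of p] that R0 by (intro mult_mono; simp)+
    then show "norm (heis_conj p s1) \<le> S" "norm (heis_conj p s2) \<le> S"
      using norm_heis_conj_le[of p s1] norm_heis_conj_le[of p s2] by linarith+
  qed
  have S0: "S \<ge> 0" using R0 by (simp add: S_def)
  define A where "A = 8 * C * S^3 + 1"
  have A: "A > 0" using C S0 by (simp add: A_def add_nonneg_pos)
  \<comment> \<open>This \<open>\<rho>\<close> is the step length whose duration
    \<open>\<rho>\<^sup>2 / 4\<close> is \<open>\<tau> / real n\<close>.\<close>
  have main: "v (0, 0) \<le> (walk_avg s1 s2 \<rho> ^^ n) g 0 + m * (14 * D\<^sup>2 * \<tau>\<^sup>2) + \<tau> * (A * \<rho>)"
    if n: "n > 0" and \<rho>: "\<rho> = 2 * sqrt (\<tau> / real n)" for n \<rho>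
  proof -
    have \<rho>0: "\<rho> > 0" using \<tau> n by (simp add: \<rho>)
    have h: "\<rho>\<^sup>2 / 4 = \<tau> / real n" using \<tau> n by (simp add: \<rho> power_mult_distrib)
    define h' where "h' = \<tau> / real n"
    have h': "h' > 0" "real n * h' = \<tau>" using \<tau> n by (simp_all add: h'_def)
    have "\<forall>p. quartic p \<le> r \<longrightarrow> v (p, - \<tau> + real k * h') \<le> (walk_avg s1 s2 \<rho> ^^ k) g p
       + m * barrier D p (real k * h') + real k * (h' * (A * \<rho>))" if "k \<le> n" for k
      using that
    proof (induction k)
      case 0
      show ?case
      proof (intro allI impI)
        fix p assume p: "quartic p \<le> r"
        have "0 \<le> m * barrier D p 0" using m quartic_nonneg by (simp add: barrier_zero)
        then show "v (p, - \<tau> + real 0 * h') \<le> (walk_avg s1 s2 \<rho> ^^ 0) g p + m * barrier D p (real 0 * h') + real 0 * (h' * (A * \<rho>))"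
          using init[OF p] by simp
      qed
    next
      case (Suc k)
      define a where "a = - \<tau> + real k * h'"
      have kn: "real k * h' + h' \<le> \<tau>"
      proof -
        have "real (Suc k) * h' \<le> real n * h'" using Suc.prems h' by (intro mult_right_mono) auto
        then show ?thesis using h'(2) by (simp add: algebra_simps)
      qed
      have kh: "0 \<le> real k * h'" using h' by simp
      have ah: "- \<tau> \<le> a" "a + \<rho>\<^sup>2 / 4 \<le> 0" using kn kh unfolding a_def h h'_def[symmetric] by linarith+
      obtain lk Bk where jk: "uniform_jets C ((walk_avg s1 s2 \<rho> ^^ k) g) lk Bk"
        using uniform_jets_iter[OF j] by blast
      have IH: "v (p, a) \<le> (walk_avg s1 s2 \<rho> ^^ k) g p + m * barrier D p (a + \<tau>) + real k * (h' * (A * \<rho>))"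
        if "quartic p \<le> r" for p
        using Suc.IH[rule_format, OF _ that] Suc.prems unfolding a_def by simp
      have "v (p, a + \<rho>\<^sup>2 / 4) \<le> walk_avg s1 s2 \<rho> ((walk_avg s1 s2 \<rho> ^^ k) g) p + m * barrier D p (a + \<rho>\<^sup>2 / 4 + \<tau>)
          + (real k * (h' * (A * \<rho>)) + \<rho>\<^sup>2 / 4 * ((8 * C * S^3 + 1) * \<rho>))" if p: "quartic p \<le> r" for p
        unfolding D_def
      proof (rule walk_step_comparison[OF s jk C \<rho>0 _ _ r m, where S = S])
        show "\<bar>(walk_avg s1 s2 \<rho> ^^ k) g q\<bar> \<le> M'" for q by (rule walk_avg_iter_bound) (rule g)
        show "0 \<le> a + \<tau>" using ah by simp
        show "0 \<le> real k * (h' * (A * \<rho>))" using h' A \<rho>0 by simp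
        show "norm (heis_conj q s1) \<le> S" "norm (heis_conj q s2) \<le> S" if "quartic q \<le> r" for q
          using S[OF that] .
        show "continuous_on (?K \<times> {a..a + \<rho>\<^sup>2 / 4}) v"
          by (rule continuous_on_subset[OF cv]) (use ah in auto)
        show "v (q, t) \<le> M" if "quartic q \<le> r" "a \<le> t" "t \<le> a + \<rho>\<^sup>2 / 4" for q t
          by (rule vM) (use that ah in linarith)+
        show "b - 2 * (B s1 s1 + B s2 s2) \<le> 0"
          if "quartic q < r" "a < t" "t < a + \<rho>\<^sup>2 / 4" and J: "superjet v q t b \<xi> B" for q t b \<xi> B
          by (rule sub[OF _ _ _ J]) (use that ah in linarith)+
        show "v (q, a) \<le> (walk_avg s1 s2 \<rho> ^^ k) g q + m * barrier ((norm s1)\<^sup>2 + (norm s2)\<^sup>2) q (a + \<tau>) + real k * (h' * (A * \<rho>))"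
          if "quartic q \<le> r" for q using IH[OF that] unfolding D_def .
        show "quartic p \<le> r" by (rule p)
      qed
      moreover have "a + \<rho>\<^sup>2 / 4 = - \<tau> + real (Suc k) * h'" "a + \<rho>\<^sup>2 / 4 + \<tau> = real (Suc k) * h'"
        "real k * (h' * (A * \<rho>)) + \<rho>\<^sup>2 / 4 * ((8 * C * S^3 + 1) * \<rho>) = real (Suc k) * (h' * (A * \<rho>))"
        unfolding a_def h h'_def[symmetric] A_def[symmetric] by (simp_all add: algebra_simps)
      ultimately show ?case by (simp only: funpow.simps o_def) blast
    qed
    from this[of n] have "v (0, - \<tau> + real n * h') \<le> (walk_avg s1 s2 \<rho> ^^ n) g 0 + m * barrier D 0 (real n * h') + real n * (h' * (A * \<rho>))"
      using r by (simp add: quartic_def)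
    moreover have "real n * (h' * (A * \<rho>)) = \<tau> * (A * \<rho>)" by (simp only: mult.assoc[symmetric] h'(2))
    ultimately show ?thesis unfolding h'(2) barrier_zero by simp
  qed
  have "(\<lambda>n. \<tau> * (A * (2 * sqrt (\<tau> / real n)))) \<longlonglongrightarrow> \<tau> * (A * (2 * sqrt 0))"
    by (intro tendsto_intros real_tendsto_divide_at_top[OF tendsto_const filterlim_real_sequentially])
  then have "\<forall>\<^sub>F n in sequentially. \<tau> * (A * (2 * sqrt (\<tau> / real n))) < e"
    using e by (intro order_tendstoD(2)) auto
  then obtain N where N: "\<forall>n\<ge>N. \<tau> * (A * (2 * sqrt (\<tau> / real n))) < e"
    unfolding eventually_sequentially by blast
  show thesis
  proof (rule that[of "max N 1"], intro allI impI)
    fix n assume "max N 1 \<le> n"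
    then have "n > 0" "N \<le> n" by auto
    then show "v (0, 0) \<le> (walk_avg s1 s2 (2 * sqrt (\<tau> / real n)) ^^ n) g 0 + m * (14 * D\<^sup>2 * \<tau>\<^sup>2) + e"
      using main[OF \<open>n > 0\<close> refl] N by force
  qed
qed

section \<open>Sums of linear subsolutions\<close>

definition hor_part :: "heis \<Rightarrow> heis" where
  "hor_part q = (fst q, fst (snd q), 0)"

lemma linear_hor_part: "linear hor_part"
  by (rule linearI) (simp_all add: hor_part_def)

lemma hor_part_horizontal: "snd (snd s) = 0 \<Longrightarrow> hor_part s = s"
  by (cases s) (simp add: hor_part_def)

lemma hor_part_mult: "hor_part (q \<odot> r) = hor_part q + hor_part r"
  by (simp add: hor_part_def heis_mult_eq)

lemma norm_hor_part_sq: "(norm (hor_part q))\<^sup>2 = xy_sq q"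
  by (simp add: norm_heis_sq hor_part_def xy_sq_def)

text \<open>\<open>hor_part\<close> is a homomorphism into an additive group, so a quadratic form in
  it has the same second-order part at every base point. Quadratic terms in the vertical coordinate
  behave differently: their second-order part picks up \<open>om p\<close>.\<close>

lemma space_jet_hor_quadratic:
  fixes \<eta> :: "heis \<Rightarrow> real" and \<beta> :: "heis \<Rightarrow> heis \<Rightarrow> real"
  assumes "linear \<eta>" "bilinear \<beta>"
  shows "space_jet (\<lambda>q. \<eta> q + \<beta> (hor_part q) (hor_part q)) p
    (\<lambda>r. \<eta> r + \<eta> (0,0,1) * om p r + (\<beta> (hor_part p) (hor_part r) + \<beta> (hor_part r) (hor_part p)))
    (\<lambda>q r. \<beta> (hor_part q) (hor_part r))"
proof (rule space_jet_of_eq)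
  show "linear (\<lambda>r. \<eta> r + \<eta> (0,0,1) * om p r + (\<beta> (hor_part p) (hor_part r) + \<beta> (hor_part r) (hor_part p)))"
    by (intro linear_compose_add linear_mult_const linear_om assms(1)
      linear_compose[OF linear_hor_part bilinear_linear(1)[OF assms(2)], unfolded o_def]
      linear_compose[OF linear_hor_part bilinear_linear(2)[OF assms(2)], unfolded o_def])
  show "bilinear (\<lambda>q r. \<beta> (hor_part q) (hor_part r))"
    by (rule bilinear_compose_linear[OF assms(2) linear_hor_part])
  fix q :: heis
  have "p \<odot> q = p + q + om p q *\<^sub>R (0,0,1)" by (simp add: heis_mult_eq)
  then have "\<eta> (p \<odot> q) = \<eta> p + \<eta> q + om p q * \<eta> (0,0,1)"
    by (simp only: linear_add[OF assms(1)] linear_scale[OF assms(1)] real_scaleR_def)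
  then show "\<eta> (p \<odot> q) + \<beta> (hor_part (p \<odot> q)) (hor_part (p \<odot> q)) =
    \<eta> p + \<beta> (hor_part p) (hor_part p) +
    (\<eta> q + \<eta> (0,0,1) * om p q + (\<beta> (hor_part p) (hor_part q) + \<beta> (hor_part q) (hor_part p))) +
    \<beta> (hor_part q) (hor_part q)"
    by (simp add: hor_part_mult bilinear_ladd[OF assms(2)] bilinear_radd[OF assms(2)])
qed

text \<open>The subtracted function has constant second-order part and constant time slope, so the
  right-hand side changes by a constant. This is used to normalize subsolutions to right-hand side
  zero.\<close>

lemma shifted_linear_subsolution:
  fixes v :: "heis \<times> real \<Rightarrow> real"
  assumes s: "snd (snd s1) = 0" "snd (snd s2) = 0" and lin: "linear \<eta>" "bilinear \<beta>"
    and sub: "\<And>y t b \<xi> B. norm y < \<delta> \<Longrightarrow> \<bar>t - t0\<bar> < \<delta> \<Longrightarrow> superjet v (p0 \<odot> y) t b \<xi> B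
       \<Longrightarrow> b - 2 * (B s1 s1 + B s2 s2) \<le> c"
    and q: "norm q < \<delta>" "\<bar>t\<bar> < \<delta>"
    and J: "superjet (\<lambda>x. v (p0 \<odot> fst x, t0 + snd x) - k - (\<eta> (fst x) + \<beta> (hor_part (fst x)) (hor_part (fst x))) - a * snd x) q t b \<xi> B"
  shows "b - 2 * (B s1 s1 + B s2 s2) \<le> c + 2 * (\<beta> s1 s1 + \<beta> s2 s2) - a"
proof -
  let ?d = "\<lambda>q. \<eta> q + \<beta> (hor_part q) (hor_part q)"
  define \<zeta> where "\<zeta> = (\<lambda>r. \<eta> r + \<eta> (0,0,1) * om q r + (\<beta> (hor_part q) (hor_part r) + \<beta> (hor_part r) (hor_part q)))"
  let ?B = "\<lambda>q r. \<beta> (hor_part q) (hor_part r)"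
  have 1: "superjet (\<lambda>x. (\<lambda>_. 1) (snd x) * ?d (fst x)) q t (0 * ?d q) (\<lambda>r. (\<lambda>_. 1) t * \<zeta> r) (\<lambda>q r. (\<lambda>_. 1) t * ?B q r)"
    unfolding \<zeta>_def
    by (rule superjet_time_mult[OF space_jet_hor_quadratic[OF lin] zero_less_one, of _ _ _ 0]) simp
  have 2: "superjet (\<lambda>x. (\<lambda>t. k + a * t) (snd x) * (\<lambda>_. 1) (fst x)) q t (a * (\<lambda>_. 1) q)
     (\<lambda>r. (\<lambda>t. k + a * t) t * (\<lambda>_. 0) r) (\<lambda>q r. (\<lambda>t. k + a * t) t * (\<lambda>_ _. 0) q r)"
    by (rule superjet_time_mult[OF space_jet_const zero_less_one, of _ _ _ 0]) (simp add: algebra_simps)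
  have "superjet (\<lambda>x. v (p0 \<odot> fst x, t0 + snd x)) q t (b + a) (\<lambda>r. \<xi> r + \<zeta> r) (\<lambda>q r. B q r + ?B q r)"
    using superjet_add[OF superjet_add[OF J 1] 2] by simp
  then have "superjet v (p0 \<odot> q) (t0 + t) (b + a) (\<lambda>r. \<xi> r + \<zeta> r) (\<lambda>q r. B q r + ?B q r)"
    by (rule superjet_left_translate)
  from sub[OF q(1) _ this] q(2) show ?thesis
    by (simp add: hor_part_horizontal[OF s(1)] hor_part_horizontal[OF s(2)])
qed

text \<open>Each function lies below the walk average of its past, up to small terms, and averages
  add. If the inequality failed by \<open>mm\<close>, then, after subtraction of the quadratic data,
  the sum at time \<open>- \<tau>\<close> would lie below \<open>- mm * \<tau>\<close> up to small
  terms, although it vanishes at the origin at time zero.\<close>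

lemma linear_sum_superjet:
  fixes v1 v2 :: "heis \<times> real \<Rightarrow> real"
  assumes s: "snd (snd s1) = 0" "snd (snd s2) = 0"
    and cont: "continuous_on UNIV v1" "continuous_on UNIV v2" and "\<delta>0 > 0"
    and sub1: "\<And>y t b \<xi> B. norm y < \<delta>0 \<Longrightarrow> \<bar>t - t0\<bar> < \<delta>0 \<Longrightarrow> superjet v1 (p0 \<odot> y) t b \<xi> B
       \<Longrightarrow> b - 2 * (B s1 s1 + B s2 s2) \<le> c1"
    and sub2: "\<And>y t b \<xi> B. norm y < \<delta>0 \<Longrightarrow> \<bar>t - t0\<bar> < \<delta>0 \<Longrightarrow> superjet v2 (p0 \<odot> y) t b \<xi> B
       \<Longrightarrow> b - 2 * (B s1 s1 + B s2 s2) \<le> c2"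
    and J: "superjet (\<lambda>x. v1 x + v2 x) p0 t0 b \<xi> B"
  shows "b - 2 * (B s1 s1 + B s2 s2) \<le> c1 + c2"
proof (rule ccontr)
  assume contra: "\<not> b - 2 * (B s1 s1 + B s2 s2) \<le> c1 + c2"
  define mm where "mm = b - 2 * (B s1 s1 + B s2 s2) - (c1 + c2)"
  have mm: "mm > 0" using contra by (simp add: mm_def)
  have lin: "linear \<xi>" and bil: "bilinear B" by (rule superjet_linear[OF J], rule superjet_bilinear[OF J])
  define D where "D = (norm s1)\<^sup>2 + (norm s2)\<^sup>2"
  have D0: "D \<ge> 0" by (simp add: D_def)
  \<comment> \<open>The mean of \<open>xy_sq\<close> after the time \<open>\<tau>\<close> is
    \<open>2 * \<tau> * D\<close>. With this choice the term carrying \<open>2 * \<epsilon>\<close>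
    costs at most a quarter of \<open>mm * \<tau>\<close>.\<close>
  define \<epsilon> where "\<epsilon> = mm / (16 * (D + 1))"
  have \<epsilon>: "\<epsilon> > 0" using mm D0 by (simp add: \<epsilon>_def)
  obtain C \<delta> where C: "C \<ge> 0" "\<delta> > 0" "\<forall>q s. norm q < \<delta> \<longrightarrow> \<bar>s - t0\<bar> < \<delta> \<longrightarrow>
    v1 (p0 \<odot> q, s) + v2 (p0 \<odot> q, s) \<le> v1 (p0, t0) + v2 (p0, t0) + b * (s - t0) + \<xi> q + B q q + \<epsilon> * (norm q)\<^sup>2 + C * (s - t0)\<^sup>2"
    by (rule superjetD[OF J \<epsilon>]) (rule that)
  obtain Cb where Cb: "Cb > 0" "\<And>q r. \<bar>B q r\<bar> \<le> Cb * norm q * norm r" by (rule bilinear_bound[OF bil]) blast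
  \<comment> \<open>The second-order data of the superjet are all charged to the first function,
    with \<open>a1\<close> the slope that compensates them; the second function only loses
    \<open>c2\<close> times the time. Both are left with right-hand side zero, and
    \<open>b = a1 + c2 + mm\<close>.\<close>
  define a1 where "a1 = c1 + 2 * (B s1 s1 + B s2 s2)"
  define w1 where "w1 = (\<lambda>x::heis \<times> real. v1 (p0 \<odot> fst x, t0 + snd x) - v1 (p0, t0) - (\<xi> (fst x) + B (hor_part (fst x)) (hor_part (fst x))) - a1 * snd x)"
  define w2 where "w2 = (\<lambda>x::heis \<times> real. v2 (p0 \<odot> fst x, t0 + snd x) - v2 (p0, t0) - (0 + (\<lambda>_ _. 0) (hor_part (fst x)) (hor_part (fst x))) - c2 * snd x)"
  \<comment> \<open>Collects the vertical contributions to \<open>B q q\<close>. The mixed terms are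
    split by Young's inequality with weight \<open>\<epsilon>\<close>, and the square of the
    vertical coordinate is part of \<open>quartic\<close>.\<close>
  define C' where "C' = \<epsilon> + Cb\<^sup>2 / \<epsilon> + Cb"
  have C'0: "C' \<ge> 0" using \<epsilon> Cb by (simp add: C'_def)
  have upper: "w1 (q, s) + w2 (q, s) \<le> mm * s + 2 * \<epsilon> * xy_sq q + C' * quartic q + C * s\<^sup>2"
    if "norm q < \<delta>" "\<bar>s\<bar> < \<delta>" for q s
  proof -
    define z where "z = snd (snd q)"
    define hq where "hq = hor_part q"
    have q: "q = hq + z *\<^sub>R (0,0,1)" by (simp add: hq_def hor_part_def z_def prod_eq_iff)
    have "B q q = B (hq + z *\<^sub>R (0,0,1)) (hq + z *\<^sub>R (0,0,1))" using q by simp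
    also have "\<dots> = B hq hq + z * B hq (0,0,1) + z * B (0,0,1) hq + z\<^sup>2 * B (0,0,1) (0,0,1)"
      by (simp only: bilinear_ladd[OF bil] bilinear_radd[OF bil] bilinear_lmul[OF bil] bilinear_rmul[OF bil] real_scaleR_def)
         (simp add: algebra_simps power2_eq_square)
    finally have Bq: "B q q = B hq hq + z * B hq (0,0,1) + z * B (0,0,1) hq + z\<^sup>2 * B (0,0,1) (0,0,1)" .
    have "\<bar>z * B hq (0,0,1)\<bar> \<le> \<bar>z\<bar> * (Cb * norm hq)" "\<bar>z * B (0,0,1) hq\<bar> \<le> \<bar>z\<bar> * (Cb * norm hq)"
      unfolding abs_mult using Cb(2)[of hq "(0,0,1)"] Cb(2)[of "(0,0,1)" hq] by (intro mult_left_mono; simp)+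
    moreover have "z\<^sup>2 * B (0,0,1) (0,0,1) \<le> z\<^sup>2 * Cb"
      using Cb(2)[of "(0,0,1)" "(0,0,1)"] by (intro mult_left_mono) (simp_all add: abs_le_iff)
    moreover have "2 * (\<bar>z\<bar> * (Cb * norm hq)) \<le> \<epsilon> * (norm hq)\<^sup>2 + Cb\<^sup>2 / \<epsilon> * z\<^sup>2"
    proof -
      have "0 \<le> (\<epsilon> * norm hq - Cb * \<bar>z\<bar>)\<^sup>2 / \<epsilon>" using \<epsilon> by simp
      also have "\<dots> = \<epsilon> * (norm hq)\<^sup>2 + Cb\<^sup>2 / \<epsilon> * z\<^sup>2 - 2 * (\<bar>z\<bar> * (Cb * norm hq))"
        using \<epsilon> by (simp add: power2_diff power_mult_distrib field_simps power2_eq_square)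
      finally show ?thesis by simp
    qed
    ultimately have "B q q - B hq hq \<le> \<epsilon> * (norm hq)\<^sup>2 + Cb\<^sup>2 / \<epsilon> * z\<^sup>2 + z\<^sup>2 * Cb"
      unfolding Bq by (simp add: abs_le_iff)
    moreover have "(norm hq)\<^sup>2 = xy_sq q" by (simp add: hq_def norm_hor_part_sq)
    moreover have "(norm q)\<^sup>2 = xy_sq q + z\<^sup>2" by (simp add: norm_heis_sq xy_sq_def z_def)
    moreover have "C' * z\<^sup>2 \<le> C' * quartic q" using C'0 by (intro mult_left_mono) (simp_all add: quartic_def z_def)
    moreover have "C' * z\<^sup>2 = \<epsilon> * z\<^sup>2 + Cb\<^sup>2 / \<epsilon> * z\<^sup>2 + z\<^sup>2 * Cb" by (simp add: C'_def algebra_simps)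
    moreover have "v1 (p0 \<odot> q, t0 + s) + v2 (p0 \<odot> q, t0 + s) \<le> v1 (p0, t0) + v2 (p0, t0) + b * s + \<xi> q + B q q + \<epsilon> * (norm q)\<^sup>2 + C * s\<^sup>2"
      using C(3)[rule_format, of q "t0 + s"] that by simp
    moreover have "mm * s = b * s - a1 * s - c2 * s" by (simp add: mm_def a1_def algebra_simps)
    moreover have "\<epsilon> * (xy_sq q + z\<^sup>2) = \<epsilon> * xy_sq q + \<epsilon> * z\<^sup>2" by (rule distrib_left)
    ultimately show ?thesis unfolding w1_def w2_def fst_conv snd_conv hq_def[symmetric] by simp
  qed
  define \<delta>1 where "\<delta>1 = min \<delta> \<delta>0"
  have \<delta>1: "\<delta>1 > 0" using C \<open>\<delta>0 > 0\<close> by (simp add: \<delta>1_def)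
  \<comment> \<open>Each squared coordinate is then at most a quarter of
    \<open>\<delta>1\<^sup>2\<close>, so the three together stay below
    \<open>\<delta>1\<^sup>2\<close>.\<close>
  define r where "r = min ((\<delta>1\<^sup>2 / 4)\<^sup>2) (\<delta>1\<^sup>2 / 4)"
  have r: "r > 0" using \<delta>1 by (simp add: r_def)
  let ?K = "{q. quartic q \<le> r}"
  have Kn: "norm q < \<delta>1" if "quartic q \<le> r" for q
  proof -
    have a: "((fst q)\<^sup>2)\<^sup>2 \<le> (\<delta>1\<^sup>2 / 4)\<^sup>2" "((fst (snd q))\<^sup>2)\<^sup>2 \<le> (\<delta>1\<^sup>2 / 4)\<^sup>2" "(snd (snd q))\<^sup>2 \<le> \<delta>1\<^sup>2 / 4"
    proof -
      have "0 \<le> ((fst q)\<^sup>2)\<^sup>2" "0 \<le> ((fst (snd q))\<^sup>2)\<^sup>2" "0 \<le> (snd (snd q))\<^sup>2" by simp_all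
      moreover have "r \<le> (\<delta>1\<^sup>2 / 4)\<^sup>2" "r \<le> \<delta>1\<^sup>2 / 4" by (simp_all add: r_def)
      ultimately show "((fst q)\<^sup>2)\<^sup>2 \<le> (\<delta>1\<^sup>2 / 4)\<^sup>2" "((fst (snd q))\<^sup>2)\<^sup>2 \<le> (\<delta>1\<^sup>2 / 4)\<^sup>2" "(snd (snd q))\<^sup>2 \<le> \<delta>1\<^sup>2 / 4"
        using that unfolding quartic_def by linarith+
    qed
    have "(fst q)\<^sup>2 \<le> \<delta>1\<^sup>2 / 4" "(fst (snd q))\<^sup>2 \<le> \<delta>1\<^sup>2 / 4"
      by (rule power2_le_imp_le[OF a(1)], simp) (rule power2_le_imp_le[OF a(2)], simp)
    then have "(norm q)\<^sup>2 < \<delta>1\<^sup>2" unfolding norm_heis_sq using a(3) zero_less_power[OF \<delta>1, of 2] by linarith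
    then show ?thesis using \<delta>1 by (intro power2_less_imp_less[of "norm q" \<delta>1]) simp_all
  qed
  have cw: "continuous_on X w1" "continuous_on X w2" for X
  proof -
    have tr: "continuous_on X (\<lambda>x::heis \<times> real. (p0 \<odot> fst x, t0 + snd x))" by (intro continuous_intros)
    have cv: "continuous_on X (\<lambda>x. v1 (p0 \<odot> fst x, t0 + snd x))" "continuous_on X (\<lambda>x. v2 (p0 \<odot> fst x, t0 + snd x))"
      by (rule continuous_on_compose2[OF cont(1) tr] continuous_on_compose2[OF cont(2) tr]; simp)+
    have bb: "bounded_bilinear B" using bil by (simp add: bilinear_conv_bounded_bilinear)
    have hp: "continuous_on X (\<lambda>x::heis \<times> real. hor_part (fst x))" unfolding hor_part_def by (intro continuous_intros)
    have "continuous_on X (\<lambda>x. \<xi> (fst x))"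
      by (rule continuous_on_compose2[OF linear_continuous_on[OF linear_conv_bounded_linear[THEN iffD1, OF lin], of UNIV]])
         (auto intro!: continuous_intros)
    then show "continuous_on X w1" unfolding w1_def
      by (intro continuous_intros cv bounded_bilinear.continuous_on[OF bb] hp)
    show "continuous_on X w2" unfolding w2_def by (intro continuous_intros cv)
  qed
  have comp: "compact (?K \<times> {- (\<delta>1 / 2)..0})" by (intro compact_Times compact_quartic compact_Icc)
  obtain M1 M2 where M12: "\<And>x. x \<in> ?K \<times> {- (\<delta>1 / 2)..0} \<Longrightarrow> norm (w1 x) \<le> M1" "\<And>x. x \<in> ?K \<times> {- (\<delta>1 / 2)..0} \<Longrightarrow> norm (w2 x) \<le> M2"
    using compact_imp_bounded[OF compact_continuous_image[OF cw(1) comp]] compact_imp_bounded[OF compact_continuous_image[OF cw(2) comp]]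
    unfolding bounded_iff ball_simps(9) image_iff by (metis imageI)
  define M where "M = 1 + max M1 M2"
  have z0: "0 \<in> ?K" using r by (simp add: quartic_def)
  have M: "M > 0"
  proof -
    have "norm (w1 (0, 0)) \<le> M1" using z0 \<delta>1 by (intro M12) auto
    then show ?thesis using norm_ge_zero[of "w1 (0,0)"] unfolding M_def by linarith
  qed
  have Mb: "\<bar>w1 (p, t)\<bar> \<le> M" "\<bar>w2 (p, t)\<bar> \<le> M" if "quartic p \<le> r" "- (\<delta>1 / 2) \<le> t" "t \<le> 0" for p t
    using M12[of "(p, t)"] that by (auto simp: M_def)
  define M' where "M' = 2 * M + 1"
  define m where "m = (M + M') / r"
  have m: "m \<ge> 0" "m * r \<ge> M + M'" using M r by (simp_all add: m_def M'_def)
  \<comment> \<open>The additional multiple of \<open>quartic\<close> dominates the global bounds of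
    \<open>g1\<close> and \<open>g2\<close> where \<open>quartic\<close> exceeds \<open>r\<close>.
    The estimate of \<open>g1 + g2\<close> thus holds on the whole group, as averaging along the
    walk demands.\<close>
  define C4 where "C4 = C' + (2 * M' + mm) / r"
  have C4: "C4 \<ge> 0" using C'0 M mm r by (simp add: C4_def M'_def)
  \<comment> \<open>All contributions of order \<open>\<tau>\<^sup>2\<close>: the time error of the
    superjet, the mean of \<open>quartic\<close>, and the two localization barriers. The choice of
    \<open>\<tau>\<close> keeps them below a quarter of \<open>mm * \<tau>\<close>.\<close>
  define A1 where "A1 = C + 14 * D\<^sup>2 * (C4 + 2 * m)"
  have A1: "A1 \<ge> 0" using C C4 m by (simp add: A1_def)
  define \<tau> where "\<tau> = min (\<delta>1 / 2) (min 1 (mm / (4 * (A1 + 1))))"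
  have \<tau>: "\<tau> > 0" "\<tau> \<le> \<delta>1 / 2" "\<tau> \<le> 1" and \<tau>A: "\<tau> \<le> mm / (4 * (A1 + 1))"
    using \<delta>1 mm A1 unfolding \<tau>_def by (simp_all only: min_less_iff_conj min.cobounded1 min.coboundedI2 min.cobounded2) simp
  have A\<tau>: "A1 * \<tau>\<^sup>2 \<le> mm / 4 * \<tau>"
  proof -
    have "A1 * \<tau> \<le> (A1 + 1) * (mm / (4 * (A1 + 1)))" using A1 \<tau> \<tau>A by (intro mult_mono) auto
    also have "\<dots> = mm / 4" using A1 by (simp add: field_simps add_nonneg_eq_0_iff)
    finally have "A1 * \<tau> * \<tau> \<le> mm / 4 * \<tau>" using \<tau> by (intro mult_right_mono) auto
    then show ?thesis by (simp add: power2_eq_square mult.assoc)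
  qed
  \<comment> \<open>Four copies of \<open>e\<close> occur, two from the approximations and two from
    the walks. As \<open>17 > 16\<close>, they stay strictly below a quarter of
    \<open>mm * \<tau>\<close>.\<close>
  define e where "e = min 1 (mm * \<tau> / 17)"
  have e: "e > 0" "e \<le> 1" "4 * e < mm / 4 * \<tau>" using mm \<tau> by (auto simp: e_def min_def)
  have w\<tau>: "continuous_on ?K (\<lambda>p. w1 (p, - \<tau>))" "continuous_on ?K (\<lambda>p. w2 (p, - \<tau>))"
    by (rule continuous_on_compose2[OF cw(1)[of UNIV]] continuous_on_compose2[OF cw(2)[of UNIV]]; auto intro!: continuous_intros)+
  have Mb\<tau>: "\<bar>w1 (p, - \<tau>)\<bar> \<le> M" "\<bar>w2 (p, - \<tau>)\<bar> \<le> M" if "p \<in> ?K" for p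
    using Mb[of p "- \<tau>"] that \<tau> by auto
  obtain g1 G1 l1 B1 where g1: "uniform_jets G1 g1 l1 B1" "\<forall>p\<in>?K. w1 (p, - \<tau>) \<le> g1 p" "\<forall>p\<in>?K. g1 p \<le> w1 (p, - \<tau>) + e"
    "\<forall>p. \<bar>g1 p\<bar> \<le> 2 * M + e"
    by (rule uniform_jets_approximation[OF compact_quartic w\<tau>(1) M Mb\<tau>(1) e(1)]) (assumption, rule that)
  obtain g2 G2 l2 B2 where g2: "uniform_jets G2 g2 l2 B2" "\<forall>p\<in>?K. w2 (p, - \<tau>) \<le> g2 p" "\<forall>p\<in>?K. g2 p \<le> w2 (p, - \<tau>) + e"
    "\<forall>p. \<bar>g2 p\<bar> \<le> 2 * M + e"
    by (rule uniform_jets_approximation[OF compact_quartic w\<tau>(2) M Mb\<tau>(2) e(1)]) (assumption, rule that)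
  have gb: "\<bar>g1 q\<bar> \<le> M'" "\<bar>g2 q\<bar> \<le> M'" for q
    using g1(4)[rule_format, of q] g2(4)[rule_format, of q] e(2) unfolding M'_def by linarith+
  have mono: "uniform_jets (max 0 G) g l B" if "uniform_jets G g l B" for G g l B
  proof -
    have "G * norm k ^ 3 \<le> max 0 G * norm k ^ 3" "G * norm k * (norm r)\<^sup>2 \<le> max 0 G * norm k * (norm r)\<^sup>2" for k r :: heis
      by (intro mult_right_mono; simp)+
    then show ?thesis using that unfolding uniform_jets_def by (meson order_trans)
  qed
  have nb: "norm q < \<delta>0" if "quartic q < r" for q using Kn[of q] that by (simp add: \<delta>1_def)
  have tb: "\<bar>t\<bar> < \<delta>0" if "- \<tau> < t" "t < 0" for t using that \<tau> \<delta>1 unfolding \<delta>1_def by linarith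
  have sw1: "b' - 2 * (B' s1 s1 + B' s2 s2) \<le> 0"
    if "quartic q < r" "- \<tau> < t" "t < 0" and J': "superjet w1 q t b' \<xi>' B'" for q t b' \<xi>' B'
  proof -
    have "b' - 2 * (B' s1 s1 + B' s2 s2) \<le> c1 + 2 * (B s1 s1 + B s2 s2) - a1"
      by (rule shifted_linear_subsolution[OF s lin bil _ nb[OF that(1)] tb[OF that(2,3)] J'[unfolded w1_def]])
         (erule (2) sub1)
    then show ?thesis by (simp add: a1_def)
  qed
  have sw2: "b' - 2 * (B' s1 s1 + B' s2 s2) \<le> 0"
    if "quartic q < r" "- \<tau> < t" "t < 0" and J': "superjet w2 q t b' \<xi>' B'" for q t b' \<xi>' B'
  proof -
    have bz: "bilinear (\<lambda>(_::heis) (_::heis). 0 :: real)" by (intro bilinearI' linear_const_zero)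
    have "b' - 2 * (B' s1 s1 + B' s2 s2) \<le> c2 + 2 * (0 + 0) - c2"
      by (rule shifted_linear_subsolution[OF s linear_const_zero bz _ nb[OF that(1)] tb[OF that(2,3)] J'[unfolded w2_def]])
         (erule (2) sub2)
    then show ?thesis by simp
  qed
  let ?T = "\<lambda>n. walk_avg s1 s2 (2 * sqrt (\<tau> / real n))"
  have vM: "w1 (p, t) \<le> M" "w2 (p, t) \<le> M" if "quartic p \<le> r" "- \<tau> \<le> t" "t \<le> 0" for p t
    using Mb[of p t] that \<tau> by auto
  obtain N1 where N1: "\<forall>n\<ge>N1. w1 (0, 0) \<le> (?T n ^^ n) g1 0 + m * (14 * D\<^sup>2 * \<tau>\<^sup>2) + e"
  proof (rule walk_mean_value[OF s mono[OF g1(1)] _ \<tau>(1) _ r m cw(1) _ _ _ e(1), folded D_def])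
    show "\<bar>g1 q\<bar> \<le> M'" for q by (rule gb(1))
    show "w1 (p, t) \<le> M" if "quartic p \<le> r" "- \<tau> \<le> t" "t \<le> 0" for p t using vM(1)[OF that] .
    show "b' - 2 * (B' s1 s1 + B' s2 s2) \<le> 0"
      if "quartic q < r" "- \<tau> < t" "t < 0" and J': "superjet w1 q t b' \<xi>' B'" for q t b' \<xi>' B'
      by (rule sw1[OF that])
    show "w1 (p, - \<tau>) \<le> g1 p" if "quartic p \<le> r" for p using g1(2) that by blast
  qed (simp, rule that)
  obtain N2 where N2: "\<forall>n\<ge>N2. w2 (0, 0) \<le> (?T n ^^ n) g2 0 + m * (14 * D\<^sup>2 * \<tau>\<^sup>2) + e"
  proof (rule walk_mean_value[OF s mono[OF g2(1)] _ \<tau>(1) _ r m cw(2) _ _ _ e(1), folded D_def])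
    show "\<bar>g2 q\<bar> \<le> M'" for q by (rule gb(2))
    show "w2 (p, t) \<le> M" if "quartic p \<le> r" "- \<tau> \<le> t" "t \<le> 0" for p t using vM(2)[OF that] .
    show "b' - 2 * (B' s1 s1 + B' s2 s2) \<le> 0"
      if "quartic q < r" "- \<tau> < t" "t < 0" and J': "superjet w2 q t b' \<xi>' B'" for q t b' \<xi>' B'
      by (rule sw2[OF that])
    show "w2 (p, - \<tau>) \<le> g2 p" if "quartic p \<le> r" for p using g2(2) that by blast
  qed (simp, rule that)
  define n where "n = max 1 (max N1 N2)"
  have n: "n > 0" by (simp add: n_def)
  define \<rho> where "\<rho> = 2 * sqrt (\<tau> / real n)"
  have \<rho>2: "real n * (\<rho>\<^sup>2 / 4) = \<tau>" "real n * (\<rho>\<^sup>2 / 2 * D) = 2 * \<tau> * D"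
    using \<tau> n by (simp_all add: \<rho>_def power_mult_distrib)
  define K0 where "K0 = - mm * \<tau> + C * \<tau>\<^sup>2 + 2 * e"
  have dom: "g1 q + g2 q \<le> (K0 + 2 * \<epsilon> * xy_sq q) + C4 * quartic q" for q
  proof (cases "quartic q \<le> r")
    case True
    have "norm q < \<delta>" "\<bar>- \<tau>\<bar> < \<delta>" using Kn[OF True] \<tau> \<delta>1 unfolding \<delta>1_def by linarith+
    from upper[OF this] have "w1 (q, - \<tau>) + w2 (q, - \<tau>) \<le> mm * - \<tau> + 2 * \<epsilon> * xy_sq q + C' * quartic q + C * \<tau>\<^sup>2" by simp
    moreover have "g1 q \<le> w1 (q, - \<tau>) + e" "g2 q \<le> w2 (q, - \<tau>) + e" using g1(3) g2(3) True by blast+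
    moreover have "C' * quartic q \<le> C4 * quartic q"
      using M mm r quartic_nonneg by (intro mult_right_mono) (simp_all add: C4_def M'_def)
    ultimately show ?thesis unfolding K0_def by simp
  next
    case False
    have "(2 * M' + mm) / r * r \<le> (2 * M' + mm) / r * quartic q" using False M mm r by (intro mult_left_mono) (simp_all add: M'_def)
    moreover have "0 \<le> C' * quartic q" using C'0 quartic_nonneg by simp
    moreover have "C4 * quartic q = C' * quartic q + (2 * M' + mm) / r * quartic q" by (simp add: C4_def distrib_right)
    moreover have "(2 * M' + mm) / r * r = 2 * M' + mm" using r by simp
    moreover have "mm * \<tau> \<le> mm" using mm \<tau> by (simp add: mult_left_le)
    moreover have "0 \<le> C * \<tau>\<^sup>2" "0 \<le> 2 * \<epsilon> * xy_sq q" using C \<epsilon> xy_sq_nonneg by simp_all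
    ultimately show ?thesis using gb[of q] e(1) unfolding K0_def by linarith
  qed
  have "(?T n ^^ n) g1 0 + (?T n ^^ n) g2 0 = (?T n ^^ n) (\<lambda>q. g1 q + g2 q) 0" by (simp only: walk_avg_iter_add)
  also have "\<dots> \<le> (?T n ^^ n) (\<lambda>q. (K0 + 2 * \<epsilon> * xy_sq q) + C4 * quartic q) 0" by (rule walk_avg_iter_mono) (rule dom)
  also have "\<dots> = K0 + 2 * \<epsilon> * (?T n ^^ n) xy_sq 0 + C4 * (?T n ^^ n) quartic 0"
    by (simp only: walk_avg_iter_add walk_avg_iter_cmult walk_avg_iter_const)
  also have "\<dots> \<le> K0 + 2 * \<epsilon> * (2 * \<tau> * D) + C4 * (14 * D\<^sup>2 * \<tau>\<^sup>2)"
  proof -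
    have "(?T n ^^ n) xy_sq 0 = 2 * \<tau> * D"
      using walk_avg_iter_xy_sq[OF s, of n \<rho> 0] \<rho>2(2) unfolding D_def[symmetric] \<rho>_def by (simp add: xy_sq_def)
    moreover have "(?T n ^^ n) quartic 0 \<le> 14 * D\<^sup>2 * \<tau>\<^sup>2"
      using walk_avg_iter_barrier[OF s, of n \<rho> 0] \<rho>2(1) unfolding D_def[symmetric] barrier_zero \<rho>_def by simp
    ultimately show ?thesis using C4 by (simp add: mult_left_mono)
  qed
  finally have "(?T n ^^ n) g1 0 + (?T n ^^ n) g2 0 \<le> K0 + 2 * \<epsilon> * (2 * \<tau> * D) + C4 * (14 * D\<^sup>2 * \<tau>\<^sup>2)" .
  moreover have "w1 (0, 0) \<le> (?T n ^^ n) g1 0 + m * (14 * D\<^sup>2 * \<tau>\<^sup>2) + e" "w2 (0, 0) \<le> (?T n ^^ n) g2 0 + m * (14 * D\<^sup>2 * \<tau>\<^sup>2) + e"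
    using N1 N2 by (simp_all add: n_def)
  moreover have "w1 (0, 0) = 0" "w2 (0, 0) = 0"
    using linear_0[OF lin] bilinear_lzero[OF bil] linear_0[OF linear_hor_part] by (simp_all add: w1_def w2_def)
  moreover have "K0 + 2 * \<epsilon> * (2 * \<tau> * D) + C4 * (14 * D\<^sup>2 * \<tau>\<^sup>2) + 2 * (m * (14 * D\<^sup>2 * \<tau>\<^sup>2)) = - mm * \<tau> + 2 * e + 4 * \<epsilon> * \<tau> * D + A1 * \<tau>\<^sup>2"
    unfolding K0_def A1_def by (simp add: algebra_simps)
  moreover have "4 * \<epsilon> * \<tau> * D \<le> mm / 4 * \<tau>"
  proof -
    have "4 * \<epsilon> * D \<le> 4 * \<epsilon> * (D + 1)" using \<epsilon> by simp
    also have "\<dots> = mm / 4" using D0 by (simp add: \<epsilon>_def field_simps add_nonneg_eq_0_iff)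
    finally have "4 * \<epsilon> * D * \<tau> \<le> mm / 4 * \<tau>" using \<tau> by (intro mult_right_mono) auto
    moreover have "4 * \<epsilon> * \<tau> * D = 4 * \<epsilon> * D * \<tau>" by simp
    ultimately show ?thesis by (simp only:)
  qed
  moreover have "mm * \<tau> = 4 * (mm / 4 * \<tau>)" by simp
  moreover have "mm / 4 * \<tau> > 0" using mm \<tau> by simp
  ultimately show False using A\<tau> e by linarith
qed

section \<open>The gradient term\<close>

text \<open>Semiconvexity in the form of supporting paraboloids along right increments, in space
  alone and with one opening \<open>C\<close> for all nearby points and times.\<close>

definition semiconvex_near :: "(heis \<times> real \<Rightarrow> real) \<Rightarrow> heis \<Rightarrow> real \<Rightarrow> real \<Rightarrow> real \<Rightarrow> bool" where
  "semiconvex_near V p0 t0 r C \<longleftrightarrow> (\<forall>y s. norm y < r \<longrightarrow> \<bar>s - t0\<bar> < r \<longrightarrow>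
     (\<exists>l. linear l \<and> (\<forall>q. norm q < r \<longrightarrow> V (p0 \<odot> y, s) + l q - C * (norm q)\<^sup>2 \<le> V (p0 \<odot> y \<odot> q, s))))"

lemma linear_nonpos_of_quadratic:
  fixes \<eta> :: "heis \<Rightarrow> real"
  assumes lin: "linear \<eta>" and "d > 0" and le: "\<And>q. norm q < d \<Longrightarrow> \<eta> q \<le> K * (norm q)\<^sup>2"
  shows "\<eta> q = 0"
proof -
  have nonpos: "\<eta> q \<le> 0" for q
  proof (rule ccontr)
    assume "\<not> \<eta> q \<le> 0"
    then have pos: "\<eta> q > 0" by simp
    define N where "N = norm q"
    have N: "N \<ge> 0" by (simp add: N_def)
    define t where "t = min (d / (2 * (N + 1))) (\<eta> q / (2 * (\<bar>K\<bar> * N\<^sup>2 + 1)))"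
    have den: "\<bar>K\<bar> * N\<^sup>2 + 1 > 0" by (simp add: add_nonneg_pos)
    have t: "t > 0" using \<open>d > 0\<close> pos N den by (simp add: t_def)
    have "t * N \<le> d / (2 * (N + 1)) * (N + 1)" using t N \<open>d > 0\<close> by (intro mult_mono) (auto simp: t_def)
    also have "\<dots> = d / 2" using N by (simp add: field_simps)
    finally have "norm (t *\<^sub>R q) < d" using t \<open>d > 0\<close> by (simp add: N_def)
    from le[OF this] have "t * \<eta> q \<le> t * (t * (K * N\<^sup>2))"
      using t by (simp add: linear_scale[OF lin] N_def power_mult_distrib power2_eq_square algebra_simps)
    then have "\<eta> q \<le> t * (K * N\<^sup>2)" using t by simp
    also have "\<dots> \<le> t * (\<bar>K\<bar> * N\<^sup>2 + 1)" using t by (intro mult_left_mono) (auto intro: order_trans[OF mult_right_mono[of K "\<bar>K\<bar>"]])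
    also have "\<dots> \<le> \<eta> q / (2 * (\<bar>K\<bar> * N\<^sup>2 + 1)) * (\<bar>K\<bar> * N\<^sup>2 + 1)"
      using den by (intro mult_right_mono) (auto simp: t_def)
    also have "\<dots> = \<eta> q / 2" using den by (simp add: field_simps)
    finally show False using pos by simp
  qed
  have "\<eta> (- q) = - \<eta> q" by (rule linear_neg[OF lin])
  then show ?thesis using nonpos[of q] nonpos[of "- q"] by simp
qed

text \<open>The superjet bounds from above what the paraboloid bounds from below. The two linear
  parts differ by a linear function of quadratic size, which must vanish.\<close>

lemma superjet_semiconvex_gradient:
  assumes J: "superjet V p s b \<xi> B" and l: "linear l" "r > 0"
    and low: "\<And>q. norm q < r \<Longrightarrow> V (p, s) + l q - C * (norm q)\<^sup>2 \<le> V (p \<odot> q, s)"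
  shows "l = \<xi>"
proof
  fix q
  note lin = superjet_linear[OF J] superjet_bilinear[OF J]
  obtain Cb where Cb: "Cb > 0" "\<And>q r. \<bar>B q r\<bar> \<le> Cb * norm q * norm r" by (rule bilinear_bound[OF lin(2)]) blast
  obtain C1 \<delta> where C1: "\<delta> > 0" "\<forall>q s'. norm q < \<delta> \<longrightarrow> \<bar>s' - s\<bar> < \<delta> \<longrightarrow>
    V (p \<odot> q, s') \<le> V (p, s) + b * (s' - s) + \<xi> q + B q q + 1 * (norm q)\<^sup>2 + C1 * (s' - s)\<^sup>2"
    by (rule superjetD[OF J zero_less_one]) (rule that)
  have "(\<lambda>q. l q - \<xi> q) q = 0"
  proof (rule linear_nonpos_of_quadratic[of _ "min r \<delta>" "C + Cb + 1"])
    show "linear (\<lambda>q. l q - \<xi> q)" by (rule linear_compose_sub[OF l(1) lin(1)])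
    show "0 < min r \<delta>" using l C1 by simp
    fix q :: heis assume q: "norm q < min r \<delta>"
    have "V (p \<odot> q, s) \<le> V (p, s) + \<xi> q + B q q + (norm q)\<^sup>2"
      using C1(2)[rule_format, of q s] q C1(1) by simp
    moreover have "V (p, s) + l q - C * (norm q)\<^sup>2 \<le> V (p \<odot> q, s)" using low q by simp
    moreover have "B q q \<le> Cb * (norm q)\<^sup>2" using Cb(2)[of q q] by (simp add: power2_eq_square mult.assoc abs_le_iff)
    ultimately show "l q - \<xi> q \<le> (C + Cb + 1) * (norm q)\<^sup>2" by (simp add: algebra_simps)
  qed
  then show "l q = \<xi> q" by simp
qed

text \<open>The squeezing argument at a fixed distance \<open>s0\<close>: semiconvexity bounds
  \<open>V\<close> from below around the nearby point, \<open>up\<close> bounds it from above around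
  \<open>p0\<close>, and continuity of \<open>V\<close> compares the two base points. The opposite
  bound follows by replacing \<open>q\<close> with \<open>- q\<close>.\<close>

lemma superjet_gradient_freeze:
  fixes V :: "heis \<times> real \<Rightarrow> real"
  assumes cont: "continuous_on UNIV V" and r: "r > 0" and C: "C \<ge> 0"
    and sc: "semiconvex_near V p0 t0 r C" and lin: "linear \<xi>0"
    and up: "\<And>q. norm q < r \<Longrightarrow> V (p0 \<odot> q, t0) \<le> V (p0, t0) + \<xi>0 q + C * (norm q)\<^sup>2"
    and \<delta>: "\<delta> > 0"
  obtains \<rho> where "\<rho> > 0" "\<rho> \<le> r" "\<forall>y s b \<xi> B q. norm y < \<rho> \<longrightarrow> \<bar>s - t0\<bar> < \<rho> \<longrightarrow>
    superjet V (p0 \<odot> y) s b \<xi> B \<longrightarrow> \<bar>\<xi> q - \<xi>0 q\<bar> \<le> \<delta> * norm q"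
proof -
  \<comment> \<open>On increments of length \<open>s0\<close> the two paraboloids cost
    \<open>2 * (C * s0\<^sup>2)\<close> and the modulus of continuity costs
    \<open>2 * \<omega>\<close>; each is at most half of \<open>\<delta> * s0\<close>.\<close>
  define s0 where "s0 = min (r / 2) (\<delta> / (4 * (C + 1)))"
  have s0: "s0 > 0" "s0 < r" "s0 \<le> \<delta> / (4 * (C + 1))" using r \<delta> C by (auto simp: s0_def)
  define \<omega> where "\<omega> = \<delta> * s0 / 4"
  have \<omega>: "\<omega> > 0" using \<delta> s0 by (simp add: \<omega>_def)
  define X where "X = (cball (0::heis) 1 \<times> {t0 - 1..t0 + 1}) \<times> cball (0::heis) s0"
  define F where "F = (\<lambda>x::(heis \<times> real) \<times> heis. V (p0 \<odot> (fst (fst x) \<odot> snd x), snd (fst x)))"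
  have "compact X" unfolding X_def by (intro compact_Times compact_cball compact_Icc)
  moreover have "continuous_on X F" unfolding F_def
    by (rule continuous_on_compose2[OF cont]) (auto intro!: continuous_intros)
  ultimately have "uniformly_continuous_on X F" by (intro compact_uniformly_continuous)
  then obtain d where d: "d > 0" "\<And>x x'. x \<in> X \<Longrightarrow> x' \<in> X \<Longrightarrow> dist x' x < d \<Longrightarrow> dist (F x') (F x) < \<omega>"
    unfolding uniformly_continuous_on_def using \<omega> by meson
  define \<rho> where "\<rho> = min r (min 1 (d / 2))"
  have \<rho>: "\<rho> > 0" "\<rho> \<le> r" using r d by (auto simp: \<rho>_def)
  have close: "\<bar>V (p0 \<odot> (y \<odot> q), s) - V (p0 \<odot> q, t0)\<bar> < \<omega>"
    if "norm y < \<rho>" "\<bar>s - t0\<bar> < \<rho>" "norm q \<le> s0" for y q s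
  proof -
    have "((y, s), q) \<in> X" "((0, t0), q) \<in> X" using that by (auto simp: X_def \<rho>_def abs_less_iff)
    moreover have "dist ((y, s), q) ((0, t0), q) < d"
    proof -
      have "dist ((y, s), q) ((0, t0), q) = norm (y, s - t0)" by (simp add: dist_Pair_Pair dist_norm norm_Pair)
      also have "\<dots> \<le> norm y + \<bar>s - t0\<bar>" using norm_Pair_le[of y "s - t0"] by simp
      also have "\<dots> < d" using that by (simp add: \<rho>_def)
      finally show ?thesis .
    qed
    ultimately have "dist (F ((y, s), q)) (F ((0, t0), q)) < \<omega>" using d(2)[of "((0, t0), q)" "((y, s), q)"] by blast
    then show ?thesis by (simp add: F_def dist_real_def)
  qed
  have main: "\<xi> q - \<xi>0 q \<le> \<delta> * norm q"
    if y: "norm y < \<rho>" "\<bar>s - t0\<bar> < \<rho>" and J: "superjet V (p0 \<odot> y) s b \<xi> B" for y s b \<xi> B q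
  proof (cases "q = 0")
    case True
    then show ?thesis using linear_0[OF lin] linear_0[OF superjet_linear[OF J]] by simp
  next
    case False
    then have nq: "norm q > 0" by simp
    have "norm y < r" "\<bar>s - t0\<bar> < r" using y \<rho> by auto
    then obtain l where l: "linear l" "\<forall>q. norm q < r \<longrightarrow> V (p0 \<odot> y, s) + l q - C * (norm q)\<^sup>2 \<le> V (p0 \<odot> y \<odot> q, s)"
      using sc unfolding semiconvex_near_def by blast
    have "l = \<xi>" by (rule superjet_semiconvex_gradient[OF J l(1) r]) (use l(2) in blast)
    define q1 where "q1 = (s0 / norm q) *\<^sub>R q"
    have n1: "norm q1 = s0" using nq s0 by (simp add: q1_def)
    have "V (p0 \<odot> y, s) + \<xi> q1 - C * s0\<^sup>2 \<le> V (p0 \<odot> (y \<odot> q1), s)"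
      using l(2)[rule_format, of q1] n1 s0 \<open>l = \<xi>\<close> by (simp add: heis_assoc)
    moreover have "V (p0 \<odot> (y \<odot> q1), s) < V (p0 \<odot> q1, t0) + \<omega>" using close[OF y, of q1] n1 by linarith
    moreover have "V (p0, t0) < V (p0 \<odot> y, s) + \<omega>" using close[OF y, of 0] s0(1) by simp
    moreover have "V (p0 \<odot> q1, t0) \<le> V (p0, t0) + \<xi>0 q1 + C * s0\<^sup>2" using up[of q1] n1 s0 by simp
    ultimately have "\<xi> q1 - \<xi>0 q1 \<le> 2 * (C * s0\<^sup>2) + 2 * \<omega>" by linarith
    also have "\<dots> \<le> \<delta> * s0"
    proof -
      have "C * s0 \<le> (C + 1) * (\<delta> / (4 * (C + 1)))" using C s0 by (intro mult_mono) auto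
      also have "\<dots> = \<delta> / 4" using C by (simp add: field_simps)
      finally have "C * s0 * s0 \<le> \<delta> / 4 * s0" using s0 by (intro mult_right_mono) auto
      then have "2 * (C * s0\<^sup>2) \<le> \<delta> * s0 / 2" by (simp add: power2_eq_square mult.assoc)
      then show ?thesis by (simp add: \<omega>_def)
    qed
    finally have "s0 / norm q * (\<xi> q - \<xi>0 q) \<le> s0 / norm q * (\<delta> * norm q)"
      unfolding q1_def using nq
      by (simp only: linear_scale[OF lin] linear_scale[OF superjet_linear[OF J]] real_scaleR_def right_diff_distrib) (simp add: mult.commute)
    moreover have "s0 / norm q > 0" using s0 nq by simp
    ultimately show ?thesis by (rule mult_left_le_imp_le)
  qed
  show thesis
  proof (rule that[OF \<rho>], intro allI impI)
    fix y s b \<xi> B q assume h: "norm y < \<rho>" "\<bar>s - t0\<bar> < \<rho>" "superjet V (p0 \<odot> y) s b \<xi> B"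
    have "\<xi> (- q) - \<xi>0 (- q) = - (\<xi> q - \<xi>0 q)"
      by (simp add: linear_neg[OF lin] linear_neg[OF superjet_linear[OF h(3)]])
    then show "\<bar>\<xi> q - \<xi>0 q\<bar> \<le> \<delta> * norm q" using main[OF h, of q] main[OF h, of "- q"] by (simp add: abs_le_iff)
  qed
qed

lemma norm_grad2_diff_le:
  assumes "\<And>q. \<bar>\<xi> q - \<eta> q\<bar> \<le> \<delta> * norm q"
  shows "norm (grad2 \<xi> - grad2 \<eta>) \<le> 2 * \<delta>"
proof -
  have n: "norm ((1,0,0)::heis) = 1" "norm ((0,1,0)::heis) = 1" by (simp_all add: norm_Pair)
  have "norm (grad2 \<xi> - grad2 \<eta>) \<le> (\<Sum>i\<in>UNIV. \<bar>(grad2 \<xi> - grad2 \<eta>) $ i\<bar>)" by (rule norm_le_l1_cart)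
  also have "\<dots> = \<bar>\<xi> (1,0,0) - \<eta> (1,0,0)\<bar> + \<bar>\<xi> (0,1,0) - \<eta> (0,1,0)\<bar>" by (simp add: sum_2 grad2_def)
  also have "\<dots> \<le> \<delta> * norm ((1,0,0)::heis) + \<delta> * norm ((0,1,0)::heis)" by (intro add_mono assms)
  finally show ?thesis unfolding n by simp
qed

lemma semiconvex_near_mono:
  assumes "semiconvex_near V p0 t0 r C" "r' \<le> r" "C \<le> C'"
  shows "semiconvex_near V p0 t0 r' C'"
  unfolding semiconvex_near_def
proof (intro allI impI)
  fix y :: heis and s assume y: "norm y < r'" "\<bar>s - t0\<bar> < r'"
  then have "norm y < r" "\<bar>s - t0\<bar> < r" using assms(2) by auto
  then obtain l where l: "linear l" "\<forall>q. norm q < r \<longrightarrow> V (p0 \<odot> y, s) + l q - C * (norm q)\<^sup>2 \<le> V (p0 \<odot> y \<odot> q, s)"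
    using assms(1) unfolding semiconvex_near_def by blast
  have "V (p0 \<odot> y, s) + l q - C' * (norm q)\<^sup>2 \<le> V (p0 \<odot> y \<odot> q, s)" if "norm q < r'" for q
  proof -
    have "C * (norm q)\<^sup>2 \<le> C' * (norm q)\<^sup>2" using assms(3) by (intro mult_right_mono) auto
    moreover have "V (p0 \<odot> y, s) + l q - C * (norm q)\<^sup>2 \<le> V (p0 \<odot> y \<odot> q, s)" using l(2) that assms(2) by auto
    ultimately show ?thesis by linarith
  qed
  with l(1) show "\<exists>l. linear l \<and> (\<forall>q. norm q < r' \<longrightarrow> V (p0 \<odot> y, s) + l q - C' * (norm q)\<^sup>2 \<le> V (p0 \<odot> y \<odot> q, s))"
    by blast
qed

text \<open>Both gradients are frozen near the touching point because each function is squeezed between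
  two paraboloids there; this reduces the semilinear inequality to the linear one.\<close>

lemma semilinear_sum_superjet:
  fixes v1 v2 :: "heis \<times> real \<Rightarrow> real" and H1 H2 :: "real^2 \<Rightarrow> real"
  assumes s: "snd (snd s1) = 0" "snd (snd s2) = 0"
    and cont: "continuous_on UNIV v1" "continuous_on UNIV v2" and r: "r > 0" and C: "C \<ge> 0"
    and sc: "semiconvex_near v1 p0 t0 r C" "semiconvex_near v2 p0 t0 r C"
    and L1: "L1 \<ge> 0" "\<And>a b. \<bar>H1 a - H1 b\<bar> \<le> L1 * norm (a - b)" "\<And>a b. \<bar>H2 a - H2 b\<bar> \<le> L1 * norm (a - b)"
    and sub1: "\<And>y t b \<xi> B. norm y < r \<Longrightarrow> \<bar>t - t0\<bar> < r \<Longrightarrow> superjet v1 (p0 \<odot> y) t b \<xi> B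
       \<Longrightarrow> b - 2 * (B s1 s1 + B s2 s2) + H1 (grad2 \<xi>) \<le> 0"
    and sub2: "\<And>y t b \<xi> B. norm y < r \<Longrightarrow> \<bar>t - t0\<bar> < r \<Longrightarrow> superjet v2 (p0 \<odot> y) t b \<xi> B
       \<Longrightarrow> b - 2 * (B s1 s1 + B s2 s2) + H2 (grad2 \<xi>) \<le> 0"
    and J: "superjet (\<lambda>x. v1 x + v2 x) p0 t0 b \<xi> B"
  obtains a1 a2 where "a1 + a2 = grad2 \<xi>" "b - 2 * (B s1 s1 + B s2 s2) + H1 a1 + H2 a2 \<le> 0"
proof -
  note lin = superjet_linear[OF J] superjet_bilinear[OF J]
  obtain Cb where Cb: "Cb > 0" "\<And>q r. \<bar>B q r\<bar> \<le> Cb * norm q * norm r" by (rule bilinear_bound[OF lin(2)]) blast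
  obtain C1 \<delta>1 where C1: "\<delta>1 > 0" "\<forall>q s'. norm q < \<delta>1 \<longrightarrow> \<bar>s' - t0\<bar> < \<delta>1 \<longrightarrow>
    v1 (p0 \<odot> q, s') + v2 (p0 \<odot> q, s') \<le> v1 (p0, t0) + v2 (p0, t0) + b * (s' - t0) + \<xi> q + B q q + 1 * (norm q)\<^sup>2 + C1 * (s' - t0)\<^sup>2"
    by (rule superjetD[OF J zero_less_one]) (rule that)
  have z: "norm (0::heis) < r" "\<bar>t0 - t0\<bar> < r" using r by simp_all
  obtain l1 where l1: "linear l1" "\<forall>q. norm q < r \<longrightarrow> v1 (p0, t0) + l1 q - C * (norm q)\<^sup>2 \<le> v1 (p0 \<odot> q, t0)"
    using sc(1)[unfolded semiconvex_near_def, rule_format, OF z] by auto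
  obtain l2 where l2: "linear l2" "\<forall>q. norm q < r \<longrightarrow> v2 (p0, t0) + l2 q - C * (norm q)\<^sup>2 \<le> v2 (p0 \<odot> q, t0)"
    using sc(2)[unfolded semiconvex_near_def, rule_format, OF z] by auto
  define r' where "r' = min r \<delta>1"
  have r': "r' > 0" "r' \<le> r" using r C1 by (auto simp: r'_def)
  define C' where "C' = C + Cb + 1"
  have C': "C' \<ge> 0" "C \<le> C'" using C Cb by (auto simp: C'_def)
  have sum: "v1 (p0 \<odot> q, t0) + v2 (p0 \<odot> q, t0) \<le> v1 (p0, t0) + v2 (p0, t0) + \<xi> q + (Cb + 1) * (norm q)\<^sup>2" if "norm q < r'" for q
  proof -
    have "B q q \<le> Cb * (norm q)\<^sup>2" using Cb(2)[of q q] by (simp add: power2_eq_square mult.assoc abs_le_iff)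
    then show ?thesis using C1(2)[rule_format, of q t0] that C1(1) by (simp add: r'_def algebra_simps)
  qed
  \<comment> \<open>The supporting slopes of the two functions add up to the gradient of the sum,
    which the superjet bounds from above.\<close>
  have eq: "l1 q + l2 q = \<xi> q" for q
  proof -
    have "(\<lambda>q. l1 q + l2 q - \<xi> q) q = 0"
    proof (rule linear_nonpos_of_quadratic[OF _ r'(1), of _ "2 * C + Cb + 1"])
      show "linear (\<lambda>q. l1 q + l2 q - \<xi> q)" by (intro linear_compose_sub linear_compose_add l1 l2 lin)
      fix q :: heis assume q: "norm q < r'"
      then have "norm q < r" using r' by simp
      then show "l1 q + l2 q - \<xi> q \<le> (2 * C + Cb + 1) * (norm q)\<^sup>2"
        using sum[OF q] l1(2)[rule_format, of q] l2(2)[rule_format, of q] by (simp add: algebra_simps)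
    qed
    then show ?thesis by simp
  qed
  \<comment> \<open>Subtracting the supporting paraboloid of one function from the upper bound for
    the sum leaves an upper paraboloid for the other.\<close>
  have up1: "v1 (p0 \<odot> q, t0) \<le> v1 (p0, t0) + l1 q + C' * (norm q)\<^sup>2"
    and up2: "v2 (p0 \<odot> q, t0) \<le> v2 (p0, t0) + l2 q + C' * (norm q)\<^sup>2" if q: "norm q < r'" for q
  proof -
    have "norm q < r" using q r' by simp
    then show "v1 (p0 \<odot> q, t0) \<le> v1 (p0, t0) + l1 q + C' * (norm q)\<^sup>2" "v2 (p0 \<odot> q, t0) \<le> v2 (p0, t0) + l2 q + C' * (norm q)\<^sup>2"
      using sum[OF q] l1(2)[rule_format, of q] l2(2)[rule_format, of q] eq[of q] by (simp_all add: C'_def algebra_simps)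
  qed
  have "b - 2 * (B s1 s1 + B s2 s2) + H1 (grad2 l1) + H2 (grad2 l2) \<le> 0"
  proof (rule le_of_all_eps)
    fix \<delta> :: real assume \<delta>: "\<delta> > 0"
    obtain \<rho>1 where \<rho>1: "\<rho>1 > 0" "\<rho>1 \<le> r'" "\<forall>y s b \<xi> B q. norm y < \<rho>1 \<longrightarrow> \<bar>s - t0\<bar> < \<rho>1 \<longrightarrow>
      superjet v1 (p0 \<odot> y) s b \<xi> B \<longrightarrow> \<bar>\<xi> q - l1 q\<bar> \<le> \<delta> * norm q"
      by (rule superjet_gradient_freeze[OF cont(1) r'(1) C'(1) semiconvex_near_mono[OF sc(1) r'(2) C'(2)] l1(1) up1 \<delta>])
         (assumption, rule that)
    obtain \<rho>2 where \<rho>2: "\<rho>2 > 0" "\<rho>2 \<le> r'" "\<forall>y s b \<xi> B q. norm y < \<rho>2 \<longrightarrow> \<bar>s - t0\<bar> < \<rho>2 \<longrightarrow>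
      superjet v2 (p0 \<odot> y) s b \<xi> B \<longrightarrow> \<bar>\<xi> q - l2 q\<bar> \<le> \<delta> * norm q"
      by (rule superjet_gradient_freeze[OF cont(2) r'(1) C'(1) semiconvex_near_mono[OF sc(2) r'(2) C'(2)] l2(1) up2 \<delta>])
         (assumption, rule that)
    define \<rho> where "\<rho> = min \<rho>1 \<rho>2"
    have \<rho>: "\<rho> > 0" using \<rho>1 \<rho>2 by (simp add: \<rho>_def)
    \<comment> \<open>With frozen gradients each nonlinear term is a constant up to
      \<open>L1 * (2 * \<delta>)\<close>, so both functions are subsolutions of a linear inequality
      near the touching point.\<close>
    have "b - 2 * (B s1 s1 + B s2 s2) \<le> (- H1 (grad2 l1) + L1 * (2 * \<delta>)) + (- H2 (grad2 l2) + L1 * (2 * \<delta>))"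
    proof (rule linear_sum_superjet[OF s cont \<rho> _ _ J])
      show "b' - 2 * (B' s1 s1 + B' s2 s2) \<le> - H1 (grad2 l1) + L1 * (2 * \<delta>)"
        if y: "norm y < \<rho>" "\<bar>t - t0\<bar> < \<rho>" and J': "superjet v1 (p0 \<odot> y) t b' \<xi>' B'" for y t b' \<xi>' B'
      proof -
        have yr: "norm y < r" "\<bar>t - t0\<bar> < r" "norm y < \<rho>1" "\<bar>t - t0\<bar> < \<rho>1" using y \<rho>1 r' by (auto simp: \<rho>_def)
        have "\<bar>\<xi>' q - l1 q\<bar> \<le> \<delta> * norm q" for q using \<rho>1(3) yr(3,4) J' by blast
        then have "L1 * norm (grad2 \<xi>' - grad2 l1) \<le> L1 * (2 * \<delta>)" by (intro mult_left_mono norm_grad2_diff_le L1)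
        then show ?thesis
          using sub1[OF yr(1,2) J'] L1(2)[of "grad2 \<xi>'" "grad2 l1"] by (simp add: abs_le_iff)
      qed
      show "b' - 2 * (B' s1 s1 + B' s2 s2) \<le> - H2 (grad2 l2) + L1 * (2 * \<delta>)"
        if y: "norm y < \<rho>" "\<bar>t - t0\<bar> < \<rho>" and J': "superjet v2 (p0 \<odot> y) t b' \<xi>' B'" for y t b' \<xi>' B'
      proof -
        have yr: "norm y < r" "\<bar>t - t0\<bar> < r" "norm y < \<rho>2" "\<bar>t - t0\<bar> < \<rho>2" using y \<rho>1 r' by (auto simp: \<rho>_def)
        have "\<bar>\<xi>' q - l2 q\<bar> \<le> \<delta> * norm q" for q using \<rho>2(3) yr(3,4) J' by blast
        then have "L1 * norm (grad2 \<xi>' - grad2 l2) \<le> L1 * (2 * \<delta>)" by (intro mult_left_mono norm_grad2_diff_le L1)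
        then show ?thesis
          using sub2[OF yr(1,2) J'] L1(3)[of "grad2 \<xi>'" "grad2 l2"] by (simp add: abs_le_iff)
      qed
    qed
    then show "b - 2 * (B s1 s1 + B s2 s2) + H1 (grad2 l1) + H2 (grad2 l2) \<le> \<delta> * (4 * L1)" by (simp add: algebra_simps)
  qed
  moreover have "grad2 l1 + grad2 l2 = grad2 \<xi>"
    by (simp add: grad2_def vec_eq_iff forall_2 eq)
  ultimately show thesis using that by blast
qed

section \<open>Sup-convolution along left translates\<close>

text \<open>Left translations keep superjets intact. Restricting \<open>k\<close> to the unit ball
  makes the supremum attained for every continuous \<open>u\<close>, whatever its growth, and the
  squared Euclidean norm expands exactly to second order.\<close>

definition sup_conv :: "real \<Rightarrow> (heis \<times> real \<Rightarrow> real) \<Rightarrow> heis \<times> real \<Rightarrow> real" where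
  "sup_conv \<epsilon> u x = (SUP k\<in>cball 0 1. u (k \<odot> fst x, snd x) - (norm k)\<^sup>2 / \<epsilon>)"

lemma sup_conv_attained:
  assumes cont: "continuous_on UNIV u"
  obtains k where "norm k \<le> 1" "sup_conv \<epsilon> u x = u (k \<odot> fst x, snd x) - (norm k)\<^sup>2 / \<epsilon>"
    "\<forall>k'. norm k' \<le> 1 \<longrightarrow> u (k' \<odot> fst x, snd x) - (norm k')\<^sup>2 / \<epsilon> \<le> sup_conv \<epsilon> u x"
proof -
  let ?f = "\<lambda>k. u (k \<odot> fst x, snd x) - (norm k)\<^sup>2 * (1 / \<epsilon>)"
  have "continuous_on (cball 0 1) ?f"
    by (intro continuous_intros continuous_on_compose2[OF cont]) auto
  from continuous_attains_sup[OF compact_cball _ this]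
  obtain k where k: "k \<in> cball 0 1" "\<forall>k'\<in>cball 0 1. ?f k' \<le> ?f k" by auto
  have "sup_conv \<epsilon> u x = ?f k"
    unfolding sup_conv_def using k by (intro cSup_eq_maximum) auto
  with k show thesis by (intro that[of k]) auto
qed

lemma sup_conv_ge:
  assumes "continuous_on UNIV u" "norm k \<le> 1"
  shows "u (k \<odot> p, s) - (norm k)\<^sup>2 / \<epsilon> \<le> sup_conv \<epsilon> u (p, s)"
proof -
  obtain k0 where "\<forall>k'. norm k' \<le> 1 \<longrightarrow> u (k' \<odot> fst (p,s), snd (p,s)) - (norm k')\<^sup>2 / \<epsilon> \<le> sup_conv \<epsilon> u (p,s)"
    by (rule sup_conv_attained[OF assms(1)]) (rule that)
  then show ?thesis using assms(2) by simp
qed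

lemma continuous_on_sup_conv:
  assumes cont: "continuous_on UNIV u"
  shows "continuous_on UNIV (sup_conv \<epsilon> u)"
proof -
  have "\<exists>d>0. \<forall>x'. dist x' x < d \<longrightarrow> dist (sup_conv \<epsilon> u x') (sup_conv \<epsilon> u x) < e" if e: "e > 0" for x e
  proof -
    define X where "X = cball x 1 \<times> cball (0::heis) 1"
    define F where "F = (\<lambda>y::(heis \<times> real) \<times> heis. u (snd y \<odot> fst (fst y), snd (fst y)))"
    have "compact X" unfolding X_def by (intro compact_Times compact_cball)
    moreover have "continuous_on X F" unfolding F_def
      by (rule continuous_on_compose2[OF cont]) (auto intro!: continuous_intros)
    ultimately have "uniformly_continuous_on X F" by (intro compact_uniformly_continuous)
    moreover have "e / 2 > 0" using e by simp
    ultimately obtain d where d: "d > 0" "\<And>y y'. y \<in> X \<Longrightarrow> y' \<in> X \<Longrightarrow> dist y' y < d \<Longrightarrow> dist (F y') (F y) < e / 2"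
      unfolding uniformly_continuous_on_def by meson
    show ?thesis
    proof (rule exI[of _ "min d 1"], intro conjI allI impI)
      show "0 < min d 1" using d by simp
      fix x' assume x': "dist x' x < min d 1"
      have close: "\<bar>u (k \<odot> fst x', snd x') - u (k \<odot> fst x, snd x)\<bar> < e / 2" if "norm k \<le> 1" for k
      proof -
        have "(x', k) \<in> X" "(x, k) \<in> X" using that x' by (auto simp: X_def dist_commute)
        moreover have "dist (x', k) (x, k) < d" using x' by (simp add: dist_Pair_Pair)
        ultimately show ?thesis using d(2)[of "(x, k)" "(x', k)"] by (simp add: F_def dist_real_def)
      qed
      obtain k where k: "norm k \<le> 1" "sup_conv \<epsilon> u x = u (k \<odot> fst x, snd x) - (norm k)\<^sup>2 / \<epsilon>"
        "\<forall>k'. norm k' \<le> 1 \<longrightarrow> u (k' \<odot> fst x, snd x) - (norm k')\<^sup>2 / \<epsilon> \<le> sup_conv \<epsilon> u x"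
        by (rule sup_conv_attained[OF cont]) (rule that)
      obtain k' where k': "norm k' \<le> 1" "sup_conv \<epsilon> u x' = u (k' \<odot> fst x', snd x') - (norm k')\<^sup>2 / \<epsilon>"
        "\<forall>k. norm k \<le> 1 \<longrightarrow> u (k \<odot> fst x', snd x') - (norm k)\<^sup>2 / \<epsilon> \<le> sup_conv \<epsilon> u x'"
        by (rule sup_conv_attained[OF cont]) (rule that)
      have "sup_conv \<epsilon> u x - e / 2 \<le> sup_conv \<epsilon> u x'" using k k'(3)[rule_format, OF k(1)] close[OF k(1)] by linarith
      moreover have "sup_conv \<epsilon> u x' - e / 2 \<le> sup_conv \<epsilon> u x" using k' k(3)[rule_format, OF k'(1)] close[OF k'(1)] by linarith
      ultimately show "dist (sup_conv \<epsilon> u x') (sup_conv \<epsilon> u x) < e" using e by (simp add: dist_real_def abs_le_iff)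
    qed
  qed
  then show ?thesis unfolding continuous_on_iff by auto
qed

text \<open>At a maximizer \<open>k\<close> the translate of \<open>u\<close>, lowered by the
  penalty, touches the sup-convolution from below and inherits its superjet. Comparison with the
  identity bounds the penalty by an increment of \<open>u\<close>.\<close>

lemma sup_conv_superjet:
  assumes cont: "continuous_on UNIV u" and J: "superjet (sup_conv \<epsilon> u) p t b \<xi> B"
  obtains k where "norm k \<le> 1" "(norm k)\<^sup>2 / \<epsilon> \<le> u (k \<odot> p, t) - u (p, t)" "superjet u (k \<odot> p) t b \<xi> B"
proof -
  obtain k where k: "norm k \<le> 1" "sup_conv \<epsilon> u (p,t) = u (k \<odot> fst (p,t), snd (p,t)) - (norm k)\<^sup>2 / \<epsilon>"
    "\<forall>k'. norm k' \<le> 1 \<longrightarrow> u (k' \<odot> fst (p,t), snd (p,t)) - (norm k')\<^sup>2 / \<epsilon> \<le> sup_conv \<epsilon> u (p,t)"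
    by (rule sup_conv_attained[OF cont]) (rule that)
  have bound: "(norm k)\<^sup>2 / \<epsilon> \<le> u (k \<odot> p, t) - u (p, t)" using k(2) k(3)[rule_format, of 0] by simp
  have "superjet (\<lambda>x. u (k \<odot> fst x, 0 + snd x)) p t (b + 0) \<xi> B"
  proof (rule superjet_touch[OF J zero_less_one, of _ _ 0])
    fix q s
    have "u (k \<odot> (p \<odot> q), s) - (norm k)\<^sup>2 / \<epsilon> \<le> sup_conv \<epsilon> u (p \<odot> q, s)" by (rule sup_conv_ge[OF cont k(1)])
    then show "u (k \<odot> fst (p \<odot> q, s), 0 + snd (p \<odot> q, s)) - sup_conv \<epsilon> u (p \<odot> q, s)
      \<le> u (k \<odot> fst (p, t), 0 + snd (p, t)) - sup_conv \<epsilon> u (p, t) + 0 * (s - t) + 0 * (s - t)\<^sup>2"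
      using k(2) by simp
  qed
  then have "superjet u (k \<odot> p) (0 + t) (b + 0) \<xi> B" by (rule superjet_left_translate)
  then have "superjet u (k \<odot> p) t b \<xi> B" by simp
  with k(1) bound show thesis by (rule that)
qed

text \<open>When the point moves to \<open>p \<odot> q\<close>, the maximizer is moved to the
  \<open>k'\<close> with \<open>k' \<odot> (p \<odot> q) = k \<odot> p\<close>. The value of
  \<open>u\<close> does not change, and the penalty changes by an explicit quadratic function of
  \<open>q\<close>. The bound on \<open>\<epsilon>\<close> places \<open>k\<close> in the ball of
  radius one half, which leaves room for \<open>k'\<close> in the unit ball.\<close>

lemma sup_conv_semiconvex:
  assumes cont: "continuous_on UNIV u" and \<epsilon>: "\<epsilon> > 0" "\<epsilon> * (2 * M) \<le> 1 / 4"
    and M: "\<And>k y s. norm k \<le> 1 \<Longrightarrow> norm y < r0 \<Longrightarrow> \<bar>s - t0\<bar> < r0 \<Longrightarrow> \<bar>u (k \<odot> (p0 \<odot> y), s)\<bar> \<le> M"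
    and r0: "r0 > 0"
  obtains r C where "r > 0" "r \<le> r0" "C \<ge> 0" "semiconvex_near (sup_conv \<epsilon> u) p0 t0 r C"
proof -
  define R where "R = norm p0 + r0 + norm p0 * r0"
  have R0: "R \<ge> 0" using r0 by (simp add: R_def)
  \<comment> \<open>Makes the shift \<open>A (cc q)\<close> of the maximizer at most
    \<open>1 / 2\<close> in norm.\<close>
  define r where "r = min r0 (1 / (4 * (1 + 2 * R)))"
  have r: "r > 0" "r \<le> r0" "(1 + 2 * R) * r \<le> 1 / 4"
  proof -
    show "r > 0" "r \<le> r0" using r0 R0 by (auto simp: r_def)
    have "(1 + 2 * R) * r \<le> (1 + 2 * R) * (1 / (4 * (1 + 2 * R)))" using R0 by (intro mult_left_mono) (auto simp: r_def)
    also have "\<dots> = 1 / 4" using R0 by (simp add: field_simps)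
    finally show "(1 + 2 * R) * r \<le> 1 / 4" .
  qed
  define C where "C = 4 * (1 + 2 * R)\<^sup>2 / \<epsilon>"
  have C: "C \<ge> 0" using \<epsilon> by (simp add: C_def)
  have "semiconvex_near (sup_conv \<epsilon> u) p0 t0 r C"
    unfolding semiconvex_near_def
  proof (intro allI impI)
    fix y :: heis and s assume y: "norm y < r" "\<bar>s - t0\<bar> < r"
    define p where "p = p0 \<odot> y"
    have "norm p \<le> norm p0 + norm y + norm p0 * norm y" unfolding p_def by (rule norm_heis_mult_le)
    also have "\<dots> \<le> R" unfolding R_def using y r by (intro add_mono mult_left_mono) auto
    finally have pR: "norm p \<le> R" .
    have yr: "norm y < r0" "\<bar>s - t0\<bar> < r0" using y r by auto
    obtain k where k: "norm k \<le> 1" "sup_conv \<epsilon> u (p,s) = u (k \<odot> fst (p,s), snd (p,s)) - (norm k)\<^sup>2 / \<epsilon>"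
      "\<forall>k'. norm k' \<le> 1 \<longrightarrow> u (k' \<odot> fst (p,s), snd (p,s)) - (norm k')\<^sup>2 / \<epsilon> \<le> sup_conv \<epsilon> u (p,s)"
      by (rule sup_conv_attained[OF cont]) (rule that)
    have "(norm k)\<^sup>2 / \<epsilon> \<le> u (k \<odot> p, s) - u (0 \<odot> p, s)" using k(2) k(3)[rule_format, of 0] by simp
    also have "\<dots> \<le> 2 * M" using M[OF k(1) yr] M[of 0, OF _ yr] unfolding p_def by (simp add: abs_le_iff)
    finally have "(norm k)\<^sup>2 \<le> \<epsilon> * (2 * M)" using \<epsilon>(1) by (simp add: field_simps)
    then have "(norm k)\<^sup>2 \<le> (1/2)\<^sup>2" using \<epsilon>(2) by (simp add: power2_eq_square)
    then have khalf: "norm k \<le> 1 / 2" by (rule power2_le_imp_le) simp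
    define A where "A = (\<lambda>c. c + (0, 0, om k c))"
    have linA: "linear A" unfolding A_def
      by (rule linearI) (simp_all add: linear_add[OF linear_om] linear_scale[OF linear_om] prod_eq_iff algebra_simps)
    have nA: "norm (A c) \<le> 2 * norm c" for c
    proof -
      have "norm (A c) \<le> norm c + \<bar>om k c\<bar>" unfolding A_def by (metis norm_triangle_ineq norm_vert)
      also have "\<bar>om k c\<bar> \<le> 1 * norm c" by (rule order_trans[OF abs_om_le]) (use k(1) in \<open>intro mult_right_mono; simp\<close>)
      finally show ?thesis by simp
    qed
    define cc where "cc = (\<lambda>q. heis_conj p (- q))"
    have lincc: "linear cc" unfolding cc_def
      using linear_compose[OF linear_uminus linear_heis_conj[of p]] by (simp add: o_def)
    have ncc: "norm (cc q) \<le> (1 + 2 * R) * norm q" for q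
    proof -
      have "norm (cc q) \<le> (1 + 2 * norm p) * norm q" unfolding cc_def using norm_heis_conj_le[of p "- q"] by simp
      also have "\<dots> \<le> (1 + 2 * R) * norm q" using pR by (intro mult_right_mono) auto
      finally show ?thesis .
    qed
    define l where "l = (\<lambda>q. - (2 / \<epsilon>) * (k \<bullet> A (cc q)))"
    have "linear (\<lambda>q. k \<bullet> A (cc q))"
      using linear_compose[OF linear_compose[OF lincc linA] bounded_linear.linear[OF bounded_linear_inner_right[of k]]]
      by (simp add: o_def)
    then have linl: "linear l" unfolding l_def by (rule linear_mult_const)
    have "sup_conv \<epsilon> u (p, s) + l q - C * (norm q)\<^sup>2 \<le> sup_conv \<epsilon> u (p \<odot> q, s)" if q: "norm q < r" for q
    proof -
      define k' where "k' = k \<odot> cc q"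
      have k'A: "k' = k + A (cc q)" by (simp add: k'_def A_def heis_mult_eq)
      have "norm (A (cc q)) \<le> 2 * ((1 + 2 * R) * norm q)" using nA[of "cc q"] ncc[of q] by linarith
      moreover have "(1 + 2 * R) * norm q \<le> (1 + 2 * R) * r" using q R0 by (intro mult_left_mono) auto
      ultimately have "norm k' \<le> 1" using khalf r(3) norm_triangle_ineq[of k "A (cc q)"] unfolding k'A by linarith
      have "cc q \<odot> p = p \<odot> - q" unfolding cc_def by (rule heis_conj_mult)
      then have "k' \<odot> (p \<odot> q) = k \<odot> (p \<odot> (- q \<odot> q))" unfolding k'_def by (simp only: heis_assoc[symmetric]) (simp only: heis_assoc)
      then have kp: "k' \<odot> (p \<odot> q) = k \<odot> p" by simp
      have "u (k \<odot> p, s) - (norm k')\<^sup>2 / \<epsilon> \<le> sup_conv \<epsilon> u (p \<odot> q, s)"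
        using sup_conv_ge[OF cont \<open>norm k' \<le> 1\<close>, of "p \<odot> q" s \<epsilon>] unfolding kp .
      moreover have "(norm k')\<^sup>2 / \<epsilon> \<le> (norm k)\<^sup>2 / \<epsilon> - l q + C * (norm q)\<^sup>2"
      proof -
        have "(norm k')\<^sup>2 = (norm k)\<^sup>2 + 2 * (k \<bullet> A (cc q)) + (norm (A (cc q)))\<^sup>2"
          unfolding k'A by (simp add: power2_norm_eq_inner inner_add_left inner_add_right inner_commute)
        moreover have "(norm (A (cc q)))\<^sup>2 \<le> (2 * ((1 + 2 * R) * norm q))\<^sup>2"
        proof (rule power_mono)
          show "norm (A (cc q)) \<le> 2 * ((1 + 2 * R) * norm q)" using nA[of "cc q"] ncc[of q] by linarith
        qed simp
        ultimately have "(norm k')\<^sup>2 \<le> (norm k)\<^sup>2 + 2 * (k \<bullet> A (cc q)) + 4 * (1 + 2 * R)\<^sup>2 * (norm q)\<^sup>2"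
          by (simp add: power_mult_distrib mult.assoc)
        then have "(norm k')\<^sup>2 / \<epsilon> \<le> ((norm k)\<^sup>2 + 2 * (k \<bullet> A (cc q)) + 4 * (1 + 2 * R)\<^sup>2 * (norm q)\<^sup>2) / \<epsilon>"
          using \<epsilon>(1) by (intro divide_right_mono) auto
        then show ?thesis by (simp add: l_def C_def add_divide_distrib)
      qed
      ultimately show ?thesis using k(2) by simp
    qed
    with linl show "\<exists>l. linear l \<and> (\<forall>q. norm q < r \<longrightarrow> sup_conv \<epsilon> u (p0 \<odot> y, s) + l q - C * (norm q)\<^sup>2 \<le> sup_conv \<epsilon> u (p0 \<odot> y \<odot> q, s))"
      unfolding p_def by blast
  qed
  with r C show thesis by (intro that)
qed

section \<open>Growth barrier\<close>

definition bracket4 :: "heis \<Rightarrow> real" where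
  "bracket4 p = 1 + ((fst p)\<^sup>2)\<^sup>2 + ((fst (snd p))\<^sup>2)\<^sup>2 + 16 * (snd (snd p))\<^sup>2"

lemma bracket4_ge: "bracket4 p \<ge> 1" "bracket4 p \<ge> quartic p"
proof -
  have "0 \<le> ((fst p)\<^sup>2)\<^sup>2" "0 \<le> ((fst (snd p))\<^sup>2)\<^sup>2" "0 \<le> (snd (snd p))\<^sup>2" by simp_all
  then show "bracket4 p \<ge> 1" "bracket4 p \<ge> quartic p" unfolding bracket4_def quartic_def by linarith+
qed

lemma heis_bracket_eq: "heis_bracket p = root 4 (bracket4 p)"
  by (cases p) (simp add: bracket4_def)

lemma heis_bracket_ge: "heis_bracket p \<ge> 1"
  unfolding heis_bracket_eq using bracket4_ge(1)[of p] by simp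

lemma heis_bracket_pow4: "heis_bracket p ^ 4 = bracket4 p"
  unfolding heis_bracket_eq using bracket4_ge(1)[of p] by simp

lemma continuous_on_bracket4: "continuous_on S bracket4"
  unfolding bracket4_def[abs_def] by (intro continuous_intros)

lemma compact_bracket4: "compact {p. bracket4 p \<le> R}"
proof -
  have "closed {p. bracket4 p \<le> R}"
    by (intro closed_Collect_le continuous_on_bracket4 continuous_intros)
  moreover have "{p. bracket4 p \<le> R} = {q. quartic q \<le> R} \<inter> {p. bracket4 p \<le> R}"
    using bracket4_ge(2) by (auto intro: order_trans)
  ultimately show ?thesis using compact_Int_closed[OF compact_quartic] by metis
qed

text \<open>Translation by a bounded element adds bounded terms and, vertically, a term linear in
  \<open>p\<close>, whose square is dominated by the fourth powers. Through the fourth root, the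
  growth exponent then changes only by a factor.\<close>

lemma bracket4_translate:
  assumes "norm g \<le> R"
  shows "bracket4 (g \<odot> p) \<le> (12 + 16 * R^4 + 192 * R\<^sup>2) * bracket4 p"
proof -
  obtain a b c where g: "g = (a,b,c)" by (cases g)
  obtain x y z where p: "p = (x,y,z)" by (cases p)
  have R: "\<bar>a\<bar> \<le> R" "\<bar>b\<bar> \<le> R" "\<bar>c\<bar> \<le> R" using abs_coord_le_norm[of g] assms by (auto simp: g)
  have sq: "a\<^sup>2 \<le> R\<^sup>2" "b\<^sup>2 \<le> R\<^sup>2" "c\<^sup>2 \<le> R\<^sup>2"
    using R by (auto intro: power2_le_iff_abs_le[THEN iffD2] order_trans[OF abs_ge_zero])
  have q: "(a\<^sup>2)\<^sup>2 \<le> R^4" "(b\<^sup>2)\<^sup>2 \<le> R^4"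
    using power_mono[OF sq(1), of 2] power_mono[OF sq(2), of 2] by (simp_all add: power4_eq_xxxx power2_eq_square)
  have two: "(s + t)\<^sup>2 \<le> 2 * s\<^sup>2 + 2 * t\<^sup>2" for s t :: real
  proof -
    have "2 * s\<^sup>2 + 2 * t\<^sup>2 - (s + t)\<^sup>2 = (s - t)\<^sup>2" by (simp add: power2_eq_square algebra_simps)
    then show ?thesis using zero_le_power2[of "s - t"] by linarith
  qed
  have four: "((s + t)\<^sup>2)\<^sup>2 \<le> 8 * (s\<^sup>2)\<^sup>2 + 8 * (t\<^sup>2)\<^sup>2" for s t :: real
  proof -
    have "((s + t)\<^sup>2)\<^sup>2 \<le> (2 * s\<^sup>2 + 2 * t\<^sup>2)\<^sup>2" by (rule power_mono[OF two]) simp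
    also have "\<dots> \<le> 2 * (2 * s\<^sup>2)\<^sup>2 + 2 * (2 * t\<^sup>2)\<^sup>2" by (rule two)
    also have "\<dots> = 8 * (s\<^sup>2)\<^sup>2 + 8 * (t\<^sup>2)\<^sup>2" by (simp add: power_mult_distrib)
    finally show ?thesis .
  qed
  have x1: "s\<^sup>2 \<le> 1 + (s\<^sup>2)\<^sup>2" for s :: real
  proof -
    have "1 + (s\<^sup>2)\<^sup>2 - s\<^sup>2 = (s\<^sup>2 - 1/2)\<^sup>2 + 3/4" by (simp add: power2_eq_square algebra_simps)
    then show ?thesis using zero_le_power2[of "s\<^sup>2 - 1/2"] by linarith
  qed
  define w where "w = (a * y - x * b) / 2"
  have w: "w\<^sup>2 \<le> R\<^sup>2 * (2 + (x\<^sup>2)\<^sup>2 + (y\<^sup>2)\<^sup>2)"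
  proof -
    have "(a * y + (- x * b))\<^sup>2 \<le> 2 * (a * y)\<^sup>2 + 2 * (- x * b)\<^sup>2" by (rule two)
    then have "(a * y - x * b)\<^sup>2 \<le> 2 * (a\<^sup>2 * y\<^sup>2) + 2 * (b\<^sup>2 * x\<^sup>2)" by (simp add: power_mult_distrib mult.commute)
    moreover have "0 \<le> a\<^sup>2 * y\<^sup>2" "0 \<le> b\<^sup>2 * x\<^sup>2" by simp_all
    moreover have "w\<^sup>2 = (a * y - x * b)\<^sup>2 / 4" by (simp add: w_def power_divide)
    ultimately have "w\<^sup>2 \<le> a\<^sup>2 * y\<^sup>2 + b\<^sup>2 * x\<^sup>2" by linarith
    also have "\<dots> \<le> R\<^sup>2 * y\<^sup>2 + R\<^sup>2 * x\<^sup>2" using sq by (intro add_mono mult_right_mono) auto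
    also have "\<dots> = R\<^sup>2 * (x\<^sup>2 + y\<^sup>2)" by (simp add: algebra_simps)
    also have "\<dots> \<le> R\<^sup>2 * (2 + (x\<^sup>2)\<^sup>2 + (y\<^sup>2)\<^sup>2)" using x1[of x] x1[of y] by (intro mult_left_mono) auto
    finally show ?thesis .
  qed
  have z: "(c + z + w)\<^sup>2 \<le> 4 * c\<^sup>2 + 4 * w\<^sup>2 + 2 * z\<^sup>2"
  proof -
    have "(c + z + w)\<^sup>2 = ((c + w) + z)\<^sup>2" by (simp add: algebra_simps)
    also have "\<dots> \<le> 2 * (c + w)\<^sup>2 + 2 * z\<^sup>2" by (rule two)
    also have "\<dots> \<le> 2 * (2 * c\<^sup>2 + 2 * w\<^sup>2) + 2 * z\<^sup>2" using two[of c w] by simp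
    finally show ?thesis by simp
  qed
  define X where "X = (x\<^sup>2)\<^sup>2 + (y\<^sup>2)\<^sup>2"
  have X0: "X \<ge> 0" by (simp add: X_def)
  have "bracket4 (g \<odot> p) = 1 + ((a + x)\<^sup>2)\<^sup>2 + ((b + y)\<^sup>2)\<^sup>2 + 16 * (c + z + w)\<^sup>2"
    by (simp add: bracket4_def g p w_def)
  also have "\<dots> \<le> 1 + 8 * X + 16 * R^4 + 16 * (4 * R\<^sup>2 + 4 * (R\<^sup>2 * (2 + X)) + 2 * z\<^sup>2)"
  proof -
    have "w\<^sup>2 \<le> R\<^sup>2 * (2 + X)" using w by (simp add: X_def add.assoc)
    then have "16 * (c + z + w)\<^sup>2 \<le> 16 * (4 * R\<^sup>2 + 4 * (R\<^sup>2 * (2 + X)) + 2 * z\<^sup>2)" using z sq(3) by simp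
    then show ?thesis using four[of a x] four[of b y] q unfolding X_def by simp
  qed
  also have "\<dots> = 1 + 8 * X + 16 * R^4 + 192 * R\<^sup>2 + 64 * (R\<^sup>2 * X) + 32 * z\<^sup>2" by (simp add: algebra_simps)
  also have "\<dots> \<le> (12 + 16 * R^4 + 192 * R\<^sup>2) * (1 + X + 16 * z\<^sup>2)"
  proof -
    have "(12 + 16 * R^4 + 192 * R\<^sup>2) * (1 + X + 16 * z\<^sup>2) - (1 + 8 * X + 16 * R^4 + 192 * R\<^sup>2 + 64 * (R\<^sup>2 * X) + 32 * z\<^sup>2)
      = 11 + 4 * X + 160 * z\<^sup>2 + 16 * R^4 * X + 256 * R^4 * z\<^sup>2 + 128 * (R\<^sup>2 * X) + 3072 * R\<^sup>2 * z\<^sup>2"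
      by (simp add: algebra_simps)
    moreover have "0 \<le> 11 + 4 * X + 160 * z\<^sup>2 + 16 * R^4 * X + 256 * R^4 * z\<^sup>2 + 128 * (R\<^sup>2 * X) + 3072 * R\<^sup>2 * z\<^sup>2"
      using X0 by simp
    ultimately show ?thesis by linarith
  qed
  also have "1 + X + 16 * z\<^sup>2 = bracket4 p" by (simp add: bracket4_def p X_def)
  finally show ?thesis .
qed

lemma heis_bracket_translate:
  assumes "norm g \<le> R"
  shows "heis_bracket (g \<odot> p) \<le> root 4 (12 + 16 * R^4 + 192 * R\<^sup>2) * heis_bracket p"
  unfolding heis_bracket_eq real_root_mult[symmetric]
  using bracket4_translate[OF assms, of p] by simp

lemma space_jet_bracket4:
  "space_jet bracket4 p
    (\<lambda>q. 4 * fst p ^ 3 * fst q + 4 * fst (snd p) ^ 3 * fst (snd q) + 32 * snd (snd p) * (snd (snd q) + om p q))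
    (\<lambda>q r. 6 * (fst p)\<^sup>2 * (fst q * fst r) + 6 * (fst (snd p))\<^sup>2 * (fst (snd q) * fst (snd r))
      + 16 * ((snd (snd q) + om p q) * (snd (snd r) + om p r)))"
proof -
  note x2 = space_jet_square[OF space_jet_coordinates(1)[of p]]
  note y2 = space_jet_square[OF space_jet_coordinates(2)[of p]]
  note z2 = space_jet_cmult[OF space_jet_square[OF space_jet_coordinates(3)[of p]], of 16]
  note j = space_jet_add[OF space_jet_add[OF space_jet_add[OF space_jet_const[of 1 p] space_jet_square[OF x2]] space_jet_square[OF y2]] z2]
  show ?thesis
    using j unfolding bracket4_def[abs_def] by (simp add: algebra_simps power2_eq_square power3_eq_cube)
qed

text \<open>The mean value inequality is applied to \<open>\<Phi>\<close> minus its quadratic Taylor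
  polynomial; its derivative is \<open>o(s - s0)\<close> by differentiability of
  \<open>\<Phi>1\<close> at the single point \<open>s0\<close>.\<close>

lemma second_order_peano:
  fixes \<Phi> \<Phi>1 :: "real \<Rightarrow> real"
  assumes "d > 0" and D: "\<And>s. \<bar>s - s0\<bar> < d \<Longrightarrow> (\<Phi> has_real_derivative \<Phi>1 s) (at s)"
    and D2: "(\<Phi>1 has_real_derivative D2) (at s0)" and e: "e > 0"
  shows "\<exists>\<delta>>0. \<forall>a. \<bar>a\<bar> < \<delta> \<longrightarrow> \<bar>\<Phi> (s0 + a) - \<Phi> s0 - \<Phi>1 s0 * a - D2 / 2 * a\<^sup>2\<bar> \<le> e * a\<^sup>2"
proof -
  obtain d' where d'0: "d' > 0" and "\<forall>s. norm (s - s0) < d' \<longrightarrow> norm (\<Phi>1 s - \<Phi>1 s0 - D2 * (s - s0)) \<le> e * norm (s - s0)"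
    using D2 e unfolding has_field_derivative_def has_derivative_at_alt by blast
  then have d': "d' > 0" "\<And>s. \<bar>s - s0\<bar> < d' \<Longrightarrow> \<bar>\<Phi>1 s - \<Phi>1 s0 - D2 * (s - s0)\<bar> \<le> e * \<bar>s - s0\<bar>"
    by simp_all
  define \<delta> where "\<delta> = min d d'"
  have "\<bar>\<Phi> (s0 + a) - \<Phi> s0 - \<Phi>1 s0 * a - D2 / 2 * a\<^sup>2\<bar> \<le> e * a\<^sup>2" if a: "\<bar>a\<bar> < \<delta>" for a
  proof -
    define F where "F = (\<lambda>s. \<Phi> s - \<Phi>1 s0 * (s - s0) - D2 / 2 * (s - s0)\<^sup>2)"
    have DF: "(F has_real_derivative \<Phi>1 s - \<Phi>1 s0 - D2 * (s - s0)) (at s)" if "\<bar>s - s0\<bar> < d" for s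
      unfolding F_def by (auto intro!: derivative_eq_intros D[OF that])
    have "norm (F (s0 + a) - F s0) \<le> (e * \<bar>a\<bar>) * norm (s0 + a - s0)"
    proof (rule field_differentiable_bound[of "closed_segment s0 (s0 + a)"])
      fix s assume s: "s \<in> closed_segment s0 (s0 + a)"
      have sa: "\<bar>s - s0\<bar> \<le> \<bar>a\<bar>" using s unfolding closed_segment_eq_real_ivl by (auto split: if_splits)
      have "\<bar>s - s0\<bar> < d" "\<bar>s - s0\<bar> < d'" using sa a by (simp_all add: \<delta>_def)
      show "(F has_field_derivative \<Phi>1 s - \<Phi>1 s0 - D2 * (s - s0)) (at s within closed_segment s0 (s0 + a))"
        by (rule has_field_derivative_at_within[OF DF[OF \<open>\<bar>s - s0\<bar> < d\<close>]])
      have "e * \<bar>s - s0\<bar> \<le> e * \<bar>a\<bar>" using sa e by (intro mult_left_mono) auto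
      then show "norm (\<Phi>1 s - \<Phi>1 s0 - D2 * (s - s0)) \<le> e * \<bar>a\<bar>"
        using d'(2)[OF \<open>\<bar>s - s0\<bar> < d'\<close>] unfolding real_norm_def by linarith
    qed auto
    then show ?thesis by (simp add: F_def power2_eq_square mult.assoc)
  qed
  moreover have "\<delta> > 0" using d' \<open>d > 0\<close> by (simp add: \<delta>_def)
  ultimately show ?thesis by blast
qed

text \<open>With \<open>g\<close> the bracket at \<open>p\<close>, the horizontal derivatives of
  \<open>bracket4\<close> are of size \<open>g ^ 3\<close> and \<open>g\<^sup>2\<close>, while the
  outer derivative brings the factor \<open>k / (4 * g ^ 3)\<close>. Gradient and second-order term
  are thus bounded multiples of the exponential, which a factor \<open>exp (\<Lambda> * t)\<close>
  compensates. The numbers are \<open>56 / 4 = 14\<close>, \<open>(16 / 4)\<^sup>2 = 16\<close> and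
  \<open>2 * 16 / 4 = 8\<close>.\<close>

lemma growth_barrier:
  fixes k L1 :: real
  assumes s: "snd (snd s1) = 0" "snd (snd s2) = 0" and k: "k \<ge> 0" and L1: "L1 \<ge> 0"
  defines "\<Lambda> \<equiv> (14 * k + 16 * k\<^sup>2) * ((norm s1)\<^sup>2 + (norm s2)\<^sup>2) + 8 * k * L1"
  obtains \<xi> B where "space_jet (\<lambda>p. exp (k * heis_bracket p)) p \<xi> B"
    "2 * (B s1 s1 + B s2 s2) + L1 * norm (grad2 \<xi>) \<le> \<Lambda> * exp (k * heis_bracket p)"
proof -
  define g where "g = heis_bracket p"
  have g1: "g \<ge> 1" unfolding g_def by (rule heis_bracket_ge)
  define G where "G = bracket4 p"
  have G: "G \<ge> 1" "g ^ 4 = G" "root 4 G = g"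
    unfolding G_def g_def by (rule bracket4_ge heis_bracket_pow4 heis_bracket_eq[symmetric])+
  define \<Phi> where "\<Phi> = (\<lambda>s. exp (k * root 4 s))"
  define \<Phi>1 where "\<Phi>1 = (\<lambda>s. exp (k * root 4 s) * (k * inverse (4 * root 4 s ^ 3)))"
  have dr: "(root 4 has_real_derivative inverse (4 * root 4 s ^ 3)) (at s)" if "s > 0" for s
    using DERIV_real_root[of 4 s] that by (simp add: numeral_eq_Suc)
  have D: "(\<Phi> has_real_derivative \<Phi>1 s) (at s)" if "\<bar>s - G\<bar> < 1" for s
  proof -
    have "s > 0" using that G by linarith
    from DERIV_chain2[OF DERIV_exp DERIV_cmult[OF dr[OF this], of k]] show ?thesis unfolding \<Phi>_def \<Phi>1_def .
  qed
  define D2 where "D2 = exp (k * g) * ((k * inverse (4 * g ^ 3))\<^sup>2 - k * (12 * g\<^sup>2 * inverse (4 * g ^ 3)) / (4 * g ^ 3)\<^sup>2)"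
  have D2: "(\<Phi>1 has_real_derivative D2) (at G)"
  proof -
    have r0: "4 * root 4 G ^ 3 \<noteq> 0" using g1 by (simp add: G)
    have G0: "G > 0" using G(1) by simp
    note e = DERIV_chain2[OF DERIV_exp DERIV_cmult[OF dr[OF G0], of k]]
    note i = DERIV_cmult[OF DERIV_inverse_fun[OF DERIV_cmult[OF DERIV_power[OF dr[OF G0], of 3], of 4] r0], of k]
    show ?thesis
      unfolding \<Phi>1_def
      by (rule DERIV_cong[OF DERIV_mult[OF e i]], unfold G(3))
         (use g1 in \<open>simp add: D2_def power2_eq_square power3_eq_cube numeral_eq_Suc field_simps\<close>)
  qed
  \<comment> \<open>The discarded summand comes from the concavity of the fourth root and has the
    favourable sign.\<close>
  have D2le: "D2 \<le> exp (k * g) * (k\<^sup>2 * (inverse (4 * g ^ 3))\<^sup>2)"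
  proof -
    have "0 \<le> k * (12 * g\<^sup>2 * inverse (4 * g ^ 3)) / (4 * g ^ 3)\<^sup>2" using k g1 by simp
    then have "(k * inverse (4 * g ^ 3))\<^sup>2 - k * (12 * g\<^sup>2 * inverse (4 * g ^ 3)) / (4 * g ^ 3)\<^sup>2 \<le> k\<^sup>2 * (inverse (4 * g ^ 3))\<^sup>2"
      unfolding power_mult_distrib[of k "inverse (4 * g ^ 3)"] by linarith
    then show ?thesis unfolding D2_def by (rule mult_left_mono) simp
  qed
  define \<eta> where "\<eta> = (\<lambda>q. 4 * fst p ^ 3 * fst q + 4 * fst (snd p) ^ 3 * fst (snd q) + 32 * snd (snd p) * (snd (snd q) + om p q))"
  define A where "A = (\<lambda>q r. 6 * (fst p)\<^sup>2 * (fst q * fst r) + 6 * (fst (snd p))\<^sup>2 * (fst (snd q) * fst (snd r))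
      + 16 * ((snd (snd q) + om p q) * (snd (snd r) + om p r)))"
  have jG: "space_jet bracket4 p \<eta> A" unfolding \<eta>_def A_def by (rule space_jet_bracket4)
  have j: "space_jet (\<lambda>q. \<Phi> (bracket4 q)) p (\<lambda>q. \<Phi>1 G * \<eta> q) (\<lambda>q r. \<Phi>1 G * A q r + D2 / 2 * (\<eta> q * \<eta> r))"
  proof (rule space_jet_compose[OF jG])
    fix e :: real assume e: "e > 0"
    show "\<exists>\<delta>>0. \<forall>a. \<bar>a\<bar> < \<delta> \<longrightarrow> \<bar>\<Phi> (bracket4 p + a) - \<Phi> (bracket4 p) - \<Phi>1 G * a - D2 / 2 * a\<^sup>2\<bar> \<le> e * a\<^sup>2"
      using second_order_peano[OF zero_less_one D D2 e] unfolding G_def .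
  qed
  obtain x y z where p: "p = (x,y,z)" by (cases p)
  have x: "\<bar>x\<bar> \<le> g" "\<bar>y\<bar> \<le> g" "\<bar>z\<bar> \<le> g\<^sup>2 / 4"
  proof -
    have e: "(x\<^sup>2)\<^sup>2 \<le> (g\<^sup>2)\<^sup>2" "(y\<^sup>2)\<^sup>2 \<le> (g\<^sup>2)\<^sup>2" "z\<^sup>2 \<le> (g\<^sup>2 / 4)\<^sup>2"
    proof -
      have "(g\<^sup>2)\<^sup>2 = 1 + (x\<^sup>2)\<^sup>2 + (y\<^sup>2)\<^sup>2 + 16 * z\<^sup>2"
        using G(2) unfolding G_def bracket4_def p by (simp add: power4_eq_xxxx power2_eq_square)
      moreover have "0 \<le> (x\<^sup>2)\<^sup>2" "0 \<le> (y\<^sup>2)\<^sup>2" "0 \<le> z\<^sup>2" by simp_all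
      moreover have "(g\<^sup>2 / 4)\<^sup>2 = (g\<^sup>2)\<^sup>2 / 16" by (simp add: power_divide)
      ultimately show "(x\<^sup>2)\<^sup>2 \<le> (g\<^sup>2)\<^sup>2" "(y\<^sup>2)\<^sup>2 \<le> (g\<^sup>2)\<^sup>2" "z\<^sup>2 \<le> (g\<^sup>2 / 4)\<^sup>2" by linarith+
    qed
    have "x\<^sup>2 \<le> g\<^sup>2" "y\<^sup>2 \<le> g\<^sup>2" by (rule power2_le_imp_le[OF e(1)], simp) (rule power2_le_imp_le[OF e(2)], simp)
    then show "\<bar>x\<bar> \<le> g" "\<bar>y\<bar> \<le> g" using g1 by (auto intro!: power2_le_imp_le[of "\<bar>_\<bar>" g])
    show "\<bar>z\<bar> \<le> g\<^sup>2 / 4" using e(3) by (intro power2_le_imp_le[of "\<bar>z\<bar>" "g\<^sup>2 / 4"]) simp_all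
  qed
  have \<eta>b: "\<bar>\<eta> q\<bar> \<le> 16 * g ^ 3 * norm q" if q0: "snd (snd q) = 0" for q
  proof -
    obtain a b where q: "q = (a,b,0)" using q0 by (cases q) simp
    have ab: "\<bar>a\<bar> \<le> norm q" "\<bar>b\<bar> \<le> norm q" using abs_coord_le_norm[of q] by (auto simp: q)
    have m: "\<bar>u * v\<bar> \<le> U * V" if "\<bar>u\<bar> \<le> U" "\<bar>v\<bar> \<le> V" for u v U V :: real
      unfolding abs_mult using that by (intro mult_mono) auto
    have x3: "\<bar>x ^ 3\<bar> \<le> g ^ 3" "\<bar>y ^ 3\<bar> \<le> g ^ 3" using x by (auto simp: power_abs intro: power_mono)
    have "\<bar>x ^ 3 * a\<bar> \<le> g ^ 3 * norm q" "\<bar>y ^ 3 * b\<bar> \<le> g ^ 3 * norm q" by (rule m[OF x3(1) ab(1)] m[OF x3(2) ab(2)])+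
    moreover have "\<bar>z * (x * b)\<bar> \<le> g\<^sup>2 / 4 * (g * norm q)" "\<bar>z * (y * a)\<bar> \<le> g\<^sup>2 / 4 * (g * norm q)"
      by (rule m[OF x(3) m[OF x(1) ab(2)]] m[OF x(3) m[OF x(2) ab(1)]])+
    moreover have "g\<^sup>2 / 4 * (g * norm q) = g ^ 3 * norm q / 4" by (simp add: power2_eq_square power3_eq_cube)
    moreover have "\<eta> q = 4 * (x ^ 3 * a) + 4 * (y ^ 3 * b) + 16 * (z * (x * b)) - 16 * (z * (y * a))"
      by (simp add: \<eta>_def q p om_def field_simps)
    ultimately show ?thesis unfolding abs_le_iff by linarith
  qed
  have Ab: "2 * A q q \<le> 56 * g\<^sup>2 * (norm q)\<^sup>2" if q0: "snd (snd q) = 0" for q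
  proof -
    obtain a b where q: "q = (a,b,0)" using q0 by (cases q) simp
    have n: "(norm q)\<^sup>2 = a\<^sup>2 + b\<^sup>2" using norm_horizontal_sq[OF q0] by (simp add: q)
    have x2: "x\<^sup>2 \<le> g\<^sup>2" "y\<^sup>2 \<le> g\<^sup>2" using x power_mono[of "\<bar>x\<bar>" g 2] power_mono[of "\<bar>y\<bar>" g 2] by simp_all
    have "(x * b - a * y)\<^sup>2 + (x * a + y * b)\<^sup>2 = (x\<^sup>2 + y\<^sup>2) * (a\<^sup>2 + b\<^sup>2)" by (simp add: power2_eq_square algebra_simps)
    then have "(x * b - a * y)\<^sup>2 \<le> (x\<^sup>2 + y\<^sup>2) * (a\<^sup>2 + b\<^sup>2)" using zero_le_power2[of "x * a + y * b"] by linarith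
    also have "\<dots> \<le> (2 * g\<^sup>2) * (a\<^sup>2 + b\<^sup>2)" using x2 by (intro mult_right_mono) auto
    finally have c: "(x * b - a * y)\<^sup>2 \<le> 2 * (g\<^sup>2 * (a\<^sup>2 + b\<^sup>2))" by simp
    have "x\<^sup>2 * a\<^sup>2 \<le> g\<^sup>2 * (a\<^sup>2 + b\<^sup>2)" "y\<^sup>2 * b\<^sup>2 \<le> g\<^sup>2 * (a\<^sup>2 + b\<^sup>2)" using x2 by (intro mult_mono; simp)+
    moreover have "2 * A q q = 12 * (x\<^sup>2 * a\<^sup>2) + 12 * (y\<^sup>2 * b\<^sup>2) + 8 * (x * b - a * y)\<^sup>2"
      by (simp add: A_def q p om_def power2_eq_square field_simps)
    moreover have "0 \<le> g\<^sup>2 * (a\<^sup>2 + b\<^sup>2)" by simp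
    ultimately show ?thesis using c unfolding n mult.assoc[of 56] by linarith
  qed
  define E where "E = exp (k * g)"
  have E: "E > 0" by (simp add: E_def)
  have \<Phi>1G: "\<Phi>1 G = E * (k / (4 * g ^ 3))" unfolding \<Phi>1_def G(3) E_def by (simp add: field_simps)
  have \<Phi>1n: "\<Phi>1 G \<ge> 0" unfolding \<Phi>1G using E k g1 by simp
  have gne: "g \<noteq> 0" using g1 by simp
  have Bb: "2 * (\<Phi>1 G * A q q + D2 / 2 * (\<eta> q * \<eta> q)) \<le> E * (14 * k + 16 * k\<^sup>2) * (norm q)\<^sup>2" if q0: "snd (snd q) = 0" for q
  proof -
    have "\<Phi>1 G * (2 * A q q) \<le> \<Phi>1 G * (56 * g\<^sup>2 * (norm q)\<^sup>2)" using Ab[OF q0] \<Phi>1n by (rule mult_left_mono)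
    also have "\<dots> = E * (14 * k) * (norm q)\<^sup>2 * (1 / g)" unfolding \<Phi>1G using gne by (simp add: field_simps power2_eq_square power3_eq_cube)
    also have "\<dots> \<le> E * (14 * k) * (norm q)\<^sup>2 * 1" using E k g1 by (intro mult_left_mono) auto
    finally have 1: "\<Phi>1 G * (2 * A q q) \<le> E * (14 * k) * (norm q)\<^sup>2" by simp
    have "(\<eta> q)\<^sup>2 \<le> (16 * g ^ 3 * norm q)\<^sup>2" using \<eta>b[OF q0] power_mono[of "\<bar>\<eta> q\<bar>" "16 * g ^ 3 * norm q" 2] by simp
    have "D2 * (\<eta> q)\<^sup>2 \<le> (E * (k\<^sup>2 * (inverse (4 * g ^ 3))\<^sup>2)) * (\<eta> q)\<^sup>2"
      using D2le unfolding E_def by (intro mult_right_mono) auto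
    also have "\<dots> \<le> (E * (k\<^sup>2 * (inverse (4 * g ^ 3))\<^sup>2)) * (16 * g ^ 3 * norm q)\<^sup>2"
      using \<open>(\<eta> q)\<^sup>2 \<le> _\<close> E by (intro mult_left_mono) auto
    also have "\<dots> = E * (16 * k\<^sup>2) * (norm q)\<^sup>2" using gne by (simp add: field_simps power_mult_distrib power2_eq_square)
    finally have 2: "D2 * (\<eta> q)\<^sup>2 \<le> E * (16 * k\<^sup>2) * (norm q)\<^sup>2" .
    show ?thesis using 1 2 by (simp add: power2_eq_square algebra_simps)
  qed
  have gr: "norm (grad2 (\<lambda>q. \<Phi>1 G * \<eta> q)) \<le> 8 * k * E"
  proof -
    have n: "norm ((1,0,0)::heis) = 1" "norm ((0,1,0)::heis) = 1" by (simp_all add: norm_Pair)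
    have "norm (grad2 (\<lambda>q. \<Phi>1 G * \<eta> q)) \<le> (\<Sum>i\<in>UNIV. \<bar>grad2 (\<lambda>q. \<Phi>1 G * \<eta> q) $ i\<bar>)" by (rule norm_le_l1_cart)
    also have "\<dots> = \<Phi>1 G * \<bar>\<eta> (1,0,0)\<bar> + \<Phi>1 G * \<bar>\<eta> (0,1,0)\<bar>" using \<Phi>1n by (simp add: sum_2 grad2_def abs_mult)
    also have "\<dots> \<le> \<Phi>1 G * (16 * g ^ 3) + \<Phi>1 G * (16 * g ^ 3)"
      using \<eta>b[of "(1,0,0)"] \<eta>b[of "(0,1,0)"] \<Phi>1n unfolding n by (intro add_mono mult_left_mono) simp_all
    also have "\<dots> = 8 * k * E" unfolding \<Phi>1G using gne by (simp add: field_simps)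
    finally show ?thesis .
  qed
  show thesis
  proof (rule that)
    show "space_jet (\<lambda>p. exp (k * heis_bracket p)) p (\<lambda>q. \<Phi>1 G * \<eta> q) (\<lambda>q r. \<Phi>1 G * A q r + D2 / 2 * (\<eta> q * \<eta> r))"
      using j unfolding \<Phi>_def heis_bracket_eq .
    have "L1 * norm (grad2 (\<lambda>q. \<Phi>1 G * \<eta> q)) \<le> L1 * (8 * k * E)" using gr L1 by (rule mult_left_mono)
    then show "2 * (\<Phi>1 G * A s1 s1 + D2 / 2 * (\<eta> s1 * \<eta> s1) + (\<Phi>1 G * A s2 s2 + D2 / 2 * (\<eta> s2 * \<eta> s2)))
      + L1 * norm (grad2 (\<lambda>q. \<Phi>1 G * \<eta> q)) \<le> \<Lambda> * exp (k * heis_bracket p)"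
      using Bb[OF s(1)] Bb[OF s(2)] unfolding \<Lambda>_def E_def[symmetric] g_def[symmetric] by (simp add: algebra_simps)
  qed
qed

section \<open>The translation estimate\<close>

text \<open>Small factors on either side come from the maximizers of the sup-convolutions and from
  conjugated increments. Used with \<open>h\<close> itself and with the identity in its
  place.\<close>

lemma gauge_perturb:
  assumes "\<sigma> > 0"
  obtains \<kappa> where "\<kappa> > 0" "\<forall>a b. norm a < \<kappa> \<longrightarrow> norm b < \<kappa> \<longrightarrow> koranyi_gauge (a \<odot> h \<odot> b) < koranyi_gauge h + \<sigma>"
proof -
  have "continuous_on UNIV (\<lambda>x::heis \<times> heis. koranyi_gauge (fst x \<odot> h \<odot> snd x))"
    by (rule continuous_on_compose2[OF continuous_on_gauge[of UNIV]]) (auto intro!: continuous_intros)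
  then have "open {x::heis \<times> heis. koranyi_gauge (fst x \<odot> h \<odot> snd x) < koranyi_gauge h + \<sigma>}"
    by (intro open_Collect_less continuous_intros) auto
  moreover have "(0, 0) \<in> {x::heis \<times> heis. koranyi_gauge (fst x \<odot> h \<odot> snd x) < koranyi_gauge h + \<sigma>}"
    using assms by simp
  ultimately obtain \<kappa> where \<kappa>: "\<kappa> > 0" "ball (0,0) \<kappa> \<subseteq> {x::heis \<times> heis. koranyi_gauge (fst x \<odot> h \<odot> snd x) < koranyi_gauge h + \<sigma>}"
    unfolding open_contains_ball by blast
  show thesis
  proof (rule that[of "\<kappa> / 2"], use \<kappa>(1) in simp, intro allI impI)
    fix a b :: heis assume "norm a < \<kappa> / 2" "norm b < \<kappa> / 2"
    then have "norm (a, b) < \<kappa>" using norm_Pair_le[of a b] by simp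
    then have "(a, b) \<in> ball (0,0) \<kappa>" by (simp add: dist_norm norm_Pair)
    then show "koranyi_gauge (a \<odot> h \<odot> b) < koranyi_gauge h + \<sigma>" using \<kappa>(2) by auto
  qed
qed

lemma heis_bracket_translate_bound:
  obtains c where "c \<ge> 1" "\<forall>g p. norm g \<le> R \<longrightarrow> heis_bracket (g \<odot> p) \<le> c * heis_bracket p"
proof (rule that)
  have "0 \<le> R ^ 4" "0 \<le> R\<^sup>2" by simp_all
  then have "1 \<le> 12 + 16 * R ^ 4 + 192 * R\<^sup>2" by linarith
  then show "1 \<le> root 4 (12 + 16 * R ^ 4 + 192 * R\<^sup>2)" by simp
  show "\<forall>g p. norm g \<le> R \<longrightarrow> heis_bracket (g \<odot> p) \<le> root 4 (12 + 16 * R ^ 4 + 192 * R\<^sup>2) * heis_bracket p"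
    using heis_bracket_translate by blast
qed

lemma semiconvex_near_left_translate:
  assumes "semiconvex_near V (h \<odot> p) t r C"
  shows "semiconvex_near (\<lambda>x. V (h \<odot> fst x, snd x)) p t r C"
  using assms unfolding semiconvex_near_def by (simp add: heis_assoc)

text \<open>The hypotheses in jet form, for a function continuous at all times and with initial data
  already in right-invariant form. The supersolution condition is stated for \<open>- u\<close>, so
  that two subsolutions can be added. Since \<open>L0\<close> may be zero, the case of
  \<open>f\<close> independent of the point is an instance.\<close>

locale heis_parabolic =
  fixes s1 s2 :: heis and f :: "heis \<Rightarrow> real^2 \<Rightarrow> real" and u :: "heis \<times> real \<Rightarrow> real" and L0 L1 L :: real
  assumes s: "snd (snd s1) = 0" "snd (snd s2) = 0"
    and L1: "L1 \<ge> 0" "\<And>p a b. \<bar>f p a - f p b\<bar> \<le> L1 * norm (a - b)"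
    and L0: "L0 \<ge> 0" "\<And>p q a. \<bar>f p a - f q a\<bar> \<le> L0 * koranyi_gauge (p \<odot> - q)"
    and cont: "continuous_on UNIV u"
    and sub: "\<And>p t b \<xi> B. t > 0 \<Longrightarrow> superjet u p t b \<xi> B \<Longrightarrow> b - 2 * (B s1 s1 + B s2 s2) + f p (grad2 \<xi>) \<le> 0"
    and super: "\<And>p t b \<xi> B. t > 0 \<Longrightarrow> superjet (\<lambda>x. - u x) p t b \<xi> B \<Longrightarrow> b - 2 * (B s1 s1 + B s2 s2) - f p (- grad2 \<xi>) \<le> 0"
    and growth: "exp_growth u"
    and L: "L \<ge> 0" and init: "\<And>g p. u (g \<odot> p, 0) - u (p, 0) \<le> L * koranyi_gauge g"
begin

lemma cont_neg: "continuous_on UNIV (\<lambda>x. - u x)"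
  by (intro continuous_intros cont)

text \<open>The regularized difference of the translate and of \<open>u\<close> is compared with
  \<open>L * H + L0 * H * t\<close>, enlarged by small constants and by the growth barrier. At a
  first failure the sum inequality contradicts the time slope: the translation costs
  \<open>L0 * H\<close>, the gradient and second-order terms are paid for by the barrier, and
  \<open>\<sigma>\<close> outweighs the errors of regularization.\<close>

lemma right_translation_estimate:
  assumes "t \<ge> 0"
  shows "u (h \<odot> p, t) - u (p, t) \<le> (L + L0 * t) * koranyi_gauge h"
proof (rule ccontr)
  assume contra: "\<not> ?thesis"
  define \<gamma> where "\<gamma> = u (h \<odot> p, t) - u (p, t) - (L + L0 * t) * koranyi_gauge h"
  have \<gamma>: "\<gamma> > 0" using contra by (simp add: \<gamma>_def)
  define H where "H = koranyi_gauge h"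
  define T where "T = t + 1"
  have T: "T > 0" "t < T" using assms by (simp_all add: T_def)
  obtain k0 C0 where k0: "k0 > 0" "C0 > 0" "\<forall>p. \<forall>t\<in>{0..T}. \<bar>u (p, t)\<bar> \<le> C0 * exp (k0 * heis_bracket p)"
    using growth T unfolding exp_growth_def by meson
  \<comment> \<open>Bounds the norm of \<open>a \<odot> h\<close> for \<open>a\<close> in the unit
    ball, by \<open>norm_heis_mult_le\<close>.\<close>
  define Rg where "Rg = 1 + 2 * norm h"
  obtain c where c: "c \<ge> 1" "\<forall>g p. norm g \<le> Rg \<longrightarrow> heis_bracket (g \<odot> p) \<le> c * heis_bracket p"
    by (rule heis_bracket_translate_bound)
  \<comment> \<open>The factor \<open>c\<close> absorbs the translation of the bracket; the extra
    \<open>1\<close> lets the barrier outgrow the solution by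
    \<open>exp (heis_bracket q)\<close>.\<close>
  define k where "k = k0 * c + 1"
  have k: "k \<ge> 0" using k0 c by (simp add: k_def)
  define \<Lambda> where "\<Lambda> = (14 * k + 16 * k\<^sup>2) * ((norm s1)\<^sup>2 + (norm s2)\<^sup>2) + 8 * k * L1"
  define E where "E = (\<lambda>p. exp (k * heis_bracket p))"
  have E: "E q > 0" for q by (simp add: E_def)
  have \<Lambda>: "\<Lambda> \<ge> 0" using k L1 by (simp add: \<Lambda>_def)
  \<comment> \<open>At \<open>(p, t)\<close> the terms with \<open>\<sigma>\<close> and the barrier
    with \<open>\<eta>\<close> contribute \<open>\<gamma> / 4\<close> each, so half of the assumed
    excess remains for the final contradiction.\<close>
  define \<sigma> where "\<sigma> = \<gamma> / (4 * (1 + t))"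
  have \<sigma>: "\<sigma> > 0" using \<gamma> assms by (simp add: \<sigma>_def)
  define \<eta> where "\<eta> = \<gamma> / (4 * (exp (\<Lambda> * t) * E p))"
  have \<eta>: "\<eta> > 0" using \<gamma> E by (simp add: \<eta>_def)
  \<comment> \<open>Tolerance for the gauges of perturbed translations. Each of the two functions
    produces an error \<open>L0 * \<sigma>'\<close>, and together these must stay strictly below the
    time slope \<open>\<sigma>\<close>.\<close>
  define \<sigma>' where "\<sigma>' = \<sigma> / (2 * (L0 + L + 1))"
  have \<sigma>': "\<sigma>' > 0" "L * \<sigma>' \<le> \<sigma>" "2 * (L0 * \<sigma>') < \<sigma>"
  proof -
    have d: "2 * (L0 + L + 1) > 0" using L0 L by simp
    show p: "\<sigma>' > 0" using \<sigma> d by (simp add: \<sigma>'_def)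
    have eq: "(2 * (L0 + L + 1)) * \<sigma>' = \<sigma>" using d by (simp add: \<sigma>'_def)
    have "0 \<le> L * \<sigma>'" "0 \<le> L0 * \<sigma>'" using p L L0 by simp_all
    moreover have "(2 * (L0 + L + 1)) * \<sigma>' = 2 * (L0 * \<sigma>') + 2 * (L * \<sigma>') + 2 * \<sigma>'" by (simp add: algebra_simps)
    ultimately show "L * \<sigma>' \<le> \<sigma>" "2 * (L0 * \<sigma>') < \<sigma>" using eq p by linarith+
  qed
  obtain \<kappa>1 where \<kappa>1: "\<kappa>1 > 0" "\<forall>a b. norm a < \<kappa>1 \<longrightarrow> norm b < \<kappa>1 \<longrightarrow> koranyi_gauge (a \<odot> h \<odot> b) < koranyi_gauge h + \<sigma>'"
    by (rule gauge_perturb[OF \<sigma>'(1)])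
  obtain \<kappa>2 where \<kappa>2: "\<kappa>2 > 0" "\<forall>a b. norm a < \<kappa>2 \<longrightarrow> norm b < \<kappa>2 \<longrightarrow> koranyi_gauge (a \<odot> 0 \<odot> b) < koranyi_gauge 0 + \<sigma>'"
    by (rule gauge_perturb[OF \<sigma>'(1)])
  have g0: "koranyi_gauge 0 = 0" by (simp add: koranyi_gauge_eq)
  define \<kappa> where "\<kappa> = min \<kappa>1 \<kappa>2"
  have \<kappa>0: "\<kappa> > 0" using \<kappa>1 \<kappa>2 by (simp add: \<kappa>_def)
  have \<kappa>h: "koranyi_gauge (a \<odot> h \<odot> b) \<le> H + \<sigma>'" "koranyi_gauge (a \<odot> b) \<le> \<sigma>'" if "norm a < \<kappa>" "norm b < \<kappa>" for a b
    using \<kappa>1(2)[rule_format, of a b] \<kappa>2(2)[rule_format, of a b] that unfolding \<kappa>_def H_def g0 by simp_all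
  \<comment> \<open>Where \<open>bracket4 q = R\<close> this gives
    \<open>2 * C0 \<le> \<eta> * heis_bracket q\<close>, so on the lateral boundary the barrier
    exceeds the growth bounds of both functions together.\<close>
  define R where "R = max (bracket4 p) ((2 * C0 / \<eta>) ^ 4)"
  define K where "K = {q. bracket4 q \<le> R}"
  have compK: "compact K" unfolding K_def by (rule compact_bracket4)
  have pK: "p \<in> K" by (simp add: K_def R_def)
  define Y where "Y = (cball (0::heis) 1 \<times> K) \<times> {0..T}"
  have compY: "compact Y" unfolding Y_def by (intro compact_Times compK compact_cball compact_Icc)
  have "continuous_on Y (\<lambda>y. u (fst (fst y) \<odot> (h \<odot> snd (fst y)), snd y))" "continuous_on Y (\<lambda>y. u (fst (fst y) \<odot> snd (fst y), snd y))"
    by (rule continuous_on_compose2[OF cont]; auto intro!: continuous_intros)+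
  then have "bounded ((\<lambda>y. u (fst (fst y) \<odot> (h \<odot> snd (fst y)), snd y)) ` Y)" "bounded ((\<lambda>y. u (fst (fst y) \<odot> snd (fst y), snd y)) ` Y)"
    using compY by (auto intro: compact_imp_bounded compact_continuous_image)
  then obtain M1 M2 where M12: "\<forall>y\<in>Y. norm (u (fst (fst y) \<odot> (h \<odot> snd (fst y)), snd y)) \<le> M1"
    "\<forall>y\<in>Y. norm (u (fst (fst y) \<odot> snd (fst y), snd y)) \<le> M2"
    unfolding bounded_iff by (auto simp: image_iff)
  define M where "M = max M1 M2"
  have Mh: "\<bar>u (a \<odot> (h \<odot> q), s)\<bar> \<le> M" "\<bar>u (a \<odot> q, s)\<bar> \<le> M" if "norm a \<le> 1" "q \<in> K" "0 \<le> s" "s \<le> T" for a q s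
  proof -
    have "((a, q), s) \<in> Y" using that by (simp add: Y_def)
    then show "\<bar>u (a \<odot> (h \<odot> q), s)\<bar> \<le> M" "\<bar>u (a \<odot> q, s)\<bar> \<le> M"
      using M12 unfolding M_def by force+
  qed
  have M0: "M \<ge> 0"
  proof -
    have "\<bar>u (0 \<odot> p, 0)\<bar> \<le> M" using pK T by (intro Mh) auto
    then show ?thesis by linarith
  qed
  \<comment> \<open>The first entry of the minimum keeps the maximizers in the half ball, as
    semiconvexity requires; the second keeps them below \<open>\<kappa>\<close>. The bound
    \<open>M\<close> refers to the whole unit ball of translations and is thus fixed before
    \<open>\<epsilon>\<close>.\<close>
  define \<epsilon> where "\<epsilon> = min (1/4) (\<kappa>\<^sup>2 / 2) / (2 * M + 1)"
  have \<epsilon>: "\<epsilon> > 0" "\<epsilon> * (2 * M) \<le> 1 / 4" "\<epsilon> * (2 * M) < \<kappa>\<^sup>2"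
  proof -
    have m: "min (1/4) (\<kappa>\<^sup>2 / 2) > 0" using \<kappa>0 by simp
    then show e: "\<epsilon> > 0" using M0 by (simp add: \<epsilon>_def)
    have "\<epsilon> * (2 * M) \<le> \<epsilon> * (2 * M + 1)" using e by simp
    also have "\<dots> = min (1/4) (\<kappa>\<^sup>2 / 2)" using M0 by (simp add: \<epsilon>_def)
    finally have le: "\<epsilon> * (2 * M) \<le> min (1/4) (\<kappa>\<^sup>2 / 2)" .
    then show "\<epsilon> * (2 * M) \<le> 1 / 4" by simp
    have "\<kappa>\<^sup>2 / 2 < \<kappa>\<^sup>2" using \<kappa>0 by simp
    moreover have "\<epsilon> * (2 * M) \<le> \<kappa>\<^sup>2 / 2" using le min.cobounded2 by (rule order_trans)
    ultimately show "\<epsilon> * (2 * M) < \<kappa>\<^sup>2" by linarith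
  qed
  have small: "norm a < \<kappa>" if "(norm a)\<^sup>2 / \<epsilon> \<le> 2 * M" for a :: heis
  proof -
    have "(norm a)\<^sup>2 \<le> \<epsilon> * (2 * M)" using that \<epsilon>(1) by (simp add: field_simps)
    then have "(norm a)\<^sup>2 < \<kappa>\<^sup>2" using \<epsilon>(3) by simp
    then show ?thesis using \<kappa>0 by (intro power2_less_imp_less[of "norm a" \<kappa>]) auto
  qed
  define V1 where "V1 = (\<lambda>x::heis \<times> real. sup_conv \<epsilon> u (h \<odot> fst x, snd x))"
  define V2 where "V2 = sup_conv \<epsilon> (\<lambda>x. - u x)"
  have cV: "continuous_on UNIV V1" "continuous_on UNIV V2"
    unfolding V1_def V2_def
    by (rule continuous_on_compose2[OF continuous_on_sup_conv[OF cont]]; auto intro!: continuous_intros)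
       (rule continuous_on_sup_conv[OF cont_neg])
  define w where "w = (\<lambda>x. V1 x + V2 x)"
  define \<Psi> where "\<Psi> = (\<lambda>x::heis \<times> real. (\<eta> * exp (\<Lambda> * snd x)) * E (fst x) + (L * H + \<sigma> + (L0 * H + \<sigma>) * snd x))"
  have "w (p, t) \<le> \<Psi> (p, t)"
  proof (rule cylinder_comparison[of K 0 T w \<Psi> "{q. bracket4 q < R}"])
    show "compact K" by (rule compK)
    show "0 < T" by (rule T)
    show "continuous_on (K \<times> {0..T}) w" unfolding w_def
      by (intro continuous_intros continuous_on_subset[OF cV(1)] continuous_on_subset[OF cV(2)]) auto
    show "continuous_on (K \<times> {0..T}) \<Psi>"
    proof -
      have "continuous_on X (\<lambda>x. heis_bracket (fst x))" for X :: "(heis \<times> real) set"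
        unfolding heis_bracket_eq
        by (intro continuous_intros continuous_on_compose2[OF continuous_on_bracket4[of UNIV]]) auto
      then show ?thesis unfolding \<Psi>_def E_def by (intro continuous_intros)
    qed
    show "p \<in> K" "0 \<le> t" "t \<le> T" using pK assms T by auto
  next
    fix q assume q: "q \<in> K"
    obtain a where a: "norm a \<le> 1" "sup_conv \<epsilon> u (h \<odot> q, 0) = u (a \<odot> (h \<odot> q), 0) - (norm a)\<^sup>2 / \<epsilon>"
      "\<forall>k'. norm k' \<le> 1 \<longrightarrow> u (k' \<odot> (h \<odot> q), 0) - (norm k')\<^sup>2 / \<epsilon> \<le> sup_conv \<epsilon> u (h \<odot> q, 0)"
      by (rule sup_conv_attained[OF cont, of \<epsilon> "(h \<odot> q, 0)", unfolded fst_conv snd_conv]) (rule that)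
    obtain b where b: "norm b \<le> 1" "sup_conv \<epsilon> (\<lambda>x. - u x) (q, 0) = - u (b \<odot> q, 0) - (norm b)\<^sup>2 / \<epsilon>"
      "\<forall>k'. norm k' \<le> 1 \<longrightarrow> - u (k' \<odot> q, 0) - (norm k')\<^sup>2 / \<epsilon> \<le> sup_conv \<epsilon> (\<lambda>x. - u x) (q, 0)"
      by (rule sup_conv_attained[OF cont_neg, of \<epsilon> "(q, 0)", unfolded fst_conv snd_conv]) (rule that)
    have bd: "\<bar>u (a \<odot> (h \<odot> q), 0)\<bar> \<le> M" "\<bar>u (0 \<odot> (h \<odot> q), 0)\<bar> \<le> M" "\<bar>u (b \<odot> q, 0)\<bar> \<le> M" "\<bar>u (0 \<odot> q, 0)\<bar> \<le> M"
      using a(1) b(1) q T by (intro Mh; simp)+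
    have "(norm a)\<^sup>2 / \<epsilon> \<le> 2 * M" using a(2) a(3)[rule_format, of 0] bd(1,2) by (simp add: abs_le_iff)
    then have na: "norm a < \<kappa>" by (rule small)
    have "(norm b)\<^sup>2 / \<epsilon> \<le> 2 * M" using b(2) b(3)[rule_format, of 0] bd(3,4) by (simp add: abs_le_iff)
    then have nb: "norm (- b) < \<kappa>" using small[of b] by simp
    have "w (q, 0) \<le> u (a \<odot> (h \<odot> q), 0) - u (b \<odot> q, 0)"
    proof -
      have "0 \<le> (norm a)\<^sup>2 / \<epsilon>" "0 \<le> (norm b)\<^sup>2 / \<epsilon>" using \<epsilon>(1) by simp_all
      then show ?thesis unfolding w_def V1_def V2_def using a(2) b(2) by simp
    qed
    \<comment> \<open>The two displaced points differ by the left translation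
      \<open>a \<odot> h \<odot> - b\<close>, a small perturbation of \<open>h\<close>, so the
      initial estimate applies directly.\<close>
    also have "a \<odot> (h \<odot> q) = (a \<odot> h \<odot> - b) \<odot> (b \<odot> q)" by (simp add: heis_assoc)
    also have "u (\<dots>, 0) - u (b \<odot> q, 0) \<le> L * koranyi_gauge (a \<odot> h \<odot> - b)" by (rule init)
    also have "\<dots> \<le> L * (H + \<sigma>')" using \<kappa>h(1)[OF na nb] L by (rule mult_left_mono)
    also have "\<dots> \<le> L * H + \<sigma>" using \<sigma>'(2) by (simp add: distrib_left)
    also have "\<dots> \<le> \<Psi> (q, 0)" using \<eta> E[of q] by (simp add: \<Psi>_def)
    finally show "w (q, 0) \<le> \<Psi> (q, 0)" .
  next
    fix q t assume q: "q \<in> K" "q \<notin> {q. bracket4 q < R}" and t: "0 \<le> t" "t \<le> T"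
    have qR: "bracket4 q = R" using q by (simp add: K_def)
    obtain a where a: "norm a \<le> 1" "sup_conv \<epsilon> u (h \<odot> q, t) = u (a \<odot> (h \<odot> q), t) - (norm a)\<^sup>2 / \<epsilon>"
      by (rule sup_conv_attained[OF cont, of \<epsilon> "(h \<odot> q, t)", unfolded fst_conv snd_conv]) (rule that)
    obtain b where b: "norm b \<le> 1" "sup_conv \<epsilon> (\<lambda>x. - u x) (q, t) = - u (b \<odot> q, t) - (norm b)\<^sup>2 / \<epsilon>"
      by (rule sup_conv_attained[OF cont_neg, of \<epsilon> "(q, t)", unfolded fst_conv snd_conv]) (rule that)
    have bu: "\<bar>u (g \<odot> q, t)\<bar> \<le> C0 * exp ((k - 1) * heis_bracket q)" if g: "norm g \<le> Rg" for g
    proof -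
      have "\<bar>u (g \<odot> q, t)\<bar> \<le> C0 * exp (k0 * heis_bracket (g \<odot> q))" using k0(3) t by simp
      also have "\<dots> \<le> C0 * exp (k0 * (c * heis_bracket q))"
        using k0 c(2) g by (intro mult_left_mono exp_le_cancel_iff[THEN iffD2]) simp_all
      finally show ?thesis by (simp add: k_def mult.assoc)
    qed
    have "norm (a \<odot> h) \<le> norm a + norm h + norm a * norm h" by (rule norm_heis_mult_le)
    also have "\<dots> \<le> Rg" using a(1) mult_right_mono[OF a(1), of "norm h"] by (simp add: Rg_def)
    finally have "\<bar>u (a \<odot> (h \<odot> q), t)\<bar> \<le> C0 * exp ((k - 1) * heis_bracket q)" using bu[of "a \<odot> h"] by (simp add: heis_assoc)
    moreover have "norm b \<le> Rg" using b(1) by (simp add: Rg_def) (use norm_ge_zero[of h] in linarith)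
    then have "\<bar>u (b \<odot> q, t)\<bar> \<le> C0 * exp ((k - 1) * heis_bracket q)" by (rule bu)
    moreover have "w (q, t) \<le> u (a \<odot> (h \<odot> q), t) - u (b \<odot> q, t)"
    proof -
      have "0 \<le> (norm a)\<^sup>2 / \<epsilon>" "0 \<le> (norm b)\<^sup>2 / \<epsilon>" using \<epsilon>(1) by simp_all
      then show ?thesis unfolding w_def V1_def V2_def using a(2) b(2) by simp
    qed
    ultimately have "w (q, t) \<le> 2 * C0 * exp ((k - 1) * heis_bracket q)" unfolding abs_le_iff by linarith
    also have "\<dots> \<le> \<eta> * exp (heis_bracket q) * exp ((k - 1) * heis_bracket q)"
    proof (rule mult_right_mono)
      have pos: "2 * C0 / \<eta> \<ge> 0" using k0 \<eta> by simp
      have "2 * C0 / \<eta> = root 4 ((2 * C0 / \<eta>) ^ 4)" using pos by (simp add: real_root_power_cancel)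
      also have "\<dots> \<le> root 4 R" by (simp add: R_def)
      also have "\<dots> = heis_bracket q" by (simp add: heis_bracket_eq qR)
      also have "\<dots> \<le> exp (heis_bracket q)" using exp_ge_add_one_self[of "heis_bracket q"] by linarith
      finally show "2 * C0 \<le> \<eta> * exp (heis_bracket q)" using \<eta> by (simp add: field_simps)
    qed simp
    also have "\<dots> = \<eta> * 1 * E q" by (simp add: E_def mult.assoc exp_add[symmetric] algebra_simps)
    also have "\<dots> \<le> (\<eta> * exp (\<Lambda> * t)) * E q" using \<eta> E[of q] \<Lambda> t by (intro mult_right_mono mult_left_mono) simp_all
    also have "\<dots> \<le> \<Psi> (q, t)"
    proof -
      have "0 \<le> L * H + \<sigma> + (L0 * H + \<sigma>) * t"
        using L L0 \<sigma> t gauge_nonneg[of h] unfolding H_def by simp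
      then show ?thesis by (simp add: \<Psi>_def)
    qed
    finally show "w (q, t) \<le> \<Psi> (q, t)" .
  next
    fix q t d \<Lambda>' assume q: "q \<in> K" "q \<in> {q. bracket4 q < R}" and t: "0 < t" "t < T" and d: "(0::real) \<le> d"
      and max: "\<And>q' s. q' \<in> K \<Longrightarrow> 0 \<le> s \<Longrightarrow> s \<le> T \<Longrightarrow> w (q', s) - \<Psi> (q', s) \<le> w (q, t) - \<Psi> (q, t) + d * (s - t) + \<Lambda>' * (s - t)\<^sup>2"
    have "open {y. bracket4 (q \<odot> y) < R}"
      by (intro open_Collect_less continuous_on_compose2[OF continuous_on_bracket4[of UNIV]] continuous_intros) auto
    moreover have "0 \<in> {y. bracket4 (q \<odot> y) < R}" using q by simp
    ultimately obtain r1 where r1: "r1 > 0" "ball 0 r1 \<subseteq> {y. bracket4 (q \<odot> y) < R}"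
      unfolding open_contains_ball by blast
    \<comment> \<open>Keeps the points inside the sublevel set, the times inside the open interval,
      and the conjugated increments below \<open>\<kappa>\<close>.\<close>
    define r0 where "r0 = min r1 (min (min t (T - t)) (\<kappa> / (1 + 2 * norm q)))"
    have nq: "1 + 2 * norm q > 0" by (simp add: add_pos_nonneg)
    have r0: "r0 > 0" using r1 t \<kappa>0 nq by (simp add: r0_def)
    have r0K: "q \<odot> y \<in> K" if "norm y < r0" for y
    proof -
      have "y \<in> ball 0 r1" using that by (simp add: r0_def)
      then show ?thesis using r1(2) by (auto simp: K_def intro: less_imp_le)
    qed
    have r0t: "0 < s" "s < T" if "\<bar>s - t\<bar> < r0" for s using that by (auto simp: r0_def)
    have r0\<kappa>: "norm (heis_conj q y) < \<kappa>" if "norm y < r0" for y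
    proof -
      have "norm (heis_conj q y) \<le> (1 + 2 * norm q) * norm y" by (rule norm_heis_conj_le)
      also have "\<dots> < (1 + 2 * norm q) * (\<kappa> / (1 + 2 * norm q))" using that nq by (intro mult_strict_left_mono) (auto simp: r0_def)
      also have "\<dots> = \<kappa>" using nq by simp
      finally show ?thesis .
    qed
    obtain ra Ca where ra: "ra > 0" "ra \<le> r0" "Ca \<ge> 0" "semiconvex_near (sup_conv \<epsilon> u) (h \<odot> q) t ra Ca"
    proof (rule sup_conv_semiconvex[OF cont \<epsilon>(1,2) _ r0])
      show "\<bar>u (k \<odot> (h \<odot> q \<odot> y), s)\<bar> \<le> M" if "norm k \<le> 1" "norm y < r0" "\<bar>s - t\<bar> < r0" for k y s
        using Mh(1)[OF that(1) r0K[OF that(2)], of s] r0t[OF that(3)] by (simp add: heis_assoc)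
    qed (rule that)
    obtain rb Cb where rb: "rb > 0" "rb \<le> r0" "Cb \<ge> 0" "semiconvex_near V2 q t rb Cb"
    proof (rule sup_conv_semiconvex[OF cont_neg \<epsilon>(1,2) _ r0, folded V2_def])
      show "\<bar>- u (k \<odot> (q \<odot> y), s)\<bar> \<le> M" if "norm k \<le> 1" "norm y < r0" "\<bar>s - t\<bar> < r0" for k y s
        using Mh(2)[OF that(1) r0K[OF that(2)], of s] r0t[OF that(3)] by simp
    qed (rule that)
    define r where "r = min ra rb"
    define C where "C = max Ca Cb"
    have r: "r > 0" "r \<le> r0" "C \<ge> 0" using ra rb by (auto simp: r_def C_def)
    have "semiconvex_near V1 q t ra Ca" unfolding V1_def by (rule semiconvex_near_left_translate[OF ra(4)])
    then have sc1: "semiconvex_near V1 q t r C" by (rule semiconvex_near_mono) (simp_all add: r_def C_def)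
    have sc2: "semiconvex_near V2 q t r C" by (rule semiconvex_near_mono[OF rb(4)]) (simp_all add: r_def C_def)
    obtain \<xi>E BE where jE: "space_jet (\<lambda>p. exp (k * heis_bracket p)) q \<xi>E BE"
      "2 * (BE s1 s1 + BE s2 s2) + L1 * norm (grad2 \<xi>E) \<le> \<Lambda> * exp (k * heis_bracket q)"
      by (rule growth_barrier[OF s k L1(1), folded \<Lambda>_def]) (rule that)
    define m where "m = \<eta> * exp (\<Lambda> * t)"
    have m: "m > 0" using \<eta> by (simp add: m_def)
    have "\<exists>\<delta>>0. \<exists>Ct. \<forall>s. \<bar>s - t\<bar> < \<delta> \<longrightarrow> \<bar>\<eta> * exp (\<Lambda> * s) - \<eta> * exp (\<Lambda> * t) - m * \<Lambda> * (s - t)\<bar> \<le> Ct * (s - t)\<^sup>2"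
    proof -
      have D1: "((\<lambda>s. \<eta> * exp (\<Lambda> * s)) has_real_derivative \<eta> * exp (\<Lambda> * s) * \<Lambda>) (at s)" for s
        by (auto intro!: derivative_eq_intros)
      have D2: "((\<lambda>s. \<eta> * exp (\<Lambda> * s) * \<Lambda>) has_real_derivative \<eta> * exp (\<Lambda> * t) * \<Lambda> * \<Lambda>) (at t)"
        by (auto intro!: derivative_eq_intros)
      obtain \<delta> where \<delta>: "\<delta> > 0" "\<forall>a. \<bar>a\<bar> < \<delta> \<longrightarrow> \<bar>\<eta> * exp (\<Lambda> * (t + a)) - \<eta> * exp (\<Lambda> * t) - \<eta> * exp (\<Lambda> * t) * \<Lambda> * a
        - \<eta> * exp (\<Lambda> * t) * \<Lambda> * \<Lambda> / 2 * a\<^sup>2\<bar> \<le> 1 * a\<^sup>2"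
        using second_order_peano[OF zero_less_one D1 D2 zero_less_one] by blast
      define Q where "Q = \<eta> * exp (\<Lambda> * t) * \<Lambda> * \<Lambda> / 2"
      have "\<bar>\<eta> * exp (\<Lambda> * s) - \<eta> * exp (\<Lambda> * t) - m * \<Lambda> * (s - t)\<bar> \<le> (1 + \<bar>Q\<bar>) * (s - t)\<^sup>2" if "\<bar>s - t\<bar> < \<delta>" for s
      proof -
        have "\<bar>Q * (s - t)\<^sup>2\<bar> \<le> \<bar>Q\<bar> * (s - t)\<^sup>2" by (simp add: abs_mult)
        then show ?thesis using \<delta>(2)[rule_format, of "s - t"] that unfolding m_def Q_def[symmetric] distrib_right by simp
      qed
      with \<delta>(1) show ?thesis by blast
    qed
    then obtain \<delta>t Ct where \<delta>t: "\<delta>t > 0" "\<And>s. \<bar>s - t\<bar> < \<delta>t \<Longrightarrow> \<bar>\<eta> * exp (\<Lambda> * s) - \<eta> * exp (\<Lambda> * t) - m * \<Lambda> * (s - t)\<bar> \<le> Ct * (s - t)\<^sup>2"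
      by blast
    have 1: "superjet (\<lambda>x. (\<lambda>s. \<eta> * exp (\<Lambda> * s)) (snd x) * (\<lambda>p. exp (k * heis_bracket p)) (fst x)) q t (m * \<Lambda> * exp (k * heis_bracket q))
      (\<lambda>y. (\<lambda>s. \<eta> * exp (\<Lambda> * s)) t * \<xi>E y) (\<lambda>y z. (\<lambda>s. \<eta> * exp (\<Lambda> * s)) t * BE y z)"
      by (rule superjet_time_mult[OF jE(1) \<delta>t])
    have 2: "superjet (\<lambda>x. (\<lambda>s. L * H + \<sigma> + (L0 * H + \<sigma>) * s) (snd x) * (\<lambda>_. 1) (fst x)) q t ((L0 * H + \<sigma>) * (\<lambda>_. 1) q)
      (\<lambda>y. (\<lambda>s. L * H + \<sigma> + (L0 * H + \<sigma>) * s) t * (\<lambda>_. 0) y) (\<lambda>y z. (\<lambda>s. L * H + \<sigma> + (L0 * H + \<sigma>) * s) t * (\<lambda>_ _. 0) y z)"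
      by (rule superjet_time_mult[OF space_jet_const zero_less_one, of _ _ _ 0]) (simp add: algebra_simps)
    have P: "superjet \<Psi> q t (m * \<Lambda> * E q + (L0 * H + \<sigma>)) (\<lambda>y. m * \<xi>E y) (\<lambda>y z. m * BE y z)"
      using superjet_add[OF 1 2] unfolding \<Psi>_def E_def m_def by simp
    have J: "superjet (\<lambda>x. V1 x + V2 x) q t ((m * \<Lambda> * E q + (L0 * H + \<sigma>)) + d) (\<lambda>y. m * \<xi>E y) (\<lambda>y z. m * BE y z)"
    proof (rule superjet_touch[OF P r0])
      fix y :: heis and s' assume y: "norm y < r0" "\<bar>s' - t\<bar> < r0"
      show "V1 (q \<odot> y, s') + V2 (q \<odot> y, s') - \<Psi> (q \<odot> y, s') \<le> V1 (q, t) + V2 (q, t) - \<Psi> (q, t) + d * (s' - t) + \<Lambda>' * (s' - t)\<^sup>2"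
        using max[OF r0K[OF y(1)], of s'] r0t[OF y(2)] by (simp add: w_def)
    qed
    \<comment> \<open>Both nonlinearities are frozen at \<open>q\<close>. The points at which
      \<open>f\<close> is actually evaluated lie within gauge \<open>H + \<sigma>'\<close> of
      \<open>q\<close> for the translate and within \<open>\<sigma>'\<close> for \<open>u\<close>;
      the cost by (A2') is subtracted in advance.\<close>
    define H1 where "H1 = (\<lambda>a. f q a - L0 * (H + \<sigma>'))"
    define H2 where "H2 = (\<lambda>a. - f q (- a) - L0 * \<sigma>')"
    have lip: "\<bar>H1 a - H1 b\<bar> \<le> L1 * norm (a - b)" "\<bar>H2 a - H2 b\<bar> \<le> L1 * norm (a - b)" for a b
      using L1(2)[of q a b] L1(2)[of q "- b" "- a"] by (simp_all add: H1_def H2_def norm_minus_commute)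
    \<comment> \<open>The distance in (A2') is right-invariant while base points move by right
      increments. Conjugation turns the increment \<open>y\<close> into a small last factor inside
      the gauge.\<close>
    have conjq: "q \<odot> y \<odot> - q = heis_conj q y" for y
      unfolding heis_conj_mult[of q y, symmetric] by (simp add: heis_assoc)
    obtain a1 a2 where a12: "a1 + a2 = grad2 (\<lambda>y. m * \<xi>E y)"
      "((m * \<Lambda> * E q + (L0 * H + \<sigma>)) + d) - 2 * (m * BE s1 s1 + m * BE s2 s2) + H1 a1 + H2 a2 \<le> 0"
    proof (rule semilinear_sum_superjet[OF s cV r(1) r(3) sc1 sc2 L1(1) lip(1) lip(2) _ _ J])
      show "b - 2 * (B s1 s1 + B s2 s2) + H1 (grad2 \<xi>) \<le> 0"
        if y: "norm y < r" "\<bar>s' - t\<bar> < r" and J1: "superjet V1 (q \<odot> y) s' b \<xi> B" for y s' b \<xi> B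
      proof -
        have y0: "norm y < r0" "\<bar>s' - t\<bar> < r0" using y r by auto
        have "superjet (\<lambda>x. sup_conv \<epsilon> u (h \<odot> fst x, 0 + snd x)) (q \<odot> y) s' b \<xi> B"
          using J1 unfolding V1_def by simp
        then have "superjet (sup_conv \<epsilon> u) (h \<odot> (q \<odot> y)) (0 + s') b \<xi> B" by (rule superjet_left_translate)
        then have "superjet (sup_conv \<epsilon> u) (h \<odot> (q \<odot> y)) s' b \<xi> B" by simp
        then obtain a where a: "norm a \<le> 1" "(norm a)\<^sup>2 / \<epsilon> \<le> u (a \<odot> (h \<odot> (q \<odot> y)), s') - u (h \<odot> (q \<odot> y), s')"
          "superjet u (a \<odot> (h \<odot> (q \<odot> y))) s' b \<xi> B"
          by (rule sup_conv_superjet[OF cont])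
        have "\<bar>u (a \<odot> (h \<odot> (q \<odot> y)), s')\<bar> \<le> M" "\<bar>u (0 \<odot> (h \<odot> (q \<odot> y)), s')\<bar> \<le> M"
          using a(1) r0K[OF y0(1)] r0t[OF y0(2)] by (intro Mh; simp)+
        then have "norm a < \<kappa>" using a(2) by (intro small) (simp add: abs_le_iff)
        then have g: "koranyi_gauge (a \<odot> h \<odot> heis_conj q y) \<le> H + \<sigma>'" using r0\<kappa>[OF y0(1)] by (rule \<kappa>h)
        have eq: "a \<odot> (h \<odot> (q \<odot> y)) \<odot> - q = a \<odot> h \<odot> heis_conj q y" by (simp only: heis_assoc conjq[symmetric])
        have "L0 * koranyi_gauge (a \<odot> (h \<odot> (q \<odot> y)) \<odot> - q) \<le> L0 * (H + \<sigma>')"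
          unfolding eq using g L0(1) by (rule mult_left_mono)
        then have "H1 (grad2 \<xi>) \<le> f (a \<odot> (h \<odot> (q \<odot> y))) (grad2 \<xi>)"
          using L0(2)[of "a \<odot> (h \<odot> (q \<odot> y))" "grad2 \<xi>" q] unfolding H1_def abs_le_iff by linarith
        then show ?thesis using sub[OF r0t(1)[OF y0(2)] a(3)] by linarith
      qed
      show "b - 2 * (B s1 s1 + B s2 s2) + H2 (grad2 \<xi>) \<le> 0"
        if y: "norm y < r" "\<bar>s' - t\<bar> < r" and J2: "superjet V2 (q \<odot> y) s' b \<xi> B" for y s' b \<xi> B
      proof -
        have y0: "norm y < r0" "\<bar>s' - t\<bar> < r0" using y r by auto
        obtain a where a: "norm a \<le> 1" "(norm a)\<^sup>2 / \<epsilon> \<le> - u (a \<odot> (q \<odot> y), s') - - u (q \<odot> y, s')"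
          "superjet (\<lambda>x. - u x) (a \<odot> (q \<odot> y)) s' b \<xi> B"
          by (rule sup_conv_superjet[OF cont_neg J2[unfolded V2_def]])
        have "\<bar>u (a \<odot> (q \<odot> y), s')\<bar> \<le> M" "\<bar>u (0 \<odot> (q \<odot> y), s')\<bar> \<le> M"
          using a(1) r0K[OF y0(1)] r0t[OF y0(2)] by (intro Mh; simp)+
        then have "norm a < \<kappa>" using a(2) by (intro small) (simp add: abs_le_iff)
        then have g: "koranyi_gauge (a \<odot> heis_conj q y) \<le> \<sigma>'" using r0\<kappa>[OF y0(1)] by (rule \<kappa>h)
        have eq: "a \<odot> (q \<odot> y) \<odot> - q = a \<odot> heis_conj q y" by (simp only: heis_assoc conjq[symmetric])
        have "L0 * koranyi_gauge (a \<odot> (q \<odot> y) \<odot> - q) \<le> L0 * \<sigma>'"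
          unfolding eq using g L0(1) by (rule mult_left_mono)
        then have "H2 (grad2 \<xi>) \<le> - f (a \<odot> (q \<odot> y)) (- grad2 \<xi>)"
          using L0(2)[of "a \<odot> (q \<odot> y)" "- grad2 \<xi>" q] unfolding H2_def abs_le_iff by linarith
        then show ?thesis using super[OF r0t(1)[OF y0(2)] a(3)] by linarith
      qed
    qed (rule that)
    have gm: "grad2 (\<lambda>y. m * \<xi>E y) = m *\<^sub>R grad2 \<xi>E" by (simp add: grad2_def vec_eq_iff forall_2)
    \<comment> \<open>The two gradients are not known separately, but their sum is the gradient of
      the barrier. By (A1) the nonlinear terms differ by at most \<open>L1\<close> times its norm,
      which is the quantity built into \<open>\<Lambda>\<close>.\<close>
    have "f q (- a2) - f q a1 \<le> L1 * norm (- a2 - a1)" using L1(2)[of q "- a2" a1] by (simp add: abs_le_iff)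
    also have "norm (- a2 - a1) = norm (a1 + a2)" using norm_minus_commute[of "- a2" a1] by simp
    also have "\<dots> = norm (m *\<^sub>R grad2 \<xi>E)" unfolding a12(1) gm ..
    also have "\<dots> = m * norm (grad2 \<xi>E)" using m by simp
    finally have lower: "f q a1 - f q (- a2) \<ge> - (L1 * (m * norm (grad2 \<xi>E)))" by simp
    have "m * (2 * (BE s1 s1 + BE s2 s2) + L1 * norm (grad2 \<xi>E)) \<le> m * (\<Lambda> * E q)"
      using jE(2) m unfolding E_def by (intro mult_left_mono) auto
    then have "2 * (m * BE s1 s1 + m * BE s2 s2) + L1 * (m * norm (grad2 \<xi>E)) \<le> m * \<Lambda> * E q" by (simp add: algebra_simps)
    moreover have "H1 a1 + H2 a2 = f q a1 - f q (- a2) - L0 * H - 2 * (L0 * \<sigma>')" by (simp add: H1_def H2_def distrib_left)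
    ultimately show False using a12(2) lower \<sigma>'(3) d by linarith
  qed
  moreover have "u (h \<odot> p, t) - u (p, t) \<le> w (p, t)"
    using sup_conv_ge[OF cont, of 0 "h \<odot> p" t \<epsilon>] sup_conv_ge[OF cont_neg, of 0 p t \<epsilon>] by (simp add: w_def V1_def V2_def)
  moreover have "\<Psi> (p, t) = \<gamma> / 4 + L * H + \<sigma> * (1 + t) + L0 * H * t"
    using E[of p] by (simp add: \<Psi>_def \<eta>_def algebra_simps)
  moreover have "\<sigma> * (1 + t) = \<gamma> / 4" using assms by (simp add: \<sigma>_def add_nonneg_eq_0_iff field_simps)
  moreover have "u (h \<odot> p, t) - u (p, t) = \<gamma> + L * H + L0 * H * t" by (simp add: \<gamma>_def H_def algebra_simps)
  ultimately show False using \<gamma> by linarith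
qed

lemma right_lipschitz:
  assumes "t \<ge> 0"
  shows "\<bar>u (p, t) - u (q, t)\<bar> \<le> (L + L0 * t) * koranyi_gauge (p \<odot> - q)"
proof -
  have "p \<odot> - q \<odot> q = p" "q \<odot> - p \<odot> p = q" by (simp_all add: heis_assoc)
  moreover have "koranyi_gauge (q \<odot> - p) = koranyi_gauge (p \<odot> - q)"
    by (simp add: koranyi_gauge_eq heis_mult_eq om_def power2_eq_square algebra_simps)
  ultimately show ?thesis
    using right_translation_estimate[OF assms, of "p \<odot> - q" q] right_translation_estimate[OF assms, of "q \<odot> - p" p]
    by (simp add: abs_le_iff)
qed

end

section \<open>Exchanging the left- and right-invariant distances\<close>

definition z_reflect :: "heis \<Rightarrow> heis" where
  "z_reflect p = (fst p, fst (snd p), - snd (snd p))"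

lemma z_reflect_reflect [simp]: "z_reflect (z_reflect p) = p"
  by (simp add: z_reflect_def)

text \<open>Like inversion, the reflection reverses the order of products, and the gauge ignores the
  sign of the vertical coordinate; hence the left-invariant distance becomes the right-invariant
  one.\<close>

lemma gauge_z_reflect: "koranyi_gauge (- z_reflect p \<odot> z_reflect q) = koranyi_gauge (p \<odot> - q)"
  by (simp add: koranyi_gauge_eq heis_mult_eq om_def z_reflect_def power2_eq_square algebra_simps)

lemma d_L_eq: "d_L p q = koranyi_gauge (- p \<odot> q)"
  by (simp add: d_L_def heis_inv_eq)

text \<open>An even or vertically even function sees the left- and the right-invariant distance alike.\<close>

lemma lipschitz_left_right:
  assumes "heis_even w \<or> vertically_even w"
  shows "(\<forall>p q. \<bar>w p - w q\<bar> \<le> c * d_L p q) \<longleftrightarrow> (\<forall>p q. \<bar>w p - w q\<bar> \<le> c * koranyi_gauge (p \<odot> - q))"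
proof -
  obtain R where R: "\<And>p. R (R p) = p" "\<And>p. w (R p) = w p" "\<And>p q. d_L (R p) (R q) = koranyi_gauge (p \<odot> - q)"
    using assms
  proof
    assume "heis_even w"
    then have "w (- p) = w p" for p unfolding heis_even_def heis_inv_eq by metis
    then show thesis by (intro that[of uminus]) (simp_all add: d_L_eq)
  next
    assume "vertically_even w"
    then have "w (z_reflect p) = w p" for p unfolding vertically_even_def z_reflect_def by (metis prod.collapse)
    then show thesis by (intro that[of z_reflect]) (simp_all add: d_L_eq gauge_z_reflect)
  qed
  have "\<bar>w p - w q\<bar> \<le> c * koranyi_gauge (p \<odot> - q)" if "\<forall>p q. \<bar>w p - w q\<bar> \<le> c * d_L p q" for p q
    using that[rule_format, of "R p" "R q"] by (simp add: R(2,3))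
  moreover have "\<bar>w p - w q\<bar> \<le> c * d_L p q" if "\<forall>p q. \<bar>w p - w q\<bar> \<le> c * koranyi_gauge (p \<odot> - q)" for p q
    using that[rule_format, of "R p" "R q"] R(3)[of "R p" "R q"] by (simp add: R(1,2))
  ultimately show ?thesis by blast
qed

theorem corollary4p3:
  fixes A :: "real^2^2"
    and f :: "heis \<Rightarrow> real^2 \<Rightarrow> real"
    and u :: "heis \<times> real \<Rightarrow> real"
    and u0 :: "heis \<Rightarrow> real"
    and L L0 :: real
  assumes A: "psd_matrix A"
    and A1: "\<exists>L1>0. \<forall>p w1 w2. \<bar>f p w1 - f p w2\<bar> \<le> L1 * norm (w1 - w2)"
    and L0: "L0 > 0"
    and A2': "\<forall>p q \<xi>. \<bar>f p \<xi> - f q \<xi>\<bar> \<le> L0 * koranyi_gauge (p \<odot> heis_inv q)"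
    and A3: "\<exists>Cf>0. \<forall>p \<xi>. \<bar>f p \<xi>\<bar> \<le> Cf * (1 + norm \<xi>)"
    and cont: "continuous_on (UNIV \<times> {0..}) u"
    and sol: "viscosity_solution A f u"
    and init: "\<forall>p. u (p, 0) = u0 p"
    and G: "exp_growth u"
    and even: "\<forall>t\<ge>0. heis_even (\<lambda>p. u (p, t)) \<or> vertically_even (\<lambda>p. u (p, t))"
    and L: "L > 0"
    and Lip: "\<forall>p q. \<bar>u0 p - u0 q\<bar> \<le> L * d_L p q"
  shows "(\<forall>p q. \<forall>t\<ge>0. \<bar>u (p, t) - u (q, t)\<bar> \<le> (L + L0 * t) * d_L p q) \<and>
         ((\<forall>p q \<xi>. f p \<xi> = f q \<xi>) \<longrightarrow>
            (\<forall>p q. \<forall>t\<ge>0. \<bar>u (p, t) - u (q, t)\<bar> \<le> (L + 0 * t) * d_L p q))"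
proof -
  obtain s1 s2 where s: "snd (snd s1) = 0" "snd (snd s2) = 0" "A = form_matrix s1 s2"
    by (rule psd_matrix_form[OF A]) (rule that)
  obtain L1 where L1: "L1 > 0" "\<forall>p w1 w2. \<bar>f p w1 - f p w2\<bar> \<le> L1 * norm (w1 - w2)" using A1 by blast
  \<comment> \<open>Extending the solution to negative times by its initial values gives continuity
    on the whole space; superjets at positive times are unaffected.\<close>
  define v where "v = (\<lambda>x. u (fst x, max 0 (snd x)))"
  have v: "v (p, t) = u (p, t)" if "t \<ge> 0" for p t using that by (simp add: v_def)
  have cont_v: "continuous_on UNIV v"
    unfolding v_def by (intro continuous_on_compose2[OF cont] continuous_intros) auto
  have growth_v: "exp_growth v"
    using G unfolding exp_growth_def v_def by (simp add: max_def)
  \<comment> \<open>The factor \<open>c\<close> is \<open>1\<close> for the subsolution and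
    \<open>-1\<close> for the supersolution.\<close>
  have jet: "superjet (\<lambda>x. c * u x) p t b \<xi> B" if "t > 0" "superjet (\<lambda>x. c * v x) p t b \<xi> B" for c p t b \<xi> B
  proof -
    have "superjet (\<lambda>x. c * u x) p t (b + 0) \<xi> B"
    proof (rule superjet_touch[OF that(2,1)])
      fix q :: heis and r assume "\<bar>r - t\<bar> < t"
      then have "v (p \<odot> q, r) = u (p \<odot> q, r)" "v (p, t) = u (p, t)" by (simp_all add: v)
      then show "c * u (p \<odot> q, r) - c * v (p \<odot> q, r) \<le> c * u (p, t) - c * v (p, t) + 0 * (r - t) + 0 * (r - t)\<^sup>2" by simp
    qed
    then show ?thesis by simp
  qed
  have sub: "viscosity_subsolution (form_matrix s1 s2) f u" and super: "viscosity_supersolution (form_matrix s1 s2) f u"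
    using sol unfolding viscosity_solution_def s(3) by simp_all
  have sub_v: "b - 2 * (B s1 s1 + B s2 s2) + f p (grad2 \<xi>) \<le> 0" if "t > 0" "superjet v p t b \<xi> B" for p t b \<xi> B
    by (rule subsolution_superjet[OF sub that(1) _ s(1,2)]) (use jet[of t 1, OF that(1)] that(2) in simp)
  have super_v: "b - 2 * (B s1 s1 + B s2 s2) - f p (- grad2 \<xi>) \<le> 0" if "t > 0" "superjet (\<lambda>x. - v x) p t b \<xi> B" for p t b \<xi> B
    by (rule supersolution_superjet[OF super that(1) _ s(1,2)]) (use jet[of t "-1", OF that(1)] that(2) in simp)
  have "\<forall>p q. \<bar>u (p, 0) - u (q, 0)\<bar> \<le> L * d_L p q" using Lip init by simp
  then have right0: "\<forall>p q. \<bar>u (p, 0) - u (q, 0)\<bar> \<le> L * koranyi_gauge (p \<odot> - q)"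
    using lipschitz_left_right[of "\<lambda>p. u (p, 0)" L] even by simp
  have init_v: "v (g \<odot> p, 0) - v (p, 0) \<le> L * koranyi_gauge g" for g p
    using right0[rule_format, of "g \<odot> p" p] by (simp add: v heis_assoc abs_le_iff)
  \<comment> \<open>The constant \<open>K\<close> is kept general because the estimate is used
    twice: with \<open>L0\<close>, and with \<open>0\<close> when \<open>f\<close> does not depend
    on the point.\<close>
  have main: "\<forall>p q. \<forall>t\<ge>0. \<bar>u (p, t) - u (q, t)\<bar> \<le> (L + K * t) * d_L p q"
    if K: "K \<ge> 0" "\<And>p q a. \<bar>f p a - f q a\<bar> \<le> K * koranyi_gauge (p \<odot> - q)" for K
  proof -
    interpret heis_parabolic s1 s2 f v K L1 L
    proof
      show "snd (snd s1) = 0" "snd (snd s2) = 0" "0 \<le> L1" "0 \<le> K" "0 \<le> L" using s L1 K L by simp_all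
      show "continuous_on UNIV v" "exp_growth v" by fact+
      show "\<bar>f p a - f p b\<bar> \<le> L1 * norm (a - b)" for p a b using L1(2)[rule_format, of p a b] .
      show "\<bar>f p a - f q a\<bar> \<le> K * koranyi_gauge (p \<odot> - q)" for p q a by (rule K(2))
      show "b - 2 * (B s1 s1 + B s2 s2) + f p (grad2 \<xi>) \<le> 0" if "0 < t" "superjet v p t b \<xi> B" for p t b \<xi> B
        using that by (rule sub_v)
      show "b - 2 * (B s1 s1 + B s2 s2) - f p (- grad2 \<xi>) \<le> 0" if "0 < t" "superjet (\<lambda>x. - v x) p t b \<xi> B" for p t b \<xi> B
        using that by (rule super_v)
      show "v (g \<odot> p, 0) - v (p, 0) \<le> L * koranyi_gauge g" for g p by (rule init_v)
    qed
    have "\<forall>p q. \<bar>u (p, t) - u (q, t)\<bar> \<le> (L + K * t) * d_L p q" if t: "t \<ge> 0" for t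
      unfolding lipschitz_left_right[OF even[rule_format, OF t]]
      using right_lipschitz[OF t] by (simp add: v[OF t])
    then show ?thesis by blast
  qed
  show ?thesis
  proof (rule conjI[OF _ impI])
    show "\<forall>p q. \<forall>t\<ge>0. \<bar>u (p, t) - u (q, t)\<bar> \<le> (L + L0 * t) * d_L p q"
      by (rule main) (use L0 A2' in \<open>simp_all only: less_imp_le heis_inv_eq\<close>)
    assume "\<forall>p q \<xi>. f p \<xi> = f q \<xi>"
    note indep = this[rule_format]
    have "\<bar>f p a - f q a\<bar> \<le> 0 * koranyi_gauge (p \<odot> - q)" for p q a
      using indep[of p a q] by simp
    then show "\<forall>p q. \<forall>t\<ge>0. \<bar>u (p, t) - u (q, t)\<bar> \<le> (L + 0 * t) * d_L p q"
      by (rule main[OF order_refl])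
  qed
qed

end
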